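(* Let $I\subset\mathbb{R}$ be a compact interval and let $f:I\to I$ be a non-degenerate smooth interval map that is topologically exact on its Julia set $J(f)$ and such that $\chi_{\inf}(f)>0$. Then there are $\delta>0$ and $\lambda>1$ such that for every point $x$ in $J(f)$, every integer $n\ge1$, and every pull-back $W$ of $B(x,\delta)$ by $f^n$, we have $$|W|\le\lambda^{-n}.$$
   Context: Let $I$ be a compact interval of $\mathbb{R}$. A non-injective smooth ($C^\infty$) map $f:I\to I$ is *non-degenerate* if the set of points at which the derivative of $f$ vanishes is finite and if at each of these points a higher order derivative of $f$ is non-zero. The *Fatou set* of $f$ is the largest (relatively) open subset of $I$ on which the family of iterates $(f^n)_{n\ge1}$ is normal (locally equicontinuous). The *Julia set* $J(f)$ is the complement in $I$ of the Fatou set. The map $f$ is *topologically exact on $J(f)$* if $J(f)$ is not reduced to a single point and for every open subset $U$ of $I$ intersecting $J(f)$ there is an integer $n\ge1$ such that $f^n(U)\supset J(f)$. Define $$\chi_{\inf}(f)=\inf\left\{\int\ln|Df|\,d\mu : \mu \text{ Borel probability measure on } J(f) \text{ invariant by } f\right\},$$ with $\ln 0=-\infty$. For an interval $J\subset I$ and $n\ge1$, a *pull-back of $J$ by $f^n$* is a connected component of $f^{-n}(J)$. For an interval $W$, $|W|$ denotes its length, and $B(x,\delta)$ is the open ball in $I$ of center $x$ and radius $\delta$. *)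

theory Defs
  imports "HOL-Probability.Probability"
begin

text \<open>
  Iterated derivative relative to a set: at the endpoints of an interval it is one-sided, and on
  the interval it depends only on the values of the function there.
\<close>

fun nderiv_on :: "real set \<Rightarrow> nat \<Rightarrow> (real \<Rightarrow> real) \<Rightarrow> real \<Rightarrow> real" where
  "nderiv_on I 0 f = f"
| "nderiv_on I (Suc k) f = (\<lambda>x. vector_derivative (nderiv_on I k f) (at x within I))"

definition smooth_on :: "real set \<Rightarrow> (real \<Rightarrow> real) \<Rightarrow> bool" where
  "smooth_on I f \<longleftrightarrow> (\<forall>k. \<forall>x\<in>I. nderiv_on I k f differentiable (at x within I))"

definition nondegenerate_smooth_map :: "real set \<Rightarrow> (real \<Rightarrow> real) \<Rightarrow> bool" where
  "nondegenerate_smooth_map I f \<longleftrightarrow>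
     f ` I \<subseteq> I \<and> smooth_on I f \<and> \<not> inj_on f I \<and>
     finite {x \<in> I. nderiv_on I 1 f x = 0} \<and>
     (\<forall>x\<in>I. nderiv_on I 1 f x = 0 \<longrightarrow> (\<exists>k\<ge>2. nderiv_on I k f x \<noteq> 0))"

definition equicontinuous_iterates_on :: "(real \<Rightarrow> real) \<Rightarrow> real set \<Rightarrow> bool" where
  "equicontinuous_iterates_on f S \<longleftrightarrow>
     (\<forall>x\<in>S. \<forall>\<epsilon>>0. \<exists>\<eta>>0. \<forall>n\<ge>1. \<forall>y\<in>S.
        dist y x < \<eta> \<longrightarrow> dist ((f ^^ n) y) ((f ^^ n) x) < \<epsilon>)"

definition normal_iterates_on :: "(real \<Rightarrow> real) \<Rightarrow> real set \<Rightarrow> bool" where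
  "normal_iterates_on f U \<longleftrightarrow> locally (equicontinuous_iterates_on f) U"

text \<open>
  The union below is itself relatively open with normal iterates, so it is the largest such set;
  see \<open>fatou_set_greatest\<close>.
\<close>

definition fatou_set :: "real set \<Rightarrow> (real \<Rightarrow> real) \<Rightarrow> real set" where
  "fatou_set I f = \<Union>{U. openin (top_of_set I) U \<and> normal_iterates_on f U}"

lemma normal_iterates_on_fatou_set: "normal_iterates_on f (fatou_set I f)"
  unfolding normal_iterates_on_def
proof (rule locallyI)
  fix w x assume w: "openin (top_of_set (fatou_set I f)) w" and x: "x \<in> w"
  then have "x \<in> fatou_set I f"
    using openin_imp_subset by blast
  then obtain U where U: "openin (top_of_set I) U" "locally (equicontinuous_iterates_on f) U" "x \<in> U"
    unfolding fatou_set_def normal_iterates_on_def by blast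
  have sub: "U \<subseteq> fatou_set I f"
    using U unfolding fatou_set_def normal_iterates_on_def by blast
  have fI: "fatou_set I f \<subseteq> I"
    unfolding fatou_set_def using openin_imp_subset by blast
  have oU: "openin (top_of_set (fatou_set I f)) U"
    using U(1) sub fI by (rule openin_subset_trans)
  have "openin (top_of_set U) (U \<inter> w)"
    using openin_Int[OF oU w] by (rule openin_subset_trans) (use sub in auto)
  then obtain u v where uv: "openin (top_of_set U) u" "equicontinuous_iterates_on f v"
      "x \<in> u" "u \<subseteq> v" "v \<subseteq> U \<inter> w"
    using locallyE[OF U(2), of "U \<inter> w" x] U(3) x by blast
  have "openin (top_of_set (fatou_set I f)) u"
    using uv(1) oU by (rule openin_trans)
  then show "\<exists>u v. openin (top_of_set (fatou_set I f)) u \<and> equicontinuous_iterates_on f v \<and>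
      x \<in> u \<and> u \<subseteq> v \<and> v \<subseteq> w"
    using uv by blast
qed

lemma fatou_set_greatest:
  "openin (top_of_set I) (fatou_set I f) \<and> normal_iterates_on f (fatou_set I f) \<and>
   (\<forall>U. openin (top_of_set I) U \<and> normal_iterates_on f U \<longrightarrow> U \<subseteq> fatou_set I f)"
  using normal_iterates_on_fatou_set[of f I]
  by (auto simp: fatou_set_def)

definition julia_set :: "real set \<Rightarrow> (real \<Rightarrow> real) \<Rightarrow> real set" where
  "julia_set I f = I - fatou_set I f"

text \<open>An empty Julia set is not excluded: only a one-point Julia set is.\<close>

definition topologically_exact_on_julia :: "real set \<Rightarrow> (real \<Rightarrow> real) \<Rightarrow> bool" where
  "topologically_exact_on_julia I f \<longleftrightarrow>
     \<not> is_singleton (julia_set I f) \<and>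
     (\<forall>U. openin (top_of_set I) U \<and> U \<inter> julia_set I f \<noteq> {} \<longrightarrow>
        (\<exists>n\<ge>1. julia_set I f \<subseteq> (f ^^ n) ` U))"

text \<open>Here $\ln 0 = -\infty$, whereas \<open>ln 0 = 0\<close> in the library.\<close>

definition ln_ext :: "real \<Rightarrow> ereal" where
  "ln_ext t = (if t = 0 then - \<infinity> else ereal (ln t))"

text \<open>
  Positive part minus negative part. For \<open>g = ln_ext \<bar>Df\<bar>\<close> and a finite measure the positive part
  is integrable, as \<open>Df\<close> is bounded, so the value lies in $[-\infty, \infty)$ and the convention
  \<open>\<infinity> - \<infinity> = \<infinity>\<close> of \<^typ>\<open>ereal\<close> is never used.
\<close>

definition integral_ext :: "'a measure \<Rightarrow> ('a \<Rightarrow> ereal) \<Rightarrow> ereal" where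
  "integral_ext M g =
     enn2ereal (\<integral>\<^sup>+ x. e2ennreal (g x) \<partial>M) - enn2ereal (\<integral>\<^sup>+ x. e2ennreal (- g x) \<partial>M)"

definition invariant_prob_measures :: "real set \<Rightarrow> (real \<Rightarrow> real) \<Rightarrow> real measure set" where
  "invariant_prob_measures J f =
     {M. sets M = sets (restrict_space borel J) \<and> prob_space M \<and>
         f \<in> measurable M M \<and> distr M M f = M}"

definition chi_inf :: "real set \<Rightarrow> (real \<Rightarrow> real) \<Rightarrow> ereal" where
  "chi_inf I f =
     (INF M \<in> invariant_prob_measures (julia_set I f) f.
        integral_ext M (\<lambda>x. ln_ext \<bar>nderiv_on I 1 f x\<bar>))"

definition pullbacks :: "real set \<Rightarrow> (real \<Rightarrow> real) \<Rightarrow> nat \<Rightarrow> real set \<Rightarrow> real set set" where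
  "pullbacks I f n K = components {x \<in> I. (f ^^ n) x \<in> K}"

end

theory Submission
  imports Defs
begin

text \<open>
  Call a closed subinterval of \<open>{a..b}\<close> an arc. The uniform measure on a cycle of period \<open>n\<close> in the Julia
  set \<open>J\<close> shows that the derivative of \<open>f\<^sup>n\<close> along the cycle is at least $e^{\nu n}$ for some fixed \<open>\<nu> > 0\<close>.
  In particular critical points in \<open>J\<close> are not periodic, so the orbit of a small arc meeting \<open>J\<close> is close to
  critical points only rarely, and its accumulated distortion is subexponential. If the first \<open>k\<close> images of an
  arc \<open>A\<close> are small and a later image covers \<open>J\<close>, then \<open>A\<close> contains a periodic point, or edges of a gap of \<open>J\<close>
  forming a cycle, and so \<open>A\<close> is exponentially small in \<open>k\<close>.

  By exactness, an arc with a point of \<open>J\<close> in its interior grows to a definite size. Then either it covers \<open>J\<close>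
  after a bounded time, or up to a small error it lies in a gap of \<open>J\<close>, on one side of an edge. The latter is the
  main difficulty: edges of gaps turn out to be preperiodic, hence repelling; gaps shrink exponentially under
  pull-back, by the covering argument applied to slightly larger arcs; and the fraction of a gap cut off by an arc
  at its edge is controlled along the orbit, because the gaps on one side of a critical point are disjoint. Finally,
  if \<open>\<delta>\<close> is small, a pull-back of a ball of radius \<open>\<delta>\<close> meets \<open>J\<close>, and all its images are small.
\<close>

section \<open>Arcs and the mean value theorem\<close>

text \<open>Near a critical point two derivatives on one arc can have any ratio, so distortion is
  used one-sidedly: up to the constant \<open>C\<close>, an image is at least as long as the arc
  times its largest derivative. This suffices, since lengths are only bounded from above, given a
  lower bound for a derivative or for a shorter arc along the same orbit. The obstacle is that
  length alone does not produce a cycle: all images of a free arc are free, so none covers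
  \<open>J\<close> and \<open>closing\<close> says nothing about it. At the outset critical points
  and ends of \<open>{a..b}\<close> outside \<open>J\<close> might even be mapped into
  \<open>J\<close>. Until edges of gaps are known to be preperiodic, statements about
  \<open>J\<close> are therefore proved up to finite sets. Afterwards backward invariance follows,
  since preperiodic points of \<open>J\<close> repel while the iterates are equicontinuous off
  \<open>J\<close>; it ensures that pull-backs meet \<open>J\<close>. Sizes are then controlled
  backwards in time: that an arc is short follows from its later images being short.\<close>

locale interval_map =
  fixes a b :: real and f df :: "real \<Rightarrow> real"
  assumes ab: "a < b"
    and maps: "x \<in> {a..b} \<Longrightarrow> f x \<in> {a..b}"
    and deriv: "x \<in> {a..b} \<Longrightarrow> (f has_real_derivative df x) (at x within {a..b})"
    and cont_df: "continuous_on {a..b} df"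
    and finite_zeros: "finite {x \<in> {a..b}. df x = 0}"
    and order: "c \<in> {a..b} \<Longrightarrow> df c = 0 \<Longrightarrow>
      \<exists>p k1 k2 \<rho>. 0 < k1 \<and> 0 < k2 \<and> 0 < \<rho> \<and> (\<forall>x\<in>{a..b}. \<bar>x - c\<bar> < \<rho> \<longrightarrow>
        k1 * \<bar>x - c\<bar> ^ p \<le> \<bar>df x\<bar> \<and> \<bar>df x\<bar> \<le> k2 * \<bar>x - c\<bar> ^ p)"
begin

definition Crit :: "real set" where "Crit = {x \<in> {a..b}. df x = 0}"

definition arc :: "real set \<Rightarrow> bool" where
  "arc A \<longleftrightarrow> (\<exists>u v. a \<le> u \<and> u < v \<and> v \<le> b \<and> A = {u..v})"

abbreviation width :: "nat \<Rightarrow> real set \<Rightarrow> real" where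
  "width n A \<equiv> diameter ((f ^^ n) ` A)"

lemma arcI: "a \<le> u \<Longrightarrow> u < v \<Longrightarrow> v \<le> b \<Longrightarrow> arc {u..v}"
  unfolding arc_def by blast

lemma arcE:
  assumes "arc A"
  obtains u v where "a \<le> u" "u < v" "v \<le> b" "A = {u..v}"
  using assms unfolding arc_def by blast

lemma arc_subset: "arc A \<Longrightarrow> A \<subseteq> {a..b}"
  by (auto elim!: arcE)

lemma arc_bounded: "arc A \<Longrightarrow> bounded A"
  by (auto elim!: arcE)

lemma arc_compact: "arc A \<Longrightarrow> compact A"
  by (auto elim!: arcE)

lemma arc_diameter_pos: "arc A \<Longrightarrow> 0 < diameter A"
  by (auto elim!: arcE)

lemma arc_diameter_le: "arc A \<Longrightarrow> diameter A \<le> b - a"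
  by (auto elim!: arcE)

lemma arc_diameter_mono: "arc B \<Longrightarrow> A \<subseteq> B \<Longrightarrow> diameter A \<le> diameter B"
  by (simp add: arc_bounded diameter_subset)

lemma arc_dist_le: "arc A \<Longrightarrow> x \<in> A \<Longrightarrow> y \<in> A \<Longrightarrow> \<bar>x - y\<bar> \<le> diameter A"
  by (metis arc_bounded diameter_bounded_bound dist_real_def)

lemma finite_Crit: "finite Crit"
  using finite_zeros by (simp add: Crit_def)

lemma cont_f: "continuous_on {a..b} f"
  by (rule DERIV_continuous_on[OF deriv])

lemma iter_in: "x \<in> {a..b} \<Longrightarrow> (f ^^ n) x \<in> {a..b}"
  using maps by (induction n) auto

lemma iter_image: "A \<subseteq> {a..b} \<Longrightarrow> (f ^^ n) ` A \<subseteq> {a..b}"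
  using iter_in by blast

lemma iter_add_image: "(f ^^ (m + n)) ` A = (f ^^ m) ` (f ^^ n) ` A"
  by (simp add: funpow_add image_comp)

lemma cont_iter: "continuous_on {a..b} (f ^^ n)"
proof (induction n)
  case 0 show ?case by (simp add: id_def)
next
  case (Suc n)
  have "continuous_on ((f ^^ n) ` {a..b}) f"
    by (rule continuous_on_subset[OF cont_f iter_image]) simp
  with continuous_on_compose[OF Suc this] show ?case by simp
qed

lemma mvt_ex:
  assumes "a \<le> u" "u < v" "v \<le> b"
  shows "\<exists>z\<in>{u<..<v}. f v - f u = (v - u) * df z"
proof -
  show ?thesis
  proof (rule mvt[OF assms(2), where f = f and f' = "\<lambda>x h. h * df x"])
    show "continuous_on {u..v} f" using cont_f continuous_on_subset assms by fastforce
    fix x assume x: "u < x" "x < v"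
    have "at x within {a..b} = at x" using x assms by (intro at_within_interior) auto
    with deriv[of x] x assms show "(f has_derivative (\<lambda>h. h * df x)) (at x)"
      by (auto simp: has_field_derivative_def mult_commute_abs)
  next
    fix z assume "u < z" "z < v" "f v - f u = (v - u) * df z"
    then show ?thesis by (intro bexI[of _ z]) auto
  qed
qed

lemma bound_ex:
  "\<exists>M\<ge>1. (\<forall>x\<in>{a..b}. \<bar>df x\<bar> \<le> M) \<and> (\<forall>x\<in>{a..b}. \<forall>y\<in>{a..b}. \<bar>f x - f y\<bar> \<le> M * \<bar>x - y\<bar>)"
proof -
  have "bounded (df ` {a..b})"
    by (intro compact_imp_bounded compact_continuous_image cont_df) auto
  then obtain B where B: "\<And>x. x \<in> {a..b} \<Longrightarrow> \<bar>df x\<bar> \<le> B"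
    unfolding bounded_iff by (metis imageI real_norm_def)
  define M where "M = max 1 B"
  have M: "\<bar>df x\<bar> \<le> M" if "x \<in> {a..b}" for x using B[OF that] by (simp add: M_def)
  have less: "\<bar>f y - f x\<bar> \<le> M * \<bar>y - x\<bar>" if xy: "x \<in> {a..b}" "y \<in> {a..b}" "x < y" for x y
  proof -
    obtain z where z: "z \<in> {x<..<y}" "f y - f x = (y - x) * df z"
      using mvt_ex[OF _ xy(3)] xy by (metis atLeastAtMost_iff)
    have "\<bar>df z\<bar> \<le> M" using z that by (intro M) auto
    then show ?thesis using z that by (simp add: abs_mult mult.commute mult_right_mono)
  qed
  have "\<bar>f x - f y\<bar> \<le> M * \<bar>x - y\<bar>" if "x \<in> {a..b}" "y \<in> {a..b}" for x y
    using less[of x y] less[of y x] that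
    by (cases x y rule: linorder_cases) (auto simp: abs_minus_commute)
  then show ?thesis using M by (intro exI[of _ M]) (auto simp: M_def)
qed

text \<open>One constant bounds the derivative and the Lipschitz constant; being at least 1, it has
  increasing powers.\<close>

definition M :: real where
  "M = (SOME M. M \<ge> 1 \<and> (\<forall>x\<in>{a..b}. \<bar>df x\<bar> \<le> M) \<and> (\<forall>x\<in>{a..b}. \<forall>y\<in>{a..b}. \<bar>f x - f y\<bar> \<le> M * \<bar>x - y\<bar>))"

lemma M_props:
  shows M_ge_1: "1 \<le> M"
    and abs_df_le: "x \<in> {a..b} \<Longrightarrow> \<bar>df x\<bar> \<le> M"
    and lipschitz: "x \<in> {a..b} \<Longrightarrow> y \<in> {a..b} \<Longrightarrow> \<bar>f x - f y\<bar> \<le> M * \<bar>x - y\<bar>"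
proof -
  have "M \<ge> 1 \<and> (\<forall>x\<in>{a..b}. \<bar>df x\<bar> \<le> M) \<and> (\<forall>x\<in>{a..b}. \<forall>y\<in>{a..b}. \<bar>f x - f y\<bar> \<le> M * \<bar>x - y\<bar>)"
    unfolding M_def using someI_ex[of "\<lambda>M. M \<ge> 1 \<and> (\<forall>x\<in>{a..b}. \<bar>df x\<bar> \<le> M) \<and>
      (\<forall>x\<in>{a..b}. \<forall>y\<in>{a..b}. \<bar>f x - f y\<bar> \<le> M * \<bar>x - y\<bar>)"] bound_ex by blast
  then show "1 \<le> M" "x \<in> {a..b} \<Longrightarrow> \<bar>df x\<bar> \<le> M"
    "x \<in> {a..b} \<Longrightarrow> y \<in> {a..b} \<Longrightarrow> \<bar>f x - f y\<bar> \<le> M * \<bar>x - y\<bar>" by auto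
qed

lemma lipschitz_iter:
  assumes "x \<in> {a..b}" "y \<in> {a..b}"
  shows "\<bar>(f ^^ n) x - (f ^^ n) y\<bar> \<le> M ^ n * \<bar>x - y\<bar>"
proof (induction n)
  case (Suc n)
  have "\<bar>(f ^^ Suc n) x - (f ^^ Suc n) y\<bar> \<le> M * \<bar>(f ^^ n) x - (f ^^ n) y\<bar>"
    using lipschitz iter_in assms by simp
  also have "\<dots> \<le> M * (M ^ n * \<bar>x - y\<bar>)"
    using Suc M_ge_1 by (intro mult_left_mono) auto
  finally show ?case by simp
qed simp

lemma df_zero_finite_interval: "u < v \<Longrightarrow> a \<le> u \<Longrightarrow> v \<le> b \<Longrightarrow> \<exists>z\<in>{u<..<v}. df z \<noteq> 0"
proof (rule ccontr)
  assume *: "u < v" "a \<le> u" "v \<le> b" "\<not> (\<exists>z\<in>{u<..<v}. df z \<noteq> 0)"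
  then have "{u<..<v} \<subseteq> {x \<in> {a..b}. df x = 0}" by auto
  then have "finite {u<..<v}" using finite_zeros by (rule finite_subset)
  then show False using \<open>u < v\<close> by (simp add: infinite_Ioo)
qed

text \<open>The image does not degenerate, because \<open>df\<close> has finitely many zeros and so
  \<open>f\<close> is constant on no arc.\<close>

lemma image_arc:
  assumes "arc A" shows "arc (f ` A)"
proof -
  obtain u v where A: "a \<le> u" "u < v" "v \<le> b" "A = {u..v}" using assms by (rule arcE)
  have c: "continuous_on A f" by (rule continuous_on_subset[OF cont_f arc_subset[OF assms]])
  have "connected (f ` A) \<and> compact (f ` A)"
    using c A connected_continuous_image compact_continuous_image by (metis compact_Icc connected_Icc)
  then obtain p q where pq: "f ` A = {p..q}"
    unfolding connected_compact_interval_1 by (elim exE)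
  have sub: "f ` A \<subseteq> {a..b}" using maps A by auto
  obtain z where z: "z \<in> {u<..<v}" "df z \<noteq> 0" using df_zero_finite_interval A by blast
  have "p < q"
  proof (rule ccontr)
    assume "\<not> p < q"
    then have const: "f x = p" if "x \<in> A" for x
    proof -
      have "f x \<in> {p..q}" using pq that by blast
      with \<open>\<not> p < q\<close> show ?thesis by auto
    qed
    have "(f has_real_derivative 0) (at z within {u..v})"
    proof (rule has_field_derivative_transform_within[where d = 1])
      show "((\<lambda>_. p) has_real_derivative 0) (at z within {u..v})" by simp
    qed (use z const A in auto)
    moreover have "(f has_real_derivative df z) (at z within {u..v})"
      using deriv[of z] z A by (auto intro: has_field_derivative_subset)
    ultimately have "df z = 0"
      using z A by (metis at_within_interior greaterThanLessThan_iff interior_atLeastAtMost_real DERIV_unique)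
    with z show False by simp
  qed
  with pq sub show ?thesis by (auto intro!: arcI)
qed

lemma iter_arc: "arc A \<Longrightarrow> arc ((f ^^ n) ` A)"
proof (induction n)
  case (Suc n)
  then have "arc (f ` (f ^^ n) ` A)" by (intro image_arc) auto
  then show ?case by (simp add: image_comp)
qed simp

lemma diameter_iter_le:
  assumes "arc A" shows "width n A \<le> M ^ n * diameter A"
proof (rule diameter_le)
  show "(f ^^ n) ` A \<noteq> {} \<or> 0 \<le> M ^ n * diameter A"
    using arc_diameter_pos[OF assms] M_ge_1 by auto
  fix x y assume "x \<in> (f ^^ n) ` A" "y \<in> (f ^^ n) ` A"
  then obtain s t where st: "s \<in> A" "t \<in> A" "x = (f ^^ n) s" "y = (f ^^ n) t" by auto
  have "\<bar>x - y\<bar> \<le> M ^ n * \<bar>s - t\<bar>" using lipschitz_iter st arc_subset[OF assms] by blast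
  also have "\<dots> \<le> M ^ n * diameter A"
    using arc_dist_le[OF assms] st M_ge_1 by (intro mult_left_mono) auto
  finally show "norm (x - y) \<le> M ^ n * diameter A" by simp
qed

lemma image_diameter_ge: "arc A \<Longrightarrow> x \<in> A \<Longrightarrow> y \<in> A \<Longrightarrow> \<bar>(f ^^ n) x - (f ^^ n) y\<bar> \<le> width n A"
  by (rule arc_dist_le[OF iter_arc]) auto

text \<open>Grid argument: an arc of length at least \<open>\<rho>\<close> contains one of finitely
  many cells of length \<open>h < \<rho> / 2\<close>, and no cell has a degenerate image. The bound
  depends on \<open>n\<close>.\<close>

lemma diameter_image_lower:
  assumes "\<rho> > 0"
  shows "\<exists>\<kappa>>0. \<forall>A. arc A \<and> diameter A \<ge> \<rho> \<longrightarrow> width n A \<ge> \<kappa>"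
proof -
  obtain N :: nat where N: "(b - a) / N < \<rho> / 2" "N > 0"
  proof -
    obtain N :: nat where N: "2 * (b - a) / \<rho> < N" using reals_Archimedean2 by blast
    have "0 < 2 * (b - a) / \<rho>" using ab assms by simp
    then have "N > 0" using N by linarith
    with N assms show ?thesis by (intro that[of N]) (auto simp: field_simps)
  qed
  define h where "h = (b - a) / N"
  define cell where "cell k = {a + real k * h .. a + real (Suc k) * h}" for k
  have h: "h > 0" using ab N by (simp add: h_def)
  have cell_arc: "arc (cell k)" if "k < N" for k
  proof -
    have "real (Suc k) * h \<le> real N * h" using that h by (intro mult_right_mono) auto
    also have "\<dots> = b - a" using N by (simp add: h_def)
    finally show ?thesis unfolding cell_def using h by (intro arcI) (auto simp: algebra_simps)
  qed
  define \<kappa> where "\<kappa> = Min ((\<lambda>k. diameter ((f ^^ n) ` cell k)) ` {..<N})"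
  have \<kappa>: "\<kappa> > 0" unfolding \<kappa>_def using N cell_arc iter_arc arc_diameter_pos by (subst Min_gr_iff) auto
  have "width n A \<ge> \<kappa>" if "arc A" "diameter A \<ge> \<rho>" for A
  proof -
    obtain u v where A: "a \<le> u" "u < v" "v \<le> b" "A = {u..v}" using \<open>arc A\<close> by (rule arcE)
    then have uv: "v - u \<ge> \<rho>" using that by simp
    \<comment> \<open>The first grid point not to the left of \<open>u\<close>. It is less than
      \<open>h\<close> away, so the cell starting there ends before \<open>u + 2 * h\<close>, hence
      before \<open>v\<close>.\<close>
    define k where "k = nat \<lceil>(u - a) / h\<rceil>"
    have k: "real k \<ge> (u - a) / h" "real k < (u - a) / h + 1"
      using A h unfolding k_def by (auto simp: of_nat_nat) linarith+
    then have k1: "a + real k * h \<ge> u" "a + real k * h < u + h"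
      using h by (auto simp: field_simps)
    have "h < \<rho> / 2" using N(1) unfolding h_def .
    then have k2: "a + real (Suc k) * h < v" using uv k1 by (simp add: algebra_simps)
    have "real (Suc k) * h < N * h" using k2 A N by (auto simp: h_def)
    then have "k < N" using h by (simp add: mult_less_cancel_right)
    have "cell k \<subseteq> A" using k1 k2 A by (auto simp: cell_def)
    have "\<kappa> \<le> diameter ((f ^^ n) ` cell k)" unfolding \<kappa>_def using \<open>k < N\<close> by (intro Min_le) auto
    also have "\<dots> \<le> width n A"
      using \<open>cell k \<subseteq> A\<close> iter_arc[OF \<open>arc A\<close>] by (intro arc_diameter_mono) auto
    finally show ?thesis .
  qed
  then show ?thesis using \<kappa> by blast
qed

end

section \<open>Distortion\<close>

context interval_map begin

lemma diameter_image_ge_deriv: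
  assumes "arc A" "s \<in> A" "t \<in> A" "s < t" "\<And>z. s < z \<Longrightarrow> z < t \<Longrightarrow> m \<le> \<bar>df z\<bar>"
  shows "(t - s) * m \<le> diameter (f ` A)"
proof -
  have st: "a \<le> s" "t \<le> b" using arc_subset[OF assms(1)] assms(2,3) by auto
  obtain z where z: "z \<in> {s<..<t}" "f t - f s = (t - s) * df z" using mvt_ex[OF st(1) assms(4) st(2)] by auto
  have "(t - s) * m \<le> (t - s) * \<bar>df z\<bar>" using assms z by (intro mult_left_mono) auto
  also have "\<dots> = \<bar>f t - f s\<bar>" using z assms(4) by (simp add: abs_mult)
  also have "\<dots> \<le> diameter (f ` A)" using image_diameter_ge[of A t s 1] assms by simp
  finally show ?thesis .
qed

text \<open>The image of an arc is compared with the largest derivative on the arc, because the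
  ratio of two derivatives is unbounded near a critical point. The second half bounds that largest
  derivative from below by a power of the length.\<close>

definition quasi_mult_on :: "real set \<Rightarrow> real \<Rightarrow> real \<Rightarrow> nat \<Rightarrow> bool" where
  "quasi_mult_on U C c p \<longleftrightarrow> (\<forall>A. arc A \<and> A \<subseteq> U \<longrightarrow>
     (\<forall>y\<in>A. diameter A * \<bar>df y\<bar> \<le> C * diameter (f ` A)) \<and> (\<exists>y\<in>A. c * diameter A ^ p \<le> \<bar>df y\<bar>))"

lemma quasi_mult_regular:
  assumes x: "x \<in> {a..b}" and nz: "df x \<noteq> 0"
  shows "\<exists>\<rho>>0. \<exists>C\<ge>1. \<exists>c>0. \<exists>p. quasi_mult_on (ball x \<rho>) C c p"
proof -
  define m where "m = \<bar>df x\<bar> / 2"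
  have m: "m > 0" using nz by (simp add: m_def)
  obtain \<rho> where \<rho>: "\<rho> > 0" "\<And>y. y \<in> {a..b} \<Longrightarrow> dist y x < \<rho> \<Longrightarrow> dist (df y) (df x) < m"
    using cont_df x m unfolding continuous_on_iff by blast
  have bnd: "m \<le> \<bar>df y\<bar>" "\<bar>df y\<bar> \<le> 3 * m" if "y \<in> {a..b}" "y \<in> ball x \<rho>" for y
  proof -
    have "dist (df y) (df x) < m" using that by (intro \<rho>(2)) (auto simp: dist_commute)
    then show "m \<le> \<bar>df y\<bar>" "\<bar>df y\<bar> \<le> 3 * m" unfolding dist_real_def m_def by linarith+
  qed
  have "quasi_mult_on (ball x \<rho>) 3 m 0"
    unfolding quasi_mult_on_def
  proof (intro allI impI conjI ballI)
    fix A y assume A: "arc A \<and> A \<subseteq> ball x \<rho>" and y: "y \<in> A"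
    obtain u v where uv: "a \<le> u" "u < v" "v \<le> b" "A = {u..v}" using A arcE by blast
    have "(v - u) * m \<le> diameter (f ` A)"
    proof (rule diameter_image_ge_deriv)
      fix z assume "u < z" "z < v"
      then have "z \<in> A" using uv by simp
      then show "m \<le> \<bar>df z\<bar>" using bnd A arc_subset by blast
    qed (use A uv in auto)
    moreover have "\<bar>df y\<bar> \<le> 3 * m" using bnd A y arc_subset by blast
    then have "(v - u) * \<bar>df y\<bar> \<le> (v - u) * (3 * m)" using uv by (intro mult_left_mono) auto
    moreover have "(v - u) * (3 * m) = 3 * ((v - u) * m)" by simp
    ultimately have "(v - u) * \<bar>df y\<bar> \<le> 3 * diameter (f ` A)" by linarith
    then show "diameter A * \<bar>df y\<bar> \<le> 3 * diameter (f ` A)" using uv by simp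
  next
    fix A assume A: "arc A \<and> A \<subseteq> ball x \<rho>"
    obtain u v where uv: "a \<le> u" "u < v" "v \<le> b" "A = {u..v}" using A arcE by blast
    have "u \<in> A" using uv by simp
    moreover have "u \<in> ball x \<rho>" "u \<in> {a..b}" using A \<open>u \<in> A\<close> arc_subset by blast+
    ultimately show "\<exists>y\<in>A. m * diameter A ^ 0 \<le> \<bar>df y\<bar>" using bnd(1)[of u] by (intro bexI[of _ u]) auto
  qed
  then show ?thesis using \<rho> m by (intro exI[of _ \<rho>] conjI exI[of _ 3] exI[of _ m] exI[of _ 0]) auto
qed

text \<open>Let \<open>R\<close> be the distance from \<open>c\<close> to the farther end of the
  arc, whose length is then at most \<open>2 * R\<close>. The derivative is at most
  \<open>k2 * R ^ p\<close> on the arc and at least \<open>k1 * (R / 2) ^ p\<close> on the quarter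
  of the arc at that end. The image of this quarter gives the lower bound.\<close>

lemma quasi_mult_critical:
  assumes c: "c \<in> {a..b}" and z: "df c = 0"
  shows "\<exists>\<rho>>0. \<exists>C\<ge>1. \<exists>k>0. \<exists>p. quasi_mult_on (ball c \<rho>) C k p"
proof -
  obtain p k1 k2 \<rho> where k: "0 < k1" "0 < k2" "0 < \<rho>"
    and bnd: "\<And>x. x \<in> {a..b} \<Longrightarrow> \<bar>x - c\<bar> < \<rho> \<Longrightarrow> k1 * \<bar>x - c\<bar> ^ p \<le> \<bar>df x\<bar> \<and> \<bar>df x\<bar> \<le> k2 * \<bar>x - c\<bar> ^ p"
    using order[OF c z] by blast
  have "k1 * \<bar>x - c\<bar> ^ p \<le> k2 * \<bar>x - c\<bar> ^ p" if "x \<in> {a..b}" "\<bar>x - c\<bar> < \<rho>" for x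
    using bnd[OF that] by linarith
  \<comment> \<open>The factors come from the quarter, the halved distance and the two constants in
    \<open>order\<close>.\<close>
  define C where "C = max 1 (4 * 2 ^ p * (k2 / k1))"
  have main: "(\<forall>y\<in>A. diameter A * \<bar>df y\<bar> \<le> C * diameter (f ` A)) \<and> (\<exists>y\<in>A. (k1 / 2 ^ p) * diameter A ^ p \<le> \<bar>df y\<bar>)"
    if A: "arc A" "A \<subseteq> ball c \<rho>" for A
  proof -
    obtain u v where uv: "a \<le> u" "u < v" "v \<le> b" "A = {u..v}" using A arcE by blast
    define R where "R = max \<bar>u - c\<bar> \<bar>v - c\<bar>"
    have R: "\<bar>y - c\<bar> \<le> R" if "y \<in> A" for y using that uv by (auto simp: R_def)
    have len: "v - u \<le> 2 * R" using R[of u] R[of v] uv by auto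
    have inb: "y \<in> {a..b}" "\<bar>y - c\<bar> < \<rho>" if "y \<in> A" for y
      using A that uv by (auto simp: dist_real_def abs_minus_commute)
    have low: "k1 * (R / 2) ^ p \<le> \<bar>df y\<bar>" if "y \<in> A" "R / 2 \<le> \<bar>y - c\<bar>" for y
    proof -
      have "k1 * (R / 2) ^ p \<le> k1 * \<bar>y - c\<bar> ^ p" using that k len uv by (intro mult_left_mono power_mono) auto
      then show ?thesis using bnd[OF inb[OF that(1)]] by linarith
    qed
    have up: "\<bar>df y\<bar> \<le> k2 * R ^ p" if "y \<in> A" for y
    proof -
      have "k2 * \<bar>y - c\<bar> ^ p \<le> k2 * R ^ p" using k R[OF that] by (intro mult_left_mono power_mono) auto
      then show ?thesis using bnd[OF inb[OF that]] by linarith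
    qed
    have "(v - u) / 4 * (k1 * (R / 2) ^ p) \<le> diameter (f ` A)"
    proof (cases "R = \<bar>v - c\<bar>")
      case True
      then have "v \<ge> c" using uv by (auto simp: R_def max_def abs_if split: if_splits)
      have "(v - (v - (v - u) / 4)) * (k1 * (R / 2) ^ p) \<le> diameter (f ` A)"
      proof (rule diameter_image_ge_deriv[OF A(1)])
        fix z assume "v - (v - u) / 4 < z" "z < v"
        then show "k1 * (R / 2) ^ p \<le> \<bar>df z\<bar>" using True \<open>v \<ge> c\<close> len uv by (intro low) (auto simp: field_simps)
      qed (use uv in \<open>auto simp: field_simps\<close>)
      then show ?thesis by simp
    next
      case False
      then have "u \<le> c" "R = c - u" using uv by (auto simp: R_def max_def abs_if split: if_splits)
      have "((u + (v - u) / 4) - u) * (k1 * (R / 2) ^ p) \<le> diameter (f ` A)"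
      proof (rule diameter_image_ge_deriv[OF A(1)])
        fix z assume "u < z" "z < u + (v - u) / 4"
        then show "k1 * (R / 2) ^ p \<le> \<bar>df z\<bar>" using \<open>R = c - u\<close> \<open>u \<le> c\<close> len uv by (intro low) (auto simp: field_simps)
      qed (use uv in \<open>auto simp: field_simps\<close>)
      then show ?thesis by simp
    qed
    then have "(4 * 2 ^ p * (k2 / k1)) * ((v - u) / 4 * (k1 * (R / 2) ^ p)) \<le> (4 * 2 ^ p * (k2 / k1)) * diameter (f ` A)"
      using k by (intro mult_left_mono) auto
    moreover have "(4 * 2 ^ p * (k2 / k1)) * ((v - u) / 4 * (k1 * (R / 2) ^ p)) = (v - u) * (k2 * R ^ p)"
      using k by (simp add: field_simps power_divide)
    ultimately have d: "(v - u) * (k2 * R ^ p) \<le> (4 * 2 ^ p * (k2 / k1)) * diameter (f ` A)" by simp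
    have dpos: "0 \<le> diameter (f ` A)" using image_arc[OF A(1)] arc_diameter_pos by fastforce
    have "diameter A * \<bar>df y\<bar> \<le> C * diameter (f ` A)" if "y \<in> A" for y
    proof -
      have "diameter A * \<bar>df y\<bar> \<le> (v - u) * (k2 * R ^ p)" using up[OF that] uv by (auto intro!: mult_left_mono)
      also have "\<dots> \<le> C * diameter (f ` A)"
        using dpos by (intro order_trans[OF d] mult_right_mono) (auto simp: C_def)
      finally show ?thesis .
    qed
    moreover have "\<exists>y\<in>A. (k1 / 2 ^ p) * diameter A ^ p \<le> \<bar>df y\<bar>"
    proof -
      obtain y where y: "y \<in> A" "\<bar>y - c\<bar> = R"
      proof -
        have "\<bar>u - c\<bar> = R \<or> \<bar>v - c\<bar> = R" by (simp add: R_def max_def)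
        moreover have "u \<in> A" "v \<in> A" using uv by auto
        ultimately show ?thesis using that by blast
      qed
      have "diameter A ^ p \<le> (2 * R) ^ p" using len uv by (intro power_mono) auto
      then have "(k1 / 2 ^ p) * diameter A ^ p \<le> (k1 / 2 ^ p) * (2 * R) ^ p" using k by (intro mult_left_mono) auto
      also have "\<dots> = k1 * \<bar>y - c\<bar> ^ p" using y by (simp add: power_mult_distrib)
      also have "\<dots> \<le> \<bar>df y\<bar>" using bnd inb[OF y(1)] by blast
      finally show ?thesis using y by blast
    qed
    ultimately show ?thesis by blast
  qed
  have "quasi_mult_on (ball c \<rho>) C (k1 / 2 ^ p) p"
    unfolding quasi_mult_on_def using main by blast
  moreover have "C \<ge> 1" "k1 / 2 ^ p > 0" using k by (auto simp: C_def)
  ultimately show ?thesis using k by blast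
qed

lemma quasi_mult_local:
  assumes "x \<in> {a..b}"
  shows "\<exists>\<rho>>0. \<exists>C\<ge>1. \<exists>c>0. \<exists>p. quasi_mult_on (ball x \<rho>) C c p"
  using quasi_mult_regular[OF assms] quasi_mult_critical[OF assms] by blast

lemma quasi_mult_small:
  "\<exists>\<rho>>0. \<exists>C\<ge>1. \<exists>c>0. \<exists>p. \<forall>A. arc A \<and> diameter A < \<rho> \<longrightarrow>
     (\<forall>y\<in>A. diameter A * \<bar>df y\<bar> \<le> C * diameter (f ` A)) \<and> (\<exists>y\<in>A. c * diameter A ^ p \<le> \<bar>df y\<bar>)"
proof -
  obtain \<rho> C c p where loc: "\<And>x. x \<in> {a..b} \<Longrightarrow> \<rho> x > 0 \<and> C x \<ge> (1::real) \<and> c x > (0::real) \<and> quasi_mult_on (ball x (\<rho> x)) (C x) (c x) (p x)"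
    using quasi_mult_local by metis
  have "{a..b} \<subseteq> (\<Union>x\<in>{a..b}. ball x (\<rho> x))" using loc by force
  then obtain D where D: "D \<subseteq> {a..b}" "finite D" "{a..b} \<subseteq> (\<Union>x\<in>D. ball x (\<rho> x))"
    using compactE_image[of "{a..b}" "{a..b}" "\<lambda>x. ball x (\<rho> x)"] by (metis compact_Icc open_ball)
  have "D \<noteq> {}" using D ab by auto
  obtain \<delta> where \<delta>: "\<delta> > 0" "\<And>T. T \<subseteq> {a..b} \<Longrightarrow> diameter T < \<delta> \<Longrightarrow> \<exists>B\<in>(\<lambda>x. ball x (\<rho> x)) ` D. T \<subseteq> B"
    by (rule Lebesgue_number_lemma[of "{a..b}" "(\<lambda>x. ball x (\<rho> x)) ` D"]) (use D \<open>D \<noteq> {}\<close> in auto)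
  define C' where "C' = Max (C ` D)"
  define c' where "c' = Min (c ` D)"
  define p' where "p' = Max (p ` D)"
  have C': "C x \<le> C'" "c' \<le> c x" "p x \<le> p'" if "x \<in> D" for x
    using that D(2) by (auto simp: C'_def c'_def p'_def)
  have c'0: "c' > 0" unfolding c'_def using D loc \<open>D \<noteq> {}\<close> by (subst Min_gr_iff) auto
  have C'1: "C' \<ge> 1" using C' loc D \<open>D \<noteq> {}\<close> by (metis all_not_in_conv order_trans subsetD)
  \<comment> \<open>For lengths below 1 the lower bound only gets weaker when the exponent is raised
    to the maximum \<open>p'\<close>.\<close>
  have "(\<forall>y\<in>A. diameter A * \<bar>df y\<bar> \<le> C' * diameter (f ` A)) \<and> (\<exists>y\<in>A. c' * diameter A ^ p' \<le> \<bar>df y\<bar>)"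
    if A: "arc A" "diameter A < min \<delta> 1" for A
  proof -
    obtain x where x: "x \<in> D" "A \<subseteq> ball x (\<rho> x)" using \<delta>(2)[of A] A arc_subset by auto
    then have q: "quasi_mult_on (ball x (\<rho> x)) (C x) (c x) (p x)" using loc D by blast
    have dpos: "0 \<le> diameter (f ` A)" using image_arc[OF A(1)] arc_diameter_pos by fastforce
    have "diameter A * \<bar>df y\<bar> \<le> C' * diameter (f ` A)" if "y \<in> A" for y
    proof -
      have "diameter A * \<bar>df y\<bar> \<le> C x * diameter (f ` A)" using q A x that unfolding quasi_mult_on_def by blast
      also have "\<dots> \<le> C' * diameter (f ` A)" using C' x dpos by (intro mult_right_mono) auto
      finally show ?thesis .
    qed
    moreover obtain y where y: "y \<in> A" "c x * diameter A ^ p x \<le> \<bar>df y\<bar>"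
      using q A x unfolding quasi_mult_on_def by blast
    have "c' * diameter A ^ p' \<le> c x * diameter A ^ p x"
      using C'[OF x(1)] c'0 A arc_diameter_pos[OF A(1)] by (intro mult_mono power_decreasing) auto
    ultimately show ?thesis using y by (metis order_trans)
  qed
  then show ?thesis using \<delta> c'0 C'1
    by (intro exI[of _ "min \<delta> 1"] conjI exI[of _ C'] exI[of _ c'] exI[of _ p']) auto
qed

text \<open>Long arcs satisfy the bound with some constant because their images have length bounded
  below.\<close>

lemma quasi_mult:
  "\<exists>C\<ge>1. \<forall>A. arc A \<longrightarrow> (\<forall>y\<in>A. diameter A * \<bar>df y\<bar> \<le> C * diameter (f ` A))"
proof -
  obtain \<rho> C c p where \<rho>: "\<rho> > 0" "C \<ge> 1" "c > 0"
    and q0: "\<forall>A. arc A \<and> diameter A < \<rho> \<longrightarrow>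
     (\<forall>y\<in>A. diameter A * \<bar>df y\<bar> \<le> C * diameter (f ` A)) \<and> (\<exists>y\<in>A. c * diameter A ^ p \<le> \<bar>df y\<bar>)"
    using quasi_mult_small by (elim exE conjE) (rule that)
  then have q: "\<And>A y. arc A \<Longrightarrow> diameter A < \<rho> \<Longrightarrow> y \<in> A \<Longrightarrow> diameter A * \<bar>df y\<bar> \<le> C * diameter (f ` A)"
    by blast
  obtain \<kappa> where \<kappa>: "\<kappa> > 0" "\<And>A. arc A \<Longrightarrow> diameter A \<ge> \<rho> \<Longrightarrow> diameter (f ` A) \<ge> \<kappa>"
    using diameter_image_lower[OF \<rho>(1), of 1] by auto
  define C' where "C' = max C ((b - a) * M / \<kappa>)"
  have "diameter A * \<bar>df y\<bar> \<le> C' * diameter (f ` A)" if A: "arc A" "y \<in> A" for A y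
  proof (cases "diameter A < \<rho>")
    case True
    have dpos: "0 \<le> diameter (f ` A)" using image_arc[OF A(1)] arc_diameter_pos by fastforce
    then have "C * diameter (f ` A) \<le> C' * diameter (f ` A)" by (intro mult_right_mono) (auto simp: C'_def)
    with q[OF A(1) True A(2)] show ?thesis by linarith
  next
    case False
    have "diameter A * \<bar>df y\<bar> \<le> (b - a) * M"
      using arc_diameter_le[OF A(1)] ab abs_df_le[OF subsetD[OF arc_subset[OF A(1)] A(2)]] by (intro mult_mono) auto
    also have "\<dots> \<le> (b - a) * M / \<kappa> * diameter (f ` A)"
      using \<kappa>(2)[OF A(1)] False \<kappa>(1) ab M_ge_1 by (simp add: pos_le_divide_eq mult.commute mult_left_mono)
    also have "\<dots> \<le> C' * diameter (f ` A)"
      using \<kappa>(2)[OF A(1)] False \<kappa>(1) by (intro mult_right_mono) (auto simp: C'_def)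
    finally show ?thesis .
  qed
  moreover have "C' \<ge> 1" using \<rho> by (auto simp: C'_def)
  ultimately show ?thesis by blast
qed

definition C :: real where
  "C = (SOME C. C \<ge> 1 \<and> (\<forall>A. arc A \<longrightarrow> (\<forall>y\<in>A. diameter A * \<bar>df y\<bar> \<le> C * diameter (f ` A))))"

lemma C_props:
  shows C_ge_1: "1 \<le> C"
    and diameter_image_ge: "arc A \<Longrightarrow> y \<in> A \<Longrightarrow> diameter A * \<bar>df y\<bar> \<le> C * diameter (f ` A)"
proof -
  have "C \<ge> 1 \<and> (\<forall>A. arc A \<longrightarrow> (\<forall>y\<in>A. diameter A * \<bar>df y\<bar> \<le> C * diameter (f ` A)))"
    unfolding C_def using quasi_mult by (rule someI_ex)
  then show "1 \<le> C" "arc A \<Longrightarrow> y \<in> A \<Longrightarrow> diameter A * \<bar>df y\<bar> \<le> C * diameter (f ` A)" by auto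
qed

text \<open>Up to \<open>C\<close>, the image has at least the length of the arc times the largest
  derivative, and that derivative is at least a power of the length.\<close>

lemma diameter_image_power:
  "\<exists>k>0. \<exists>p. \<forall>A. arc A \<longrightarrow> k * diameter A ^ p \<le> diameter (f ` A)"
proof -
  obtain \<rho> C' c p where \<rho>: "\<rho> > 0" "C' \<ge> (1::real)" "c > 0"
    and q0: "\<forall>A. arc A \<and> diameter A < \<rho> \<longrightarrow>
     (\<forall>y\<in>A. diameter A * \<bar>df y\<bar> \<le> C' * diameter (f ` A)) \<and> (\<exists>y\<in>A. c * diameter A ^ p \<le> \<bar>df y\<bar>)"
    using quasi_mult_small by (elim exE conjE) (rule that)
  then have q: "\<And>A. arc A \<Longrightarrow> diameter A < \<rho> \<Longrightarrow> \<exists>y\<in>A. c * diameter A ^ p \<le> \<bar>df y\<bar>"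
    by blast
  obtain \<kappa> where \<kappa>: "\<kappa> > 0" "\<And>A. arc A \<Longrightarrow> diameter A \<ge> \<rho> \<Longrightarrow> diameter (f ` A) \<ge> \<kappa>"
    using diameter_image_lower[OF \<rho>(1), of 1] by auto
  define k where "k = min (c / C) (\<kappa> / (b - a) ^ Suc p)"
  have "k * diameter A ^ Suc p \<le> diameter (f ` A)" if A: "arc A" for A
  proof (cases "diameter A < \<rho>")
    case True
    then obtain y where y: "y \<in> A" "c * diameter A ^ p \<le> \<bar>df y\<bar>" using q A by blast
    have "diameter A * (c * diameter A ^ p) \<le> diameter A * \<bar>df y\<bar>"
      using y arc_diameter_pos[OF A] by (intro mult_left_mono) auto
    also have "\<dots> \<le> C * diameter (f ` A)" by (rule diameter_image_ge[OF A y(1)])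
    finally have "c / C * diameter A ^ Suc p \<le> diameter (f ` A)"
      using C_ge_1 by (simp add: field_simps)
    moreover have "k * diameter A ^ Suc p \<le> c / C * diameter A ^ Suc p"
      using arc_diameter_pos[OF A] by (intro mult_right_mono) (auto simp: k_def)
    ultimately show ?thesis by linarith
  next
    case False
    have "k * diameter A ^ Suc p \<le> \<kappa> / (b - a) ^ Suc p * diameter A ^ Suc p"
      using arc_diameter_pos[OF A] by (intro mult_right_mono) (auto simp: k_def)
    also have "\<dots> \<le> \<kappa> / (b - a) ^ Suc p * (b - a) ^ Suc p"
      using arc_diameter_pos[OF A] arc_diameter_le[OF A] \<kappa> ab by (intro mult_left_mono power_mono) auto
    also have "\<dots> = \<kappa>" using ab by simp
    finally show ?thesis using \<kappa>(2)[OF A] False by linarith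
  qed
  moreover have "k > 0" using \<rho> \<kappa> C_ge_1 ab by (auto simp: k_def)
  ultimately show ?thesis by blast
qed

text \<open>Carries an upper bound on the length of an image back to the arc itself, at the price of
  a root.\<close>

lemma diameter_iter_power:
  "\<exists>k>0. \<exists>p. \<forall>A. arc A \<longrightarrow> k * diameter A ^ p \<le> width n A"
proof (induction n)
  case 0
  show ?case by (intro exI[of _ 1] conjI exI[of _ "1::nat"]) auto
next
  case (Suc n)
  obtain k p where k: "k > 0" "\<And>A. arc A \<Longrightarrow> k * diameter A ^ p \<le> width n A" using Suc by blast
  obtain l q where l: "l > 0" "\<And>A. arc A \<Longrightarrow> l * diameter A ^ q \<le> diameter (f ` A)"
    using diameter_image_power by blast
  have "l * k ^ q * diameter A ^ (p * q) \<le> diameter ((f ^^ Suc n) ` A)" if A: "arc A" for A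
  proof -
    have "l * k ^ q * diameter A ^ (p * q) = l * (k * diameter A ^ p) ^ q"
      by (simp add: power_mult power_mult_distrib)
    also have "\<dots> \<le> l * width n A ^ q"
      using l(1) k arc_diameter_pos[OF A] A by (intro mult_left_mono power_mono) (auto intro!: mult_nonneg_nonneg)
    also have "\<dots> \<le> diameter (f ` (f ^^ n) ` A)" by (rule l(2)[OF iter_arc[OF A]])
    finally show ?thesis by (simp add: image_comp)
  qed
  moreover have "l * k ^ q > 0" using l k by simp
  ultimately show ?case by blast
qed

text \<open>Away from \<open>Crit\<close> the derivative is bounded below, so on short arcs it is
  constant up to the factor \<open>exp \<epsilon>\<close>; only visits near \<open>Crit\<close> cost
  the full constant \<open>C\<close>.\<close>

lemma small_distortion:
  assumes \<epsilon>: "\<epsilon> > 0" and r': "r' > 0"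
  shows "\<exists>r>0. \<forall>A. arc A \<and> diameter A < r \<and> (\<forall>x\<in>A. \<forall>c\<in>Crit. r' \<le> \<bar>x - c\<bar>) \<longrightarrow>
     (\<forall>y\<in>A. diameter A * \<bar>df y\<bar> \<le> exp \<epsilon> * diameter (f ` A))"
proof -
  define K where "K = {x \<in> {a..b}. \<forall>c\<in>Crit. r' \<le> \<bar>x - c\<bar>}"
  have "K = {a..b} \<inter> (\<Inter>c\<in>Crit. - ball c r')" by (auto simp: K_def dist_real_def abs_minus_commute not_less)
  then have cK: "compact K" by (auto intro!: compact_Int_closed closed_INT)
  have "\<exists>m>0. \<forall>x\<in>K. m \<le> \<bar>df x\<bar>"
  proof (cases "K = {}")
    case False
    have "continuous_on K (\<lambda>x. \<bar>df x\<bar>)"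
      by (intro continuous_on_rabs continuous_on_subset[OF cont_df]) (auto simp: K_def)
    then obtain x where x: "x \<in> K" "\<And>y. y \<in> K \<Longrightarrow> \<bar>df x\<bar> \<le> \<bar>df y\<bar>"
      using continuous_attains_inf[OF cK False] by blast
    have "x \<notin> Crit" using x r' by (force simp: K_def)
    then have "df x \<noteq> 0" using x by (auto simp: K_def Crit_def)
    then show ?thesis using x by (intro exI[of _ "\<bar>df x\<bar>"]) auto
  qed (auto intro: exI[of _ 1])
  then obtain m where m: "m > 0" "\<And>x. x \<in> K \<Longrightarrow> m \<le> \<bar>df x\<bar>" by blast
  \<comment> \<open>Since \<open>m \<le> \<bar>df y\<bar>\<close>, a change of the derivative by
    less than \<open>w\<close> leaves at least
    \<open>exp (- \<epsilon>) * \<bar>df y\<bar>\<close>.\<close>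
  define w where "w = (1 - exp (- \<epsilon>)) * m"
  have w: "w > 0" using \<epsilon> m by (simp add: w_def)
  have "uniformly_continuous_on {a..b} df" by (rule compact_uniformly_continuous[OF cont_df]) auto
  then obtain r where r: "r > 0" "\<And>x y. x \<in> {a..b} \<Longrightarrow> y \<in> {a..b} \<Longrightarrow> \<bar>x - y\<bar> < r \<Longrightarrow> \<bar>df x - df y\<bar> < w"
    using w unfolding uniformly_continuous_on_def dist_real_def by metis
  have "diameter A * \<bar>df y\<bar> \<le> exp \<epsilon> * diameter (f ` A)"
    if A: "arc A" "diameter A < r" "\<And>x c. x \<in> A \<Longrightarrow> c \<in> Crit \<Longrightarrow> r' \<le> \<bar>x - c\<bar>" and y: "y \<in> A" for A y
  proof -
    obtain u v where uv: "a \<le> u" "u < v" "v \<le> b" "A = {u..v}" using A arcE by blast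
    have yK: "y \<in> K" using y A uv by (auto simp: K_def)
    have "(v - u) * (exp (- \<epsilon>) * \<bar>df y\<bar>) \<le> diameter (f ` A)"
    proof (rule diameter_image_ge_deriv[OF A(1)])
      fix z assume z: "u < z" "z < v"
      have "\<bar>df z - df y\<bar> < w" using z y uv A(2) by (intro r(2)) auto
      moreover have "w \<le> (1 - exp (- \<epsilon>)) * \<bar>df y\<bar>" using m(2)[OF yK] \<epsilon> unfolding w_def by (intro mult_left_mono) auto
      ultimately show "exp (- \<epsilon>) * \<bar>df y\<bar> \<le> \<bar>df z\<bar>" by (simp add: algebra_simps)
    qed (use uv in auto)
    then show ?thesis using uv by (simp add: exp_minus field_simps)
  qed
  then show ?thesis using r by (intro exI[of _ r]) auto
qed

end

text \<open>A window of \<open>T + 1\<close> integers beginning at the least element of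
  \<open>B\<close> contains at most \<open>s\<close> elements. Removing it costs \<open>s\<close>
  and shortens the range by \<open>T + 1\<close>.\<close>

lemma card_separated_le:
  fixes B :: "nat set"
  assumes s: "s \<ge> 1"
  shows "\<lbrakk>B \<subseteq> {..<N}; \<And>i j. i \<in> B \<Longrightarrow> j \<in> B \<Longrightarrow> i < j \<Longrightarrow> j - i < s \<or> T < j - i\<rbrakk>
    \<Longrightarrow> real (card B) \<le> real s * (real N / (real T + 1) + 1)"
proof (induction N arbitrary: B rule: less_induct)
  case (less N)
  have fB: "finite B" using less.prems(1) finite_subset by blast
  show ?case
  proof (cases "B = {}")
    case True
    then show ?thesis by simp
  next
    case False
    define m where "m = Min B"
    have m: "m \<in> B" "\<And>j. j \<in> B \<Longrightarrow> m \<le> j" using False fB by (auto simp: m_def)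
    have near: "B \<inter> {..m + T} \<subseteq> {m..<m + s}"
    proof
      fix j assume j: "j \<in> B \<inter> {..m + T}"
      then show "j \<in> {m..<m + s}" using less.prems(2)[OF m(1), of j] m(2)[of j] s by (cases "j = m") auto
    qed
    have c1: "card (B \<inter> {..m + T}) \<le> s" using card_mono[OF _ near] by simp
    \<comment> \<open>The shift by \<open>T + 1\<close> keeps differences and fits the remaining
      elements into the shorter range of the induction hypothesis.\<close>
    define B' where "B' = (\<lambda>j. j - Suc T) ` (B \<inter> {Suc (m + T)..})"
    have inj: "inj_on (\<lambda>j. j - Suc T) (B \<inter> {Suc (m + T)..})" by (auto intro!: inj_onI)
    have c2: "card B' = card (B \<inter> {Suc (m + T)..})" unfolding B'_def by (rule card_image[OF inj])
    have un: "B = (B \<inter> {..m + T}) \<union> (B \<inter> {Suc (m + T)..})" by auto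
    have "card B = card (B \<inter> {..m + T}) + card (B \<inter> {Suc (m + T)..})"
      using fB by (subst un, subst card_Un_disjoint) auto
    then have c: "card B \<le> s + card B'" using c1 c2 by simp
    show ?thesis
    proof (cases "N \<le> Suc T")
      case True
      then have "B \<inter> {Suc (m + T)..} = {}" using less.prems(1) by auto
      then have "card B \<le> s" using c by (simp add: B'_def)
      then have "real (card B) \<le> real s * 1" by simp
      also have "\<dots> \<le> real s * (real N / (real T + 1) + 1)" by (intro mult_left_mono) auto
      finally show ?thesis .
    next
      case False
      have "real (card B') \<le> real s * (real (N - Suc T) / (real T + 1) + 1)"
      proof (rule less.IH)
        show "N - Suc T < N" using False by simp
        show "B' \<subseteq> {..<N - Suc T}" using less.prems(1) by (auto simp: B'_def)
        fix i j assume "i \<in> B'" "j \<in> B'" "i < j"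
        then obtain i' j' where ij: "i' \<in> B" "j' \<in> B" "i' \<ge> Suc T" "j' \<ge> Suc T" "i = i' - Suc T" "j = j' - Suc T"
          by (auto simp: B'_def)
        then show "j - i < s \<or> T < j - i" using less.prems(2)[of i' j'] \<open>i < j\<close> by auto
      qed
      moreover have "real (N - Suc T) / (real T + 1) = real N / (real T + 1) - 1"
        using False by (simp add: of_nat_diff field_simps)
      ultimately have "real (card B') \<le> real s * (real N / (real T + 1))" by simp
      then show ?thesis using c by (simp add: algebra_simps)
    qed
  qed
qed

section \<open>Expanding Julia sets and the telescoped distortion estimate\<close>

text \<open>Requiring the property for all smaller values lets the minimum of finitely many
  thresholds serve for all of them.\<close>

lemma finite_uniform_small:
  assumes "finite S" "\<And>s. s \<in> S \<Longrightarrow> \<exists>\<rho>>0::real. \<forall>\<rho>'. 0 < \<rho>' \<and> \<rho>' \<le> \<rho> \<longrightarrow> P s \<rho>'"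
  shows "\<exists>\<rho>>0. \<forall>s\<in>S. \<forall>\<rho>'. 0 < \<rho>' \<and> \<rho>' \<le> \<rho> \<longrightarrow> P s \<rho>'"
  using assms
proof (induction S rule: finite_induct)
  case empty
  show ?case by (intro exI[of _ 1]) auto
next
  case (insert s S)
  then obtain \<rho>1 where 1: "\<rho>1 > 0" "\<forall>s\<in>S. \<forall>\<rho>'. 0 < \<rho>' \<and> \<rho>' \<le> \<rho>1 \<longrightarrow> P s \<rho>'" by auto
  obtain \<rho>2 where 2: "\<rho>2 > 0" "\<forall>\<rho>'. 0 < \<rho>' \<and> \<rho>' \<le> \<rho>2 \<longrightarrow> P s \<rho>'" using insert.prems by auto
  show ?case using 1 2 by (intro exI[of _ "min \<rho>1 \<rho>2"]) auto
qed

lemma finite_uniform_large: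
  assumes "finite S" "\<And>s. s \<in> S \<Longrightarrow> \<exists>n0::nat. \<forall>n\<ge>n0. P s n"
  shows "\<exists>n0. \<forall>s\<in>S. \<forall>n\<ge>n0. P s n"
  using assms
proof (induction S rule: finite_induct)
  case (insert s S)
  then obtain n1 where 1: "\<forall>s\<in>S. \<forall>n\<ge>n1. P s n" by auto
  obtain n2 where 2: "\<forall>n\<ge>n2. P s n" using insert.prems by auto
  show ?case using 1 2 by (intro exI[of _ "max n1 n2"]) auto
qed simp

text \<open>\<open>J_back\<close> holds because \<open>f\<close> is open at every other point, and \<open>periodic\<close> is the bound
  \<open>\<nu> \<le> chi_inf\<close> for the uniform measure on the orbit of \<open>p\<close>.\<close>

locale expanding_julia = interval_map +
  fixes J :: "real set" and \<nu> :: real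
  assumes \<nu>_pos: "0 < \<nu>"
    and closed_J: "closed J"
    and J_sub: "J \<subseteq> {a..b}"
    and J_forward: "x \<in> J \<Longrightarrow> f x \<in> J"
    and J_nonempty: "J \<noteq> {}"
    and J_not_singleton: "\<not> is_singleton J"
    and exact: "openin (top_of_set {a..b}) U \<Longrightarrow> U \<inter> J \<noteq> {} \<Longrightarrow> \<exists>n\<ge>1. J \<subseteq> (f ^^ n) ` U"
    and J_back: "e \<in> {a..b} \<Longrightarrow> e \<notin> J \<Longrightarrow> f e \<in> J \<Longrightarrow> df e = 0 \<or> e = a \<or> e = b"
    and fatou: "e \<in> {a..b} \<Longrightarrow> e \<notin> J \<Longrightarrow> \<epsilon> > 0 \<Longrightarrow>
      \<exists>\<eta>>0. \<forall>n. \<forall>x\<in>{a..b}. \<bar>x - e\<bar> < \<eta> \<longrightarrow> \<bar>(f ^^ n) x - (f ^^ n) e\<bar> < \<epsilon>"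
    and periodic: "p \<in> J \<Longrightarrow> n \<ge> 1 \<Longrightarrow> (f ^^ n) p = p \<Longrightarrow> exp (\<nu> * real n) \<le> (\<Prod>j<n. \<bar>df ((f ^^ j) p)\<bar>)"
begin

lemma J_iter: "x \<in> J \<Longrightarrow> (f ^^ n) x \<in> J"
  using J_forward by (induction n) auto

lemma crit_not_periodic:
  assumes "c \<in> Crit" "c \<in> J" "n \<ge> 1"
  shows "(f ^^ n) c \<noteq> c"
proof
  assume "(f ^^ n) c = c"
  then have "exp (\<nu> * real n) \<le> (\<Prod>j<n. \<bar>df ((f ^^ j) c)\<bar>)" using periodic assms by blast
  also have "\<dots> = 0" using assms by (intro prod_zero) (auto simp: Crit_def intro!: bexI[of _ 0])
  finally show False using exp_gt_zero[of "\<nu> * real n"] by linarith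
qed

text \<open>A critical point outside \<open>J\<close> has positive distance from \<open>J\<close>.
  One inside \<open>J\<close> is not periodic, so its first \<open>T\<close> iterates avoid a
  neighbourhood of it, and by the Lipschitz bound so do those of nearby points.\<close>

lemma crit_separation:
  "\<exists>\<rho>>0. \<forall>c\<in>Crit. (c \<notin> J \<longrightarrow> (\<forall>x\<in>J. \<rho> \<le> \<bar>x - c\<bar>)) \<and>
     (c \<in> J \<longrightarrow> (\<forall>m\<in>{1..T}. \<forall>x\<in>{a..b}. \<bar>x - c\<bar> < \<rho> \<longrightarrow> \<rho> \<le> \<bar>(f ^^ m) x - c\<bar>))"
proof -
  have "\<exists>\<rho>>0. \<forall>c\<in>Crit. \<forall>\<rho>'. 0 < \<rho>' \<and> \<rho>' \<le> \<rho> \<longrightarrow> (c \<notin> J \<longrightarrow> (\<forall>x\<in>J. \<rho>' \<le> \<bar>x - c\<bar>)) \<and>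
     (c \<in> J \<longrightarrow> (\<forall>m\<in>{1..T}. \<forall>x\<in>{a..b}. \<bar>x - c\<bar> < \<rho>' \<longrightarrow> \<rho>' \<le> \<bar>(f ^^ m) x - c\<bar>))"
  proof (rule finite_uniform_small[OF finite_Crit])
    fix c assume c: "c \<in> Crit"
    show "\<exists>\<rho>>0. \<forall>\<rho>'. 0 < \<rho>' \<and> \<rho>' \<le> \<rho> \<longrightarrow> (c \<notin> J \<longrightarrow> (\<forall>x\<in>J. \<rho>' \<le> \<bar>x - c\<bar>)) \<and>
     (c \<in> J \<longrightarrow> (\<forall>m\<in>{1..T}. \<forall>x\<in>{a..b}. \<bar>x - c\<bar> < \<rho>' \<longrightarrow> \<rho>' \<le> \<bar>(f ^^ m) x - c\<bar>))"
    proof (cases "c \<in> J")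
      case False
      obtain d where d: "d > 0" "\<forall>x\<in>J. d \<le> dist c x"
        using separate_point_closed[OF closed_J False] by blast
      then show ?thesis using False by (intro exI[of _ d]) (auto simp: dist_real_def abs_minus_commute intro: order_trans)
    next
      case True
      have "\<exists>\<rho>>0. \<forall>m\<in>{1..T}. \<forall>\<rho>'. 0 < \<rho>' \<and> \<rho>' \<le> \<rho> \<longrightarrow> (\<forall>x\<in>{a..b}. \<bar>x - c\<bar> < \<rho>' \<longrightarrow> \<rho>' \<le> \<bar>(f ^^ m) x - c\<bar>)"
      proof (rule finite_uniform_small)
        fix m assume m: "m \<in> {1..T}"
        define d where "d = \<bar>(f ^^ m) c - c\<bar>"
        have d: "d > 0" using crit_not_periodic[OF c True] m by (auto simp: d_def)
        have cI: "c \<in> {a..b}" using c by (auto simp: Crit_def)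
        \<comment> \<open>Points within this distance of \<open>c\<close> have images within
          \<open>d / 2\<close> of \<open>(f ^^ m) c\<close>, hence at least \<open>d / 2\<close>
          away from \<open>c\<close>.\<close>
        define \<rho> where "\<rho> = d / (2 * M ^ m)"
        have Mm: "M ^ m \<ge> 1" using M_ge_1 by simp
        have \<rho>: "\<rho> > 0" "\<rho> \<le> d / 2" "M ^ m * \<rho> = d / 2" using d Mm M_ge_1 by (auto simp: \<rho>_def field_simps mult_left_le)
        have "\<rho>' \<le> \<bar>(f ^^ m) x - c\<bar>" if "0 < \<rho>'" "\<rho>' \<le> \<rho>" "x \<in> {a..b}" "\<bar>x - c\<bar> < \<rho>'" for \<rho>' x
        proof -
          have "\<bar>(f ^^ m) x - (f ^^ m) c\<bar> \<le> M ^ m * \<bar>x - c\<bar>" using lipschitz_iter that cI by blast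
          also have "\<dots> \<le> M ^ m * \<rho>" using that Mm by (intro mult_left_mono) auto
          finally have "\<bar>(f ^^ m) x - (f ^^ m) c\<bar> \<le> d / 2" using \<rho> by simp
          moreover have "d \<le> \<bar>(f ^^ m) x - (f ^^ m) c\<bar> + \<bar>(f ^^ m) x - c\<bar>" unfolding d_def by linarith
          ultimately have "d / 2 \<le> \<bar>(f ^^ m) x - c\<bar>" by simp
          then show ?thesis using \<rho> that by linarith
        qed
        then show "\<exists>\<rho>>0. \<forall>\<rho>'. 0 < \<rho>' \<and> \<rho>' \<le> \<rho> \<longrightarrow> (\<forall>x\<in>{a..b}. \<bar>x - c\<bar> < \<rho>' \<longrightarrow> \<rho>' \<le> \<bar>(f ^^ m) x - c\<bar>)"
          using \<rho>(1) by blast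
      qed auto
      then show ?thesis using True by blast
    qed
  qed
  then obtain \<rho> where \<rho>: "\<rho> > 0" "\<And>c \<rho>'. c \<in> Crit \<Longrightarrow> 0 < \<rho>' \<and> \<rho>' \<le> \<rho> \<Longrightarrow> (c \<notin> J \<longrightarrow> (\<forall>x\<in>J. \<rho>' \<le> \<bar>x - c\<bar>)) \<and>
     (c \<in> J \<longrightarrow> (\<forall>m\<in>{1..T}. \<forall>x\<in>{a..b}. \<bar>x - c\<bar> < \<rho>' \<longrightarrow> \<rho>' \<le> \<bar>(f ^^ m) x - c\<bar>))" by metis
  show ?thesis using \<rho>(1) \<rho>(2)[of _ \<rho>] by (intro exI[of _ \<rho>]) auto
qed

text \<open>\<open>w\<close> is the size of a second object transported along the orbit of \<open>A\<close>. A factor \<open>C\<close> is lost whenever the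
  image of \<open>A\<close> is large or close to a critical point in \<open>J\<close>; the times of the latter kind are far apart, since such
  critical points are not periodic.\<close>

lemma telescope:
  assumes \<epsilon>: "\<epsilon> > 0"
  shows "\<exists>r1>0. \<exists>K\<ge>1. \<forall>r0 A N w. 0 < r0 \<and> r0 \<le> r1 \<and> arc A \<and> A \<inter> J \<noteq> {} \<and> w 0 \<ge> 0 \<and>
     (\<forall>j<N. \<exists>y\<in>(f ^^ j) ` A. w (Suc j) \<le> w j * \<bar>df y\<bar>) \<longrightarrow>
     diameter A * w N \<le> K * exp (\<epsilon> * real N) * C ^ card {j. j < N \<and> r0 \<le> width j A}
       * width N A * w 0"
proof -
  \<comment> \<open>Logarithm of the loss if every critical point is visited once. By the choice of
    \<open>T\<close>, one visit to each of them every \<open>T + 1\<close> steps costs at most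
    \<open>\<epsilon> / 2\<close> per step.\<close>
  define s where "s = real (card Crit) * ln C"
  have lnC: "ln C \<ge> 0" using C_ge_1 by simp
  then have s0: "s \<ge> 0" by (simp add: s_def)
  obtain T :: nat where T: "s / (real T + 1) \<le> \<epsilon> / 2"
  proof -
    obtain T :: nat where "2 * s / \<epsilon> < real T" using reals_Archimedean2 by blast
    then show ?thesis using \<epsilon> by (intro that[of T]) (simp add: field_simps)
  qed
  obtain \<rho> where \<rho>: "\<rho> > 0"
    and sepF: "\<And>c x. c \<in> Crit \<Longrightarrow> c \<notin> J \<Longrightarrow> x \<in> J \<Longrightarrow> \<rho> \<le> \<bar>x - c\<bar>"
    and sepJ: "\<And>c m x. c \<in> Crit \<Longrightarrow> c \<in> J \<Longrightarrow> 1 \<le> m \<Longrightarrow> m \<le> T \<Longrightarrow> x \<in> {a..b} \<Longrightarrow> \<bar>x - c\<bar> < \<rho> \<Longrightarrow> \<rho> \<le> \<bar>(f ^^ m) x - c\<bar>"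
    using crit_separation[of T] by (metis atLeastAtMost_iff)
  obtain r where r: "r > 0" and dist: "\<And>A y. arc A \<Longrightarrow> diameter A < r \<Longrightarrow> (\<And>x c. x \<in> A \<Longrightarrow> c \<in> Crit \<Longrightarrow> \<rho> / 2 \<le> \<bar>x - c\<bar>) \<Longrightarrow>
      y \<in> A \<Longrightarrow> diameter A * \<bar>df y\<bar> \<le> exp (\<epsilon> / 2) * diameter (f ` A)"
    using small_distortion[of "\<epsilon> / 2" "\<rho> / 2"] \<epsilon> \<rho> by (metis half_gt_zero)
  define r1 where "r1 = min r (\<rho> / 2)"
  define K where "K = exp s"
  have "diameter A * w N \<le> K * exp (\<epsilon> * real N) * C ^ card {j. j < N \<and> r0 \<le> width j A}
       * width N A * w 0"
    if r0: "0 < r0" "r0 \<le> r1" and A: "arc A" "A \<inter> J \<noteq> {}" and w0: "w 0 \<ge> 0"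
      and w: "\<And>j. j < N \<Longrightarrow> \<exists>y\<in>(f ^^ j) ` A. w (Suc j) \<le> w j * \<bar>df y\<bar>" for r0 A N and w :: "nat \<Rightarrow> real"
  proof -
    define D where "D j = width j A" for j
    have Dpos: "D j > 0" for j using arc_diameter_pos[OF iter_arc[OF A(1)]] by (simp add: D_def)
    define Bn where "Bn = {j. j < N \<and> r0 \<le> D j}"
    \<comment> \<open>Times at which the image is short and comes near \<open>c\<close>; it is then
      entirely within \<open>\<rho>\<close> of \<open>c\<close>.\<close>
    define Bc where "Bc c = {j. j < N \<and> D j < r0 \<and> (\<exists>x\<in>(f ^^ j) ` A. \<bar>x - c\<bar> < \<rho> / 2)}" for c
    define bad where "bad = Bn \<union> (\<Union>c\<in>Crit. Bc c)"
    have bad_sub: "bad \<subseteq> {..<N}" by (auto simp: bad_def Bn_def Bc_def)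
    define g where "g j = (if j \<in> bad then C else exp (\<epsilon> / 2))" for j
    have g0: "g j > 0" for j using C_ge_1 by (simp add: g_def)
    have step: "D j * \<bar>df y\<bar> \<le> g j * D (Suc j)" if "j < N" "y \<in> (f ^^ j) ` A" for j y
    proof -
      have aj: "arc ((f ^^ j) ` A)" by (rule iter_arc[OF A(1)])
      have Suc: "D (Suc j) = diameter (f ` (f ^^ j) ` A)" by (simp add: D_def image_comp)
      show ?thesis
      proof (cases "j \<in> bad")
        case True
        then show ?thesis using diameter_image_ge[OF aj that(2)] by (simp add: Suc g_def) (simp add: D_def)
      next
        case False
        then have "D j < r0" "\<And>x c. x \<in> (f ^^ j) ` A \<Longrightarrow> c \<in> Crit \<Longrightarrow> \<rho> / 2 \<le> \<bar>x - c\<bar>"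
          using that by (force simp: bad_def Bn_def Bc_def)+
        then have "D j * \<bar>df y\<bar> \<le> exp (\<epsilon> / 2) * diameter (f ` (f ^^ j) ` A)"
          using dist[OF aj _ _ that(2)] r0 by (simp add: D_def r1_def)
        then show ?thesis using False by (simp add: Suc g_def)
      qed
    qed
    \<comment> \<open>By \<open>step\<close>, the quotient of \<open>w\<close> and \<open>D\<close>
      grows at time \<open>j\<close> by at most the factor \<open>g j\<close>.\<close>
    have "D 0 * w n \<le> (\<Prod>j<n. g j) * D n * w 0" if "n \<le> N" for n
      using that
    proof (induction n)
      case (Suc n)
      obtain y where y: "y \<in> (f ^^ n) ` A" "w (Suc n) \<le> w n * \<bar>df y\<bar>" using w[of n] Suc.prems by auto
      have "D 0 * w (Suc n) \<le> D 0 * (w n * \<bar>df y\<bar>)" using y Dpos[of 0] by (intro mult_left_mono) auto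
      also have "\<dots> = (D 0 * w n) * \<bar>df y\<bar>" by simp
      also have "\<dots> \<le> ((\<Prod>j<n. g j) * D n * w 0) * \<bar>df y\<bar>" using Suc by (intro mult_right_mono) auto
      also have "\<dots> = ((\<Prod>j<n. g j) * w 0) * (D n * \<bar>df y\<bar>)" by simp
      also have "\<dots> \<le> ((\<Prod>j<n. g j) * w 0) * (g n * D (Suc n))"
        using step[of n y] Suc.prems y g0 w0 by (intro mult_left_mono mult_nonneg_nonneg prod_nonneg) (auto simp: less_imp_le)
      finally show ?case by (simp add: mult_ac)
    qed simp
    then have tel: "D 0 * w N \<le> (\<Prod>j<N. g j) * D N * w 0" by simp
    have "(\<Prod>j<N. g j) \<le> (\<Prod>j<N. exp (\<epsilon> / 2) * (if j \<in> bad then C else 1))"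
    proof (intro prod_mono conjI)
      fix j show "0 \<le> g j" using g0[of j] by simp
      have "1 \<le> exp (\<epsilon> / 2)" using \<epsilon> by simp
      then show "g j \<le> exp (\<epsilon> / 2) * (if j \<in> bad then C else 1)"
        using C_ge_1 by (auto simp: g_def mult_le_cancel_right1)
    qed
    also have "\<dots> = exp (\<epsilon> / 2) ^ N * C ^ card bad"
    proof -
      have "(\<Prod>j<N. if j \<in> bad then C else 1) = (\<Prod>j\<in>bad. C)"
        using bad_sub by (subst prod.inter_restrict[symmetric]) (auto simp: Int_absorb1 Int_absorb2 Int_commute)
      then show ?thesis by (simp add: prod.distrib)
    qed
    also have "\<dots> \<le> exp (\<epsilon> / 2) ^ N * (C ^ card Bn * (exp s * exp (\<epsilon> / 2 * N)))"
    proof (intro mult_left_mono)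
      have fin: "finite (Bc c)" "finite Bn" for c by (auto simp: Bc_def Bn_def)
      have cb: "card bad \<le> card Bn + (\<Sum>c\<in>Crit. card (Bc c))"
        unfolding bad_def using card_Un_le card_UN_le[OF finite_Crit] by (metis add_left_mono order_trans)
      have "real (card (Bc c)) \<le> real N / (real T + 1) + 1" if c: "c \<in> Crit" for c
      proof (cases "c \<in> J")
        case False
        \<comment> \<open>Every image contains a point of \<open>J\<close>, which stays
          \<open>\<rho>\<close> away from \<open>c\<close>.\<close>
        have "Bc c = {}"
        proof (rule ccontr)
          assume "Bc c \<noteq> {}"
          then obtain j x where j: "D j < r0" "x \<in> (f ^^ j) ` A" "\<bar>x - c\<bar> < \<rho> / 2" by (auto simp: Bc_def)
          obtain z where z: "z \<in> A" "z \<in> J" using A by blast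
          have "\<bar>(f ^^ j) z - x\<bar> \<le> D j" unfolding D_def using z j by (intro arc_dist_le iter_arc A) auto
          moreover have "\<rho> \<le> \<bar>(f ^^ j) z - c\<bar>" using sepF[OF c False] J_iter z by blast
          ultimately show False using j r0 unfolding r1_def by linarith
        qed
        then show ?thesis by simp
      next
        case True
        \<comment> \<open>Two visits at most \<open>T\<close> steps apart would bring a point near
          \<open>c\<close> back to within \<open>\<rho>\<close> of \<open>c\<close>.\<close>
        have "real (card (Bc c)) \<le> real 1 * (real N / (real T + 1) + 1)"
        proof (rule card_separated_le)
          show "Bc c \<subseteq> {..<N}" by (auto simp: Bc_def)
          fix i j assume ij: "i \<in> Bc c" "j \<in> Bc c" "i < j"
          obtain x where x: "x \<in> (f ^^ i) ` A" "\<bar>x - c\<bar> < \<rho> / 2" using ij by (auto simp: Bc_def)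
          obtain y where y: "y \<in> (f ^^ j) ` A" "\<bar>y - c\<bar> < \<rho> / 2" "D j < r0" using ij by (auto simp: Bc_def)
          have xI: "x \<in> {a..b}" using x iter_image arc_subset[OF A(1)] by blast
          have e: "(f ^^ (j - i)) ` (f ^^ i) ` A = (f ^^ j) ` A"
            using iter_add_image[of "j - i" i A] ij(3) by simp
          have "(f ^^ (j - i)) x \<in> (f ^^ j) ` A" using x(1) e by blast
          then have "\<bar>(f ^^ (j - i)) x - y\<bar> \<le> D j" unfolding D_def using y by (intro arc_dist_le iter_arc A) auto
          then have "\<bar>(f ^^ (j - i)) x - c\<bar> < \<rho>" using y r0 unfolding r1_def by linarith
          then have "\<not> j - i \<le> T" using sepJ[OF c True _ _ xI, of "j - i"] ij(3) x \<rho> by fastforce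
          then show "j - i < 1 \<or> T < j - i" by simp
        qed simp
        then show ?thesis by simp
      qed
      then have "(\<Sum>c\<in>Crit. real (card (Bc c))) \<le> real (card Crit) * (real N / (real T + 1) + 1)"
        by (rule sum_bounded_above)
      then have "ln C * (\<Sum>c\<in>Crit. real (card (Bc c))) \<le> ln C * (real (card Crit) * (real N / (real T + 1) + 1))"
        using lnC by (intro mult_left_mono)
      also have "\<dots> = s + s / (real T + 1) * N" by (simp add: s_def distrib_left)
      finally have sum: "ln C * (\<Sum>c\<in>Crit. real (card (Bc c))) \<le> s + s / (real T + 1) * N" .
      have "C ^ card bad \<le> C ^ (card Bn + (\<Sum>c\<in>Crit. card (Bc c)))" using cb C_ge_1 by (intro power_increasing) auto
      also have "\<dots> = C ^ card Bn * exp (ln C * (\<Sum>c\<in>Crit. real (card (Bc c))))"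
        using C_ge_1 by (simp add: power_add exp_of_nat2_mult flip: of_nat_sum)
      also have "\<dots> \<le> C ^ card Bn * (exp s * exp (\<epsilon> / 2 * N))"
      proof -
        have "s / (real T + 1) * N \<le> \<epsilon> / 2 * N" using T by (intro mult_right_mono) auto
        then have "exp (ln C * (\<Sum>c\<in>Crit. real (card (Bc c)))) \<le> exp (s + \<epsilon> / 2 * N)"
          using sum unfolding exp_le_cancel_iff by linarith
        then show ?thesis using C_ge_1 by (simp add: exp_add)
      qed
      finally show "C ^ card bad \<le> C ^ card Bn * (exp s * exp (\<epsilon> / 2 * N))" .
    qed simp
    also have "\<dots> = K * exp (\<epsilon> * real N) * C ^ card Bn"
    proof -
      have "exp (\<epsilon> / 2) ^ N * exp (\<epsilon> / 2 * N) = exp (\<epsilon> * N)"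
        by (simp add: exp_of_nat_mult[symmetric] exp_add[symmetric])
      then show ?thesis by (simp add: K_def mult_ac)
    qed
    finally have "(\<Prod>j<N. g j) * D N * w 0 \<le> K * exp (\<epsilon> * real N) * C ^ card Bn * D N * w 0"
      using Dpos[of N] w0 by (intro mult_right_mono) auto
    then show ?thesis using tel by (simp add: D_def Bn_def)
  qed
  moreover have "r1 > 0" "K \<ge> 1" using r \<rho> s0 by (auto simp: r1_def K_def)
  ultimately show ?thesis by (intro exI[of _ r1] conjI exI[of _ K]) auto
qed

end

section \<open>Cycles, free arcs and gaps\<close>

lemma exp_eventually_gt:
  assumes "(c::real) > 0"
  shows "\<exists>n0. \<forall>n\<ge>n0. B < exp (c * real n)"
proof -
  obtain n0 :: nat where n0: "\<bar>B\<bar> / c < real n0" using reals_Archimedean2 by blast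
  have "B < exp (c * real n)" if "n \<ge> n0" for n
  proof -
    have "\<bar>B\<bar> < c * real n0" using n0 assms by (simp add: field_simps)
    also have "\<dots> \<le> c * real n" using that assms by simp
    also have "\<dots> < exp (c * real n)" using exp_ge_add_one_self[of "c * real n"] by linarith
    finally show ?thesis by linarith
  qed
  then show ?thesis by blast
qed

section \<open>Derivatives along orbits and preperiodic points\<close>

context interval_map begin

text \<open>By the chain rule, the absolute value of the derivative of \<open>f ^^ n\<close> at
  \<open>p\<close>.\<close>

definition Df :: "nat \<Rightarrow> real \<Rightarrow> real" where "Df n p = (\<Prod>j<n. \<bar>df ((f ^^ j) p)\<bar>)"

lemma Df_0 [simp]: "Df 0 p = 1"
  by (simp add: Df_def)

lemma Df_Suc: "Df (Suc n) p = Df n p * \<bar>df ((f ^^ n) p)\<bar>"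
  by (simp add: Df_def)

lemma Df_add: "Df (m + n) p = Df n p * Df m ((f ^^ n) p)"
proof (induction m)
  case (Suc m)
  have "(f ^^ m) ((f ^^ n) p) = (f ^^ (m + n)) p" by (simp add: funpow_add)
  then show ?case using Suc by (simp add: Df_Suc)
qed simp

lemma Df_nonneg: "0 \<le> Df n p"
  by (simp add: Df_def prod_nonneg)

lemma Df_le: "p \<in> {a..b} \<Longrightarrow> Df n p \<le> M ^ n"
proof -
  assume p: "p \<in> {a..b}"
  have "(\<Prod>j<n. \<bar>df ((f ^^ j) p)\<bar>) \<le> (\<Prod>j<n. M)"
    by (intro prod_mono conjI abs_ge_zero abs_df_le iter_in p)
  then show ?thesis by (simp add: Df_def)
qed

lemma arc_near:
  assumes "e \<in> {a..b}" "\<eta> > 0"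
  shows "\<exists>A. arc A \<and> e \<in> A \<and> (\<forall>x\<in>A. \<bar>x - e\<bar> < \<eta>)"
proof -
  have "arc {max a (e - \<eta> / 2)..min b (e + \<eta> / 2)}"
    using assms ab by (intro arcI) (auto simp: min_def max_def)
  moreover have "e \<in> {max a (e - \<eta> / 2)..min b (e + \<eta> / 2)}" using assms by auto
  moreover have "\<bar>x - e\<bar> < \<eta>" if "x \<in> {max a (e - \<eta> / 2)..min b (e + \<eta> / 2)}" for x
  proof -
    have "e - \<eta> / 2 \<le> x" "x \<le> e + \<eta> / 2" using that by auto
    then show ?thesis using assms(2) by linarith
  qed
  ultimately show ?thesis by blast
qed

definition preper :: "real \<Rightarrow> bool" where "preper q \<longleftrightarrow> (\<exists>i j. i < j \<and> (f ^^ i) q = (f ^^ j) q)"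

text \<open>Starting one step later than necessary yields \<open>i \<ge> 1\<close>, so that
  \<open>preper_repels\<close> finds its large image at a positive time.\<close>

lemma preper_cycle:
  assumes "preper q"
  shows "\<exists>i\<ge>1. \<exists>P\<ge>1. (f ^^ P) ((f ^^ i) q) = (f ^^ i) q"
proof -
  obtain i j where ij: "i < j" "(f ^^ i) q = (f ^^ j) q" using assms by (auto simp: preper_def)
  have "(f ^^ (j - i)) ((f ^^ Suc i) q) = f ((f ^^ (j - i)) ((f ^^ i) q))"
    by (simp add: funpow_swap1)
  also have "(f ^^ (j - i)) ((f ^^ i) q) = (f ^^ (j - i + i)) q" by (simp only: funpow_add comp_apply)
  also have "\<dots> = (f ^^ j) q" using ij(1) by simp
  finally have "(f ^^ (j - i)) ((f ^^ Suc i) q) = (f ^^ Suc i) q" using ij by simp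
  then show ?thesis using ij(1) by (intro exI[of _ "Suc i"] conjI exI[of _ "j - i"]) auto
qed

lemma preper_iter: "preper ((f ^^ n) q) \<longleftrightarrow> preper q"
proof
  assume "preper ((f ^^ n) q)"
  then obtain i j where "i < j" "(f ^^ i) ((f ^^ n) q) = (f ^^ j) ((f ^^ n) q)" by (auto simp: preper_def)
  then have "i + n < j + n" "(f ^^ (i + n)) q = (f ^^ (j + n)) q" by (simp_all add: funpow_add)
  then show "preper q" unfolding preper_def by blast
next
  assume "preper q"
  then obtain i j where "i < j" "(f ^^ i) q = (f ^^ j) q" by (auto simp: preper_def)
  then have "(f ^^ n) ((f ^^ i) q) = (f ^^ n) ((f ^^ j) q)" by simp
  then have "(f ^^ (n + i)) q = (f ^^ (n + j)) q" by (simp only: funpow_add comp_apply)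
  then have "(f ^^ (i + n)) q = (f ^^ (j + n)) q" by (simp only: add.commute)
  then have "(f ^^ i) ((f ^^ n) q) = (f ^^ j) ((f ^^ n) q)" by (simp only: funpow_add comp_apply)
  then show "preper ((f ^^ n) q)" unfolding preper_def using \<open>i < j\<close> by blast
qed

lemma finite_orbit_preper: "finite {q. \<exists>i. q = (f ^^ i) p} \<Longrightarrow> preper p"
proof -
  assume fin: "finite {q. \<exists>i. q = (f ^^ i) p}"
  have "range (\<lambda>i. (f ^^ i) p) \<subseteq> {q. \<exists>i. q = (f ^^ i) p}" by blast
  then have "finite (range (\<lambda>i. (f ^^ i) p))" using fin by (rule finite_subset)
  then have "\<not> inj (\<lambda>i. (f ^^ i) p)" using finite_imageD[of "\<lambda>i. (f ^^ i) p" UNIV] infinite_UNIV_nat by blast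
  then obtain i j where "i \<noteq> j" "(f ^^ i) p = (f ^^ j) p" by (auto simp: inj_def)
  then show ?thesis unfolding preper_def by (metis linorder_neqE_nat)
qed

lemma preper_finite_orbit:
  assumes "preper p" shows "finite {q. \<exists>i. q = (f ^^ i) p}"
proof -
  obtain i j where ij: "i < j" "(f ^^ i) p = (f ^^ j) p" using assms by (auto simp: preper_def)
  have "(f ^^ n) p \<in> (\<lambda>k. (f ^^ k) p) ` {..<j}" for n
  proof (induction n rule: less_induct)
    case (less n)
    show ?case
    proof (cases "n < j")
      case False
      have "(f ^^ n) p = (f ^^ (n - j + j)) p" using False by simp
      also have "\<dots> = (f ^^ (n - j)) ((f ^^ j) p)" by (simp only: funpow_add comp_apply)
      also have "\<dots> = (f ^^ (n - j + i)) p" using ij(2) by (simp add: funpow_add)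
      finally show ?thesis using less[of "n - j + i"] ij(1) False by simp
    qed auto
  qed
  then have "{q. \<exists>i. q = (f ^^ i) p} \<subseteq> (\<lambda>k. (f ^^ k) p) ` {..<j}" by auto
  then show ?thesis by (rule finite_subset) auto
qed

end

section \<open>Repelling points and perfectness of the Julia set\<close>

context expanding_julia begin

lemma J_in: "x \<in> J \<Longrightarrow> x \<in> {a..b}"
  using J_sub by blast

lemma cycle_growth:
  assumes "p \<in> J" "P \<ge> 1" "(f ^^ P) p = p"
  shows "exp (\<nu> * real (n * P)) \<le> Df (n * P) p"
proof (cases "n = 0")
  case False
  have "(f ^^ (n * P)) p = p"
    using assms(3) by (induction n) (auto simp: funpow_add)
  then show ?thesis using periodic[OF assms(1), of "n * P"] False assms(2) by (simp add: Df_def)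
qed simp

lemma telescope_small:
  assumes "\<epsilon> > 0"
  shows "\<exists>r1>0. \<exists>K\<ge>1. \<forall>A N w. arc A \<and> A \<inter> J \<noteq> {} \<and> w 0 \<ge> 0 \<and>
     (\<forall>j<N. width j A < r1 \<and> (\<exists>y\<in>(f ^^ j) ` A. w (Suc j) \<le> w j * \<bar>df y\<bar>)) \<longrightarrow>
     diameter A * w N \<le> K * exp (\<epsilon> * real N) * width N A * w 0"
proof -
  obtain r1 K where r1: "r1 > 0" "K \<ge> 1" and *: "\<forall>r0 A N w. 0 < r0 \<and> r0 \<le> r1 \<and> arc A \<and> A \<inter> J \<noteq> {} \<and> w 0 \<ge> 0 \<and>
     (\<forall>j<N. \<exists>y\<in>(f ^^ j) ` A. w (Suc j) \<le> w j * \<bar>df y\<bar>) \<longrightarrow>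
     diameter A * w N \<le> K * exp (\<epsilon> * real N) * C ^ card {j. j < N \<and> r0 \<le> width j A}
       * width N A * w 0"
    using telescope[OF assms] by (elim exE conjE) (rule that)
  have "diameter A * w N \<le> K * exp (\<epsilon> * real N) * width N A * w 0"
    if "arc A" "A \<inter> J \<noteq> {}" "w 0 \<ge> 0" "\<And>j. j < N \<Longrightarrow> width j A < r1"
      "\<And>j. j < N \<Longrightarrow> \<exists>y\<in>(f ^^ j) ` A. w (Suc j) \<le> w j * \<bar>df y\<bar>" for A N and w :: "nat \<Rightarrow> real"
  proof -
    have e: "{j. j < N \<and> r1 \<le> width j A} = {}" using that(4) by force
    have "diameter A * w N \<le> K * exp (\<epsilon> * real N) * C ^ card {j. j < N \<and> r1 \<le> width j A}
       * width N A * w 0"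
      using *[rule_format, of r1 A w N] r1 that by blast
    then show ?thesis unfolding e by simp
  qed
  then show ?thesis using r1 by (intro exI[of _ r1] conjI exI[of _ K]) auto
qed

text \<open>The transported size is the derivative at a point of the arc; this is what is played
  against expansion along a cycle.\<close>

lemma telescope_point:
  assumes "\<epsilon> > 0"
  shows "\<exists>r1>0. \<exists>K\<ge>1. \<forall>A N p. arc A \<and> p \<in> A \<and> A \<inter> J \<noteq> {} \<and> (\<forall>j<N. width j A < r1) \<longrightarrow>
     diameter A * Df N p \<le> K * exp (\<epsilon> * real N) * width N A"
proof -
  obtain r1 K where r1: "r1 > 0" "K \<ge> 1" and *: "\<forall>A N w. arc A \<and> A \<inter> J \<noteq> {} \<and> w 0 \<ge> 0 \<and>
     (\<forall>j<N. width j A < r1 \<and> (\<exists>y\<in>(f ^^ j) ` A. w (Suc j) \<le> w j * \<bar>df y\<bar>)) \<longrightarrow>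
     diameter A * w N \<le> K * exp (\<epsilon> * real N) * width N A * w 0"
    using telescope_small[OF assms] by (elim exE conjE) (rule that)
  have "diameter A * Df N p \<le> K * exp (\<epsilon> * real N) * width N A"
    if "arc A" "p \<in> A" "A \<inter> J \<noteq> {}" "\<And>j. j < N \<Longrightarrow> width j A < r1" for A N p
  proof -
    have "diameter A * Df N p \<le> K * exp (\<epsilon> * real N) * width N A * Df 0 p"
      using that by (intro *[rule_format, of A "\<lambda>j. Df j p" N]) (auto simp: Df_Suc)
    then show ?thesis by simp
  qed
  then show ?thesis using r1 by (intro exI[of _ r1] conjI exI[of _ K]) auto
qed

text \<open>If all images stayed short, distortion at the rate \<open>\<nu> / 2\<close> would
  contradict expansion at the rate \<open>\<nu>\<close> along the cycle that \<open>q\<close>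
  reaches. The bound \<open>r1\<close> is the same for all \<open>q\<close>.\<close>

lemma preper_repels:
  "\<exists>r1>0. \<forall>q V. q \<in> J \<and> preper q \<and> arc V \<and> q \<in> V \<longrightarrow> (\<exists>i\<ge>1. r1 \<le> width i V)"
proof -
  obtain r1 K where r1: "r1 > 0" "K \<ge> 1" and tel: "\<forall>A N p. arc A \<and> p \<in> A \<and> A \<inter> J \<noteq> {} \<and> (\<forall>j<N. width j A < r1) \<longrightarrow>
     diameter A * Df N p \<le> K * exp (\<nu> / 2 * real N) * width N A"
    using telescope_point[of "\<nu> / 2"] \<nu>_pos half_gt_zero by blast
  have "\<exists>i\<ge>1. r1 \<le> width i V" if q: "q \<in> J" "preper q" and V: "arc V" "q \<in> V" for q V
  proof (rule ccontr)
    assume neg: "\<not> (\<exists>i\<ge>1. r1 \<le> width i V)"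
    obtain i P where iP: "i \<ge> 1" "P \<ge> 1" "(f ^^ P) ((f ^^ i) q) = (f ^^ i) q" using preper_cycle[OF q(2)] by blast
    define A where "A = (f ^^ i) ` V"
    define p where "p = (f ^^ i) q"
    have A: "arc A" "p \<in> A" "p \<in> J" using V iter_arc J_iter q by (auto simp: A_def p_def)
    have "width j A < r1" for j
    proof -
      have "j + i \<ge> 1" using iP by simp
      then show ?thesis using neg unfolding A_def iter_add_image[symmetric] by (metis not_le)
    qed
    then have t: "diameter A * Df N p \<le> K * exp (\<nu> / 2 * real N) * width N A" for N
      using tel A by blast
    have bound: "exp (\<nu> / 2 * real n) \<le> K * (b - a) / diameter A" for n
    proof -
      define N where "N = n * P"
      have "diameter A * exp (\<nu> * real N) \<le> diameter A * Df N p"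
        unfolding N_def using cycle_growth[of p P n] A iP arc_diameter_pos[OF A(1)] by (intro mult_left_mono) (auto simp: p_def)
      also have "\<dots> \<le> K * exp (\<nu> / 2 * real N) * width N A" by (rule t)
      also have "\<dots> \<le> K * exp (\<nu> / 2 * real N) * (b - a)"
        using arc_diameter_le[OF iter_arc[OF A(1)]] r1 by (intro mult_left_mono) auto
      finally have "diameter A * exp (\<nu> / 2 * real N) * exp (\<nu> / 2 * real N) \<le> K * (b - a) * exp (\<nu> / 2 * real N)"
        by (simp add: mult_ac exp_add[symmetric] field_simps)
      then have "diameter A * exp (\<nu> / 2 * real N) \<le> K * (b - a)" by simp
      then have "exp (\<nu> / 2 * real N) \<le> K * (b - a) / diameter A"
        using arc_diameter_pos[OF A(1)] by (simp add: field_simps)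
      moreover have "exp (\<nu> / 2 * real n) \<le> exp (\<nu> / 2 * real N)"
        using \<nu>_pos iP by (simp add: N_def mult_le_cancel_left1)
      ultimately show ?thesis by linarith
    qed
    obtain n where "K * (b - a) / diameter A < exp (\<nu> / 2 * real n)"
      using exp_eventually_gt[of "\<nu> / 2" "K * (b - a) / diameter A"] \<nu>_pos by auto
    with bound[of n] show False by simp
  qed
  then show ?thesis using r1 by blast
qed

text \<open>The set is shown to be finite first and empty in the end, by \<open>J_backward\<close>.\<close>

definition E :: "real set" where "E = {e \<in> {a..b}. e \<notin> J \<and> f e \<in> J}"

lemma finite_E: "finite E"
proof (rule finite_subset)
  show "E \<subseteq> Crit \<union> {a, b}" using J_back by (auto simp: E_def Crit_def)
qed (simp add: finite_Crit)

text \<open>The iterates are equicontinuous at \<open>e\<close>, so all images of a short arc around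
  \<open>e\<close> stay short, whereas a preperiodic point of \<open>J\<close> repels.\<close>

lemma E_not_preper:
  assumes e: "e \<in> E" shows "\<not> preper (f e)"
proof
  assume pp: "preper (f e)"
  obtain r1 where r1: "r1 > 0" and rep: "\<And>q V. q \<in> J \<Longrightarrow> preper q \<Longrightarrow> arc V \<Longrightarrow> q \<in> V \<Longrightarrow> \<exists>i\<ge>1. r1 \<le> width i V"
    using preper_repels by blast
  obtain \<eta> where \<eta>: "\<eta> > 0" "\<And>n x. x \<in> {a..b} \<Longrightarrow> \<bar>x - e\<bar> < \<eta> \<Longrightarrow> \<bar>(f ^^ n) x - (f ^^ n) e\<bar> < r1 / 4"
    using fatou[of e "r1 / 4"] e r1 by (auto simp: E_def)
  obtain A where A: "arc A" "e \<in> A" "\<And>x. x \<in> A \<Longrightarrow> \<bar>x - e\<bar> < \<eta>"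
    using arc_near[of e \<eta>] e \<eta> by (auto simp: E_def)
  have small: "width n A \<le> r1 / 2" for n
  proof (rule diameter_le)
    fix x y assume "x \<in> (f ^^ n) ` A" "y \<in> (f ^^ n) ` A"
    then obtain s t where st: "s \<in> A" "t \<in> A" "x = (f ^^ n) s" "y = (f ^^ n) t" by auto
    have "\<bar>x - (f ^^ n) e\<bar> < r1 / 4" "\<bar>y - (f ^^ n) e\<bar> < r1 / 4"
      using st \<eta>(2) A arc_subset by blast+
    then show "norm (x - y) \<le> r1 / 2" unfolding real_norm_def by linarith
  qed (use r1 in auto)
  obtain i where "r1 \<le> diameter ((f ^^ i) ` f ` A)"
    using rep[of "f e" "f ` A"] pp e A image_arc by (auto simp: E_def)
  also have "(f ^^ i) ` f ` A = (f ^^ Suc i) ` A" by (simp only: funpow_Suc_right image_comp)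
  finally show False using small[of "Suc i"] r1 by linarith
qed

lemma iter_back:
  "u \<in> {a..b} \<Longrightarrow> u \<notin> J \<Longrightarrow> (f ^^ n) u \<in> J \<Longrightarrow> \<exists>i\<le>n. \<exists>e\<in>E. (f ^^ n) u = (f ^^ i) e"
proof (induction n)
  case (Suc n)
  show ?case
  proof (cases "(f ^^ n) u \<in> J")
    case True
    then obtain i e where "i \<le> n" "e \<in> E" "(f ^^ n) u = (f ^^ i) e" using Suc by blast
    then show ?thesis by (intro exI[of _ "Suc i"]) auto
  next
    case False
    then have "(f ^^ n) u \<in> E" using Suc iter_in by (auto simp: E_def)
    then show ?thesis by (intro exI[of _ 1]) auto
  qed
qed simp

text \<open>A small neighbourhood of \<open>y\<close> meets \<open>J\<close> only in
  \<open>y\<close>. Its other points can enter \<open>J\<close> only through \<open>E\<close>, and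
  by exactness some image of it covers \<open>J\<close>.\<close>

lemma covered_by_isolated:
  assumes "y \<in> J" "d > 0" "J \<inter> ball y d \<subseteq> {y}"
  shows "\<exists>n. J \<subseteq> {(f ^^ n) y} \<union> (\<Union>i\<le>n. (f ^^ i) ` E)"
proof -
  have "openin (top_of_set {a..b}) ({a..b} \<inter> ball y d)" by (rule openin_open_Int) simp
  moreover have "y \<in> {a..b} \<inter> ball y d \<inter> J" using assms J_in by auto
  then have "{a..b} \<inter> ball y d \<inter> J \<noteq> {}" by blast
  ultimately obtain n where n: "J \<subseteq> (f ^^ n) ` ({a..b} \<inter> ball y d)" using exact by blast
  have "z \<in> {(f ^^ n) y} \<union> (\<Union>i\<le>n. (f ^^ i) ` E)" if z: "z \<in> J" for z
  proof -
    obtain u where u: "u \<in> {a..b}" "u \<in> ball y d" "z = (f ^^ n) u" using n z by blast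
    show ?thesis
    proof (cases "u \<in> J")
      case True
      then show ?thesis using assms u by auto
    next
      case False
      then show ?thesis using iter_back[of u n] u z by auto
    qed
  qed
  then show ?thesis by blast
qed

text \<open>In a finite \<open>J\<close> every point is preperiodic, so \<open>E\<close> is empty,
  and \<open>covered_by_isolated\<close> leaves a single point.\<close>

lemma infinite_J: "infinite J"
proof
  assume fin: "finite J"
  have "preper q" if "q \<in> J" for q
    using that J_iter by (intro finite_orbit_preper finite_subset[OF _ fin]) auto
  then have E: "E = {}" using E_not_preper by (auto simp: E_def)
  obtain y where y: "y \<in> J" using J_nonempty by blast
  obtain d where d: "d > 0" "\<forall>x\<in>J - {y}. d \<le> dist y x"
    using separate_point_closed[of "J - {y}" y] fin by (auto simp: finite_imp_closed)
  have "J \<inter> ball y d \<subseteq> {y}" using d by force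
  then obtain n where "J \<subseteq> {(f ^^ n) y}" using covered_by_isolated[OF y d(1)] E by auto
  then have "J = {(f ^^ n) y}" using y J_iter by blast
  then show False using J_not_singleton by (auto simp: is_singleton_def)
qed

lemma perfect_J:
  assumes y: "y \<in> J" and d: "d > 0"
  shows "infinite (J \<inter> ball y d)"
proof
  assume fin: "finite (J \<inter> ball y d)"
  obtain d' where d': "d' > 0" "\<forall>x\<in>J \<inter> ball y d - {y}. d' \<le> dist y x"
    using separate_point_closed[of "J \<inter> ball y d - {y}" y] fin by (auto simp: finite_imp_closed)
  have "J \<inter> ball y (min d d') \<subseteq> {y}" using d' by force
  then obtain n where "J \<subseteq> {(f ^^ n) y} \<union> (\<Union>i\<le>n. (f ^^ i) ` E)"
    using covered_by_isolated[OF y, of "min d d'"] d d' by auto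
  then have "finite J" by (rule finite_subset) (simp add: finite_E)
  then show False using infinite_J by simp
qed

text \<open>Removes finite exceptional sets: while \<open>E\<close> is not known to be empty,
  coverings of \<open>J\<close> are obtained only up to finitely many points.\<close>

lemma J_subset_closed:
  assumes "closed S" "finite X" "J \<subseteq> S \<union> X" shows "J \<subseteq> S"
proof
  fix y assume y: "y \<in> J"
  have "y \<in> closure S"
    unfolding closure_approachable
  proof (intro allI impI)
    fix e :: real assume "e > 0"
    then have "infinite (J \<inter> ball y e - X)" using perfect_J[OF y] assms(2) by simp
    then obtain z where "z \<in> J \<inter> ball y e - X" by (metis finite.emptyI ex_in_conv)
    then show "\<exists>z\<in>S. dist z y < e" using assms(3) by (auto simp: dist_commute)
  qed
  then show "y \<in> S" using assms(1) by simp
qed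

lemma compact_J: "compact J"
  using closed_J J_sub compact_Int_closed[of "{a..b}" J] by (simp add: Int_absorb1)

lemma image_J: "f ` J = J"
proof
  show "f ` J \<subseteq> J" using J_forward by blast
  have "closed (f ` J)"
    by (intro compact_imp_closed compact_continuous_image continuous_on_subset[OF cont_f J_sub] compact_J)
  then show "J \<subseteq> f ` J"
  proof (rule J_subset_closed)
    show "finite (f ` E)" using finite_E by simp
    obtain n where n: "n \<ge> 1" "J \<subseteq> (f ^^ n) ` {a..b}"
      using exact[of "{a..b}"] J_nonempty J_sub by auto
    \<comment> \<open>The last step of an orbit ending in \<open>J\<close> starts in
      \<open>J\<close> or in \<open>E\<close>.\<close>
    show "J \<subseteq> f ` J \<union> f ` E"
    proof
      fix y assume y: "y \<in> J"
      then obtain w where w: "w \<in> {a..b}" "y = (f ^^ n) w" using n by blast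
      obtain m where m: "n = Suc m" using n(1) by (cases n) auto
      have "y = f ((f ^^ m) w)" using w m by simp
      then show "y \<in> f ` J \<union> f ` E" using y iter_in[OF w(1), of m] by (auto simp: E_def)
    qed
  qed
qed

lemma image_iter_J: "(f ^^ n) ` J = J"
proof (induction n)
  case (Suc n)
  have "(f ^^ Suc n) ` J = f ` (f ^^ n) ` J" by (simp add: image_comp)
  then show ?case using Suc image_J by simp
qed simp

section \<open>Free arcs and gaps\<close>

text \<open>The endpoints of a free arc may belong to \<open>J\<close>.\<close>

definition free :: "real set \<Rightarrow> bool" where "free A \<longleftrightarrow> arc A \<and> interior A \<inter> J = {}"

lemma free_arc: "free A \<Longrightarrow> arc A"
  by (simp add: free_def)

lemma free_Icc: "a \<le> u \<Longrightarrow> u < v \<Longrightarrow> v \<le> b \<Longrightarrow> free {u..v} \<longleftrightarrow> {u<..<v} \<inter> J = {}"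
  by (simp add: free_def arcI interior_atLeastAtMost_real)

lemma nonfree_infinite:
  assumes "arc A" "\<not> free A" shows "infinite (interior A \<inter> J)"
proof -
  obtain y where y: "y \<in> interior A" "y \<in> J" using assms by (auto simp: free_def)
  then obtain d where "d > 0" "ball y d \<subseteq> interior A" using open_contains_ball[of "interior A"] by auto
  then show ?thesis using perfect_J[OF y(2)] finite_subset[of "J \<inter> ball y d" "interior A \<inter> J"] by blast
qed

text \<open>As \<open>J\<close> is perfect, one of its points in the interior brings infinitely many
  others. Finiteness is the form that is easily passed on to images.\<close>

lemma free_iff_finite: "arc A \<Longrightarrow> free A \<longleftrightarrow> finite (A \<inter> J)"
proof
  assume A: "arc A" and fr: "free A"
  obtain u v where uv: "a \<le> u" "u < v" "v \<le> b" "A = {u..v}" using A arcE by blast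
  have "A \<inter> J \<subseteq> {u, v}" using fr uv by (force simp: free_Icc)
  then show "finite (A \<inter> J)" by (rule finite_subset) simp
next
  assume A: "arc A" and fin: "finite (A \<inter> J)"
  show "free A"
  proof (rule ccontr)
    assume "\<not> free A"
    then have "infinite (interior A \<inter> J)" using nonfree_infinite A by blast
    moreover have "interior A \<inter> J \<subseteq> A \<inter> J" using interior_subset by blast
    ultimately show False using fin finite_subset by blast
  qed
qed

text \<open>A point of \<open>J\<close> in the image has a preimage in \<open>J\<close> or in the
  finite set \<open>E\<close>.\<close>

lemma free_image:
  assumes "free A" shows "free (f ` A)"
proof -
  have "J \<inter> f ` A \<subseteq> f ` (A \<inter> J) \<union> f ` E"
    using arc_subset[OF free_arc[OF assms]] unfolding E_def by blast
  moreover have "finite (f ` (A \<inter> J) \<union> f ` E)"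
    using assms free_iff_finite[OF free_arc[OF assms]] finite_E by simp
  ultimately have "finite (f ` A \<inter> J)" by (metis finite_subset Int_commute)
  then show ?thesis using free_iff_finite image_arc free_arc assms by blast
qed

lemma free_iter: "free A \<Longrightarrow> free ((f ^^ n) ` A)"
proof (induction n)
  case (Suc n)
  then have "free (f ` (f ^^ n) ` A)" by (intro free_image) auto
  then show ?case by (simp add: image_comp)
qed simp

lemma free_not_cover: "free A \<Longrightarrow> \<not> J \<subseteq> A"
  using free_iff_finite free_arc infinite_J by (metis Int_absorb1)

lemma free_subset: "free A \<Longrightarrow> arc B \<Longrightarrow> B \<subseteq> A \<Longrightarrow> free B"
  unfolding free_def using interior_mono by blast

text \<open>Once an image covers \<open>J\<close>, all later ones do, because \<open>f\<close> maps
  \<open>J\<close> onto itself.\<close>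

lemma nonfree_covers:
  assumes "arc A" "\<not> free A"
  shows "\<exists>n0. \<forall>n\<ge>n0. J \<subseteq> (f ^^ n) ` A"
proof -
  have sub: "interior A \<subseteq> {a..b}" using arc_subset[OF assms(1)] interior_subset by blast
  have "openin (top_of_set {a..b}) (interior A)"
    using sub open_subset by blast
  moreover have "interior A \<inter> J \<noteq> {}" using assms by (auto simp: free_def)
  ultimately obtain n0 where n0: "J \<subseteq> (f ^^ n0) ` interior A" using exact by blast
  have "J \<subseteq> (f ^^ n) ` A" if "n \<ge> n0" for n
  proof -
    have "J = (f ^^ (n - n0)) ` J" by (simp add: image_iter_J)
    also have "\<dots> \<subseteq> (f ^^ (n - n0)) ` (f ^^ n0) ` interior A" using n0 by (rule image_mono)
    also have "\<dots> = (f ^^ n) ` interior A" using iter_add_image[of "n - n0" n0] that by simp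
    also have "\<dots> \<subseteq> (f ^^ n) ` A" using interior_subset by blast
    finally show ?thesis .
  qed
  then show ?thesis by blast
qed

lemma nonfree_iter:
  assumes "arc A" "\<not> free A" shows "\<not> free ((f ^^ n) ` A)"
proof
  assume fr: "free ((f ^^ n) ` A)"
  obtain n0 where n0: "\<forall>m\<ge>n0. J \<subseteq> (f ^^ m) ` A" using nonfree_covers[OF assms] by blast
  have "free ((f ^^ (n0 + n)) ` A)" using free_iter[OF fr, of n0] by (simp add: iter_add_image)
  moreover have "J \<subseteq> (f ^^ (n0 + n)) ` A" using n0 by simp
  ultimately show False using free_not_cover by blast
qed

lemma covers_nonfree: "arc A \<Longrightarrow> J \<subseteq> (f ^^ n) ` A \<Longrightarrow> \<not> free A"
  using free_iter free_not_cover by blast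

lemma free_J_endpoint: "free {u..v} \<Longrightarrow> q \<in> J \<Longrightarrow> q \<in> {u..v} \<Longrightarrow> q = u \<or> q = v"
  by (force simp: free_def interior_atLeastAtMost_real)

text \<open>The map \<open>f\<^sup>n\<close> has a fixed point in the hull of \<open>A \<inter> J\<close>. If it is not in \<open>J\<close>, then it lies in a gap that
  \<open>f\<^sup>n\<close> maps into itself, and \<open>f\<^sup>n\<close> fixes one of its edges or exchanges them.\<close>

lemma closing:
  assumes A: "arc A" and n: "n \<ge> 1" and cov: "J \<subseteq> (f ^^ n) ` A"
  shows "\<exists>p\<in>A \<inter> J. exp (\<nu> * real n) \<le> Df n p"
proof -
  obtain u v where uv: "a \<le> u" "u < v" "v \<le> b" "A = {u..v}" using A arcE by blast
  have nf: "\<not> free A" using covers_nonfree[OF A cov] .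
  have cAJ: "compact (A \<inter> J)" using compact_J arc_compact[OF A] by (simp add: compact_Int)
  have neAJ: "A \<inter> J \<noteq> {}" 
  proof
    assume "A \<inter> J = {}"
    then have "interior A \<inter> J = {}" using interior_subset[of A] by blast
    then show False using nonfree_infinite[OF A nf] by simp
  qed
  have "closed (A \<inter> J)" "bdd_below (A \<inter> J)" "bdd_above (A \<inter> J)"
    using cAJ by (auto simp: compact_imp_closed uv)
  define \<alpha> where "\<alpha> = Inf (A \<inter> J)"
  define \<beta> where "\<beta> = Sup (A \<inter> J)"
  have \<alpha>: "\<alpha> \<in> A" "\<alpha> \<in> J" "\<And>x. x \<in> A \<inter> J \<Longrightarrow> \<alpha> \<le> x"
    using closed_contains_Inf[OF neAJ] \<open>closed (A \<inter> J)\<close> \<open>bdd_below (A \<inter> J)\<close> by (auto simp: \<alpha>_def intro: cInf_lower)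
  have \<beta>: "\<beta> \<in> A" "\<beta> \<in> J" "\<And>x. x \<in> A \<inter> J \<Longrightarrow> x \<le> \<beta>"
    using closed_contains_Sup[OF neAJ] \<open>closed (A \<inter> J)\<close> \<open>bdd_above (A \<inter> J)\<close> by (auto simp: \<beta>_def intro: cSup_upper)
  have "\<alpha> < \<beta>"
  proof (rule ccontr)
    assume "\<not> \<alpha> < \<beta>"
    then have "interior A \<inter> J \<subseteq> {\<alpha>}" using \<alpha> \<beta> interior_subset by fastforce
    then show False using nonfree_infinite[OF A nf] finite_subset by blast
  qed
  \<comment> \<open>The hull of \<open>A \<inter> J\<close>; its use puts the fixed point between
    two points of \<open>J\<close>.\<close>
  define A' where "A' = {\<alpha>..\<beta>}"
  have A': "arc A'" "A' \<subseteq> A" using \<alpha> \<beta> \<open>\<alpha> < \<beta>\<close> uv by (auto simp: A'_def intro!: arcI)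
  have cov': "J \<subseteq> (f ^^ n) ` A'"
  proof (rule J_subset_closed)
    show "closed ((f ^^ n) ` A')" using arc_compact[OF iter_arc[OF A'(1)]] by (rule compact_imp_closed)
    \<comment> \<open>The two pieces cut off are free, so their images contain only finitely many
      points of \<open>J\<close>.\<close>
    define X where "X = (if u < \<alpha> then (f ^^ n) ` {u..\<alpha>} \<inter> J else {}) \<union> (if \<beta> < v then (f ^^ n) ` {\<beta>..v} \<inter> J else {})"
    have "free {u..\<alpha>}" if "u < \<alpha>" using that \<alpha> uv by (subst free_Icc) force+
    moreover have "free {\<beta>..v}" if "\<beta> < v" using that \<beta> uv by (subst free_Icc) force+
    ultimately show "finite X"
      using free_iter free_arc free_iff_finite by (auto simp: X_def)
    show "J \<subseteq> (f ^^ n) ` A' \<union> X"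
    proof
      fix y assume y: "y \<in> J"
      then obtain x where x: "x \<in> A" "y = (f ^^ n) x" using cov by blast
      then show "y \<in> (f ^^ n) ` A' \<union> X" using y uv by (cases "x < \<alpha>"; cases "\<beta> < x") (auto simp: X_def A'_def)
    qed
  qed
  \<comment> \<open>Both ends of the hull are in \<open>J\<close> and hence are values of
    \<open>f ^^ n\<close> on it, so the intermediate value theorem gives a fixed point.\<close>
  obtain s t where st: "s \<in> A'" "t \<in> A'" "(f ^^ n) s = \<alpha>" "(f ^^ n) t = \<beta>"
    using cov' \<alpha> \<beta> by (metis imageE subsetD)
  have cont: "continuous_on A' (\<lambda>x. (f ^^ n) x - x)"
    by (intro continuous_intros continuous_on_subset[OF cont_iter] arc_subset A')
  have "\<exists>p\<in>A'. (f ^^ n) p = p"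
  proof (cases "s \<le> t")
    case True
    have "\<exists>x\<ge>s. x \<le> t \<and> (f ^^ n) x - x = 0"
      using True st by (intro IVT' continuous_on_subset[OF cont]) (auto simp: A'_def)
    then show ?thesis using st by (force simp: A'_def)
  next
    case False
    have "\<exists>x\<ge>t. x \<le> s \<and> (f ^^ n) x - x = 0"
      using False st by (intro IVT2' continuous_on_subset[OF cont]) (auto simp: A'_def)
    then show ?thesis using st by (force simp: A'_def)
  qed
  then obtain p where p: "p \<in> A'" "(f ^^ n) p = p" by blast
  show ?thesis
  proof (cases "p \<in> J")
    case True
    then show ?thesis using periodic[OF True n p(2)] p A' by (auto simp: Df_def)
  next
    case False
    then have "\<alpha> < p" "p < \<beta>" using p \<alpha> \<beta> by (auto simp: A'_def less_le)
    define q1 where "q1 = Sup (J \<inter> {\<alpha>..p})"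
    define q2 where "q2 = Inf (J \<inter> {p..\<beta>})"
    have ne: "J \<inter> {\<alpha>..p} \<noteq> {}" "J \<inter> {p..\<beta>} \<noteq> {}" using \<alpha> \<beta> \<open>\<alpha> < p\<close> \<open>p < \<beta>\<close> by auto
    have "q1 \<in> J \<inter> {\<alpha>..p}" unfolding q1_def using ne closed_J by (intro closed_contains_Sup) auto
    then have q1: "q1 \<in> J" "\<alpha> \<le> q1" "q1 < p" using False by (auto simp: less_le)
    have "q2 \<in> J \<inter> {p..\<beta>}" unfolding q2_def using ne closed_J by (intro closed_contains_Inf) auto
    then have q2: "q2 \<in> J" "q2 \<le> \<beta>" "p < q2" using False by (auto simp: less_le)
    have noJ: "x \<notin> J" if "q1 < x" "x < q2" for x
    proof
      assume x: "x \<in> J"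
      show False
      proof (cases "x \<le> p")
        case True
        then have "x \<le> q1" unfolding q1_def using x that q1 by (intro cSup_upper) auto
        then show False using that by simp
      next
        case False
        then have "q2 \<le> x" unfolding q2_def using x that q2 by (intro cInf_lower) auto
        then show False using that by simp
      qed
    qed
    define H where "H = {q1..q2}"
    have HA: "H \<subseteq> A" using q1 q2 A' by (auto simp: H_def A'_def)
    have H: "free H" unfolding H_def using q1 q2 noJ J_in by (subst free_Icc) auto
    then have fH: "free ((f ^^ n) ` H)" by (rule free_iter)
    obtain x y where xy: "x < y" "(f ^^ n) ` H = {x..y}" using free_arc[OF fH] by (auto elim: arcE)
    have "p \<in> {x..y}" 
    proof -
      have "p \<in> H" using q1 q2 by (simp add: H_def)
      then have "(f ^^ n) p \<in> (f ^^ n) ` H" by (rule imageI)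
      then show ?thesis using p xy by simp
    qed
    have noJ': "z \<notin> J" if "x < z" "z < y" for z
      using fH that unfolding xy free_def interior_atLeastAtMost_real by auto
    \<comment> \<open>The image of the gap is a free arc containing \<open>p\<close>, so it cannot
      extend past the points \<open>q1\<close> and \<open>q2\<close> of \<open>J\<close> on either
      side of \<open>p\<close>.\<close>
    have "q1 \<le> x" using noJ'[of q1] q1 \<open>p \<in> {x..y}\<close> by force
    moreover have "y \<le> q2" using noJ'[of q2] q2 \<open>p \<in> {x..y}\<close> by force
    ultimately have "{x..y} \<subseteq> {q1..q2}" by simp
    then have sub: "(f ^^ n) ` H \<subseteq> H" using xy(2) by (simp only: H_def)
    have ends: "(f ^^ n) q \<in> {q1, q2}" if "q \<in> {q1, q2}" for q
    proof -
      have "q \<in> H" "q \<in> J" using that q1 q2 by (auto simp: H_def)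
      then have "(f ^^ n) q \<in> H" "(f ^^ n) q \<in> J" using sub J_iter by auto
      then show ?thesis using noJ[of "(f ^^ n) q"] by (force simp: H_def)
    qed
    have "\<exists>q\<in>{q1, q2}. exp (\<nu> * real n) \<le> Df n q"
    proof (cases "\<exists>q\<in>{q1, q2}. (f ^^ n) q = q")
      case True
      then show ?thesis using periodic[OF _ n] q1 q2 by (auto simp: Df_def)
    next
      case False
      then have sw: "(f ^^ n) q1 = q2" "(f ^^ n) q2 = q1" using ends by auto
      \<comment> \<open>If the edges are exchanged, the derivative over \<open>2 * n\<close> steps
        is the product of those over \<open>n\<close> steps at the two edges, so one factor is at
        least \<open>exp (\<nu> * n)\<close>.\<close>
      have "(f ^^ (n + n)) q1 = q1" using sw by (simp add: funpow_add)
      then have "exp (\<nu> * real (n + n)) \<le> Df (n + n) q1" using periodic[OF q1(1), of "n + n"] n by (simp add: Df_def)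
      also have "\<dots> = Df n q1 * Df n q2" by (simp add: Df_add sw)
      finally have *: "exp (\<nu> * real n) * exp (\<nu> * real n) \<le> Df n q1 * Df n q2"
        by (simp add: exp_add[symmetric] algebra_simps)
      show ?thesis
      proof (rule ccontr)
        assume "\<not> ?thesis"
        then have "Df n q1 < exp (\<nu> * real n)" "Df n q2 < exp (\<nu> * real n)" by auto
        then have "Df n q1 * Df n q2 < exp (\<nu> * real n) * exp (\<nu> * real n)"
          using Df_nonneg by (intro mult_strict_mono') auto
        then show False using * by simp
      qed
    qed
    moreover have "q1 \<in> A" "q2 \<in> A" using HA q1 q2 by (auto simp: H_def)
    ultimately show ?thesis using q1(1) q2(1) by blast
  qed
qed

text \<open>The maximal free arcs, that is, the closures of the components of the complement of
  \<open>J\<close> in \<open>{a..b}\<close>.\<close>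

definition gap :: "real \<Rightarrow> real \<Rightarrow> bool" where
  "gap u v \<longleftrightarrow> a \<le> u \<and> u < v \<and> v \<le> b \<and> {u<..<v} \<inter> J = {} \<and> (u \<in> J \<or> u = a) \<and> (v \<in> J \<or> v = b)"

lemma gap_free: "gap u v \<Longrightarrow> free {u..v}"
  by (simp add: gap_def free_Icc)

lemma free_in_gap:
  assumes "free A" shows "\<exists>u v. gap u v \<and> A \<subseteq> {u..v}"
proof -
  obtain x y where xy: "a \<le> x" "x < y" "y \<le> b" "A = {x..y}" using free_arc[OF assms] arcE by blast
  have noJ: "{x<..<y} \<inter> J = {}" using assms xy by (simp add: free_Icc)
  define u where "u = Sup (insert a (J \<inter> {..x}))"
  define v where "v = Inf (insert b (J \<inter> {y..}))"
  have bdd: "bdd_above (insert a (J \<inter> {..x}))" "bdd_below (insert b (J \<inter> {y..}))" by auto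
  have "u \<in> insert a (J \<inter> {..x})" unfolding u_def using closed_J bdd by (intro closed_contains_Sup closed_insert closed_Int) auto
  then have u: "u = a \<or> u \<in> J" "u \<le> x" "a \<le> u" using xy J_in by auto
  have "v \<in> insert b (J \<inter> {y..})" unfolding v_def using closed_J bdd by (intro closed_contains_Inf closed_insert closed_Int) auto
  then have v: "v = b \<or> v \<in> J" "y \<le> v" "v \<le> b" using xy J_in by auto
  have "{u<..<v} \<inter> J = {}"
  proof (rule ccontr)
    assume "{u<..<v} \<inter> J \<noteq> {}"
    then obtain z where z: "u < z" "z < v" "z \<in> J" by auto
    have "\<not> z \<le> x"
    proof
      assume "z \<le> x"
      then have "z \<le> u" unfolding u_def using z bdd by (intro cSup_upper) auto
      then show False using z by simp
    qed
    moreover have "\<not> y \<le> z"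
    proof
      assume "y \<le> z"
      then have "v \<le> z" unfolding v_def using z bdd by (intro cInf_lower) auto
      then show False using z by simp
    qed
    ultimately have "z \<in> {x<..<y} \<inter> J" using z by simp
    then show False using noJ by blast
  qed
  then have "gap u v" using u v xy by (auto simp: gap_def)
  then show ?thesis using u v xy by (intro exI[of _ u] exI[of _ v]) auto
qed

lemma gap_unique:
  assumes "gap u v" "gap u' v'" "max u u' < min v v'"
  shows "u = u' \<and> v = v'"
proof -
  have m: "u < v'" "u' < v" "u < v" "u' < v'" using assms(3) by auto
  have "u' \<notin> {u<..<v}"
  proof
    assume *: "u' \<in> {u<..<v}"
    then have "u' \<in> J" using assms(1,2) unfolding gap_def greaterThanLessThan_iff by linarith
    then show False using * assms(1) unfolding gap_def by blast
  qed
  moreover have "u \<notin> {u'<..<v'}"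
  proof
    assume *: "u \<in> {u'<..<v'}"
    then have "u \<in> J" using assms(2,1) unfolding gap_def greaterThanLessThan_iff by linarith
    then show False using * assms(2) unfolding gap_def by blast
  qed
  moreover have "v \<notin> {u'<..<v'}"
  proof
    assume *: "v \<in> {u'<..<v'}"
    then have "v \<in> J" using assms(2,1) unfolding gap_def greaterThanLessThan_iff by linarith
    then show False using * assms(2) unfolding gap_def by blast
  qed
  moreover have "v' \<notin> {u<..<v}"
  proof
    assume *: "v' \<in> {u<..<v}"
    then have "v' \<in> J" using assms(1,2) unfolding gap_def greaterThanLessThan_iff by linarith
    then show False using * assms(1) unfolding gap_def by blast
  qed
  ultimately show ?thesis using m unfolding greaterThanLessThan_iff by linarith
qed

text \<open>Distinct gaps do not overlap, so those of length at least \<open>\<rho>\<close> have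
  their left ends in different cells of a grid of mesh \<open>\<rho>\<close>.\<close>

lemma finite_gaps:
  assumes "\<rho> > 0" shows "finite {(u, v). gap u v \<and> \<rho> \<le> v - u}"
proof (rule inj_on_finite)
  show "inj_on (\<lambda>(u, v). \<lfloor>u / \<rho>\<rfloor>) {(u, v). gap u v \<and> \<rho> \<le> v - u}"
  proof (rule inj_onI, clarify)
    fix u v u' v' assume g: "gap u v" "\<rho> \<le> v - u" "gap u' v'" "\<rho> \<le> v' - u'" and e: "\<lfloor>u / \<rho>\<rfloor> = \<lfloor>u' / \<rho>\<rfloor>"
    have "u / \<rho> - u' / \<rho> < 1" "u' / \<rho> - u / \<rho> < 1" using e by linarith+
    then have "u - u' < \<rho>" "u' - u < \<rho>" using assms by (simp_all add: diff_divide_distrib[symmetric])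
    moreover have "u < v" "u' < v'" using g by (auto simp: gap_def)
    ultimately have "max u u' < min v v'" using g(2,4) by (simp add: max_def min_def)
    then show "u = u' \<and> v = v'" using gap_unique g by blast
  qed
  show "(\<lambda>(u, v). \<lfloor>u / \<rho>\<rfloor>) ` {(u, v). gap u v \<and> \<rho> \<le> v - u} \<subseteq> {\<lfloor>a / \<rho>\<rfloor>..\<lfloor>b / \<rho>\<rfloor>}"
    using assms by (auto simp: gap_def intro!: floor_mono divide_right_mono)
qed simp

text \<open>A long image of \<open>V\<close> lies in one of finitely many long gaps, with the image
  of \<open>q\<close> at an edge of it. Infinitely many long images would make the orbit of
  \<open>q\<close> repeat.\<close>

lemma nonpreper_edge_shrinks:
  assumes V: "free V" "q \<in> V" "q \<in> J" and np: "\<not> preper q" and \<rho>: "\<rho> > 0"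
  shows "\<exists>n0. \<forall>n\<ge>n0. width n V < \<rho>"
proof (rule ccontr)
  assume "\<not> ?thesis"
  then have inf: "infinite {n. \<rho> \<le> width n V}"
    by (auto simp: infinite_nat_iff_unbounded_le not_less)
  define X where "X = (\<Union>(u, v)\<in>{(u, v). gap u v \<and> \<rho> \<le> v - u}. {u, v})"
  have X: "finite X" unfolding X_def using finite_gaps[OF \<rho>] by auto
  have "(f ^^ n) q \<in> X" if "\<rho> \<le> width n V" for n
  proof -
    have fr: "free ((f ^^ n) ` V)" using V free_iter by blast
    then obtain u v where g: "gap u v" "(f ^^ n) ` V \<subseteq> {u..v}" using free_in_gap by blast
    have "width n V \<le> v - u"
      using g arc_diameter_mono[OF free_arc[OF gap_free[OF g(1)]] g(2)] by (simp add: gap_def)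
    moreover have "(f ^^ n) q = u \<or> (f ^^ n) q = v"
      using free_J_endpoint[OF gap_free[OF g(1)] J_iter[OF V(3)]] g V by blast
    ultimately have "(u, v) \<in> {(u, v). gap u v \<and> \<rho> \<le> v - u}" "(f ^^ n) q \<in> {u, v}" using g that by auto
    then show ?thesis unfolding X_def by blast
  qed
  then have "(\<lambda>n. (f ^^ n) q) ` {n. \<rho> \<le> width n V} \<subseteq> X" by auto
  moreover have "inj_on (\<lambda>n. (f ^^ n) q) {n. \<rho> \<le> width n V}"
    using np unfolding preper_def by (intro inj_onI) (metis linorder_neqE_nat)
  ultimately show False using inf X by (meson finite_subset finite_imageD)
qed

text \<open>Compactness of \<open>J\<close> makes the time in exactness uniform over the balls of a
  fixed radius centred in \<open>J\<close>.\<close>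

lemma thick_covers:
  assumes \<eta>: "\<eta> > 0"
  shows "\<exists>m0. \<forall>t\<in>J. \<forall>n\<ge>m0. \<forall>A. arc A \<and> {a..b} \<inter> ball t \<eta> \<subseteq> A \<longrightarrow> J \<subseteq> (f ^^ n) ` A"
proof -
  have "J \<subseteq> (\<Union>t\<in>J. ball t (\<eta> / 2))" using \<eta> by auto
  then obtain S where S: "S \<subseteq> J" "finite S" "J \<subseteq> (\<Union>t\<in>S. ball t (\<eta> / 2))"
    using compactE_image[OF compact_J, of J "\<lambda>t. ball t (\<eta> / 2)"] by (metis open_ball)
  have "\<exists>m0. \<forall>t\<in>S. \<forall>n\<ge>m0. J \<subseteq> (f ^^ n) ` ({a..b} \<inter> ball t (\<eta> / 2))"
  proof (rule finite_uniform_large[OF S(2)])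
    fix t assume t: "t \<in> S"
    then have tI: "t \<in> {a..b}" "t \<in> J" using S J_in by auto
    obtain A where A: "arc A" "t \<in> A" "\<And>x. x \<in> A \<Longrightarrow> \<bar>x - t\<bar> < \<eta> / 2" using arc_near[OF tI(1), of "\<eta> / 2"] \<eta> by auto
    have "openin (top_of_set {a..b}) ({a..b} \<inter> ball t (\<eta> / 2))" by (rule openin_open_Int) simp
    moreover have "t \<in> {a..b} \<inter> ball t (\<eta> / 2) \<inter> J" using tI \<eta> by auto
    ultimately obtain n0 where n0: "J \<subseteq> (f ^^ n0) ` ({a..b} \<inter> ball t (\<eta> / 2))" using exact by blast
    have "J \<subseteq> (f ^^ n) ` ({a..b} \<inter> ball t (\<eta> / 2))" if "n \<ge> n0" for n
    proof -
      have "J = (f ^^ (n - n0)) ` J" by (simp add: image_iter_J)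
      also have "\<dots> \<subseteq> (f ^^ (n - n0)) ` (f ^^ n0) ` ({a..b} \<inter> ball t (\<eta> / 2))" using n0 by (rule image_mono)
      also have "\<dots> = (f ^^ n) ` ({a..b} \<inter> ball t (\<eta> / 2))" using iter_add_image[of "n - n0" n0] that by simp
      finally show ?thesis .
    qed
    then show "\<exists>n0. \<forall>n\<ge>n0. J \<subseteq> (f ^^ n) ` ({a..b} \<inter> ball t (\<eta> / 2))" by blast
  qed
  then obtain m0 where m0: "\<And>t n. t \<in> S \<Longrightarrow> n \<ge> m0 \<Longrightarrow> J \<subseteq> (f ^^ n) ` ({a..b} \<inter> ball t (\<eta> / 2))" by blast
  have "J \<subseteq> (f ^^ n) ` A" if t: "t \<in> J" and n: "n \<ge> m0" and A: "{a..b} \<inter> ball t \<eta> \<subseteq> A" for t n A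
  proof -
    obtain s where s: "s \<in> S" "t \<in> ball s (\<eta> / 2)" using S t by blast
    have "ball s (\<eta> / 2) \<subseteq> ball t \<eta>"
    proof
      fix x assume "x \<in> ball s (\<eta> / 2)"
      then show "x \<in> ball t \<eta>" using s dist_triangle[of t x s] by (auto simp: dist_commute)
    qed
    then have "(f ^^ n) ` ({a..b} \<inter> ball s (\<eta> / 2)) \<subseteq> (f ^^ n) ` A" using A by blast
    then show ?thesis using m0[OF s(1) n] by blast
  qed
  then show ?thesis by blast
qed

text \<open>If a point of \<open>J\<close> lies deeper than \<open>\<eta>\<close> inside the arc,
  \<open>thick_covers\<close> applies. Otherwise the arc trimmed by \<open>\<eta>\<close> at both
  ends is free and lies in a gap. As \<open>z\<close> is not inside that gap, it determines the
  edge.\<close>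

lemma covers_or_near_gap:
  assumes \<eta>: "0 < \<eta>" "\<eta> \<le> r / 8"
  shows "\<exists>m0. \<forall>A. \<forall>z\<in>A \<inter> J. arc A \<and> r \<le> diameter A \<longrightarrow> (\<forall>n\<ge>m0. J \<subseteq> (f ^^ n) ` A) \<or>
    (\<exists>x y. gap x y \<and> A \<subseteq> {x - \<eta>..y + \<eta>} \<and>
      ((x \<in> J \<and> x \<in> A \<and> z \<le> x \<and> x - z \<le> \<eta> \<and> {x..x + r / 2} \<subseteq> A \<inter> {x..y}) \<or>
       (y \<in> J \<and> y \<in> A \<and> y \<le> z \<and> z - y \<le> \<eta> \<and> {y - r / 2..y} \<subseteq> A \<inter> {x..y})))"
proof -
  obtain m0 where m0': "\<forall>t\<in>J. \<forall>n\<ge>m0. \<forall>A. arc A \<and> {a..b} \<inter> ball t \<eta> \<subseteq> A \<longrightarrow> J \<subseteq> (f ^^ n) ` A"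
    using thick_covers[OF \<eta>(1)] by (elim exE) (rule that)
  then have m0: "\<And>t n A. t \<in> J \<Longrightarrow> n \<ge> m0 \<Longrightarrow> arc A \<Longrightarrow> {a..b} \<inter> ball t \<eta> \<subseteq> A \<Longrightarrow> J \<subseteq> (f ^^ n) ` A"
    by blast
  have "\<exists>x y. gap x y \<and> A \<subseteq> {x - \<eta>..y + \<eta>} \<and>
      ((x \<in> J \<and> x \<in> A \<and> z \<le> x \<and> x - z \<le> \<eta> \<and> {x..x + r / 2} \<subseteq> A \<inter> {x..y}) \<or>
       (y \<in> J \<and> y \<in> A \<and> y \<le> z \<and> z - y \<le> \<eta> \<and> {y - r / 2..y} \<subseteq> A \<inter> {x..y}))"
    if z: "z \<in> A" "z \<in> J" and A: "arc A" "r \<le> diameter A" and nc: "\<not> (\<forall>n\<ge>m0. J \<subseteq> (f ^^ n) ` A)" for A z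
  proof -
    obtain u v where uv: "a \<le> u" "u < v" "v \<le> b" "A = {u..v}" using A arcE by blast
    then have len: "v - u \<ge> r" using A by simp
    have "{u + \<eta><..<v - \<eta>} \<inter> J = {}"
    proof (rule ccontr)
      assume "{u + \<eta><..<v - \<eta>} \<inter> J \<noteq> {}"
      then obtain t where t: "t \<in> J" "u + \<eta> < t" "t < v - \<eta>" by auto
      have "{a..b} \<inter> ball t \<eta> \<subseteq> A" using t uv by (auto simp: dist_real_def)
      then show False using m0 t nc A by blast
    qed
    then have "free {u + \<eta>..v - \<eta>}" using \<eta> uv len by (subst free_Icc) auto
    then obtain x y where g: "gap x y" "{u + \<eta>..v - \<eta>} \<subseteq> {x..y}" using free_in_gap by blast
    have sub: "x \<le> u + \<eta>" "v - \<eta> \<le> y" using g(2) len \<eta> by auto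
    have gg: "a \<le> x" "x < y" "y \<le> b" "{x<..<y} \<inter> J = {}" "x \<in> J \<or> x = a" "y \<in> J \<or> y = b" using g by (auto simp: gap_def)
    have zcase: "z \<le> x \<or> y \<le> z" using gg z by force
    have AA: "A \<subseteq> {x - \<eta>..y + \<eta>}" using sub uv by auto
    from zcase show ?thesis
    proof
      assume zx: "z \<le> x"
      have "x \<in> J" using gg zx z J_in[of z] by auto
      moreover have "x \<in> A" "x - z \<le> \<eta>" "{x..x + r / 2} \<subseteq> A \<inter> {x..y}" using zx z uv sub len \<eta> by auto
      ultimately show ?thesis using g AA zx by blast
    next
      assume zy: "y \<le> z"
      have "y \<in> J" using gg zy z J_in[of z] by auto
      moreover have "y \<in> A" "z - y \<le> \<eta>" "{y - r / 2..y} \<subseteq> A \<inter> {x..y}" using zy z uv sub len \<eta> by auto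
      ultimately show ?thesis using g AA zy by blast
    qed
  qed
  then show ?thesis by (intro exI[of _ m0]) blast
qed

text \<open>\<open>J\<close> is perfect and has no points just inside the arc, so it accumulates at
  the end from outside.\<close>

lemma free_accumulates:
  assumes "free {u..v}" "d > 0"
  shows "u \<in> J \<Longrightarrow> \<exists>y\<in>J. u - d < y \<and> y < u" and "v \<in> J \<Longrightarrow> \<exists>y\<in>J. v < y \<and> y < v + d"
proof -
  have uv: "u < v" "{u<..<v} \<inter> J = {}"
    using arc_diameter_pos[OF free_arc[OF assms(1)]] assms(1)
    by (auto simp: free_def interior_atLeastAtMost_real split: if_splits)
  show "\<exists>y\<in>J. u - d < y \<and> y < u" if "u \<in> J"
  proof -
    have "infinite (J \<inter> ball u (min d (v - u)) - {u})" using perfect_J[OF that, of "min d (v - u)"] assms uv by simp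
    then obtain y where "y \<in> J \<inter> ball u (min d (v - u)) - {u}" using infinite_imp_nonempty by blast
    then have "y \<in> J" "y \<noteq> u" "dist u y < d" "dist u y < v - u" by auto
    moreover have "\<not> u < y" using \<open>dist u y < v - u\<close> \<open>y \<in> J\<close> uv by (force simp: dist_real_def)
    ultimately show ?thesis by (intro bexI[of _ y]) (auto simp: dist_real_def)
  qed
  show "\<exists>y\<in>J. v < y \<and> y < v + d" if "v \<in> J"
  proof -
    have "infinite (J \<inter> ball v (min d (v - u)) - {v})" using perfect_J[OF that, of "min d (v - u)"] assms uv by simp
    then obtain y where "y \<in> J \<inter> ball v (min d (v - u)) - {v}" using infinite_imp_nonempty by blast
    then have "y \<in> J" "y \<noteq> v" "dist v y < d" "dist v y < v - u" by auto
    moreover have "\<not> y < v" using \<open>dist v y < v - u\<close> \<open>y \<in> J\<close> uv by (force simp: dist_real_def)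
    ultimately show ?thesis by (intro bexI[of _ y]) (auto simp: dist_real_def)
  qed
qed

end

section \<open>Edges of gaps are preperiodic\<close>

text \<open>The component of \<open>t0\<close> in the preimage of \<open>S\<close>. An end of it
  that is not an end of the domain is mapped to the frontier of \<open>S\<close>, since otherwise
  the component could be prolonged. It serves to cut an arc where its image crosses an edge, and to
  enlarge a gap until its image fills a neighbourhood on one side.\<close>

lemma preimage_component:
  fixes g :: "real \<Rightarrow> real"
  assumes cont: "continuous_on {u..v} g" and S: "closed S" and t0: "t0 \<in> {u..v}" "g t0 \<in> S"
  obtains u' v' where "u \<le> u'" "u' \<le> t0" "t0 \<le> v'" "v' \<le> v" "g ` {u'..v'} \<subseteq> S"
    "u' = u \<or> g u' \<in> frontier S" "v' = v \<or> g v' \<in> frontier S"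
    "\<forall>x y. u \<le> x \<and> x \<le> t0 \<and> t0 \<le> y \<and> y \<le> v \<and> g ` {x..y} \<subseteq> S \<longrightarrow> u' \<le> x \<and> y \<le> v'"
proof -
  define T where "T = {u..v} \<inter> g -` S"
  have cT: "closed T" unfolding T_def using cont S by (simp add: continuous_on_closed_vimage vimage_def Int_commute)
  define K where "K = connected_component_set T t0"
  have t0T: "t0 \<in> T" using t0 by (simp add: T_def)
  have K: "K \<subseteq> T" "connected K" "closed K" "t0 \<in> K"
    using t0T cT by (auto simp: K_def closed_connected_component connected_component_subset)
  have "bounded K" using K(1) unfolding T_def by (meson bounded_closed_interval bounded_subset inf.boundedE)
  then have "compact K" using K(3) compact_eq_bounded_closed by blast
  then obtain u' v' where uv': "K = {u'..v'}" using K(2) connected_compact_interval_1[of K] by auto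
  have maxi: "{x..y} \<subseteq> {u'..v'}" if "u \<le> x" "x \<le> t0" "t0 \<le> y" "y \<le> v" "g ` {x..y} \<subseteq> S" for x y
    unfolding uv'[symmetric] K_def using that by (intro connected_component_maximal) (auto simp: T_def)
  have ord: "u' \<le> t0" "t0 \<le> v'" using K(4) uv' by auto
  then have bd: "u \<le> u'" "v' \<le> v" using K(1) uv' by (auto simp: T_def)
  have sub: "g ` {u'..v'} \<subseteq> S" using K(1) uv' by (auto simp: T_def)
  have ext: "\<exists>d>0. \<forall>y\<in>{u..v}. \<bar>y - x\<bar> < d \<longrightarrow> g y \<in> S" if x: "x \<in> {u'..v'}" "g x \<notin> frontier S" for x
  proof -
    have "g x \<in> S" using sub x by auto
    then have "g x \<in> interior S" using x S by (simp add: frontier_def)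
    then obtain e where e: "e > 0" "ball (g x) e \<subseteq> S" by (meson mem_interior)
    have "x \<in> {u..v}" using x bd by auto
    then obtain d where "d > 0" "\<forall>y\<in>{u..v}. dist y x < d \<longrightarrow> dist (g y) (g x) < e"
      using cont e(1) unfolding continuous_on_iff by blast
    then show ?thesis using e(2) by (intro exI[of _ d]) (auto simp: dist_real_def dist_commute subset_eq)
  qed
  have "u' = u \<or> g u' \<in> frontier S"
  proof (rule ccontr)
    assume "\<not> ?thesis"
    then have n: "u < u'" "g u' \<notin> frontier S" using bd by auto
    obtain d where d: "d > 0" "\<forall>y\<in>{u..v}. \<bar>y - u'\<bar> < d \<longrightarrow> g y \<in> S" using ext[of u'] n ord by auto
    define x where "x = max u (u' - d / 2)"
    have x: "u \<le> x" "x < u'" "u' - d / 2 \<le> x" using n d by (auto simp: x_def)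
    have "g y \<in> S" if "y \<in> {x..v'}" for y
    proof (cases "y < u'")
      case True
      then show ?thesis using d that x bd ord by auto
    next
      case False
      then show ?thesis using sub that by auto
    qed
    then have "{x..v'} \<subseteq> {u'..v'}" using x ord bd by (intro maxi) auto
    then show False using x ord by auto
  qed
  moreover have "v' = v \<or> g v' \<in> frontier S"
  proof (rule ccontr)
    assume "\<not> ?thesis"
    then have n: "v' < v" "g v' \<notin> frontier S" using bd by auto
    obtain d where d: "d > 0" "\<forall>y\<in>{u..v}. \<bar>y - v'\<bar> < d \<longrightarrow> g y \<in> S" using ext[of v'] n ord by auto
    define x where "x = min v (v' + d / 2)"
    have x: "x \<le> v" "v' < x" "x \<le> v' + d / 2" using n d by (auto simp: x_def)
    have "g y \<in> S" if "y \<in> {u'..x}" for y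
    proof (cases "v' < y")
      case True
      then show ?thesis using d that x bd ord by auto
    next
      case False
      then show ?thesis using sub that by auto
    qed
    then have "{u'..x} \<subseteq> {u'..v'}" using x ord bd by (intro maxi) auto
    then show False using x ord by auto
  qed
  moreover have "\<forall>x y. u \<le> x \<and> x \<le> t0 \<and> t0 \<le> y \<and> y \<le> v \<and> g ` {x..y} \<subseteq> S \<longrightarrow> u' \<le> x \<and> y \<le> v'"
    using maxi by auto
  ultimately show ?thesis using that[of u' v'] ord bd sub by blast
qed

section \<open>Comparison of arcs and unfolded images\<close>

context interval_map begin

lemma near_diameter:
  assumes A: "arc A" and G: "arc G" and near: "\<And>s. s \<in> A \<Longrightarrow> \<exists>t\<in>G. \<bar>s - t\<bar> \<le> \<eta>"
  shows "width n A \<le> width n G + 2 * M ^ n * \<eta>"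
proof (rule diameter_le)
  have "A \<noteq> {}" using A by (auto elim!: arcE)
  then show "(f ^^ n) ` A \<noteq> {} \<or> 0 \<le> width n G + 2 * M ^ n * \<eta>" by simp
  fix x y assume "x \<in> (f ^^ n) ` A" "y \<in> (f ^^ n) ` A"
  then obtain s t where st: "s \<in> A" "t \<in> A" "x = (f ^^ n) s" "y = (f ^^ n) t" by auto
  obtain s' t' where st': "s' \<in> G" "\<bar>s - s'\<bar> \<le> \<eta>" "t' \<in> G" "\<bar>t - t'\<bar> \<le> \<eta>" using near st by blast
  have I: "s \<in> {a..b}" "t \<in> {a..b}" "s' \<in> {a..b}" "t' \<in> {a..b}" using st st' A G arc_subset by blast+
  have Mn: "0 \<le> M ^ n" using M_ge_1 by simp
  have "\<bar>x - (f ^^ n) s'\<bar> \<le> M ^ n * \<eta>"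
    using lipschitz_iter[OF I(1,3), of n] mult_left_mono[OF st'(2) Mn] st by linarith
  moreover have "\<bar>y - (f ^^ n) t'\<bar> \<le> M ^ n * \<eta>"
    using lipschitz_iter[OF I(2,4), of n] mult_left_mono[OF st'(4) Mn] st by linarith
  moreover have "\<bar>(f ^^ n) s' - (f ^^ n) t'\<bar> \<le> width n G"
    using image_diameter_ge[OF G st'(1,3)] .
  ultimately have "\<bar>x - y\<bar> \<le> width n G + (M ^ n * \<eta> + M ^ n * \<eta>)" by linarith
  then show "norm (x - y) \<le> width n G + 2 * M ^ n * \<eta>"
    by (simp only: real_norm_def mult_2 distrib_right)
qed

lemma arc_sub_near:
  assumes "arc B" "e \<in> B" "\<delta> > 0"
  shows "\<exists>P. arc P \<and> P \<subseteq> B \<and> e \<in> P \<and> (\<forall>x\<in>P. \<bar>x - e\<bar> < \<delta>)"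
proof -
  obtain u v where uv: "a \<le> u" "u < v" "v \<le> b" "B = {u..v}" using assms(1) arcE by blast
  define P where "P = {max u (e - \<delta> / 2)..min v (e + \<delta> / 2)}"
  have "arc P" unfolding P_def using uv assms by (intro arcI) (auto simp: max_def min_def)
  moreover have "P \<subseteq> B" "e \<in> P" using uv assms by (auto simp: P_def)
  moreover have "\<bar>x - e\<bar> < \<delta>" if "x \<in> P" for x
  proof -
    have "e - \<delta> / 2 \<le> x" "x \<le> e + \<delta> / 2" using that by (auto simp: P_def)
    then show ?thesis using assms(3) by linarith
  qed
  ultimately show ?thesis by blast
qed

text \<open>Without critical points inside, \<open>f\<close> is injective on the segment and maps
  ends to ends; the ends themselves may be critical.\<close>

lemma image_segment:
  assumes "closed_segment s t \<subseteq> {a..b}" "open_segment s t \<inter> Crit = {}"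
  shows "f ` closed_segment s t = closed_segment (f s) (f t)"
proof (rule continuous_injective_image_segment_1)
  show "continuous_on (closed_segment s t) f" by (rule continuous_on_subset[OF cont_f assms(1)])
  have "f x \<noteq> f y" if xy: "x \<in> closed_segment s t" "y \<in> closed_segment s t" "x < y" for x y
  proof -
    have I: "a \<le> x" "y \<le> b" using xy assms(1) by auto
    obtain z where z: "z \<in> {x<..<y}" "f y - f x = (y - x) * df z" using mvt_ex[OF I(1) xy(3) I(2)] by blast
    have "z \<in> open_segment s t" using z(1) xy
      by (auto simp: closed_segment_eq_real_ivl open_segment_eq_real_ivl split: if_splits)
    moreover have "z \<in> {a..b}" using z(1) I by auto
    ultimately have "df z \<noteq> 0" using assms(2) unfolding Crit_def by blast
    then show ?thesis using z(2) xy(3) by auto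
  qed
  then show "inj_on f (closed_segment s t)" by (intro inj_onI) (metis linorder_neqE_linordered_idom)
qed

lemma arc_endpoint:
  assumes "arc B" "e \<in> B" "B \<subseteq> {..e} \<or> B \<subseteq> {e..}"
  shows "\<exists>t. B = closed_segment e t \<and> t \<noteq> e"
proof -
  obtain u v where uv: "a \<le> u" "u < v" "v \<le> b" "B = {u..v}" using assms(1) arcE by blast
  then have "e = u \<or> e = v" using assms by auto
  then show ?thesis
  proof
    assume "e = u"
    then show ?thesis using uv by (intro exI[of _ v]) (auto simp: closed_segment_eq_real_ivl)
  next
    assume "e = v"
    then show ?thesis using uv by (intro exI[of _ u]) (auto simp: closed_segment_eq_real_ivl)
  qed
qed

lemma diameter_segment: "diameter (closed_segment e (t::real)) = \<bar>t - e\<bar>"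
  by (simp add: closed_segment_eq_real_ivl)

end

context expanding_julia begin

lemma diameter_J: "0 < diameter J" "arc A \<Longrightarrow> J \<subseteq> A \<Longrightarrow> diameter J \<le> diameter A"
proof -
  obtain x where x: "x \<in> J" using J_nonempty by blast
  obtain y where y: "y \<in> J" "y \<noteq> x" using J_not_singleton x by (auto simp: is_singleton_def)
  have "dist x y \<le> diameter J" using x y compact_imp_bounded[OF compact_J] diameter_bounded_bound by blast
  then show "0 < diameter J" using y by (metis dual_order.strict_trans1 zero_less_dist_iff)
  show "arc A \<Longrightarrow> J \<subseteq> A \<Longrightarrow> diameter J \<le> diameter A" by (rule arc_diameter_mono)
qed

text \<open>\<open>J\<close> accumulates at \<open>q\<close> from outside, so an arbitrarily short
  extension puts \<open>q\<close> into the interior and makes the arc nonfree.\<close>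

lemma free_extend:
  assumes V: "free V" "q \<in> V" "q \<in> J" and \<eta>: "\<eta> > 0"
  shows "\<exists>A. arc A \<and> V \<subseteq> A \<and> \<not> free A \<and> (\<forall>n. width n A \<le> width n V + 2 * M ^ n * \<eta>)"
proof -
  obtain x y where xy: "a \<le> x" "x < y" "y \<le> b" "V = {x..y}" using free_arc[OF V(1)] arcE by blast
  have "\<exists>u v. a \<le> u \<and> u \<le> x \<and> y \<le> v \<and> v \<le> b \<and> x - \<eta> \<le> u \<and> v \<le> y + \<eta> \<and> u < q \<and> q < v"
  proof (cases "q = x")
    case True
    then obtain z where "z \<in> J" "x - \<eta> < z" "z < x" using free_accumulates(1)[of x y \<eta>] V xy \<eta> by auto
    then show ?thesis using True xy J_in \<eta> by (intro exI[of _ z] exI[of _ y]) auto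
  next
    case False
    then have "q = y" using free_J_endpoint V xy by blast
    then obtain z where "z \<in> J" "y < z" "z < y + \<eta>" using free_accumulates(2)[of x y \<eta>] V xy \<eta> by auto
    then show ?thesis using \<open>q = y\<close> xy J_in \<eta> by (intro exI[of _ x] exI[of _ z]) auto
  qed
  then obtain u v where uv: "a \<le> u" "u \<le> x" "y \<le> v" "v \<le> b" "x - \<eta> \<le> u" "v \<le> y + \<eta>" "u < q" "q < v" by blast
  have A: "arc {u..v}" using uv by (intro arcI) auto
  moreover have "\<not> free {u..v}" using uv V(3) by (auto simp: free_def interior_atLeastAtMost_real)
  moreover have "width n {u..v} \<le> width n V + 2 * M ^ n * \<eta>" for n
  proof (rule near_diameter[OF A free_arc[OF V(1)]])
    fix s assume s: "s \<in> {u..v}"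
    show "\<exists>t\<in>V. \<bar>s - t\<bar> \<le> \<eta>"
      using s uv xy \<eta> by (intro bexI[of _ "max x (min y s)"]) (auto simp: max_def min_def)
  qed
  ultimately show ?thesis using uv xy by (intro exI[of _ "{u..v}"]) auto
qed

text \<open>Covering \<open>J\<close> at time \<open>N + m\<close> yields a point with derivative at
  least \<open>exp (\<nu> * (N + m))\<close> over that time. By \<open>telescope\<close>, the first
  \<open>N\<close> steps contribute at most a constant times
  \<open>exp (2 * \<epsilon> * N)\<close>: one \<open>\<epsilon>\<close> from distortion, one from
  the sparse large images. As \<open>m\<close> is bounded, so is \<open>N\<close>.\<close>

lemma closing_contradiction:
  assumes "\<epsilon> > 0" "3 * \<epsilon> < \<nu>"
  shows "\<exists>r1>0. \<forall>r0 l s T mm. 0 < r0 \<and> r0 \<le> r1 \<and> 0 < l \<and> s \<ge> (1::nat) \<and> real s * ln C / (real T + 1) \<le> \<epsilon> \<longrightarrow>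
     (\<exists>N1. \<forall>A N m. arc A \<and> l \<le> diameter A \<and> N \<ge> N1 \<and> 1 \<le> m \<and> m \<le> mm \<and>
        real (card {j. j < N \<and> r0 \<le> width j A}) \<le> real s * (real N / (real T + 1) + 1) \<longrightarrow>
        \<not> J \<subseteq> (f ^^ (N + m)) ` A)"
proof -
  obtain r1 K where r1: "r1 > 0" "K \<ge> 1" and tel: "\<forall>r0 A N w. 0 < r0 \<and> r0 \<le> r1 \<and> arc A \<and> A \<inter> J \<noteq> {} \<and> w 0 \<ge> 0 \<and>
     (\<forall>j<N. \<exists>y\<in>(f ^^ j) ` A. w (Suc j) \<le> w j * \<bar>df y\<bar>) \<longrightarrow>
     diameter A * w N \<le> K * exp (\<epsilon> * real N) * C ^ card {j. j < N \<and> r0 \<le> width j A}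
       * width N A * w 0"
    using telescope[OF assms(1)] by (elim exE conjE) (rule that)
  have "\<exists>N1. \<forall>A N m. arc A \<and> l \<le> diameter A \<and> N \<ge> N1 \<and> 1 \<le> m \<and> m \<le> mm \<and>
        real (card {j. j < N \<and> r0 \<le> width j A}) \<le> real s * (real N / (real T + 1) + 1) \<longrightarrow>
        \<not> J \<subseteq> (f ^^ (N + m)) ` A"
    if r0: "0 < r0" "r0 \<le> r1" and l: "0 < l" and s: "s \<ge> 1" "real s * ln C / (real T + 1) \<le> \<epsilon>" for r0 l mm and s T :: nat
  proof -
    \<comment> \<open>All factors of the comparison that do not grow with \<open>N\<close>.\<close>
    define B where "B = K * C ^ s * (b - a) * M ^ mm / l"
    obtain N1 where N1: "\<And>n. n \<ge> N1 \<Longrightarrow> B < exp ((\<nu> - 2 * \<epsilon>) * real n)"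
      using exp_eventually_gt[of "\<nu> - 2 * \<epsilon>" B] assms by auto
    have False
      if A: "arc A" "l \<le> diameter A" and N: "N \<ge> N1" and m: "1 \<le> m" "m \<le> mm"
        and cd: "real (card {j. j < N \<and> r0 \<le> width j A}) \<le> real s * (real N / (real T + 1) + 1)"
        and cov: "J \<subseteq> (f ^^ (N + m)) ` A" for A N m
    proof -
      define k where "k = card {j. j < N \<and> r0 \<le> width j A}"
      obtain p where p: "p \<in> A" "p \<in> J" "exp (\<nu> * real (N + m)) \<le> Df (N + m) p"
        using closing[OF A(1) _ cov] m by auto
      have pI: "p \<in> {a..b}" using p J_in by blast
      have AJ: "A \<inter> J \<noteq> {}" using p by blast
      have t: "diameter A * Df N p \<le> K * exp (\<epsilon> * real N) * C ^ k * width N A"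
        using tel[rule_format, of r0 A "\<lambda>j. Df j p" N] r0 A(1) AJ p(1) unfolding k_def by (auto simp: Df_Suc)
      have lnC: "0 \<le> ln C" "0 < C" using C_ge_1 by auto
      have Ck: "C ^ k \<le> C ^ s * exp (\<epsilon> * N)"
      proof -
        have "ln C * real k \<le> ln C * (real s * (real N / (real T + 1) + 1))"
          using cd lnC unfolding k_def by (intro mult_left_mono)
        also have "\<dots> = real s * ln C / (real T + 1) * N + real s * ln C" by (simp add: algebra_simps)
        also have "\<dots> \<le> \<epsilon> * N + real s * ln C" using s(2) by (intro add_right_mono mult_right_mono) auto
        finally have "exp (real k * ln C) \<le> exp (\<epsilon> * N + real s * ln C)" by (simp add: mult.commute)
        then show ?thesis using lnC by (simp add: exp_add exp_of_nat_mult mult.commute)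
      qed
      have e1: "exp (\<nu> * real N) \<le> Df N p * M ^ mm"
      proof -
        have "exp (\<nu> * real N) \<le> exp (\<nu> * real (N + m))" using \<nu>_pos by simp
        also have "\<dots> \<le> Df (m + N) p" using p(3) by (simp add: add.commute)
        also have "\<dots> = Df N p * Df m ((f ^^ N) p)" by (rule Df_add)
        also have "\<dots> \<le> Df N p * M ^ mm"
        proof (intro mult_left_mono Df_nonneg)
          have "Df m ((f ^^ N) p) \<le> M ^ m" using Df_le iter_in pI by blast
          also have "\<dots> \<le> M ^ mm" using M_ge_1 m by (intro power_increasing) auto
          finally show "Df m ((f ^^ N) p) \<le> M ^ mm" .
        qed
        finally show ?thesis .
      qed
      have "l * exp (\<nu> * real N) \<le> diameter A * (Df N p * M ^ mm)"
        using A(2) e1 l by (intro mult_mono) auto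
      also have "\<dots> = (diameter A * Df N p) * M ^ mm" by simp
      also have "\<dots> \<le> (K * exp (\<epsilon> * real N) * C ^ k * width N A) * M ^ mm"
        using t M_ge_1 by (intro mult_right_mono) auto
      also have "\<dots> \<le> (K * exp (\<epsilon> * real N) * (C ^ s * exp (\<epsilon> * N)) * (b - a)) * M ^ mm"
        using Ck arc_diameter_le[OF iter_arc[OF A(1)]] M_ge_1 r1 lnC ab
        by (intro mult_right_mono mult_mono mult_left_mono) (auto intro!: less_imp_le[OF arc_diameter_pos] iter_arc A)
      also have "\<dots> = (B * l) * exp (2 * \<epsilon> * N)"
      proof -
        have "exp (\<epsilon> * real N) * exp (\<epsilon> * N) = exp (2 * \<epsilon> * N)" by (simp add: exp_add[symmetric])
        then show ?thesis using l by (simp add: B_def mult_ac)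
      qed
      finally have "exp (\<nu> * real N) * l \<le> (B * exp (2 * \<epsilon> * N)) * l" by (simp add: mult_ac)
      then have "exp (\<nu> * real N) \<le> B * exp (2 * \<epsilon> * N)" using l by simp
      moreover have "exp (\<nu> * real N) = exp ((\<nu> - 2 * \<epsilon>) * real N) * exp (2 * \<epsilon> * N)"
        by (simp add: exp_add[symmetric] algebra_simps)
      ultimately have "exp ((\<nu> - 2 * \<epsilon>) * real N) \<le> B" by simp
      then show False using N1[OF N] by simp
    qed
    then show ?thesis by (intro exI[of _ N1]) blast
  qed
  then show ?thesis using r1 by (intro exI[of _ r1]) auto
qed

definition side :: "real \<Rightarrow> real set \<Rightarrow> bool" where
  "side e S \<longleftrightarrow> S = {..e} \<or> S = {e..}"

lemma side_facts:
  assumes "side e S"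
  shows "closed S" "frontier S = {e}"
proof -
  show "closed S" using assms by (auto simp: side_def)
  have "frontier {e..} = {e}" by (auto simp: frontier_def interior_real_atLeast)
  then show "frontier S = {e}" using assms by (auto simp: side_def)
qed

lemma side_nonfree:
  assumes S: "side e S" and acc: "\<And>d. d > 0 \<Longrightarrow> \<exists>y\<in>J. y \<in> S \<and> y \<noteq> e \<and> \<bar>y - e\<bar> < d"
    and B: "arc B" "e \<in> B" "B \<subseteq> S"
  shows "\<not> free B"
proof -
  obtain u v where uv: "a \<le> u" "u < v" "v \<le> b" "B = {u..v}" using B(1) arcE by blast
  obtain y where y: "y \<in> J" "y \<in> S" "y \<noteq> e" "\<bar>y - e\<bar> < v - u" using acc[of "v - u"] uv by auto
  have "y \<in> {u<..<v}" using S y B uv by (auto simp: side_def)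
  then show ?thesis using y uv by (auto simp: free_Icc)
qed

text \<open>Until its length reaches \<open>rh\<close>, the image of \<open>B\<close> is not folded
  and stays attached to the orbit of \<open>e\<close>. At that time it contains one of finitely many
  arcs of length \<open>rh\<close> at points of these orbits, so a common time suffices for the
  nonfree ones to cover \<open>J\<close>.\<close>

lemma grows_along_preper:
  assumes O: "finite Q" "\<forall>q\<in>Q. preper q" "Q \<subseteq> J" and r: "r > 0"
  shows "\<exists>rh>0. \<exists>m. rh \<le> r \<and> (\<forall>e\<in>Q. \<forall>S B. side e S \<and> (\<forall>d>0. \<exists>y\<in>J. y \<in> S \<and> y \<noteq> e \<and> \<bar>y - e\<bar> < d) \<and>
     arc B \<and> e \<in> B \<and> B \<subseteq> S \<and> diameter B < rh \<longrightarrow>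
     (\<exists>i. (\<forall>j<i. width j B < rh) \<and> (\<forall>n\<ge>m. J \<subseteq> (f ^^ n) ` (f ^^ i) ` B)))"
proof -
  define R where "R = (\<Union>q\<in>Q. {z. \<exists>i. z = (f ^^ i) q})"
  have finR: "finite R" unfolding R_def using O preper_finite_orbit by blast
  have R_inv: "(f ^^ i) e \<in> R" if "e \<in> Q" for i e using that unfolding R_def by blast
  \<comment> \<open>A segment that starts at an orbit point and is shorter than the distance to all
    other critical points has none in its interior.\<close>
  have "\<exists>\<rho>>0. \<forall>z\<in>R \<times> Crit. \<forall>\<rho>'. 0 < \<rho>' \<and> \<rho>' \<le> \<rho> \<longrightarrow> (snd z \<noteq> fst z \<longrightarrow> \<rho>' \<le> \<bar>snd z - fst z\<bar>)"
  proof (rule finite_uniform_small)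
    fix z assume "z \<in> R \<times> Crit"
    show "\<exists>\<rho>>0. \<forall>\<rho>'. 0 < \<rho>' \<and> \<rho>' \<le> \<rho> \<longrightarrow> (snd z \<noteq> fst z \<longrightarrow> \<rho>' \<le> \<bar>snd z - fst z\<bar>)"
      by (cases "snd z = fst z") (auto intro: exI[of _ 1] exI[of _ "\<bar>snd z - fst z\<bar>"])
  qed (simp add: finR finite_Crit)
  then obtain \<rho> where \<rho>: "\<rho> > 0" "\<And>z c. z \<in> R \<Longrightarrow> c \<in> Crit \<Longrightarrow> c \<noteq> z \<Longrightarrow> \<rho> \<le> \<bar>c - z\<bar>" by force
  define rh where "rh = min (min \<rho> r) (diameter J)"
  have rh: "rh > 0" "rh \<le> r" "rh \<le> \<rho>" "rh \<le> diameter J" using \<rho> r diameter_J(1) by (auto simp: rh_def)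
  have "\<exists>m. \<forall>B\<in>(\<lambda>z. {z..z + rh}) ` R \<union> (\<lambda>z. {z - rh..z}) ` R. \<forall>n\<ge>m. arc B \<and> \<not> free B \<longrightarrow> J \<subseteq> (f ^^ n) ` B"
  proof (rule finite_uniform_large)
    show "\<exists>n0. \<forall>n\<ge>n0. arc B \<and> \<not> free B \<longrightarrow> J \<subseteq> (f ^^ n) ` B" for B
      using nonfree_covers[of B] by blast
  qed (simp add: finR)
  then obtain m where m: "\<And>B n. B \<in> (\<lambda>z. {z..z + rh}) ` R \<union> (\<lambda>z. {z - rh..z}) ` R \<Longrightarrow> n \<ge> m \<Longrightarrow> arc B \<Longrightarrow> \<not> free B \<Longrightarrow> J \<subseteq> (f ^^ n) ` B"
    by blast
  have "\<exists>i. (\<forall>j<i. width j B < rh) \<and> (\<forall>n\<ge>m. J \<subseteq> (f ^^ n) ` (f ^^ i) ` B)"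
    if e: "e \<in> Q" and S: "side e S" and acc: "\<And>d. d > 0 \<Longrightarrow> \<exists>y\<in>J. y \<in> S \<and> y \<noteq> e \<and> \<bar>y - e\<bar> < d"
      and B: "arc B" "e \<in> B" "B \<subseteq> S" "diameter B < rh" for e S B
  proof -
    have Bi: "arc ((f ^^ i) ` B)" for i by (rule iter_arc[OF B(1)])
    have nf: "\<not> free B" using side_nonfree[OF S acc B(1-3)] .
    have seg: "\<exists>t. (f ^^ i) ` B = closed_segment ((f ^^ i) e) t \<and> t \<noteq> (f ^^ i) e"
      if "\<And>j. j < i \<Longrightarrow> width j B < rh" for i
      using that
    proof (induction i)
      case 0
      show ?case using arc_endpoint[OF B(1,2)] B(3) S by (auto simp: side_def)
    next
      case (Suc i)
      then obtain t where t: "(f ^^ i) ` B = closed_segment ((f ^^ i) e) t" by auto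
      have d: "\<bar>t - (f ^^ i) e\<bar> < rh" using Suc.prems[of i] unfolding t diameter_segment by simp
      have "open_segment ((f ^^ i) e) t \<inter> Crit = {}"
      proof (rule ccontr)
        assume "open_segment ((f ^^ i) e) t \<inter> Crit \<noteq> {}"
        then obtain c where c: "c \<in> open_segment ((f ^^ i) e) t" "c \<in> Crit" by blast
        then have "c \<noteq> (f ^^ i) e" "\<bar>c - (f ^^ i) e\<bar> \<le> \<bar>t - (f ^^ i) e\<bar>"
          by (auto simp: open_segment_eq_real_ivl split: if_splits)
        then show False using \<rho>(2)[OF R_inv[OF e, of i] c(2)] d rh by linarith
      qed
      then have "f ` closed_segment ((f ^^ i) e) t = closed_segment (f ((f ^^ i) e)) (f t)"
        using arc_subset[OF Bi[of i]] unfolding t by (intro image_segment) auto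
      moreover have "(f ^^ Suc i) ` B = f ` (f ^^ i) ` B" by (simp add: image_comp)
      ultimately have e1: "(f ^^ Suc i) ` B = closed_segment ((f ^^ Suc i) e) (f t)" by (simp add: t)
      moreover have "f t \<noteq> (f ^^ Suc i) e"
      proof
        assume "f t = (f ^^ Suc i) e"
        then have "diameter ((f ^^ Suc i) ` B) = 0" unfolding e1 by simp
        then show False using arc_diameter_pos[OF Bi[of "Suc i"]] by simp
      qed
      ultimately show ?case by blast
    qed
    obtain n0 where "\<And>n. n \<ge> n0 \<Longrightarrow> J \<subseteq> (f ^^ n) ` B" using nonfree_covers[OF B(1) nf] by blast
    then have "rh \<le> width n0 B" using diameter_J(2)[OF Bi] rh(4) by (meson order_refl order_trans)
    define i where "i = (LEAST i. rh \<le> width i B)"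
    have i: "rh \<le> width i B" unfolding i_def by (rule LeastI) fact
    have il: "width j B < rh" if "j < i" for j
      using not_less_Least that unfolding i_def by fastforce
    obtain t where t: "(f ^^ i) ` B = closed_segment ((f ^^ i) e) t" using seg[OF il] by blast
    define z where "z = (f ^^ i) e"
    have zR: "z \<in> R" using R_inv[OF e] by (simp add: z_def)
    have tz: "rh \<le> \<bar>t - z\<bar>" using i unfolding t diameter_segment z_def by simp
    \<comment> \<open>A part of \<open>B\<close> so close to \<open>e\<close> that its image fits
      into the arc \<open>H\<close> of length exactly \<open>rh\<close>; that image is nonfree,
      hence so is \<open>H\<close>.\<close>
    obtain P where P: "arc P" "P \<subseteq> B" "e \<in> P" "\<And>x. x \<in> P \<Longrightarrow> \<bar>x - e\<bar> < rh / M ^ i"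
      using arc_sub_near[OF B(1,2), of "rh / M ^ i"] rh M_ge_1 by auto
    have fP: "\<bar>y - z\<bar> \<le> rh" if yP: "y \<in> (f ^^ i) ` P" for y
    proof -
      obtain x where x: "x \<in> P" "y = (f ^^ i) x" using yP by blast
      have "\<bar>y - z\<bar> \<le> M ^ i * \<bar>x - e\<bar>"
        unfolding x z_def using x P B arc_subset[OF B(1)] by (intro lipschitz_iter) auto
      also have "\<dots> \<le> M ^ i * (rh / M ^ i)" using P(4)[OF x(1)] M_ge_1 by (intro mult_left_mono) auto
      also have "\<dots> = rh" using M_ge_1 by auto
      finally show ?thesis .
    qed
    have nfP: "\<not> free ((f ^^ i) ` P)"
      by (rule nonfree_iter[OF P(1)], rule side_nonfree[OF S acc P(1) P(3)]) (use P B in auto)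
    define H where "H = (if z < t then {z..z + rh} else {z - rh..z})"
    have HB: "H \<subseteq> (f ^^ i) ` B" using tz rh unfolding t z_def[symmetric] H_def by (auto simp: closed_segment_eq_real_ivl)
    then have HI: "H \<subseteq> {a..b}" using arc_subset[OF Bi] by blast
    have Harc: "arc H" using HI rh ab by (auto simp: H_def intro!: arcI split: if_splits)
    have PH: "(f ^^ i) ` P \<subseteq> H"
    proof
      fix y assume y: "y \<in> (f ^^ i) ` P"
      have "y \<in> closed_segment z t" using y P(2) t unfolding z_def by blast
      then show "y \<in> H" using fP[OF y] by (auto simp: H_def closed_segment_eq_real_ivl split: if_splits)
    qed
    have "\<not> free H" using free_subset[OF _ iter_arc[OF P(1)] PH] nfP by blast
    moreover have "H \<in> (\<lambda>z. {z..z + rh}) ` R \<union> (\<lambda>z. {z - rh..z}) ` R" using zR by (auto simp: H_def)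
    ultimately have "J \<subseteq> (f ^^ n) ` H" if "n \<ge> m" for n using m that Harc by blast
    then have "\<forall>n\<ge>m. J \<subseteq> (f ^^ n) ` (f ^^ i) ` B" using HB by (meson image_mono order_trans)
    then show ?thesis using il by blast
  qed
  then show ?thesis using rh by (intro exI[of _ rh] conjI exI[of _ m]) blast+
qed

text \<open>If \<open>q\<close> is not preperiodic, the images of \<open>V\<close> shrink. Enlarge \<open>V\<close> slightly beyond \<open>q\<close>: the images of the new arc
  are large only at sparse times until it covers \<open>J\<close>, which contradicts \<open>closing_contradiction\<close>. If on the
  way the arc comes to overlap a gap with a preperiodic edge, it is cut at that edge.\<close>

lemma preper_edge:
  assumes V: "free V" "q \<in> V" "q \<in> J"
  shows "preper q"
proof (rule ccontr)
  assume np: "\<not> preper q"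
  define \<epsilon> where "\<epsilon> = \<nu> / 4"
  have \<epsilon>: "\<epsilon> > 0" "3 * \<epsilon> < \<nu>" using \<nu>_pos by (auto simp: \<epsilon>_def)
  obtain r1 where r1: "r1 > 0" and contr: "\<forall>r0 l s T mm. 0 < r0 \<and> r0 \<le> r1 \<and> 0 < l \<and> s \<ge> (1::nat) \<and> real s * ln C / (real T + 1) \<le> \<epsilon> \<longrightarrow>
     (\<exists>N1. \<forall>A N m. arc A \<and> l \<le> diameter A \<and> N \<ge> N1 \<and> 1 \<le> m \<and> m \<le> mm \<and>
        real (card {j. j < N \<and> r0 \<le> width j A}) \<le> real s * (real N / (real T + 1) + 1) \<longrightarrow>
        \<not> J \<subseteq> (f ^^ (N + m)) ` A)"
    using closing_contradiction[OF \<epsilon>] by (elim exE conjE) (rule that)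
  define r0 where "r0 = min r1 (diameter J)"
  have r0: "0 < r0" "r0 \<le> r1" "r0 \<le> diameter J" using r1 diameter_J(1) by (auto simp: r0_def)
  \<comment> \<open>Replacing \<open>V\<close> by a later image makes all further images short, and
    the point \<open>w\<close> replacing \<open>q\<close> is still not preperiodic.\<close>
  obtain i1 where i1: "\<And>n. n \<ge> i1 \<Longrightarrow> width n V < r0 / 4" using nonpreper_edge_shrinks[OF V np, of "r0 / 4"] r0 by auto
  define W where "W = (f ^^ i1) ` V"
  define w where "w = (f ^^ i1) q"
  have W: "free W" "w \<in> W" "w \<in> J" using V free_iter J_iter by (auto simp: W_def w_def)
  have npw: "\<not> preper ((f ^^ n) w)" for n using np by (simp add: w_def preper_iter)
  have Wsmall: "width n W < r0 / 4" for n using i1[of "n + i1"] by (simp add: W_def iter_add_image)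
  define G where "G = {(u, v). gap u v \<and> r0 / 2 \<le> v - u}"
  have finG: "finite G" unfolding G_def by (rule finite_gaps) (use r0 in simp)
  \<comment> \<open>There are finitely many long gaps, so those with a nonpreperiodic edge have
    short images from a common time on.\<close>
  have "\<exists>s. \<forall>g\<in>G. \<forall>n\<ge>s. (\<exists>e\<in>{fst g, snd g}. e \<in> J \<and> \<not> preper e) \<longrightarrow> width n {fst g..snd g} < r0 / 2"
  proof (rule finite_uniform_large[OF finG])
    fix g assume g: "g \<in> G"
    show "\<exists>n0. \<forall>n\<ge>n0. (\<exists>e\<in>{fst g, snd g}. e \<in> J \<and> \<not> preper e) \<longrightarrow> width n {fst g..snd g} < r0 / 2"
    proof (cases "\<exists>e\<in>{fst g, snd g}. e \<in> J \<and> \<not> preper e")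
      case True
      then obtain e where e: "e \<in> {fst g, snd g}" "e \<in> J" "\<not> preper e" by blast
      have fg: "free {fst g..snd g}" "fst g < snd g" using g gap_free by (auto simp: G_def gap_def)
      have "e \<in> {fst g..snd g}" "r0 / 2 > 0" using e(1) fg(2) r0 by auto
      then have "\<exists>n0. \<forall>n\<ge>n0. width n {fst g..snd g} < r0 / 2" by (rule nonpreper_edge_shrinks[OF fg(1) _ e(2,3)])
      then show ?thesis by blast
    qed auto
  qed
  then obtain s0 where s0: "\<And>g n e. g \<in> G \<Longrightarrow> n \<ge> s0 \<Longrightarrow> e \<in> {fst g, snd g} \<Longrightarrow> e \<in> J \<Longrightarrow> \<not> preper e \<Longrightarrow>
      width n {fst g..snd g} < r0 / 2" by blast
  define s where "s = max s0 1"
  \<comment> \<open>A large time will be followed by fewer than \<open>s\<close> possibly large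
    steps and then by short images up to step \<open>T\<close>; this \<open>T\<close> makes the cost
    per step at most \<open>\<epsilon>\<close>.\<close>
  obtain T :: nat where T: "real s * ln C / (real T + 1) \<le> \<epsilon>"
  proof -
    obtain T :: nat where "real s * ln C / \<epsilon> < real T" using reals_Archimedean2 by blast
    then show ?thesis using \<epsilon> by (intro that[of T]) (simp add: field_simps)
  qed
  define Q where "Q = {e \<in> J. preper e} \<inter> (fst ` G \<union> snd ` G)"
  have Q: "finite Q" "\<forall>q\<in>Q. preper q" "Q \<subseteq> J" using finG by (auto simp: Q_def)
  obtain rh m1 where rh: "rh > 0" "rh \<le> r0" and grow: "\<forall>e\<in>Q. \<forall>S B. side e S \<and> (\<forall>d>0. \<exists>y\<in>J. y \<in> S \<and> y \<noteq> e \<and> \<bar>y - e\<bar> < d) \<and>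
     arc B \<and> e \<in> B \<and> B \<subseteq> S \<and> diameter B < rh \<longrightarrow>
     (\<exists>i. (\<forall>j<i. width j B < rh) \<and> (\<forall>n\<ge>m1. J \<subseteq> (f ^^ n) ` (f ^^ i) ` B))"
    using grows_along_preper[OF Q r0(1)] by (elim exE conjE) (rule that)
  \<comment> \<open>The three bounds serve \<open>covers_or_near_gap\<close>, make pieces cut off at
    an edge shorter than \<open>rh\<close>, and keep an error \<open>\<eta>\<close> harmless during
    \<open>T\<close> steps.\<close>
  define \<eta> where "\<eta> = min (min (r0 / 8) (rh / 2)) (r0 / (8 * M ^ T))"
  have MT: "M ^ j \<ge> 1" "M ^ j > 0" for j using M_ge_1 by (auto intro: less_le_trans[OF zero_less_one])
  have \<eta>: "0 < \<eta>" "\<eta> \<le> r0 / 8" "\<eta> \<le> rh / 2" "\<eta> \<le> r0 / (8 * M ^ T)" using r0 rh MT by (auto simp: \<eta>_def)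
  have \<eta>M: "2 * M ^ j * \<eta> < r0 / 2" if "j \<le> T" for j
  proof -
    have "M ^ j * \<eta> \<le> M ^ T * (r0 / (8 * M ^ T))"
      using \<eta> MT that M_ge_1 by (intro mult_mono power_increasing) auto
    also have "\<dots> = r0 / 8" using MT[of T] M_ge_1 by (simp add: field_simps)
    finally show ?thesis using r0 by simp
  qed
  define NL where "NL A z x y \<longleftrightarrow> gap x y \<and> A \<subseteq> {x - \<eta>..y + \<eta>} \<and>
      (x \<in> J \<and> x \<in> A \<and> z \<le> x \<and> x - z \<le> \<eta> \<and> {x..x + r0 / 2} \<subseteq> A \<inter> {x..y})" for A z x y
  define NR where "NR A z x y \<longleftrightarrow> gap x y \<and> A \<subseteq> {x - \<eta>..y + \<eta>} \<and>
      (y \<in> J \<and> y \<in> A \<and> y \<le> z \<and> z - y \<le> \<eta> \<and> {y - r0 / 2..y} \<subseteq> A \<inter> {x..y})" for A z x y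
  obtain m0 where m0': "\<forall>A. \<forall>z\<in>A \<inter> J. arc A \<and> r0 \<le> diameter A \<longrightarrow> (\<forall>n\<ge>m0. J \<subseteq> (f ^^ n) ` A) \<or>
    (\<exists>x y. gap x y \<and> A \<subseteq> {x - \<eta>..y + \<eta>} \<and>
      ((x \<in> J \<and> x \<in> A \<and> z \<le> x \<and> x - z \<le> \<eta> \<and> {x..x + r0 / 2} \<subseteq> A \<inter> {x..y}) \<or>
       (y \<in> J \<and> y \<in> A \<and> y \<le> z \<and> z - y \<le> \<eta> \<and> {y - r0 / 2..y} \<subseteq> A \<inter> {x..y})))"
    using covers_or_near_gap[OF \<eta>(1,2)] by (elim exE) (rule that)
  have m0: "(\<forall>n\<ge>m0. J \<subseteq> (f ^^ n) ` A) \<or> (\<exists>x y. NL A z x y \<or> NR A z x y)"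
    if "z \<in> A" "z \<in> J" "arc A" "r0 \<le> diameter A" for A z
    using m0'[rule_format, of z A] that unfolding NL_def NR_def by blast
  define mm where "mm = max (max m0 m1) 1"
  have "s \<ge> 1" "0 < diameter W" using arc_diameter_pos[OF free_arc[OF W(1)]] by (auto simp: s_def)
  then have "\<exists>N1. \<forall>A N m. arc A \<and> diameter W \<le> diameter A \<and> N \<ge> N1 \<and> 1 \<le> m \<and> m \<le> mm \<and>
        real (card {j. j < N \<and> r0 \<le> width j A}) \<le> real s * (real N / (real T + 1) + 1) \<longrightarrow>
        \<not> J \<subseteq> (f ^^ (N + m)) ` A"
    using contr[rule_format, of r0 "diameter W" s T mm] r0 T by blast
  then obtain N1 where N1': "\<forall>A N m. arc A \<and> diameter W \<le> diameter A \<and> N \<ge> N1 \<and> 1 \<le> m \<and> m \<le> mm \<and>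
        real (card {j. j < N \<and> r0 \<le> width j A}) \<le> real s * (real N / (real T + 1) + 1) \<longrightarrow>
        \<not> J \<subseteq> (f ^^ (N + m)) ` A" by (elim exE)
  then have N1: "\<not> J \<subseteq> (f ^^ (N + m)) ` A" if "arc A" "diameter W \<le> diameter A" "N \<ge> N1" "1 \<le> m" "m \<le> mm"
     "real (card {j. j < N \<and> r0 \<le> width j A}) \<le> real s * (real N / (real T + 1) + 1)" for A N m
    using that by blast
  \<comment> \<open>An excess this small keeps all images up to time \<open>N1\<close> short, so the
    stopping time below is at least \<open>N1\<close>.\<close>
  obtain A where A: "arc A" "W \<subseteq> A" "\<not> free A"
    and Ad: "\<And>n. width n A \<le> width n W + 2 * M ^ n * (r0 / (8 * M ^ N1))"
    using free_extend[OF W, of "r0 / (8 * M ^ N1)"] r0 MT by auto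
  have DWA: "diameter W \<le> diameter A" using A arc_diameter_mono by blast
  have early: "width n A < r0" if "n \<le> N1" for n
  proof -
    have "M ^ n * (r0 / (8 * M ^ N1)) \<le> M ^ N1 * (r0 / (8 * M ^ N1))"
      using that M_ge_1 r0 MT by (intro mult_right_mono power_increasing) auto
    also have "\<dots> = r0 / 8" using MT[of N1] M_ge_1 by (simp add: field_simps)
    finally have "2 * M ^ n * (r0 / (8 * M ^ N1)) \<le> r0 / 4" unfolding mult.assoc by linarith
    then show ?thesis using Ad[of n] Wsmall[of n] r0 by linarith
  qed
  define z where "z j = (f ^^ j) w" for j
  have z: "z j \<in> (f ^^ j) ` A" "z j \<in> J" "\<not> preper (z j)" for j
    using W A J_iter npw by (auto simp: z_def)
  have Aj: "arc ((f ^^ j) ` A)" for j by (rule iter_arc[OF A(1)])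
  \<comment> \<open>At every other time with a large image, the arc lies up to \<open>\<eta>\<close>
    in a gap with a nonpreperiodic edge, whose images shrink.\<close>
  define stop where "stop j \<longleftrightarrow> r0 \<le> width j A \<and> ((\<forall>n\<ge>m0. J \<subseteq> (f ^^ n) ` (f ^^ j) ` A) \<or>
     (\<exists>x y. NL ((f ^^ j) ` A) (z j) x y \<and> preper x) \<or> (\<exists>x y. NR ((f ^^ j) ` A) (z j) x y \<and> preper y))" for j
  have "\<exists>j. stop j"
  proof -
    obtain n0 where n0: "\<And>n. n \<ge> n0 \<Longrightarrow> J \<subseteq> (f ^^ n) ` A" using nonfree_covers[OF A(1,3)] by blast
    have "r0 \<le> width n0 A" using diameter_J(2)[OF Aj, of n0] n0 r0 by force
    moreover have "J \<subseteq> (f ^^ n) ` (f ^^ n0) ` A" for n using n0[of "n + n0"] by (simp add: iter_add_image)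
    ultimately show ?thesis unfolding stop_def by blast
  qed
  define N where "N = (LEAST j. stop j)"
  have stopN: "stop N" unfolding N_def using \<open>\<exists>j. stop j\<close> by (rule LeastI_ex)
  have nstop: "\<not> stop j" if "j < N" for j using not_less_Least that unfolding N_def by blast
  have NN1: "N \<ge> N1" using stopN early[of N] unfolding stop_def by force
  have cardN: "real (card {j. j < N \<and> r0 \<le> width j A}) \<le> real s * (real N / (real T + 1) + 1)"
  proof (rule card_separated_le)
    show "1 \<le> s" "{j. j < N \<and> r0 \<le> width j A} \<subseteq> {..<N}" by (auto simp: s_def)
    fix i j assume i: "i \<in> {j. j < N \<and> r0 \<le> width j A}"
      and j: "j \<in> {j. j < N \<and> r0 \<le> width j A}" and ij: "i < j"
    have "\<exists>x y e. gap x y \<and> (f ^^ i) ` A \<subseteq> {x - \<eta>..y + \<eta>} \<and> r0 / 2 \<le> y - x \<and> e \<in> {x, y} \<and> e \<in> J \<and> \<not> preper e"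
    proof -
      have "\<not> (\<forall>n\<ge>m0. J \<subseteq> (f ^^ n) ` (f ^^ i) ` A)" using nstop[of i] i unfolding stop_def by blast
      then obtain x y where xy: "NL ((f ^^ i) ` A) (z i) x y \<or> NR ((f ^^ i) ` A) (z i) x y"
        using m0[OF z(1,2) Aj] i by blast
      then show ?thesis
      proof
        assume l: "NL ((f ^^ i) ` A) (z i) x y"
        then have "\<not> preper x" using nstop[of i] i unfolding stop_def by blast
        moreover have "x + r0 / 2 \<in> {x..y}" using l r0 unfolding NL_def by force
        ultimately show ?thesis using l unfolding NL_def by (intro exI[of _ x] exI[of _ y]) auto
      next
        assume l: "NR ((f ^^ i) ` A) (z i) x y"
        then have "\<not> preper y" using nstop[of i] i unfolding stop_def by blast
        moreover have "y - r0 / 2 \<in> {x..y}" using l r0 unfolding NR_def by force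
        ultimately show ?thesis using l unfolding NR_def by (intro exI[of _ x] exI[of _ y]) auto
      qed
    qed
    then obtain x y e where g: "gap x y" "(f ^^ i) ` A \<subseteq> {x - \<eta>..y + \<eta>}" "r0 / 2 \<le> y - x" "e \<in> {x, y}" "e \<in> J" "\<not> preper e"
      by blast
    \<comment> \<open>At time \<open>i\<close> the arc is \<open>\<eta>\<close>-close to a long gap
      with a nonpreperiodic edge. Between \<open>s\<close> and \<open>T\<close> steps later both the
      image of the gap and the error are below \<open>r0 / 2\<close>.\<close>
    show "j - i < s \<or> T < j - i"
    proof (rule ccontr)
      assume "\<not> ?thesis"
      then have k: "s \<le> j - i" "j - i \<le> T" by auto
      have "diameter ((f ^^ (j - i)) ` (f ^^ i) ` A) \<le> width (j - i) {x..y} + 2 * M ^ (j - i) * \<eta>"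
      proof (rule near_diameter[OF Aj free_arc[OF gap_free[OF g(1)]]])
        fix t assume "t \<in> (f ^^ i) ` A"
        then have "x - \<eta> \<le> t" "t \<le> y + \<eta>" using g(2) by auto
        then show "\<exists>t'\<in>{x..y}. \<bar>t - t'\<bar> \<le> \<eta>"
          using g(1) \<eta> by (intro bexI[of _ "max x (min y t)"]) (auto simp: max_def min_def gap_def)
      qed
      also have "(f ^^ (j - i)) ` (f ^^ i) ` A = (f ^^ j) ` A" using iter_add_image[of "j - i" i A] ij by simp
      also have "width (j - i) {x..y} < r0 / 2"
        using s0[of "(x, y)" "j - i" e] g k by (auto simp: G_def s_def)
      also have "2 * M ^ (j - i) * \<eta> < r0 / 2" using \<eta>M k by blast
      finally show False using j by simp
    qed
  qed
  \<comment> \<open>The arc is cut where its image at time \<open>N\<close> crosses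
    \<open>e\<close>, keeping the part that contains \<open>W\<close>. What remains of the image is
    attached to \<open>e\<close> and shorter than \<open>rh\<close>, so it stays short until it is
    about to cover \<open>J\<close>.\<close>
  have chop: False
    if e: "e \<in> Q" and S: "side e S" and acc: "\<And>d. d > 0 \<Longrightarrow> \<exists>y\<in>J. y \<in> S \<and> y \<noteq> e \<and> \<bar>y - e\<bar> < d"
      and zS: "z N \<in> S" and near: "\<And>t. t \<in> (f ^^ N) ` A \<Longrightarrow> t \<in> S \<Longrightarrow> \<bar>t - e\<bar> \<le> \<eta>" and out: "\<not> (f ^^ N) ` A \<subseteq> S" for e S
  proof -
    have eJ: "e \<in> J" "preper e" using e Q by auto
    have ze: "z N \<noteq> e" using z(3) eJ by auto
    have fW: "free ((f ^^ N) ` W)" "z N \<in> (f ^^ N) ` W" using W free_iter by (auto simp: z_def)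
    \<comment> \<open>The image of \<open>W\<close> is free and contains
      \<open>z N \<noteq> e\<close>, so it does not reach across the point \<open>e\<close> of
      \<open>J\<close>.\<close>
    have WS: "(f ^^ N) ` W \<subseteq> S"
    proof -
      obtain p1 p2 where p: "(f ^^ N) ` W = {p1..p2}" using free_arc[OF fW(1)] by (auto elim: arcE)
      have "\<not> (p1 < e \<and> e < p2)" using fW(1) eJ(1) unfolding p free_def by (auto simp: interior_atLeastAtMost_real)
      then show ?thesis using S zS ze fW(2) unfolding p by (auto simp: side_def)
    qed
    obtain u v where uv: "a \<le> u" "u < v" "v \<le> b" "A = {u..v}" using A(1) arcE by blast
    obtain x0 y0 where xy0: "x0 < y0" "W = {x0..y0}" using free_arc[OF W(1)] by (auto elim: arcE)
    have wuv: "w \<in> {u..v}" "(f ^^ N) w \<in> S" using W A uv zS by (auto simp: z_def)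
    have cN: "continuous_on {u..v} (f ^^ N)" by (rule continuous_on_subset[OF cont_iter]) (use uv in auto)
    obtain u' v' where c: "u \<le> u'" "u' \<le> w" "w \<le> v'" "v' \<le> v" "(f ^^ N) ` {u'..v'} \<subseteq> S"
      "u' = u \<or> (f ^^ N) u' \<in> frontier S" "v' = v \<or> (f ^^ N) v' \<in> frontier S"
      and maxi: "\<forall>x y. u \<le> x \<and> x \<le> w \<and> w \<le> y \<and> y \<le> v \<and> (f ^^ N) ` {x..y} \<subseteq> S \<longrightarrow> u' \<le> x \<and> y \<le> v'"
      by (rule preimage_component[OF cN side_facts(1)[OF S] wuv])
    have "x0 \<le> w" "w \<le> y0" "u \<le> x0" "y0 \<le> v" using W(2) A(2) xy0 uv by auto
    then have sub: "u' \<le> x0" "y0 \<le> v'" using maxi[rule_format, of x0 y0] WS xy0 by blast+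
    define A' where "A' = {u'..v'}"
    have A': "arc A'" "A' \<subseteq> A" "W \<subseteq> A'" using sub xy0 c uv by (auto simp: A'_def intro!: arcI)
    have eA': "e \<in> (f ^^ N) ` A'"
    proof -
      have "\<not> (u' = u \<and> v' = v)" using out c(5) uv by auto
      then have "(f ^^ N) u' = e \<or> (f ^^ N) v' = e" using c(6,7) side_facts(2)[OF S] by auto
      then show ?thesis using sub xy0 by (auto simp: A'_def)
    qed
    define B where "B = (f ^^ N) ` A'"
    have B: "arc B" "e \<in> B" "B \<subseteq> S" using iter_arc[OF A'(1)] eA' c(5) by (auto simp: B_def A'_def)
    have "diameter B \<le> \<eta>"
    proof -
      obtain t where t: "B = closed_segment e t" using arc_endpoint[OF B(1,2)] B(3) S by (auto simp: side_def)
      have "t \<in> B" using t by simp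
      then have "\<bar>t - e\<bar> \<le> \<eta>" using near[of t] B A'(2) by (auto simp: B_def)
      then show ?thesis unfolding t diameter_segment .
    qed
    then have "diameter B < rh" using \<eta> rh by linarith
    then obtain i where i: "\<And>j. j < i \<Longrightarrow> width j B < rh" "\<And>n. n \<ge> m1 \<Longrightarrow> J \<subseteq> (f ^^ n) ` (f ^^ i) ` B"
      using grow e S acc B by blast
    \<comment> \<open>From time \<open>N\<close> on the images are shorter than
      \<open>rh \<le> r0\<close>, so no large times are added.\<close>
    have "{j. j < N + i \<and> r0 \<le> width j A'} \<subseteq> {j. j < N \<and> r0 \<le> width j A}"
    proof (rule subsetI, unfold mem_Collect_eq, elim conjE)
      fix j assume j: "j < N + i" "r0 \<le> width j A'"
      have "\<not> N \<le> j"
      proof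
        assume "N \<le> j"
        then have "(f ^^ j) ` A' = (f ^^ (j - N)) ` B" unfolding B_def using iter_add_image[of "j - N" N] by simp
        moreover have "j - N < i" using j(1) \<open>N \<le> j\<close> by linarith
        ultimately show False using i(1)[of "j - N"] j(2) rh(2) by simp
      qed
      moreover have "width j A' \<le> width j A"
        using A'(2) by (intro arc_diameter_mono[OF Aj] image_mono)
      ultimately show "j < N \<and> r0 \<le> width j A" using j by linarith
    qed
    then have "card {j. j < N + i \<and> r0 \<le> width j A'} \<le> card {j. j < N \<and> r0 \<le> width j A}"
      by (intro card_mono) auto
    then have "real (card {j. j < N + i \<and> r0 \<le> width j A'}) \<le> real s * (real N / (real T + 1) + 1)"
      using cardN by linarith
    also have "\<dots> \<le> real s * (real (N + i) / (real T + 1) + 1)"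
      by (intro mult_left_mono add_right_mono divide_right_mono) auto
    finally have "\<not> J \<subseteq> (f ^^ (N + i + mm)) ` A'"
      using NN1 A' arc_diameter_mono[OF A'(1,3)] by (intro N1) (auto simp: mm_def)
    moreover have "J \<subseteq> (f ^^ mm) ` (f ^^ i) ` B" by (rule i(2)) (simp add: mm_def)
    then have "J \<subseteq> (f ^^ (mm + (i + N))) ` A'" by (simp add: B_def iter_add_image)
    then have "J \<subseteq> (f ^^ (N + i + mm)) ` A'" by (simp add: add_ac)
    ultimately show False by blast
  qed
  from stopN consider "\<forall>n\<ge>m0. J \<subseteq> (f ^^ n) ` (f ^^ N) ` A"
    | x y where "NL ((f ^^ N) ` A) (z N) x y" "preper x"
    | x y where "NR ((f ^^ N) ` A) (z N) x y" "preper y" unfolding stop_def by blast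
  then show False
  proof cases
    case 1
    then have "J \<subseteq> (f ^^ mm) ` (f ^^ N) ` A" by (simp add: mm_def)
    then have "J \<subseteq> (f ^^ (N + mm)) ` A" by (simp add: iter_add_image[symmetric] add.commute)
    moreover have "\<not> J \<subseteq> (f ^^ (N + mm)) ` A"
      using NN1 A DWA cardN by (intro N1) (auto simp: mm_def)
    ultimately show False by blast
  next
    case 2
    then have g: "gap x y" "(f ^^ N) ` A \<subseteq> {x - \<eta>..y + \<eta>}" "x \<in> J" "z N \<le> x" "{x..x + r0 / 2} \<subseteq> (f ^^ N) ` A \<inter> {x..y}"
      by (auto simp: NL_def)
    have xr: "x + r0 / 2 \<in> (f ^^ N) ` A" "x + r0 / 2 \<le> y" using g(5) r0 by force+
    have "(x, y) \<in> G" using g xr by (auto simp: G_def)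
    then have "x \<in> fst ` G \<union> snd ` G" by (metis UnI1 fst_conv image_eqI)
    then have "x \<in> Q" using g 2 by (simp add: Q_def)
    then show False
    proof (rule chop)
      show "side x {..x}" "z N \<in> {..x}" using g by (auto simp: side_def)
      show "\<exists>y\<in>J. y \<in> {..x} \<and> y \<noteq> x \<and> \<bar>y - x\<bar> < d" if d: "d > 0" for d
      proof -
        obtain t where "t \<in> J" "x - d < t" "t < x" using free_accumulates(1)[OF gap_free[OF g(1)] d g(3)] by blast
        then show ?thesis by (intro bexI[of _ t]) auto
      qed
      show "\<bar>t - x\<bar> \<le> \<eta>" if "t \<in> (f ^^ N) ` A" "t \<in> {..x}" for t using that g(2) by auto
      show "\<not> (f ^^ N) ` A \<subseteq> {..x}" using xr r0 by auto
    qed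
  next
    case 3
    then have g: "gap x y" "(f ^^ N) ` A \<subseteq> {x - \<eta>..y + \<eta>}" "y \<in> J" "y \<le> z N" "{y - r0 / 2..y} \<subseteq> (f ^^ N) ` A \<inter> {x..y}"
      by (auto simp: NR_def)
    have xr: "y - r0 / 2 \<in> (f ^^ N) ` A" "x \<le> y - r0 / 2" using g(5) r0 by force+
    have "(x, y) \<in> G" using g xr by (auto simp: G_def)
    then have "y \<in> fst ` G \<union> snd ` G" by (metis UnI2 snd_conv image_eqI)
    then have "y \<in> Q" using g 3 by (simp add: Q_def)
    then show False
    proof (rule chop)
      show "side y {y..}" "z N \<in> {y..}" using g by (auto simp: side_def)
      show "\<exists>t\<in>J. t \<in> {y..} \<and> t \<noteq> y \<and> \<bar>t - y\<bar> < d" if d: "d > 0" for d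
      proof -
        obtain t where "t \<in> J" "y < t" "t < y + d" using free_accumulates(2)[OF gap_free[OF g(1)] d g(3)] by blast
        then show ?thesis by (intro bexI[of _ t]) auto
      qed
      show "\<bar>t - y\<bar> \<le> \<eta>" if "t \<in> (f ^^ N) ` A" "t \<in> {y..}" for t using that g(2) by auto
      show "\<not> (f ^^ N) ` A \<subseteq> {y..}" using xr r0 by auto
    qed
  qed
qed

end

section \<open>Backward stability\<close>

context expanding_julia begin

text \<open>A short arc around a point outside \<open>J\<close> is free, so
  \<open>preper_edge\<close> makes \<open>f x\<close> preperiodic, which \<open>E_not_preper\<close>
  excludes. Thus \<open>E\<close> is empty.\<close>

lemma J_backward: "x \<in> {a..b} \<Longrightarrow> f x \<in> J \<Longrightarrow> x \<in> J"
proof (rule ccontr)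
  assume x: "x \<in> {a..b}" "f x \<in> J" "x \<notin> J"
  obtain d where d: "d > 0" "\<forall>y\<in>J. d \<le> dist x y" using separate_point_closed[OF closed_J x(3)] by blast
  obtain A where A: "arc A" "x \<in> A" "\<And>y. y \<in> A \<Longrightarrow> \<bar>y - x\<bar> < d" using arc_near[OF x(1) d(1)] by blast
  have "A \<inter> J = {}" using d(2) A(3) by (force simp: dist_real_def abs_minus_commute)
  then have "free A" using A(1) by (simp add: free_iff_finite)
  then have "preper (f x)" using preper_edge[OF free_image] A(2) x(2) by blast
  moreover have "x \<in> E" using x by (simp add: E_def)
  ultimately show False using E_not_preper by blast
qed

lemma J_iter_backward: "x \<in> {a..b} \<Longrightarrow> (f ^^ n) x \<in> J \<Longrightarrow> x \<in> J"
proof (induction n)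
  case (Suc n)
  then have "(f ^^ n) x \<in> J" using J_backward[of "(f ^^ n) x"] iter_in by simp
  then show ?case using Suc by blast
qed simp

text \<open>\<open>closing\<close> gives a point with derivative at least
  \<open>exp (\<nu> * (k + m))\<close>. The last \<open>m\<close> steps contribute at most
  \<open>M ^ m\<close>, and distortion during the first \<open>k\<close> costs only a multiple of
  \<open>exp (\<epsilon> * k)\<close>.\<close>

lemma closing_bound:
  assumes "\<epsilon> > 0"
  shows "\<exists>r1>0. \<exists>K\<ge>1. \<forall>A k m. arc A \<and> m \<ge> 1 \<and> (\<forall>j<k. width j A < r1) \<and> J \<subseteq> (f ^^ (k + m)) ` A \<longrightarrow>
     diameter A \<le> K * M ^ m * exp ((\<epsilon> - \<nu>) * real k)"
proof -
  obtain r1 K where r1: "r1 > 0" "K \<ge> 1" and tel: "\<forall>A N p. arc A \<and> p \<in> A \<and> A \<inter> J \<noteq> {} \<and> (\<forall>j<N. width j A < r1) \<longrightarrow>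
     diameter A * Df N p \<le> K * exp (\<epsilon> * real N) * width N A"
    using telescope_point[OF assms] by (elim exE conjE) (rule that)
  define K' where "K' = max 1 (K * (b - a))"
  have "diameter A \<le> K' * M ^ m * exp ((\<epsilon> - \<nu>) * real k)"
    if A: "arc A" and m: "m \<ge> 1" and sm: "\<And>j. j < k \<Longrightarrow> width j A < r1" and cov: "J \<subseteq> (f ^^ (k + m)) ` A" for A k m
  proof -
    obtain p where p: "p \<in> A" "p \<in> J" "exp (\<nu> * real (k + m)) \<le> Df (k + m) p"
      using closing[OF A _ cov] m by auto
    have e1: "exp (\<nu> * real k) \<le> Df k p * M ^ m"
    proof -
      have "exp (\<nu> * real k) \<le> exp (\<nu> * real (k + m))" using \<nu>_pos by simp
      also have "\<dots> \<le> Df (m + k) p" using p(3) by (simp add: add.commute)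
      also have "\<dots> = Df k p * Df m ((f ^^ k) p)" by (rule Df_add)
      also have "\<dots> \<le> Df k p * M ^ m"
        by (intro mult_left_mono Df_nonneg Df_le iter_in J_in p)
      finally show ?thesis .
    qed
    have "diameter A * exp (\<nu> * real k) \<le> diameter A * (Df k p * M ^ m)"
      using e1 arc_diameter_pos[OF A] by (intro mult_left_mono) auto
    also have "\<dots> = (diameter A * Df k p) * M ^ m" by simp
    also have "\<dots> \<le> (K * exp (\<epsilon> * real k) * width k A) * M ^ m"
      using tel[rule_format, of A p k] A p sm M_ge_1 by (intro mult_right_mono) auto
    also have "\<dots> \<le> (K * exp (\<epsilon> * real k) * (b - a)) * M ^ m"
      using arc_diameter_le[OF iter_arc[OF A]] M_ge_1 r1 by (intro mult_right_mono mult_left_mono) auto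
    also have "\<dots> = (K * (b - a)) * (M ^ m * exp (\<epsilon> * real k))" by simp
    also have "\<dots> \<le> K' * (M ^ m * exp (\<epsilon> * real k))" using M_ge_1 by (intro mult_right_mono) (auto simp: K'_def)
    also have "\<dots> = (K' * M ^ m * exp ((\<epsilon> - \<nu>) * real k)) * exp (\<nu> * real k)"
      by (simp add: exp_add[symmetric] algebra_simps)
    finally show ?thesis by simp
  qed
  moreover have "K' \<ge> 1" by (simp add: K'_def)
  ultimately show ?thesis using r1 by (intro exI[of _ r1] conjI exI[of _ K']) auto
qed

text \<open>The condition on preperiodic points applies to all edges of gaps by \<open>preper_edge\<close>.\<close>

definition scale :: "real \<Rightarrow> bool" where
  "scale r \<longleftrightarrow> 0 < r \<and> r \<le> diameter J \<and>
     (\<forall>q V. q \<in> J \<and> arc V \<and> q \<in> V \<and> preper q \<longrightarrow> (\<exists>i\<ge>1. r \<le> width i V)) \<and>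
     (\<forall>c\<in>Crit \<union> {a, b}. c \<notin> J \<longrightarrow> (\<forall>x\<in>J. r \<le> \<bar>x - c\<bar> \<and> r \<le> \<bar>x - f c\<bar>))"

lemma scale_ex: "\<exists>r1>0. \<forall>r. 0 < r \<and> r \<le> r1 \<longrightarrow> scale r"
proof -
  obtain r2 where r2: "r2 > 0" "\<forall>q V. q \<in> J \<and> preper q \<and> arc V \<and> q \<in> V \<longrightarrow> (\<exists>i\<ge>1. r2 \<le> width i V)"
    using preper_repels by blast
  have "\<exists>\<rho>>0. \<forall>c\<in>Crit \<union> {a, b}. \<forall>r. 0 < r \<and> r \<le> \<rho> \<longrightarrow> (c \<notin> J \<longrightarrow> (\<forall>x\<in>J. r \<le> \<bar>x - c\<bar> \<and> r \<le> \<bar>x - f c\<bar>))"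
  proof (rule finite_uniform_small)
    fix c assume c: "c \<in> Crit \<union> {a, b}"
    show "\<exists>\<rho>>0. \<forall>r. 0 < r \<and> r \<le> \<rho> \<longrightarrow> (c \<notin> J \<longrightarrow> (\<forall>x\<in>J. r \<le> \<bar>x - c\<bar> \<and> r \<le> \<bar>x - f c\<bar>))"
    proof (cases "c \<in> J")
      case False
      \<comment> \<open>By backward invariance \<open>f c\<close> has positive distance from
        \<open>J\<close> as well.\<close>
      have "f c \<notin> J" using J_backward[of c] c ab False by (auto simp: Crit_def)
      obtain d1 where d1: "d1 > 0" "\<forall>x\<in>J. d1 \<le> dist c x" using separate_point_closed[OF closed_J False] by blast
      obtain d2 where d2: "d2 > 0" "\<forall>x\<in>J. d2 \<le> dist (f c) x" using separate_point_closed[OF closed_J \<open>f c \<notin> J\<close>] by blast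
      show ?thesis using d1 d2 by (intro exI[of _ "min d1 d2"]) (force simp: dist_real_def abs_minus_commute)
    qed (auto intro: exI[of _ 1])
  qed (simp add: finite_Crit)
  then obtain \<rho> where \<rho>: "\<rho> > 0" "\<And>c r x. c \<in> Crit \<union> {a, b} \<Longrightarrow> 0 < r \<Longrightarrow> r \<le> \<rho> \<Longrightarrow> c \<notin> J \<Longrightarrow> x \<in> J \<Longrightarrow> r \<le> \<bar>x - c\<bar> \<and> r \<le> \<bar>x - f c\<bar>"
    by blast
  have "scale r" if r: "0 < r" "r \<le> min (min r2 \<rho>) (diameter J)" for r
    unfolding scale_def
  proof (intro conjI allI impI ballI)
    fix q V assume "q \<in> J \<and> arc V \<and> q \<in> V \<and> preper q"
    then obtain i where "i \<ge> 1" "r2 \<le> width i V" using r2(2) by blast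
    then show "\<exists>i\<ge>1. r \<le> width i V" using r by (intro exI[of _ i]) auto
  qed (use r \<rho>(2) in auto)
  then show ?thesis using r2(1) \<rho>(1) diameter_J(1) by (intro exI[of _ "min (min r2 \<rho>) (diameter J)"]) auto
qed

lemma scale_facts:
  assumes "scale r"
  shows "0 < r" "r \<le> diameter J"
    "q \<in> J \<Longrightarrow> arc V \<Longrightarrow> q \<in> V \<Longrightarrow> free V \<Longrightarrow> \<exists>i\<ge>1. r \<le> width i V"
    "c \<in> Crit \<union> {a, b} \<Longrightarrow> c \<notin> J \<Longrightarrow> x \<in> J \<Longrightarrow> r \<le> \<bar>x - c\<bar>"
    "c \<in> Crit \<union> {a, b} \<Longrightarrow> c \<notin> J \<Longrightarrow> x \<in> J \<Longrightarrow> r \<le> \<bar>x - f c\<bar>"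
  using assms preper_edge unfolding scale_def by blast+

section \<open>Gaps shorter than the scale, and returns to the scale\<close>

definition isgap :: "real set \<Rightarrow> bool" where "isgap H \<longleftrightarrow> (\<exists>u v. gap u v \<and> H = {u..v})"

lemma isgap_free: "isgap H \<Longrightarrow> free H"
  by (auto simp: isgap_def gap_free)

text \<open>At least one edge is in \<open>J\<close>, and critical points and ends of
  \<open>{a..b}\<close> outside \<open>J\<close> are at least \<open>r\<close> away from it.\<close>

lemma small_gap:
  assumes s: "scale r" and g: "gap u v" "v - u < r"
  shows "u \<in> J" "v \<in> J" "{u<..<v} \<inter> Crit = {}"
proof -
  have uv: "a \<le> u" "u < v" "v \<le> b" "{u<..<v} \<inter> J = {}" "u \<in> J \<or> u = a" "v \<in> J \<or> v = b" using g by (auto simp: gap_def)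
  have some: "u \<in> J \<or> v \<in> J"
  proof (rule ccontr)
    assume n: "\<not> ?thesis"
    then have "J \<subseteq> {u<..<v}" using uv J_in by force
    then show False using uv(4) J_nonempty by blast
  qed
  show u: "u \<in> J"
  proof (rule ccontr)
    assume "u \<notin> J"
    then have "u = a" "v \<in> J" using uv some by auto
    then have "r \<le> \<bar>v - u\<bar>" using scale_facts(4)[OF s, of u v] \<open>u \<notin> J\<close> by auto
    then show False using g uv by simp
  qed
  show "v \<in> J"
  proof (rule ccontr)
    assume "v \<notin> J"
    then have "v = b" using uv by auto
    then have "r \<le> \<bar>u - v\<bar>" using scale_facts(4)[OF s, of v u] \<open>v \<notin> J\<close> u by auto
    then show False using g uv by simp
  qed
  show "{u<..<v} \<inter> Crit = {}"
  proof (rule ccontr)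
    assume "{u<..<v} \<inter> Crit \<noteq> {}"
    then obtain c where c: "u < c" "c < v" "c \<in> Crit" by auto
    then have "c \<notin> J" using uv by auto
    then have "r \<le> \<bar>u - c\<bar>" by (intro scale_facts(4)[OF s _ _ u]) (use c in auto)
    then show False using c g by simp
  qed
qed

text \<open>On a short gap \<open>f\<close> is injective; the image is free and its ends, the images
  of the edges, are in \<open>J\<close>.\<close>

lemma small_gap_image:
  assumes s: "scale r" and H: "isgap H" "diameter H < r"
  shows "isgap (f ` H)"
proof -
  obtain u v where g: "gap u v" "H = {u..v}" using H by (auto simp: isgap_def)
  have uv: "a \<le> u" "u < v" "v \<le> b" using g by (auto simp: gap_def)
  have d: "v - u < r" using H g uv by simp
  note sg = small_gap[OF s g(1) d]
  have seg: "closed_segment u v = {u..v}" "open_segment u v = {u<..<v}" using uv by (auto simp: closed_segment_eq_real_ivl open_segment_eq_real_ivl)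
  have im: "f ` H = closed_segment (f u) (f v)"
    using image_segment[of u v] sg(3) uv by (simp add: seg g(2))
  have "free (f ` H)" by (rule free_image[OF isgap_free[OF H(1)]])
  moreover have "f ` H = {min (f u) (f v)..max (f u) (f v)}" unfolding im by (auto simp: closed_segment_eq_real_ivl)
  ultimately have "gap (min (f u) (f v)) (max (f u) (f v))"
    using sg(1,2) J_forward by (auto simp: gap_def free_def interior_atLeastAtMost_real min_def max_def elim!: arcE split: if_splits)
  then show ?thesis using \<open>f ` H = {min (f u) (f v)..max (f u) (f v)}\<close> unfolding isgap_def by blast
qed

lemma small_gap_iter:
  assumes s: "scale r" and H: "isgap H" "\<And>j. j < k \<Longrightarrow> width j H < r"
  shows "isgap ((f ^^ k) ` H)"
  using H(2)
proof (induction k)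
  case (Suc k)
  then have "isgap (f ` (f ^^ k) ` H)" by (intro small_gap_image[OF s]) auto
  then show ?case by (simp add: image_comp)
qed (simp add: H(1))

text \<open>Only finitely many gaps are long enough, and a piece at an edge becomes large because
  edges repel.\<close>

lemma half_gap_time:
  assumes s: "scale r"
  shows "\<exists>l0. \<forall>x y. gap x y \<longrightarrow>
    (x \<in> J \<and> x + r / 2 \<le> y \<longrightarrow> (\<exists>i\<ge>1. i \<le> l0 \<and> r \<le> width i {x..x + r / 2})) \<and>
    (y \<in> J \<and> x \<le> y - r / 2 \<longrightarrow> (\<exists>i\<ge>1. i \<le> l0 \<and> r \<le> width i {y - r / 2..y}))"
proof -
  have r: "r > 0" using scale_facts(1)[OF s] .
  have "\<exists>l0. \<forall>g\<in>{(x, y). gap x y \<and> r / 2 \<le> y - x}. \<forall>l\<ge>l0.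
    (fst g \<in> J \<and> fst g + r / 2 \<le> snd g \<longrightarrow> (\<exists>i\<ge>1. i \<le> l \<and> r \<le> width i {fst g..fst g + r / 2})) \<and>
    (snd g \<in> J \<and> fst g \<le> snd g - r / 2 \<longrightarrow> (\<exists>i\<ge>1. i \<le> l \<and> r \<le> width i {snd g - r / 2..snd g}))"
  proof (rule finite_uniform_large)
    show "finite {(x, y). gap x y \<and> r / 2 \<le> y - x}" by (rule finite_gaps) (use r in simp)
    fix g assume "g \<in> {(x, y). gap x y \<and> r / 2 \<le> y - x}"
    then obtain x y where g: "g = (x, y)" "gap x y" "r / 2 \<le> y - x" by auto
    then have xy: "a \<le> x" "x < y" "y \<le> b" by (auto simp: gap_def)
    have "arc {x..x + r / 2}" "arc {y - r / 2..y}" using xy g r by (auto intro!: arcI)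
    then have fr: "free {x..x + r / 2}" "free {y - r / 2..y}"
      using free_subset[OF gap_free[OF g(2)]] g(3) by auto
    have "\<exists>l. x \<in> J \<longrightarrow> (\<exists>i\<ge>1. i \<le> l \<and> r \<le> width i {x..x + r / 2})"
      using scale_facts(3)[OF s _ free_arc[OF fr(1)] _ fr(1), of x] r by auto
    then obtain l1 where l1: "x \<in> J \<longrightarrow> (\<exists>i\<ge>1. i \<le> l1 \<and> r \<le> width i {x..x + r / 2})" by blast
    have "\<exists>l. y \<in> J \<longrightarrow> (\<exists>i\<ge>1. i \<le> l \<and> r \<le> width i {y - r / 2..y})"
      using scale_facts(3)[OF s _ free_arc[OF fr(2)] _ fr(2), of y] r by auto
    then obtain l2 where l2: "y \<in> J \<longrightarrow> (\<exists>i\<ge>1. i \<le> l2 \<and> r \<le> width i {y - r / 2..y})" by blast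
    show "\<exists>l0. \<forall>l\<ge>l0. (fst g \<in> J \<and> fst g + r / 2 \<le> snd g \<longrightarrow> (\<exists>i\<ge>1. i \<le> l \<and> r \<le> width i {fst g..fst g + r / 2})) \<and>
    (snd g \<in> J \<and> fst g \<le> snd g - r / 2 \<longrightarrow> (\<exists>i\<ge>1. i \<le> l \<and> r \<le> width i {snd g - r / 2..snd g}))"
      unfolding g(1) fst_conv snd_conv
      using l1 l2 by (intro exI[of _ "max l1 l2"]) (meson max.boundedE order_trans)
  qed
  then obtain l0 where l0': "\<forall>g\<in>{(x, y). gap x y \<and> r / 2 \<le> y - x}. \<forall>l\<ge>l0.
    (fst g \<in> J \<and> fst g + r / 2 \<le> snd g \<longrightarrow> (\<exists>i\<ge>1. i \<le> l \<and> r \<le> width i {fst g..fst g + r / 2})) \<and>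
    (snd g \<in> J \<and> fst g \<le> snd g - r / 2 \<longrightarrow> (\<exists>i\<ge>1. i \<le> l \<and> r \<le> width i {snd g - r / 2..snd g}))"
    by (elim exE)
  have l0: "(x \<in> J \<and> x + r / 2 \<le> y \<longrightarrow> (\<exists>i\<ge>1. i \<le> l0 \<and> r \<le> width i {x..x + r / 2})) \<and>
    (y \<in> J \<and> x \<le> y - r / 2 \<longrightarrow> (\<exists>i\<ge>1. i \<le> l0 \<and> r \<le> width i {y - r / 2..y}))"
    if "gap x y" "r / 2 \<le> y - x" for x y
  proof -
    have "(x, y) \<in> {(x, y). gap x y \<and> r / 2 \<le> y - x}" using that by simp
    from l0'[THEN bspec, OF this, rule_format, OF order_refl] show ?thesis unfolding fst_conv snd_conv by blast
  qed
  show ?thesis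
  proof (intro exI[of _ l0] allI impI)
    fix x y assume g: "gap x y"
    show "(x \<in> J \<and> x + r / 2 \<le> y \<longrightarrow> (\<exists>i\<ge>1. i \<le> l0 \<and> r \<le> width i {x..x + r / 2})) \<and>
    (y \<in> J \<and> x \<le> y - r / 2 \<longrightarrow> (\<exists>i\<ge>1. i \<le> l0 \<and> r \<le> width i {y - r / 2..y}))"
      using l0[OF g] by (cases "r / 2 \<le> y - x") auto
  qed
qed

text \<open>If the arc does not soon cover \<open>J\<close>, it contains a piece of length
  \<open>r / 2\<close> at an edge inside a gap, which has length at least \<open>r\<close> after a
  bounded positive time.\<close>

lemma covers_or_returns:
  assumes s: "scale r"
  shows "\<exists>k0. \<forall>A. arc A \<and> A \<inter> J \<noteq> {} \<and> r \<le> diameter A \<longrightarrow>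
    (\<forall>n\<ge>k0. J \<subseteq> (f ^^ n) ` A) \<or> (\<exists>i\<ge>1. i \<le> k0 \<and> r \<le> width i A)"
proof -
  have r: "r > 0" using scale_facts(1)[OF s] .
  obtain l0 where l0': "\<forall>x y. gap x y \<longrightarrow>
    (x \<in> J \<and> x + r / 2 \<le> y \<longrightarrow> (\<exists>i\<ge>1. i \<le> l0 \<and> r \<le> width i {x..x + r / 2})) \<and>
    (y \<in> J \<and> x \<le> y - r / 2 \<longrightarrow> (\<exists>i\<ge>1. i \<le> l0 \<and> r \<le> width i {y - r / 2..y}))"
    using half_gap_time[OF s] by (elim exE)
  have l0: "\<exists>i\<ge>1. i \<le> l0 \<and> r \<le> width i B"
    if "gap x y" "x \<in> J \<and> B = {x..x + r / 2} \<or> y \<in> J \<and> B = {y - r / 2..y}" "B \<subseteq> {x..y}" for x y B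
  proof -
    have "x + r / 2 \<in> {x..y} \<or> y - r / 2 \<in> {x..y}" "x + r / 2 \<in> B \<or> y - r / 2 \<in> B" using that r by auto
    show ?thesis using l0'[rule_format, OF that(1)] that r by (force simp: subset_eq)
  qed
  obtain m0 where m0: "\<forall>A. \<forall>z\<in>A \<inter> J. arc A \<and> r \<le> diameter A \<longrightarrow> (\<forall>n\<ge>m0. J \<subseteq> (f ^^ n) ` A) \<or>
    (\<exists>x y. gap x y \<and> A \<subseteq> {x - r / 8..y + r / 8} \<and>
      ((x \<in> J \<and> x \<in> A \<and> z \<le> x \<and> x - z \<le> r / 8 \<and> {x..x + r / 2} \<subseteq> A \<inter> {x..y}) \<or>
       (y \<in> J \<and> y \<in> A \<and> y \<le> z \<and> z - y \<le> r / 8 \<and> {y - r / 2..y} \<subseteq> A \<inter> {x..y})))"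
    using covers_or_near_gap[of "r / 8" r] r by auto
  show ?thesis
  proof (intro exI[of _ "max m0 l0"] allI impI)
    fix A assume A: "arc A \<and> A \<inter> J \<noteq> {} \<and> r \<le> diameter A"
    then obtain z where z: "z \<in> A \<inter> J" by blast
    consider "\<forall>n\<ge>m0. J \<subseteq> (f ^^ n) ` A" | x y where "gap x y" "x \<in> J" "{x..x + r / 2} \<subseteq> A \<inter> {x..y}"
      | x y where "gap x y" "y \<in> J" "{y - r / 2..y} \<subseteq> A \<inter> {x..y}"
      using m0[rule_format, OF z] A by blast
    then show "(\<forall>n\<ge>max m0 l0. J \<subseteq> (f ^^ n) ` A) \<or> (\<exists>i\<ge>1. i \<le> max m0 l0 \<and> r \<le> width i A)"
    proof cases
      case 1
      then show ?thesis by simp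
    next
      case 2
      then obtain i where i: "i \<ge> 1" "i \<le> l0" "r \<le> width i {x..x + r / 2}" using l0[of x y "{x..x + r / 2}"] by auto
      have "width i {x..x + r / 2} \<le> width i A"
        using 2 A iter_arc by (intro arc_diameter_mono image_mono) auto
      then show ?thesis using i by (intro disjI2 exI[of _ i]) auto
    next
      case 3
      then obtain i where i: "i \<ge> 1" "i \<le> l0" "r \<le> width i {y - r / 2..y}" using l0[of x y "{y - r / 2..y}"] by auto
      have "width i {y - r / 2..y} \<le> width i A"
        using 3 A iter_arc by (intro arc_diameter_mono image_mono) auto
      then show ?thesis using i by (intro disjI2 exI[of _ i]) auto
    qed
  qed
qed

lemma diameter_image_lower_upto:
  assumes "\<rho> > 0"
  shows "\<exists>\<kappa>>0. \<forall>n\<le>k. \<forall>A. arc A \<and> \<rho> \<le> diameter A \<longrightarrow> \<kappa> \<le> width n A"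
proof -
  have "\<exists>\<kappa>>0. \<forall>n\<in>{..k}. \<forall>\<kappa>'. 0 < \<kappa>' \<and> \<kappa>' \<le> \<kappa> \<longrightarrow> (\<forall>A. arc A \<and> \<rho> \<le> diameter A \<longrightarrow> \<kappa>' \<le> width n A)"
  proof (rule finite_uniform_small)
    fix n
    obtain \<kappa> where "\<kappa> > 0" "\<forall>A. arc A \<and> \<rho> \<le> diameter A \<longrightarrow> \<kappa> \<le> width n A"
      using diameter_image_lower[OF assms, of n] by blast
    then show "\<exists>\<kappa>>0. \<forall>\<kappa>'. 0 < \<kappa>' \<and> \<kappa>' \<le> \<kappa> \<longrightarrow> (\<forall>A. arc A \<and> \<rho> \<le> diameter A \<longrightarrow> \<kappa>' \<le> width n A)"
      by (intro exI[of _ \<kappa>]) force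
  qed simp
  then show ?thesis by (metis atMost_iff order_refl)
qed

text \<open>If \<open>A\<close> were long, then for \<open>n \<le> k0\<close> its image at time
  \<open>n\<close> would be too long. For \<open>n > k0\<close> either this image covers
  \<open>J\<close>, or an image at a time from 1 to \<open>k0\<close> is long, against the
  hypotheses. Nothing is assumed about the size of \<open>A\<close> itself, which permits induction
  backwards in time.\<close>

lemma backward_stable:
  assumes s: "scale r"
  shows "\<exists>\<delta>>0. \<forall>A n. arc A \<and> A \<inter> J \<noteq> {} \<and> (\<forall>i. 1 \<le> i \<and> i < n \<longrightarrow> width i A < r) \<and>
    width n A < \<delta> \<longrightarrow> diameter A < r"
proof -
  obtain k0 where k0: "\<forall>A. arc A \<and> A \<inter> J \<noteq> {} \<and> r \<le> diameter A \<longrightarrow>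
    (\<forall>n\<ge>k0. J \<subseteq> (f ^^ n) ` A) \<or> (\<exists>i\<ge>1. i \<le> k0 \<and> r \<le> width i A)"
    using covers_or_returns[OF s] by blast
  obtain \<kappa> where \<kappa>: "\<kappa> > 0" "\<And>n A. n \<le> k0 \<Longrightarrow> arc A \<Longrightarrow> r \<le> diameter A \<Longrightarrow> \<kappa> \<le> width n A"
    using diameter_image_lower_upto[OF scale_facts(1)[OF s], of k0] by blast
  have "diameter A < r" if A: "arc A" "A \<inter> J \<noteq> {}" "\<And>i. 1 \<le> i \<Longrightarrow> i < n \<Longrightarrow> width i A < r"
    "width n A < min \<kappa> (diameter J)" for A n
  proof (rule ccontr)
    assume "\<not> ?thesis"
    then have big: "r \<le> diameter A" by simp
    have n: "k0 < n" using \<kappa>(2)[OF _ A(1) big, of n] A(4) by force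
    from k0 A big consider "\<forall>n\<ge>k0. J \<subseteq> (f ^^ n) ` A" | i where "i \<ge> 1" "i \<le> k0" "r \<le> width i A" by blast
    then show False
    proof cases
      case 1
      then have "diameter J \<le> width n A" using n by (intro diameter_J(2) iter_arc A) auto
      then show False using A(4) by simp
    next
      case 2
      then show False using A(3)[of i] n by simp
    qed
  qed
  then show ?thesis using \<kappa>(1) diameter_J(1) by (intro exI[of _ "min \<kappa> (diameter J)"]) auto
qed

end

section \<open>Decay of gaps\<close>

context expanding_julia begin

lemma cover_exit_upto:
  assumes S: "finite S" and nf: "\<And>B. B \<in> S \<Longrightarrow> arc B \<Longrightarrow> \<not> free B"
  shows "\<exists>m\<ge>1. \<forall>B\<in>S. arc B \<longrightarrow> J \<subseteq> (f ^^ m) ` B"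
proof -
  have "\<exists>m. \<forall>B\<in>S. \<forall>n\<ge>m. arc B \<longrightarrow> J \<subseteq> (f ^^ n) ` B"
  proof (rule finite_uniform_large[OF S])
    fix B assume "B \<in> S"
    then show "\<exists>n0. \<forall>n\<ge>n0. arc B \<longrightarrow> J \<subseteq> (f ^^ n) ` B" using nf nonfree_covers by (cases "arc B") auto
  qed
  then obtain m where m: "\<forall>B\<in>S. \<forall>n\<ge>m. arc B \<longrightarrow> J \<subseteq> (f ^^ n) ` B" by blast
  then show ?thesis by (intro exI[of _ "max m 1"]) auto
qed

lemma not_in_nbhd:
  assumes "\<not> B \<subseteq> {x..y::real}"
  shows "\<exists>\<rho>>0. \<forall>\<rho>'. 0 < \<rho>' \<and> \<rho>' \<le> \<rho> \<longrightarrow> \<not> B \<subseteq> {x - \<rho>'..y + \<rho>'}"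
proof -
  obtain t where t: "t \<in> B" "t < x \<or> y < t" using assms by force
  define \<rho> where "\<rho> = (if t < x then x - t else t - y) / 2"
  have "\<rho> > 0" using t by (auto simp: \<rho>_def)
  moreover have "\<not> B \<subseteq> {x - \<rho>'..y + \<rho>'}" if "0 < \<rho>'" "\<rho>' \<le> \<rho>" for \<rho>'
  proof
    assume "B \<subseteq> {x - \<rho>'..y + \<rho>'}"
    then have "x - \<rho>' \<le> t" "t \<le> y + \<rho>'" using t by auto
    then show False using t that by (auto simp: \<rho>_def split: if_splits)
  qed
  ultimately show ?thesis by blast
qed

text \<open>Both \<open>f ^^ k\<close>-images, of the whole Julia set and of a piece of it next to a gap, stick out of a gap
  by an amount that can be bounded below as long as \<open>k\<close> is bounded.\<close>

lemma gap_nbhd_stable: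
  assumes s: "scale r"
  shows "\<exists>\<rho>>0. \<forall>H A k x y. isgap H \<and> diameter H < r / 2 \<and> arc A \<and> H \<subseteq> A \<and> k \<ge> 1 \<and> gap x y \<and> r / 2 \<le> y - x \<and>
     (f ^^ k) ` H = {x..y} \<and> (f ^^ k) ` A \<subseteq> {x - \<rho>..y + \<rho>} \<and> (\<forall>i. 1 \<le> i \<and> i < k \<longrightarrow> width i A < r) \<longrightarrow>
     diameter A < r"
proof -
  have r: "r > 0" using scale_facts(1)[OF s] .
  obtain k0 where k0: "\<forall>A. arc A \<and> A \<inter> J \<noteq> {} \<and> r \<le> diameter A \<longrightarrow>
    (\<forall>n\<ge>k0. J \<subseteq> (f ^^ n) ` A) \<or> (\<exists>i\<ge>1. i \<le> k0 \<and> r \<le> width i A)"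
    using covers_or_returns[OF s] by blast
  define G where "G = {(x, y). gap x y \<and> r / 2 \<le> y - x}"
  \<comment> \<open>A gap that reaches length \<open>r / 2\<close> within \<open>k0\<close> steps is
    at least this long, so only finitely many have to be considered.\<close>
  define G' where "G' = {(u, v). gap u v \<and> r / (2 * M ^ k0) \<le> v - u}"
  have M0: "0 < M ^ k0" using M_ge_1 by simp
  have fin: "finite G" "finite G'" unfolding G_def G'_def using r M0 by (intro finite_gaps; simp)+
  have "\<exists>\<rho>>0. \<forall>g\<in>G. \<forall>\<rho>'. 0 < \<rho>' \<and> \<rho>' \<le> \<rho> \<longrightarrow> \<not> J \<subseteq> {fst g - \<rho>'..snd g + \<rho>'}"
  proof (rule finite_uniform_small[OF fin(1)])
    fix g assume "g \<in> G"
    then have "free {fst g..snd g}" using gap_free by (auto simp: G_def)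
    then show "\<exists>\<rho>>0. \<forall>\<rho>'. 0 < \<rho>' \<and> \<rho>' \<le> \<rho> \<longrightarrow> \<not> J \<subseteq> {fst g - \<rho>'..snd g + \<rho>'}"
      by (intro not_in_nbhd free_not_cover)
  qed
  then obtain \<rho>1 where \<rho>1: "\<rho>1 > 0" "\<And>x y \<rho>'. (x, y) \<in> G \<Longrightarrow> 0 < \<rho>' \<Longrightarrow> \<rho>' \<le> \<rho>1 \<Longrightarrow> \<not> J \<subseteq> {x - \<rho>'..y + \<rho>'}"
    by (metis fst_conv snd_conv)
  \<comment> \<open>An arc of length at least \<open>r\<close> sticks out of a gap shorter than
    \<open>r / 2\<close> by \<open>r / 4\<close> on one side.\<close>
  define S where "S = (\<lambda>(u, v). {u - r / 4..u}) ` G' \<union> (\<lambda>(u, v). {v..v + r / 4}) ` G'"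
  have finS: "finite S" using fin by (simp add: S_def)
  have "\<exists>\<rho>>0. \<forall>q\<in>S \<times> {..k0} \<times> G. \<forall>\<rho>'. 0 < \<rho>' \<and> \<rho>' \<le> \<rho> \<longrightarrow> (arc (fst q) \<and> \<not> free (fst q) \<longrightarrow>
     \<not> (f ^^ fst (snd q)) ` fst q \<subseteq> {fst (snd (snd q)) - \<rho>'..snd (snd (snd q)) + \<rho>'})"
  proof (rule finite_uniform_small)
    show "finite (S \<times> {..k0} \<times> G)" using finS fin by simp
    fix q assume "q \<in> S \<times> {..k0} \<times> G"
    then obtain B k x y where q: "q = (B, k, x, y)" "(x, y) \<in> G" by (cases q) auto
    show "\<exists>\<rho>>0. \<forall>\<rho>'. 0 < \<rho>' \<and> \<rho>' \<le> \<rho> \<longrightarrow> (arc (fst q) \<and> \<not> free (fst q) \<longrightarrow>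
     \<not> (f ^^ fst (snd q)) ` fst q \<subseteq> {fst (snd (snd q)) - \<rho>'..snd (snd (snd q)) + \<rho>'})"
    proof (cases "arc B \<and> \<not> free B")
      case True
      have "\<not> (f ^^ k) ` B \<subseteq> {x..y}"
        using free_subset[OF gap_free iter_arc] nonfree_iter[of B k] True q(2) by (auto simp: G_def)
      from not_in_nbhd[OF this] show ?thesis unfolding q by auto
    next
      case False
      then show ?thesis unfolding q fst_conv by (intro exI[of _ 1]) auto
    qed
  qed
  then obtain \<rho>2 where \<rho>2: "\<rho>2 > 0" and *: "\<forall>q\<in>S \<times> {..k0} \<times> G. \<forall>\<rho>'. 0 < \<rho>' \<and> \<rho>' \<le> \<rho>2 \<longrightarrow> (arc (fst q) \<and> \<not> free (fst q) \<longrightarrow>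
     \<not> (f ^^ fst (snd q)) ` fst q \<subseteq> {fst (snd (snd q)) - \<rho>'..snd (snd (snd q)) + \<rho>'})" by (elim exE conjE)
  have out: "\<not> (f ^^ k) ` B \<subseteq> {x - \<rho>'..y + \<rho>'}" if "B \<in> S" "k \<le> k0" "(x, y) \<in> G" "0 < \<rho>'" "\<rho>' \<le> \<rho>2" "arc B" "\<not> free B" for B k x y \<rho>'
    using *[rule_format, of "(B, k, x, y)" \<rho>'] that by simp
  define \<rho> where "\<rho> = min \<rho>1 \<rho>2"
  have \<rho>: "\<rho> > 0" "\<rho> \<le> \<rho>1" "\<rho> \<le> \<rho>2" using \<rho>1 \<rho>2 by (auto simp: \<rho>_def)
  have main: "diameter A < r"
    if H: "isgap H" "diameter H < r / 2" and A: "arc A" "H \<subseteq> A" and k: "k \<ge> 1" and g: "gap x y" "r / 2 \<le> y - x"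
      and im: "(f ^^ k) ` H = {x..y}" "(f ^^ k) ` A \<subseteq> {x - \<rho>..y + \<rho>}"
      and sm: "\<And>i. 1 \<le> i \<Longrightarrow> i < k \<Longrightarrow> width i A < r" for H A k x y
  proof (rule ccontr)
    assume "\<not> ?thesis"
    then have big: "r \<le> diameter A" by simp
    have xyG: "(x, y) \<in> G" using g by (simp add: G_def)
    obtain u v where uv: "gap u v" "H = {u..v}" using H by (auto simp: isgap_def)
    have uv': "a \<le> u" "u < v" "v \<le> b" using uv by (auto simp: gap_def)
    have dH: "v - u < r / 2" using H uv uv' by simp
    have uJ: "u \<in> J" "v \<in> J" using small_gap(1,2)[OF s uv(1)] dH r by auto
    have "u \<in> A" using A uv uv' by auto
    then have AJ: "A \<inter> J \<noteq> {}" using uJ by blast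
    have nc: "\<not> J \<subseteq> (f ^^ k) ` A" using \<rho>1(2)[OF xyG \<rho>(1,2)] im(2) by blast
    \<comment> \<open>For \<open>k > k0\<close> the arc would cover \<open>J\<close> at time
      \<open>k\<close> or be large before; both are excluded.\<close>
    have kk: "k \<le> k0"
    proof (rule ccontr)
      assume "\<not> k \<le> k0"
      then have "k0 \<le> k" by simp
      then have "\<not> (\<forall>n\<ge>k0. J \<subseteq> (f ^^ n) ` A)" using nc by blast
      then obtain i where i: "i \<ge> 1" "i \<le> k0" "r \<le> width i A" using k0 A AJ big by blast
      then show False using sm[of i] \<open>\<not> k \<le> k0\<close> by simp
    qed
    have "r / 2 \<le> M ^ k * (v - u)"
    proof -
      have "y - x = width k H" using im(1) g(2) r by simp
      also have "\<dots> \<le> M ^ k * diameter H" by (rule diameter_iter_le[OF free_arc[OF isgap_free[OF H(1)]]])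
      finally show ?thesis using g uv uv' by simp
    qed
    also have "\<dots> \<le> M ^ k0 * (v - u)" using kk M_ge_1 uv' by (intro mult_right_mono power_increasing) auto
    finally have "r \<le> (v - u) * (2 * M ^ k0)" by (simp add: mult_ac)
    then have "r / (2 * M ^ k0) \<le> v - u" using M0 by (subst pos_divide_le_eq) auto
    then have uvG: "(u, v) \<in> G'" using uv by (simp add: G'_def)
    obtain p q where pq: "a \<le> p" "p < q" "q \<le> b" "A = {p..q}" using A arcE by blast
    have "p \<le> u" "v \<le> q" using A(2) uv uv' pq by auto
    then have cases: "p \<le> u - r / 4 \<or> v + r / 4 \<le> q" using big pq dH by auto
    then show False
    proof
      assume c: "p \<le> u - r / 4"
      define B where "B = {u - r / 4..u}"
      have B: "arc B" "B \<in> S" "B \<subseteq> A" using c uvG pq uv' \<open>v \<le> q\<close> r by (auto simp: B_def S_def intro!: arcI)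
      have "\<not> free B"
      proof -
        obtain z where "z \<in> J" "u - r / 4 < z" "z < u" using free_accumulates(1)[OF gap_free[OF uv(1)] _ uJ(1), of "r / 4"] r by auto
        then show ?thesis by (auto simp: B_def free_def interior_atLeastAtMost_real)
      qed
      then show False using out[OF B(2) kk xyG \<rho>(1,3) B(1)] B(3) im(2) by blast
    next
      assume c: "v + r / 4 \<le> q"
      define B where "B = {v..v + r / 4}"
      have B: "arc B" "B \<in> S" "B \<subseteq> A" using c uvG pq uv' \<open>p \<le> u\<close> r by (auto simp: B_def S_def intro!: arcI)
      have "\<not> free B"
      proof -
        obtain z where "z \<in> J" "v < z" "z < v + r / 4" using free_accumulates(2)[OF gap_free[OF uv(1)] _ uJ(2), of "r / 4"] r by auto
        then show ?thesis by (auto simp: B_def free_def interior_atLeastAtMost_real)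
      qed
      then show False using out[OF B(2) kk xyG \<rho>(1,3) B(1)] B(3) im(2) by blast
    qed
  qed
  show ?thesis
  proof (intro exI[of _ \<rho>] conjI allI impI)
    show "\<rho> > 0" by (rule \<rho>(1))
    fix H A k x y
    assume "isgap H \<and> diameter H < r / 2 \<and> arc A \<and> H \<subseteq> A \<and> k \<ge> 1 \<and> gap x y \<and> r / 2 \<le> y - x \<and>
     (f ^^ k) ` H = {x..y} \<and> (f ^^ k) ` A \<subseteq> {x - \<rho>..y + \<rho>} \<and> (\<forall>i. 1 \<le> i \<and> i < k \<longrightarrow> width i A < r)"
    then show "diameter A < r" by (intro main[of H A k x y]) auto
  qed
qed

text \<open>A gap never covers \<open>J\<close>. It is enlarged to the largest arc whose image at
  time \<open>k\<close> stays in the \<open>\<rho>\<close>-neighbourhood of the image gap. By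
  \<open>gap_nbhd_stable\<close> the earlier images are short, and the image reaches far enough
  across an edge to cover \<open>J\<close> in \<open>m\<close> more steps, so
  \<open>closing_bound\<close> applies to the enlarged arc.\<close>

lemma gap_decay_until_large:
  "\<exists>r1>0. \<forall>r. scale r \<and> r \<le> r1 \<longrightarrow> (\<exists>K. \<forall>H k. isgap H \<and> (\<forall>j<k. width j H < r / 2) \<and>
     r / 2 \<le> width k H \<longrightarrow> diameter H \<le> K * exp (- (\<nu> / 2) * real k))"
proof -
  obtain r1 K0 where r1: "r1 > 0" "K0 \<ge> 1" and cb: "\<forall>A k m. arc A \<and> m \<ge> 1 \<and> (\<forall>j<k. width j A < r1) \<and> J \<subseteq> (f ^^ (k + m)) ` A \<longrightarrow>
     diameter A \<le> K0 * M ^ m * exp ((\<nu> / 2 - \<nu>) * real k)"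
    using closing_bound[of "\<nu> / 2"] \<nu>_pos half_gt_zero by blast
  have "\<exists>K. \<forall>H k. isgap H \<and> (\<forall>j<k. width j H < r / 2) \<and>
     r / 2 \<le> width k H \<longrightarrow> diameter H \<le> K * exp (- (\<nu> / 2) * real k)"
    if s: "scale r" and rr: "r \<le> r1" for r
  proof -
    have r: "r > 0" using scale_facts(1)[OF s] .
    obtain \<rho> where \<rho>: "\<rho> > 0" and st: "\<forall>H A k x y. isgap H \<and> diameter H < r / 2 \<and> arc A \<and> H \<subseteq> A \<and> k \<ge> 1 \<and> gap x y \<and> r / 2 \<le> y - x \<and>
     (f ^^ k) ` H = {x..y} \<and> (f ^^ k) ` A \<subseteq> {x - \<rho>..y + \<rho>} \<and> (\<forall>i. 1 \<le> i \<and> i < k \<longrightarrow> width i A < r) \<longrightarrow>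
     diameter A < r" using gap_nbhd_stable[OF s] by (elim exE conjE)
    define G where "G = {(x, y). gap x y \<and> r / 2 \<le> y - x}"
    have finG: "finite G" unfolding G_def by (rule finite_gaps) (use r in simp)
    \<comment> \<open>The arcs of length \<open>\<rho>\<close> adjacent to the long gaps.
      \<open>J\<close> accumulates at the edges from this side, so they are nonfree.\<close>
    define S where "S = (\<lambda>(x, y). {x - \<rho>..x}) ` {g \<in> G. fst g \<in> J} \<union> (\<lambda>(x, y). {y..y + \<rho>}) ` {g \<in> G. snd g \<in> J}"
    have "\<exists>m\<ge>1. \<forall>B\<in>S. arc B \<longrightarrow> J \<subseteq> (f ^^ m) ` B"
    proof (rule cover_exit_upto)
      show "finite S" using finG by (simp add: S_def)
      fix B assume "B \<in> S" "arc B"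
      then consider x y where "gap x y" "x \<in> J" "B = {x - \<rho>..x}" | x y where "gap x y" "y \<in> J" "B = {y..y + \<rho>}"
        by (auto simp: S_def G_def)
      then show "\<not> free B"
      proof cases
        case 1
        obtain z where "z \<in> J" "x - \<rho> < z" "z < x" using free_accumulates(1)[OF gap_free[OF 1(1)] \<rho> 1(2)] by auto
        then show ?thesis using 1 by (auto simp: free_def interior_atLeastAtMost_real)
      next
        case 2
        obtain z where "z \<in> J" "y < z" "z < y + \<rho>" using free_accumulates(2)[OF gap_free[OF 2(1)] \<rho> 2(2)] by auto
        then show ?thesis using 2 by (auto simp: free_def interior_atLeastAtMost_real)
      qed
    qed
    then obtain m where m: "m \<ge> 1" "\<And>B. B \<in> S \<Longrightarrow> arc B \<Longrightarrow> J \<subseteq> (f ^^ m) ` B" by blast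
    define K where "K = max (b - a) (K0 * M ^ m)"
    have "diameter H \<le> K * exp (- (\<nu> / 2) * real k)"
      if H: "isgap H" and sm: "\<And>j. j < k \<Longrightarrow> width j H < r / 2" and lg: "r / 2 \<le> width k H" for H k
    proof (cases "k = 0")
      case True
      then show ?thesis using arc_diameter_le[OF free_arc[OF isgap_free[OF H]]] by (simp add: K_def)
    next
      case False
      have gj: "isgap ((f ^^ j) ` H)" if "j \<le> k" for j
      proof (rule small_gap_iter[OF s H])
        fix i assume "i < j"
        then show "width i H < r" using sm[of i] that r by linarith
      qed
      obtain x y where xy: "gap x y" "(f ^^ k) ` H = {x..y}" using gj[of k] by (auto simp: isgap_def)
      have xyo: "a \<le> x" "x < y" "y \<le> b" using xy by (auto simp: gap_def)
      have dxy: "r / 2 \<le> y - x" using lg xy xyo by simp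
      obtain u v where uv: "gap u v" "H = {u..v}" using H by (auto simp: isgap_def)
      have uvo: "a \<le> u" "u < v" "v \<le> b" using uv by (auto simp: gap_def)
      \<comment> \<open>For \<open>k > 0\<close> the image gap comes from a short gap, whose edges
        are in \<open>J\<close>.\<close>
      have ends: "x \<in> J" "y \<in> J"
      proof -
        obtain j where j: "k = Suc j" using False by (cases k) auto
        obtain u' v' where g': "gap u' v'" "(f ^^ j) ` H = {u'..v'}" using gj[of j] j by (auto simp: isgap_def)
        have o': "a \<le> u'" "u' < v'" "v' \<le> b" using g' by (auto simp: gap_def)
        have d': "v' - u' < r" using sm[of j] j g' o' r by simp
        note sg = small_gap[OF s g'(1) d']
        have "f ` closed_segment u' v' = closed_segment (f u') (f v')"
          using sg(3) o' by (intro image_segment) (auto simp: closed_segment_eq_real_ivl open_segment_eq_real_ivl)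
        moreover have "(f ^^ k) ` H = f ` (f ^^ j) ` H" using j by (simp add: image_comp)
        ultimately have e: "{x..y} = closed_segment (f u') (f v')" using xy(2) g'(2) o' by (simp add: closed_segment_eq_real_ivl)
        then have "{x..y} = {min (f u') (f v')..max (f u') (f v')}" by (auto simp: closed_segment_eq_real_ivl)
        then have "x = min (f u') (f v')" "y = max (f u') (f v')" using xyo by (auto simp: Icc_eq_Icc)
        then show "x \<in> J" "y \<in> J" using sg(1,2) J_forward by (auto simp: min_def max_def)
      qed
      have "(f ^^ k) u \<in> {x..y}" using xy(2) uv uvo by auto
      then have t0: "u \<in> {a..b}" "(f ^^ k) u \<in> {x - \<rho>..y + \<rho>}" using uvo \<rho> by auto
      have "closed {x - \<rho>..y + \<rho>}" by simp
      obtain u' v' where c: "a \<le> u'" "u' \<le> u" "u \<le> v'" "v' \<le> b" "(f ^^ k) ` {u'..v'} \<subseteq> {x - \<rho>..y + \<rho>}"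
        "u' = a \<or> (f ^^ k) u' \<in> frontier {x - \<rho>..y + \<rho>}" "v' = b \<or> (f ^^ k) v' \<in> frontier {x - \<rho>..y + \<rho>}"
        and maxi: "\<forall>p q. a \<le> p \<and> p \<le> u \<and> u \<le> q \<and> q \<le> b \<and> (f ^^ k) ` {p..q} \<subseteq> {x - \<rho>..y + \<rho>} \<longrightarrow> u' \<le> p \<and> q \<le> v'"
        by (rule preimage_component[OF cont_iter \<open>closed {x - \<rho>..y + \<rho>}\<close> t0])
      have "(f ^^ k) ` {u..v} \<subseteq> {x - \<rho>..y + \<rho>}" using xy(2) uv(2) \<rho> by auto
      then have vv: "v \<le> v'" using maxi[rule_format, of u v] uvo by auto
      define A where "A = {u'..v'}"
      have A: "arc A" "H \<subseteq> A" using c vv uvo uv by (auto simp: A_def intro!: arcI)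
      \<comment> \<open>Induction backwards from time \<open>k\<close>: the bound at time
        \<open>j\<close> uses those between \<open>j\<close> and \<open>k\<close>.\<close>
      have small: "width j A < r" if "j < k" for j
        using that
      proof (induction "k - j" arbitrary: j rule: less_induct)
        case less
        show ?case
        proof (rule st[rule_format, of "(f ^^ j) ` H" "(f ^^ j) ` A" "k - j" x y], intro conjI allI impI)
          have kj: "(f ^^ (k - j)) ` (f ^^ j) ` B = (f ^^ k) ` B" for B using iter_add_image[of "k - j" j] less.prems by simp
          show "isgap ((f ^^ j) ` H)" using gj less.prems by simp
          show "width j H < r / 2" using sm less.prems by blast
          show "arc ((f ^^ j) ` A)" by (rule iter_arc[OF A(1)])
          show "(f ^^ j) ` H \<subseteq> (f ^^ j) ` A" using A(2) by blast
          show "1 \<le> k - j" using less.prems by simp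
          show "gap x y" "r / 2 \<le> y - x" by fact+
          show "(f ^^ (k - j)) ` (f ^^ j) ` H = {x..y}" unfolding kj by (rule xy(2))
          show "(f ^^ (k - j)) ` (f ^^ j) ` A \<subseteq> {x - \<rho>..y + \<rho>}" unfolding kj A_def by (rule c(5))
          fix i assume i: "1 \<le> i \<and> i < k - j"
          then have "width (i + j) A < r" by (intro less.hyps) auto
          then show "diameter ((f ^^ i) ` (f ^^ j) ` A) < r" by (simp add: iter_add_image)
        qed
      qed
      have fA: "arc ((f ^^ k) ` A)" by (rule iter_arc[OF A(1)])
      have "x \<in> (f ^^ k) ` H" "y \<in> (f ^^ k) ` H" using xy(2) xyo by auto
      then have xyA: "x \<in> (f ^^ k) ` A" "y \<in> (f ^^ k) ` A" using A(2) by blast+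
      \<comment> \<open>Otherwise \<open>A\<close> is all of \<open>{a..b}\<close>, which contains
        \<open>J\<close> and so is not shorter than \<open>r\<close>.\<close>
      have "\<not> (u' = a \<and> v' = b)"
      proof
        assume "u' = a \<and> v' = b"
        then have "diameter A = b - a" using ab by (simp add: A_def)
        moreover have "diameter J \<le> diameter {a..b}" using ab J_sub by (intro diameter_J(2) arcI) auto
        ultimately show False using small[of 0] False scale_facts(2)[OF s] ab by simp
      qed
      then have "(f ^^ k) u' \<in> frontier {x - \<rho>..y + \<rho>} \<or> (f ^^ k) v' \<in> frontier {x - \<rho>..y + \<rho>}" using c by blast
      moreover have "frontier {x - \<rho>..y + \<rho>} = {x - \<rho>, y + \<rho>}"
        using xyo \<rho> by (auto simp: frontier_def interior_atLeastAtMost_real)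
      ultimately have "x - \<rho> \<in> (f ^^ k) ` A \<or> y + \<rho> \<in> (f ^^ k) ` A"
      proof -
        have "u' \<in> A" "v' \<in> A" using c vv uvo by (auto simp: A_def)
        then have "(f ^^ k) u' \<in> (f ^^ k) ` A" "(f ^^ k) v' \<in> (f ^^ k) ` A" by simp_all
        moreover have "(f ^^ k) u' \<in> {x - \<rho>, y + \<rho>} \<or> (f ^^ k) v' \<in> {x - \<rho>, y + \<rho>}"
          using \<open>(f ^^ k) u' \<in> frontier {x - \<rho>..y + \<rho>} \<or> (f ^^ k) v' \<in> frontier {x - \<rho>..y + \<rho>}\<close>
            \<open>frontier {x - \<rho>..y + \<rho>} = {x - \<rho>, y + \<rho>}\<close> by blast
        ultimately show ?thesis by auto
      qed
      then have "\<exists>B\<in>S. arc B \<and> B \<subseteq> (f ^^ k) ` A"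
      proof
        assume e: "x - \<rho> \<in> (f ^^ k) ` A"
        obtain p q where pq: "(f ^^ k) ` A = {p..q}" using fA by (auto elim: arcE)
        have "{x - \<rho>..x} \<subseteq> (f ^^ k) ` A" using e xyA unfolding pq by auto
        moreover have "arc {x - \<rho>..x}" using arc_subset[OF fA] e xyo \<rho> by (intro arcI) auto
        moreover have "{x - \<rho>..x} \<in> S" using xy dxy ends unfolding S_def G_def by (intro UnI1 image_eqI[of _ _ "(x, y)"]) auto
        ultimately show ?thesis by blast
      next
        assume e: "y + \<rho> \<in> (f ^^ k) ` A"
        obtain p q where pq: "(f ^^ k) ` A = {p..q}" using fA by (auto elim: arcE)
        have "{y..y + \<rho>} \<subseteq> (f ^^ k) ` A" using e xyA unfolding pq by auto
        moreover have "arc {y..y + \<rho>}" using arc_subset[OF fA] e xyo \<rho> by (intro arcI) auto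
        moreover have "{y..y + \<rho>} \<in> S" using xy dxy ends unfolding S_def G_def by (intro UnI2 image_eqI[of _ _ "(x, y)"]) auto
        ultimately show ?thesis by blast
      qed
      then obtain B where B: "B \<in> S" "arc B" "B \<subseteq> (f ^^ k) ` A" by blast
      have "J \<subseteq> (f ^^ m) ` (f ^^ k) ` A" using m(2)[OF B(1,2)] B(3) by blast
      then have "J \<subseteq> (f ^^ (k + m)) ` A" by (simp add: iter_add_image[symmetric] add.commute)
      then have "diameter A \<le> K0 * M ^ m * exp ((\<nu> / 2 - \<nu>) * real k)"
        using cb A(1) m(1) small rr by (meson less_le_trans)
      also have "\<dots> \<le> K * exp (- (\<nu> / 2) * real k)" unfolding K_def using ab by (intro mult_mono) (auto simp: max_def)
      finally have "diameter A \<le> K * exp (- (\<nu> / 2) * real k)" .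
      moreover have "diameter H \<le> diameter A" using A by (intro arc_diameter_mono)
      ultimately show ?thesis by linarith
    qed
    then show ?thesis by blast
  qed
  then show ?thesis using r1(1) by blast
qed

end

section \<open>Relative sizes inside a gap\<close>

text \<open>Each term is the integral of \<open>1 / x\<close> over an interval, and the intervals
  are disjoint and lie between \<open>x0\<close> and \<open>x1\<close>.\<close>

lemma sum_ln_disjoint_le:
  fixes l h :: "'i \<Rightarrow> real"
  assumes "finite S" "0 < x0" "x0 \<le> x1" "\<And>i. i \<in> S \<Longrightarrow> x0 \<le> l i \<and> l i < h i \<and> h i \<le> x1"
    and "\<And>i j. i \<in> S \<Longrightarrow> j \<in> S \<Longrightarrow> i \<noteq> j \<Longrightarrow> h i \<le> l j \<or> h j \<le> l i"
  shows "(\<Sum>i\<in>S. ln (h i) - ln (l i)) \<le> ln x1 - ln x0"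
  using assms
proof (induction "card S" arbitrary: S x1)
  case 0
  then show ?case by simp
next
  case (Suc n)
  then have ne: "S \<noteq> {}" "finite S" by auto
  obtain j where j: "j \<in> S" "\<And>i. i \<in> S \<Longrightarrow> h i \<le> h j"
  proof -
    have "Max (h ` S) \<in> h ` S" using ne by (intro Max_in) auto
    then obtain j where "j \<in> S" "Max (h ` S) = h j" by auto
    then show ?thesis using ne that[of j] by (metis Max_ge finite_imageI imageI)
  qed
  have le: "h i \<le> l j" if "i \<in> S - {j}" for i
    using Suc.prems(5)[of i j] Suc.prems(4)[of i] j that by force
  have "(\<Sum>i\<in>S - {j}. ln (h i) - ln (l i)) \<le> ln (l j) - ln x0"
  proof (rule Suc.hyps(1))
    show "n = card (S - {j})" using Suc.hyps(2) j(1) ne by simp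
    show "x0 \<le> l j" using Suc.prems(4) j(1) by blast
    show "x0 \<le> l i \<and> l i < h i \<and> h i \<le> l j" if "i \<in> S - {j}" for i using le[OF that] Suc.prems(4)[of i] that by auto
    show "h i \<le> l i' \<or> h i' \<le> l i" if "i \<in> S - {j}" "i' \<in> S - {j}" "i \<noteq> i'" for i i'
      using Suc.prems(5)[of i i'] that by auto
  qed (use ne Suc.prems(2) in auto)
  moreover have "ln (h j) \<le> ln x1" using Suc.prems(2) Suc.prems(4)[OF j(1)] by (intro ln_mono) auto
  moreover have "(\<Sum>i\<in>S. ln (h i) - ln (l i)) = (\<Sum>i\<in>S - {j}. ln (h i) - ln (l i)) + (ln (h j) - ln (l j))"
    by (simp add: sum.remove[OF ne(2) j(1)])
  ultimately show ?case by linarith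
qed

context interval_map begin

text \<open>Near \<open>c\<close> the derivative is comparable to a power of the distance, so a
  ratio \<open>\<theta>\<close> of distances costs at most a power of \<open>\<theta>\<close>; away
  from \<open>Crit\<close> only a constant is lost.\<close>

lemma df_ratio:
  "\<exists>\<rho>>0. \<exists>\<kappa>>0. \<exists>P. \<kappa> \<le> 1 \<and>
     (\<forall>c\<in>Crit. \<forall>x\<in>{a..b}. \<forall>y\<in>{a..b}. \<forall>\<theta>. \<bar>x - c\<bar> < \<rho> \<and> \<bar>y - c\<bar> < \<rho> \<and> 0 \<le> \<theta> \<and> \<theta> \<le> 1 \<and> \<theta> * \<bar>y - c\<bar> \<le> \<bar>x - c\<bar> \<longrightarrow>
        \<kappa> * \<theta> ^ P * \<bar>df y\<bar> \<le> \<bar>df x\<bar>) \<and>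
     (\<forall>x\<in>{a..b}. \<forall>y\<in>{a..b}. (\<forall>c\<in>Crit. \<rho> / 2 \<le> \<bar>x - c\<bar>) \<longrightarrow> \<kappa> * \<bar>df y\<bar> \<le> \<bar>df x\<bar>)"
proof -
  \<comment> \<open>The same \<open>\<rho>\<close> is radius, constant and inverse bound of the
    exponent, so that \<open>finite_uniform_small\<close> treats all critical points at
    once.\<close>
  define Pc where "Pc c \<rho> \<longleftrightarrow> (\<forall>x\<in>{a..b}. \<forall>y\<in>{a..b}. \<forall>\<theta>. \<bar>x - c\<bar> < \<rho> \<and> \<bar>y - c\<bar> < \<rho> \<and> 0 \<le> \<theta> \<and> \<theta> \<le> 1 \<and> \<theta> * \<bar>y - c\<bar> \<le> \<bar>x - c\<bar> \<longrightarrow>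
        (\<exists>P. real P \<le> 1 / \<rho> \<and> \<rho> * \<theta> ^ P * \<bar>df y\<bar> \<le> \<bar>df x\<bar>))" for c \<rho>
  have "\<exists>\<rho>>0. \<forall>c\<in>Crit. \<forall>\<rho>'. 0 < \<rho>' \<and> \<rho>' \<le> \<rho> \<longrightarrow> Pc c \<rho>'"
  proof (rule finite_uniform_small[OF finite_Crit])
    fix c assume "c \<in> Crit"
    then obtain p k1 k2 \<rho>0 where k: "0 < k1" "0 < k2" "0 < \<rho>0"
      and bnd: "\<forall>x\<in>{a..b}. \<bar>x - c\<bar> < \<rho>0 \<longrightarrow> k1 * \<bar>x - c\<bar> ^ p \<le> \<bar>df x\<bar> \<and> \<bar>df x\<bar> \<le> k2 * \<bar>x - c\<bar> ^ p"
      using order[of c] unfolding Crit_def by blast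
    define \<rho> where "\<rho> = min (min \<rho>0 (k1 / k2)) (1 / (real p + 1))"
    have \<rho>: "\<rho> > 0" "\<rho> \<le> \<rho>0" "\<rho> \<le> k1 / k2" "\<rho> \<le> 1 / (real p + 1)" using k by (auto simp: \<rho>_def)
    have "Pc c \<rho>'" if r: "0 < \<rho>'" "\<rho>' \<le> \<rho>" for \<rho>'
      unfolding Pc_def
    proof (intro ballI allI impI exI[of _ p] conjI)
      fix x y \<theta> assume xy: "x \<in> {a..b}" "y \<in> {a..b}" and
        t: "\<bar>x - c\<bar> < \<rho>' \<and> \<bar>y - c\<bar> < \<rho>' \<and> 0 \<le> \<theta> \<and> \<theta> \<le> 1 \<and> \<theta> * \<bar>y - c\<bar> \<le> \<bar>x - c\<bar>"
      have "\<rho>' \<le> 1 / (real p + 1)" using r \<rho> by simp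
      then have "\<rho>' * (real p + 1) \<le> 1" by (simp add: field_simps)
      then have "\<rho>' * real p \<le> 1" using r by (simp add: algebra_simps)
      then show "real p \<le> 1 / \<rho>'" using r by (simp add: field_simps)
      have "\<rho>' * \<theta> ^ p * \<bar>df y\<bar> \<le> \<rho>' * \<theta> ^ p * (k2 * \<bar>y - c\<bar> ^ p)"
        using bnd xy t r \<rho> by (intro mult_left_mono) auto
      also have "\<dots> = (\<rho>' * k2) * (\<theta> * \<bar>y - c\<bar>) ^ p" by (simp add: power_mult_distrib)
      also have "\<dots> \<le> k1 * \<bar>x - c\<bar> ^ p"
      proof (intro mult_mono power_mono)
        have "\<rho>' \<le> k1 / k2" using r \<rho> by simp
        then show "\<rho>' * k2 \<le> k1" using k by (simp add: field_simps)
      qed (use t k r in auto)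
      also have "\<dots> \<le> \<bar>df x\<bar>" using bnd xy t r \<rho> by auto
      finally show "\<rho>' * \<theta> ^ p * \<bar>df y\<bar> \<le> \<bar>df x\<bar>" .
    qed
    then show "\<exists>\<rho>>0. \<forall>\<rho>'. 0 < \<rho>' \<and> \<rho>' \<le> \<rho> \<longrightarrow> Pc c \<rho>'" using \<rho>(1) by blast
  qed
  then obtain \<rho> where \<rho>: "\<rho> > 0" "\<And>c. c \<in> Crit \<Longrightarrow> Pc c \<rho>" by (metis order_refl)
  define K where "K = {x \<in> {a..b}. \<forall>c\<in>Crit. \<rho> / 2 \<le> \<bar>x - c\<bar>}"
  have "K = {a..b} \<inter> (\<Inter>c\<in>Crit. - ball c (\<rho> / 2))" by (auto simp: K_def dist_real_def abs_minus_commute not_less)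
  then have cK: "compact K" by (auto intro!: compact_Int_closed closed_INT)
  have "\<exists>m>0. \<forall>x\<in>K. m \<le> \<bar>df x\<bar>"
  proof (cases "K = {}")
    case False
    have "continuous_on K (\<lambda>x. \<bar>df x\<bar>)"
      by (intro continuous_on_rabs continuous_on_subset[OF cont_df]) (auto simp: K_def)
    then obtain x where x: "x \<in> K" "\<And>y. y \<in> K \<Longrightarrow> \<bar>df x\<bar> \<le> \<bar>df y\<bar>"
      using continuous_attains_inf[OF cK False] by blast
    have "x \<notin> Crit" using x \<rho> by (force simp: K_def)
    then have "df x \<noteq> 0" using x by (auto simp: K_def Crit_def)
    then show ?thesis using x by (intro exI[of _ "\<bar>df x\<bar>"]) auto
  qed (auto intro: exI[of _ 1])
  then obtain m where m: "m > 0" "\<And>x. x \<in> K \<Longrightarrow> m \<le> \<bar>df x\<bar>" by blast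
  define P where "P = nat \<lfloor>1 / \<rho>\<rfloor>"
  have P: "p \<le> P" if "real p \<le> 1 / \<rho>" for p using that \<rho> by (simp add: P_def le_nat_floor)
  define \<kappa> where "\<kappa> = min (min 1 \<rho>) (m / M)"
  have \<kappa>: "\<kappa> > 0" "\<kappa> \<le> 1" "\<kappa> \<le> \<rho>" "\<kappa> \<le> m / M" using \<rho> m M_ge_1 by (auto simp: \<kappa>_def)
  have 1: "\<kappa> * \<theta> ^ P * \<bar>df y\<bar> \<le> \<bar>df x\<bar>" if c: "c \<in> Crit" and xy: "x \<in> {a..b}" "y \<in> {a..b}"
    and t: "\<bar>x - c\<bar> < \<rho>" "\<bar>y - c\<bar> < \<rho>" "0 \<le> \<theta>" "\<theta> \<le> 1" "\<theta> * \<bar>y - c\<bar> \<le> \<bar>x - c\<bar>" for c x y \<theta>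
  proof -
    obtain p where p: "real p \<le> 1 / \<rho>" "\<rho> * \<theta> ^ p * \<bar>df y\<bar> \<le> \<bar>df x\<bar>"
      using \<rho>(2)[OF c] xy t unfolding Pc_def by blast
    have "\<kappa> * \<theta> ^ P * \<bar>df y\<bar> \<le> \<rho> * \<theta> ^ p * \<bar>df y\<bar>"
      using \<kappa> t P[OF p(1)] \<rho> by (intro mult_right_mono mult_mono power_decreasing) auto
    then show ?thesis using p by linarith
  qed
  have 2: "\<kappa> * \<bar>df y\<bar> \<le> \<bar>df x\<bar>" if "x \<in> {a..b}" "y \<in> {a..b}" "\<And>c. c \<in> Crit \<Longrightarrow> \<rho> / 2 \<le> \<bar>x - c\<bar>" for x y
  proof -
    have "\<kappa> * \<bar>df y\<bar> \<le> m / M * M" using \<kappa> abs_df_le[OF that(2)] m M_ge_1 by (intro mult_mono) auto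
    also have "\<dots> = m" using M_ge_1 by simp
    also have "\<dots> \<le> \<bar>df x\<bar>" using that by (intro m(2)) (auto simp: K_def)
    finally show ?thesis .
  qed
  show ?thesis using \<rho>(1) \<kappa>(1,2) 1 2 by (intro exI[of _ \<rho>] conjI exI[of _ \<kappa>] exI[of _ P]) auto
qed

end

context expanding_julia begin

text \<open>Here \<open>w\<close> and \<open>e\<close> are the edges of a gap, and \<open>w'\<close>
  is the far end of a piece at \<open>w\<close>. The image of the gap is its length times the
  derivative at some point of it. The loss is a constant unless a critical point at or behind
  \<open>w\<close> is closer than the length of the gap. Of the two bounds given then, the second is
  useful even if \<open>w\<close> itself is critical.\<close>

lemma relative_size_step:
  "\<exists>\<rho>>0. \<exists>c2>0. \<exists>P. c2 \<le> 1 \<and> (\<forall>w e w'. closed_segment w e \<subseteq> {a..b} \<and> open_segment w e \<inter> Crit = {} \<and> \<bar>e - w\<bar> < \<rho> \<and>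
     w' \<in> closed_segment w e \<and> w' \<noteq> w \<longrightarrow>
     (let g = \<bar>e - w\<bar>; \<sigma> = \<bar>w' - w\<bar> / g; \<sigma>' = \<bar>f w' - f w\<bar> / \<bar>f e - f w\<bar> in
       c2 * \<sigma> \<le> \<sigma>' \<or>
       (\<exists>c\<in>Crit. (c - w) * (e - w) \<le> 0 \<and> \<bar>w - c\<bar> < g \<and>
          c2 * \<sigma> * (\<bar>w - c\<bar> / g) ^ P \<le> \<sigma>' \<and> c2 * \<sigma> ^ Suc P \<le> \<sigma>')))"
proof -
  obtain \<rho> \<kappa> P where \<rho>: "\<rho> > 0" "\<kappa> > 0" "\<kappa> \<le> 1"
    and near: "\<forall>c\<in>Crit. \<forall>x\<in>{a..b}. \<forall>y\<in>{a..b}. \<forall>\<theta>. \<bar>x - c\<bar> < \<rho> \<and> \<bar>y - c\<bar> < \<rho> \<and> 0 \<le> \<theta> \<and> \<theta> \<le> 1 \<and> \<theta> * \<bar>y - c\<bar> \<le> \<bar>x - c\<bar> \<longrightarrow>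
        \<kappa> * \<theta> ^ P * \<bar>df y\<bar> \<le> \<bar>df x\<bar>"
    and far: "\<forall>x\<in>{a..b}. \<forall>y\<in>{a..b}. (\<forall>c\<in>Crit. \<rho> / 2 \<le> \<bar>x - c\<bar>) \<longrightarrow> \<kappa> * \<bar>df y\<bar> \<le> \<bar>df x\<bar>"
    using df_ratio by (elim exE conjE) (rule that)
  \<comment> \<open>The factor \<open>2 ^ P\<close> pays for the ratio of distances being known only
    up to 2.\<close>
  define c2 where "c2 = \<kappa> / (C * 2 ^ P)"
  have C0: "C > 0" using C_ge_1 by simp
  have "C * 2 ^ P \<ge> 1" using C_ge_1 mult_mono[of 1 C 1 "2 ^ P"] by simp
  then have c2: "c2 > 0" "c2 \<le> 1" using \<rho> C0 by (auto simp: c2_def field_simps intro: order_trans)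
  have main: "c2 * \<sigma> \<le> \<sigma>' \<or> (\<exists>c\<in>Crit. (c - w) * (e - w) \<le> 0 \<and> \<bar>w - c\<bar> < g \<and>
          c2 * \<sigma> * (\<bar>w - c\<bar> / g) ^ P \<le> \<sigma>' \<and> c2 * \<sigma> ^ Suc P \<le> \<sigma>')"
    if sub: "closed_segment w e \<subseteq> {a..b}" and nc: "open_segment w e \<inter> Crit = {}" and gs: "\<bar>e - w\<bar> < \<rho> / 2"
      and w': "w' \<in> closed_segment w e" "w' \<noteq> w" and defs: "g = \<bar>e - w\<bar>" "\<sigma> = \<bar>w' - w\<bar> / g" "\<sigma>' = \<bar>f w' - f w\<bar> / \<bar>f e - f w\<bar>" for w e w' g \<sigma> \<sigma>'
  proof -
    have we: "w \<in> {a..b}" "e \<in> {a..b}" "w' \<in> {a..b}" using sub w' by auto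
    define h where "h = \<bar>w' - w\<bar>"
    have h: "0 < h" "h \<le> g" using w' by (auto simp: h_def defs closed_segment_eq_real_ivl split: if_splits)
    have g: "0 < g" "g < \<rho> / 2" using h gs defs by auto
    obtain z where z: "z \<in> closed_segment w e" "\<bar>f e - f w\<bar> = g * \<bar>df z\<bar>"
    proof (cases "w < e")
      case True
      obtain z where "z \<in> {w<..<e}" "f e - f w = (e - w) * df z" using mvt_ex[of w e] True we by auto
      then show ?thesis using that[of z] True by (auto simp: closed_segment_eq_real_ivl defs abs_mult)
    next
      case False
      then have "e < w" using g defs by auto
      then obtain z where z: "z \<in> {e<..<w}" "f w - f e = (w - e) * df z" using mvt_ex[of e w] we by auto
      have "\<bar>f e - f w\<bar> = \<bar>f w - f e\<bar>" by (rule abs_minus_commute)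
      then show ?thesis using that[of z] z \<open>e < w\<close> by (auto simp: closed_segment_eq_real_ivl defs abs_mult)
    qed
    have zI: "z \<in> {a..b}" using z sub by blast
    have inj: "f e \<noteq> f w"
    proof
      assume "f e = f w"
      then have "f ` closed_segment w e = {f w}" using image_segment[OF sub nc] by simp
      moreover have "arc (closed_segment w e)" using we g by (auto simp: closed_segment_eq_real_ivl defs intro!: arcI)
      ultimately show False using arc_diameter_pos[OF image_arc] by fastforce
    qed
    have V: "closed_segment w w' \<subseteq> closed_segment w e" using w'(1) by (simp add: subset_closed_segment)
    have arcV: "arc (closed_segment w w')" using we w'(2) by (auto simp: closed_segment_eq_real_ivl intro!: arcI)
    have oV: "open_segment w w' \<inter> Crit = {}"
    proof -
      have "open_segment w w' \<subseteq> open_segment w e"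
        using w'(1) by (auto simp: closed_segment_eq_real_ivl open_segment_eq_real_ivl split: if_splits)
      then show ?thesis using nc by blast
    qed
    have "f ` closed_segment w w' = closed_segment (f w) (f w')" using image_segment[of w w'] V sub oV by blast
    then have low: "h * \<bar>df t\<bar> \<le> C * \<bar>f w' - f w\<bar>" if "t \<in> closed_segment w w'" for t
      using diameter_image_ge[OF arcV that] by (simp add: diameter_segment h_def)
    have ratio: "\<sigma> * q / C \<le> \<sigma>'" if "t \<in> closed_segment w w'" "q * \<bar>df z\<bar> \<le> \<bar>df t\<bar>" for t q
    proof -
      have dz: "\<bar>df z\<bar> > 0" using inj z g by (auto simp: zero_less_mult_iff)
      have "h * (q * \<bar>df z\<bar>) \<le> h * \<bar>df t\<bar>" using that h by (intro mult_left_mono) auto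
      also have "\<dots> \<le> C * \<bar>f w' - f w\<bar>" by (rule low[OF that(1)])
      finally have "h * q * \<bar>df z\<bar> \<le> C * \<bar>f w' - f w\<bar>" by simp
      then show ?thesis using dz g C0 unfolding defs(2,3) z(2) h_def[symmetric] by (simp add: field_simps)
    qed
    have \<sigma>: "\<sigma> = h / g" "0 < \<sigma>" "\<sigma> \<le> 1" using h g by (auto simp: defs h_def)
    have c2C: "c2 * \<sigma> \<le> \<sigma> * \<kappa> / C"
    proof -
      have "\<kappa> / (C * 2 ^ P) \<le> \<kappa> / C" using \<rho> C0 by (intro divide_left_mono) auto
      then have "c2 * \<sigma> \<le> \<kappa> / C * \<sigma>" unfolding c2_def using \<sigma> by (intro mult_right_mono) auto
      then show ?thesis by (simp add: mult.commute)
    qed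
    have wV: "w \<in> closed_segment w w'" "w' \<in> closed_segment w w'" by auto
    show ?thesis
    proof (cases "\<forall>c\<in>Crit. \<rho> / 2 \<le> \<bar>w - c\<bar>")
      case True
      then have "\<kappa> * \<bar>df z\<bar> \<le> \<bar>df w\<bar>" using far we zI by blast
      from ratio[OF wV(1) this] c2C show ?thesis by linarith
    next
      case False
      then obtain c where c: "c \<in> Crit" "\<bar>w - c\<bar> < \<rho> / 2" by auto
      have inball: "\<bar>t - c\<bar> < \<rho>" if "t \<in> closed_segment w e" for t
      proof -
        have "\<bar>t - w\<bar> \<le> g" using that by (auto simp: defs closed_segment_eq_real_ivl split: if_splits)
        then show ?thesis using c g by linarith
      qed
      have cns: "c \<notin> open_segment w e" using c nc by blast
      show ?thesis
      proof (cases "(c - w) * (e - w) \<le> 0")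
        case far_side: False
        \<comment> \<open>With \<open>c\<close> at or beyond the other edge, \<open>w\<close> is the
          point of the gap farthest from \<open>c\<close>, so up to a constant its derivative is the
          largest.\<close>
        have "\<bar>z - c\<bar> \<le> \<bar>w - c\<bar>"
          using far_side cns z(1) by (auto simp: closed_segment_eq_real_ivl open_segment_eq_real_ivl mult_le_0_iff not_le split: if_splits)
        then have "\<kappa> * 1 ^ P * \<bar>df z\<bar> \<le> \<bar>df w\<bar>"
          using near[rule_format, OF c(1) we(1) zI, of 1] inball[OF z(1)] inball[of w] by auto
        then have "\<kappa> * \<bar>df z\<bar> \<le> \<bar>df w\<bar>" by simp
        from ratio[OF wV(1) this] c2C show ?thesis by linarith
      next
        case near_side: True
        define d where "d = \<bar>w - c\<bar>"
        have d0: "d \<ge> 0" by (simp add: d_def)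
        have dist_c: "\<bar>t - c\<bar> = d + \<bar>t - w\<bar>" if "t \<in> closed_segment w e" for t
          using near_side that g defs unfolding d_def
          by (auto simp: closed_segment_eq_real_ivl mult_le_0_iff split: if_splits)
        \<comment> \<open>Ratio of the distances of \<open>w'\<close> and \<open>e\<close> from
          \<open>c\<close>, which lies behind \<open>w\<close> or equals it.\<close>
        define \<theta> where "\<theta> = (d + h) / (d + g)"
        have \<theta>: "0 \<le> \<theta>" "\<theta> \<le> 1" using h g d0 by (auto simp: \<theta>_def)
        have "\<theta> * \<bar>z - c\<bar> \<le> \<bar>w' - c\<bar>"
        proof -
          have "\<bar>z - w\<bar> \<le> g" using z(1) by (auto simp: defs closed_segment_eq_real_ivl split: if_splits)
          then have "\<theta> * \<bar>z - c\<bar> \<le> \<theta> * (d + g)" using dist_c[OF z(1)] \<theta> by (intro mult_left_mono) auto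
          also have "\<dots> = d + h" using g d0 by (simp add: \<theta>_def)
          also have "\<dots> = \<bar>w' - c\<bar>" using dist_c[OF w'(1)] by (simp add: h_def)
          finally show ?thesis .
        qed
        then have "\<kappa> * \<theta> ^ P * \<bar>df z\<bar> \<le> \<bar>df w'\<bar>"
          using near[rule_format, OF c(1) we(3) zI, of \<theta>] inball[OF z(1)] inball[OF w'(1)] \<theta> by auto
        from ratio[OF wV(2) this] have r1: "\<sigma> * (\<kappa> * \<theta> ^ P) / C \<le> \<sigma>'" .
        have key: "c2 * \<sigma> * x ^ P \<le> \<sigma>'" if "0 \<le> x" "x / 2 \<le> \<theta>" for x
        proof -
          have "(x / 2) ^ P \<le> \<theta> ^ P" using that by (intro power_mono) auto
          then have "\<sigma> * (\<kappa> * (x / 2) ^ P) / C \<le> \<sigma> * (\<kappa> * \<theta> ^ P) / C"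
            using \<sigma> \<rho> C0 by (intro divide_right_mono mult_left_mono) auto
          moreover have "\<sigma> * (\<kappa> * (x / 2) ^ P) / C = c2 * \<sigma> * x ^ P"
            by (simp add: c2_def power_divide mult_ac)
          ultimately show ?thesis using r1 by linarith
        qed
        show ?thesis
        proof (cases "g \<le> d")
          case True
          have "1 / 2 \<le> \<theta>" using True h g d0 by (simp add: \<theta>_def field_simps)
          then show ?thesis using key[of 1] by simp
        next
          case False
          have "d / g / 2 \<le> \<theta>" "\<sigma> / 2 \<le> \<theta>"
          proof -
            have "d / g / 2 = d / (2 * g)" by simp
            also have "\<dots> \<le> (d + h) / (2 * g)" using h g by (intro divide_right_mono) auto
            also have "\<dots> \<le> \<theta>" unfolding \<theta>_def using False h g d0 by (intro divide_left_mono) auto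
            finally show "d / g / 2 \<le> \<theta>" .
            have "\<sigma> / 2 = h / (2 * g)" by (simp add: \<sigma>(1))
            also have "\<dots> \<le> (d + h) / (2 * g)" using d0 g by (intro divide_right_mono) auto
            also have "\<dots> \<le> \<theta>" unfolding \<theta>_def using False h g d0 by (intro divide_left_mono) auto
            finally show "\<sigma> / 2 \<le> \<theta>" .
          qed
          then have "c2 * \<sigma> * (d / g) ^ P \<le> \<sigma>'" "c2 * \<sigma> * \<sigma> ^ P \<le> \<sigma>'"
            using key[of "d / g"] key[of \<sigma>] d0 g \<sigma> by auto
          then show ?thesis using c(1) near_side False by (intro disjI2 bexI[of _ c]) (auto simp: d_def mult.assoc)
        qed
      qed
    qed
  qed
  have "\<forall>w e w'. closed_segment w e \<subseteq> {a..b} \<and> open_segment w e \<inter> Crit = {} \<and> \<bar>e - w\<bar> < \<rho> / 2 \<and>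
     w' \<in> closed_segment w e \<and> w' \<noteq> w \<longrightarrow>
     (let g = \<bar>e - w\<bar>; \<sigma> = \<bar>w' - w\<bar> / g; \<sigma>' = \<bar>f w' - f w\<bar> / \<bar>f e - f w\<bar> in
       c2 * \<sigma> \<le> \<sigma>' \<or>
       (\<exists>c\<in>Crit. (c - w) * (e - w) \<le> 0 \<and> \<bar>w - c\<bar> < g \<and>
          c2 * \<sigma> * (\<bar>w - c\<bar> / g) ^ P \<le> \<sigma>' \<and> c2 * \<sigma> ^ Suc P \<le> \<sigma>'))"
    unfolding Let_def
  proof (intro allI impI, elim conjE)
    fix w e w'
    assume "closed_segment w e \<subseteq> {a..b}" "open_segment w e \<inter> Crit = {}" "\<bar>e - w\<bar> < \<rho> / 2"
     "w' \<in> closed_segment w e" "w' \<noteq> w"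
    from main[OF this refl refl refl]
    show "c2 * (\<bar>w' - w\<bar> / \<bar>e - w\<bar>) \<le> \<bar>f w' - f w\<bar> / \<bar>f e - f w\<bar> \<or>
       (\<exists>c\<in>Crit. (c - w) * (e - w) \<le> 0 \<and> \<bar>w - c\<bar> < \<bar>e - w\<bar> \<and>
          c2 * (\<bar>w' - w\<bar> / \<bar>e - w\<bar>) * (\<bar>w - c\<bar> / \<bar>e - w\<bar>) ^ P \<le> \<bar>f w' - f w\<bar> / \<bar>f e - f w\<bar> \<and>
          c2 * (\<bar>w' - w\<bar> / \<bar>e - w\<bar>) ^ Suc P \<le> \<bar>f w' - f w\<bar> / \<bar>f e - f w\<bar>)" .
  qed
  then show ?thesis using \<rho>(1) c2 half_gt_zero[of \<rho>] by (intro exI[of _ "\<rho> / 2"] conjI exI[of _ c2] exI[of _ P])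
qed

text \<open>Let \<open>\<sigma>\<close> be the fraction of the gap taken by \<open>V\<close>. One step decreases \<open>\<sigma>\<close> at most by a constant factor, unless a
  critical point \<open>c\<close> on the side of the edge is closer than the length \<open>g\<close> of the gap; then \<open>- ln \<sigma>\<close> grows by a
  multiple of \<open>ln (g / d)\<close>, where \<open>d\<close> is the distance to \<open>c\<close>. For a given \<open>c\<close> and side these gaps are disjoint, so all
  these terms but the one of the gap closest to \<open>c\<close> add up to at most a multiple of \<open>k\<close>; that exceptional step
  merely multiplies \<open>- ln \<sigma>\<close> by a constant.\<close>

lemma relative_gap:
  "\<exists>r1>0. \<exists>L\<ge>1. \<exists>Q\<ge>0. \<forall>r H V w k. scale r \<and> r \<le> r1 \<and> isgap H \<and> (\<forall>j<k. width j H < r / 2) \<and>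
     r / 2 \<le> width k H \<and> arc V \<and> V \<subseteq> H \<and> w \<in> V \<and> w \<in> J \<longrightarrow>
     ln (width k H / width k V) \<le> L * (ln (diameter H / diameter V) + Q * (real k + 1))"
proof -
  obtain \<rho> c2 P where \<rho>: "\<rho> > 0" "c2 > 0" "c2 \<le> 1"
    and step: "\<forall>w e w'. closed_segment w e \<subseteq> {a..b} \<and> open_segment w e \<inter> Crit = {} \<and> \<bar>e - w\<bar> < \<rho> \<and>
     w' \<in> closed_segment w e \<and> w' \<noteq> w \<longrightarrow>
     (let g = \<bar>e - w\<bar>; \<sigma> = \<bar>w' - w\<bar> / g; \<sigma>' = \<bar>f w' - f w\<bar> / \<bar>f e - f w\<bar> in
       c2 * \<sigma> \<le> \<sigma>' \<or>
       (\<exists>c\<in>Crit. (c - w) * (e - w) \<le> 0 \<and> \<bar>w - c\<bar> < g \<and>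
          c2 * \<sigma> * (\<bar>w - c\<bar> / g) ^ P \<le> \<sigma>' \<and> c2 * \<sigma> ^ Suc P \<le> \<sigma>'))"
    using relative_size_step by (elim exE conjE) (rule that)
  define b0 where "b0 = - ln c2"
  have b0: "b0 \<ge> 0" using \<rho> by (simp add: b0_def)
  define nT where "nT = 2 * card Crit"
  \<comment> \<open>A type is a critical point together with a side. Each type has at most one
    exceptional step, which multiplies the logarithm by \<open>P + 1\<close>.\<close>
  define L where "L = (real P + 1) ^ nT"
  have lnM: "ln M \<ge> 0" using M_ge_1 by simp
  define Q where "Q = b0 + real P * real nT * (ln 2 + ln M)"
  have "ln (width k H / width k V) \<le> L * (ln (diameter H / diameter V) + Q * (real k + 1))"
    if s: "scale r" "r \<le> \<rho>" and H: "isgap H" and sm: "\<And>j. j < k \<Longrightarrow> width j H < r / 2"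
      and lg: "r / 2 \<le> width k H" and V: "arc V" "V \<subseteq> H" "w \<in> V" "w \<in> J" for r H V w k
  proof -
    have r: "r > 0" using scale_facts(1)[OF s(1)] .
    obtain u v where uv: "gap u v" "H = {u..v}" using H by (auto simp: isgap_def)
    have uvo: "a \<le> u" "u < v" "v \<le> b" using uv by (auto simp: gap_def)
    have wuv: "w = u \<or> w = v" using free_J_endpoint[OF gap_free[OF uv(1)] V(4)] V uv by blast
    define e where "e = (if w = u then v else u)"
    have He: "H = closed_segment w e" using wuv uv(2) uvo by (auto simp: e_def closed_segment_eq_real_ivl)
    have "V \<subseteq> {..w} \<or> V \<subseteq> {w..}" using V(2) wuv uv(2) by auto
    then obtain w' where w': "V = closed_segment w w'" "w' \<noteq> w" using arc_endpoint[OF V(1,3)] by blast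
    define W where "W j = (f ^^ j) w" for j
    define W' where "W' j = (f ^^ j) w'" for j
    define e' where "e' j = (f ^^ j) e" for j
    have gapj: "isgap ((f ^^ j) ` H)" if "j \<le> k" for j
    proof (rule small_gap_iter[OF s(1) H])
      fix i assume "i < j"
      then show "width i H < r" using sm[of i] that r by linarith
    qed
    have Hj: "arc ((f ^^ j) ` H)" for j by (rule iter_arc[OF free_arc[OF isgap_free[OF H]]])
    have Vj: "arc ((f ^^ j) ` V)" for j by (rule iter_arc[OF V(1)])
    have nocrit: "open_segment x y \<inter> Crit = {}" if hyp: "(f ^^ j) ` H = closed_segment x y" and jk: "j < k" for j x y
    proof -
      obtain p q where pq: "gap p q" "(f ^^ j) ` H = {p..q}" using gapj[of j] jk by (auto simp: isgap_def)
      have "p < q" using pq by (simp add: gap_def)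
      then have "q - p < r" using sm[OF jk] pq(2) r \<open>p < q\<close> by simp
      then have "{p<..<q} \<inter> Crit = {}" using small_gap(3)[OF s(1) pq(1)] by blast
      moreover have "open_segment x y = {p<..<q}"
        using hyp pq(2) \<open>p < q\<close> by (auto simp: closed_segment_eq_real_ivl open_segment_eq_real_ivl Icc_eq_Icc split: if_splits)
      ultimately show ?thesis by simp
    qed
    have seg: "(f ^^ j) ` H = closed_segment (W j) (e' j) \<and> (f ^^ j) ` V = closed_segment (W j) (W' j)" if "j \<le> k" for j
      using that
    proof (induction j)
      case 0
      then show ?case using He w' by (simp add: W_def W'_def e'_def)
    next
      case (Suc j)
      then have IH: "(f ^^ j) ` H = closed_segment (W j) (e' j)" "(f ^^ j) ` V = closed_segment (W j) (W' j)" and jk: "j < k" by auto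
      have nc: "open_segment (W j) (e' j) \<inter> Crit = {}" by (rule nocrit[OF IH(1) jk])
      have "W' j \<in> closed_segment (W j) (e' j)" using IH V(2) by (metis ends_in_segment(2) image_mono subsetD)
      then have "open_segment (W j) (W' j) \<subseteq> open_segment (W j) (e' j)"
        by (auto simp: closed_segment_eq_real_ivl open_segment_eq_real_ivl split: if_splits)
      then have nc': "open_segment (W j) (W' j) \<inter> Crit = {}" using nc by blast
      have "f ` (f ^^ j) ` H = closed_segment (f (W j)) (f (e' j))"
        unfolding IH(1) using arc_subset[OF Hj[of j]] IH(1) nc by (intro image_segment) auto
      moreover have "f ` (f ^^ j) ` V = closed_segment (f (W j)) (f (W' j))"
        unfolding IH(2) using arc_subset[OF Vj[of j]] IH(2) nc' by (intro image_segment) auto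
      ultimately show ?case by (simp add: W_def W'_def e'_def image_comp)
    qed
    define g where "g j = width j H" for j
    define h where "h j = width j V" for j
    have gj: "g j = \<bar>e' j - W j\<bar>" "h j = \<bar>W' j - W j\<bar>" if "j \<le> k" for j
      using seg[OF that] by (simp_all add: g_def h_def diameter_segment)
    have gpos: "g j > 0" "h j > 0" "h j \<le> g j" for j
      using arc_diameter_pos[OF Hj[of j]] arc_diameter_pos[OF Vj[of j]] arc_diameter_mono[OF Hj[of j] image_mono[OF V(2)]]
      by (auto simp: g_def h_def)
    define \<sigma> where "\<sigma> j = h j / g j" for j
    have \<sigma>: "0 < \<sigma> j" "\<sigma> j \<le> 1" for j using gpos[of j] by (auto simp: \<sigma>_def)
    define U where "U j = - ln (\<sigma> j)" for j
    have U0: "U j \<ge> 0" for j using \<sigma>[of j] by (simp add: U_def)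
    have st: "c2 * \<sigma> j \<le> \<sigma> (Suc j) \<or> (\<exists>c\<in>Crit. (c - W j) * (e' j - W j) \<le> 0 \<and> \<bar>W j - c\<bar> < g j \<and>
          c2 * \<sigma> j * (\<bar>W j - c\<bar> / g j) ^ P \<le> \<sigma> (Suc j) \<and> c2 * \<sigma> j ^ Suc P \<le> \<sigma> (Suc j))" if j: "j < k" for j
    proof -
      have IH: "(f ^^ j) ` H = closed_segment (W j) (e' j)" "(f ^^ j) ` V = closed_segment (W j) (W' j)" using seg[of j] j by auto
      have 1: "closed_segment (W j) (e' j) \<subseteq> {a..b}" using arc_subset[OF Hj[of j]] IH by simp
      have 2: "open_segment (W j) (e' j) \<inter> Crit = {}" by (rule nocrit[OF IH(1) j])
      have 3: "\<bar>e' j - W j\<bar> < \<rho>" using sm[OF j] s(2) r gj(1)[of j] j by (simp add: g_def)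
      have 4: "W' j \<in> closed_segment (W j) (e' j)" using IH V(2) by (metis ends_in_segment(2) image_mono subsetD)
      have 5: "W' j \<noteq> W j" using gj(2)[of j] gpos(2)[of j] j by auto
      have eqs: "\<bar>W' j - W j\<bar> = h j" "\<bar>e' j - W j\<bar> = g j" using gj[of j] j by auto
      have "\<bar>f (W' j) - f (W j)\<bar> = h (Suc j)" "\<bar>f (e' j) - f (W j)\<bar> = g (Suc j)"
        using gj[of "Suc j"] j by (auto simp: W_def W'_def e'_def)
      then show ?thesis using step[rule_format, of "W j" "e' j" "W' j"] 1 2 3 4 5 unfolding Let_def eqs \<sigma>_def by auto
    qed
    define X where "X = {j. j < k \<and> \<not> c2 * \<sigma> j \<le> \<sigma> (Suc j)}"
    have finX: "finite X" by (simp add: X_def)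
    have "\<forall>j\<in>X. \<exists>c. c \<in> Crit \<and> (c - W j) * (e' j - W j) \<le> 0 \<and> \<bar>W j - c\<bar> < g j \<and>
          c2 * \<sigma> j * (\<bar>W j - c\<bar> / g j) ^ P \<le> \<sigma> (Suc j) \<and> c2 * \<sigma> j ^ Suc P \<le> \<sigma> (Suc j)"
      using st by (auto simp: X_def)
    then obtain cc where cc: "\<And>j. j \<in> X \<Longrightarrow> cc j \<in> Crit" "\<And>j. j \<in> X \<Longrightarrow> (cc j - W j) * (e' j - W j) \<le> 0"
      "\<And>j. j \<in> X \<Longrightarrow> \<bar>W j - cc j\<bar> < g j" "\<And>j. j \<in> X \<Longrightarrow> c2 * \<sigma> j * (\<bar>W j - cc j\<bar> / g j) ^ P \<le> \<sigma> (Suc j)"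
      "\<And>j. j \<in> X \<Longrightarrow> c2 * \<sigma> j ^ Suc P \<le> \<sigma> (Suc j)" by metis
    define d where "d j = \<bar>W j - cc j\<bar>" for j
    define \<tau> where "\<tau> j = (cc j, W j < e' j)" for j
    define Ty where "Ty = Crit \<times> (UNIV :: bool set)"
    have Ty: "finite Ty" "card Ty = nT" using finite_Crit by (auto simp: Ty_def nT_def card_cartesian_product)
    define Xt where "Xt t = {j \<in> X. \<tau> j = t}" for t
    \<comment> \<open>Time of the gap of type \<open>t\<close> whose edge is nearest to the critical
      point; only this step is exceptional.\<close>
    define js where "js t = (SOME j. j \<in> Xt t \<and> (\<forall>i\<in>Xt t. d j \<le> d i))" for t
    have js: "js t \<in> Xt t" "\<And>i. i \<in> Xt t \<Longrightarrow> d (js t) \<le> d i" if "Xt t \<noteq> {}" for t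
    proof -
      have "finite (Xt t)" using finX by (simp add: Xt_def)
      then have "Min (d ` Xt t) \<in> d ` Xt t" using that by (intro Min_in) auto
      then obtain j where "j \<in> Xt t" "d j = Min (d ` Xt t)" by auto
      then have "j \<in> Xt t \<and> (\<forall>i\<in>Xt t. d j \<le> d i)" using \<open>finite (Xt t)\<close> by simp
      then have "js t \<in> Xt t \<and> (\<forall>i\<in>Xt t. d (js t) \<le> d i)" unfolding js_def by (rule someI)
      then show "js t \<in> Xt t" "\<And>i. i \<in> Xt t \<Longrightarrow> d (js t) \<le> d i" by auto
    qed
    \<comment> \<open>A repeated gap would reach its long image before time
      \<open>k\<close>.\<close>
    have distinct_gaps: "(f ^^ i) ` H \<noteq> (f ^^ j) ` H" if "i < j" "j < k" for i j
    proof
      assume eq: "(f ^^ i) ` H = (f ^^ j) ` H"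
      have "(f ^^ (k - j)) ` (f ^^ i) ` H = (f ^^ (k - j)) ` (f ^^ j) ` H" using eq by simp
      then have "(f ^^ (k - j + i)) ` H = (f ^^ k) ` H" using that by (simp add: iter_add_image[symmetric])
      moreover have "k - j + i < k" using that by simp
      ultimately show False using sm[of "k - j + i"] lg by simp
    qed
    \<comment> \<open>Measured by the distance from \<open>c\<close>, the gaps of one type are the
      intervals from \<open>d\<close> to \<open>d + g\<close>, and distinct gaps do not
      overlap.\<close>
    have disj: "d i + g i \<le> d j \<or> d j + g j \<le> d i" if ij: "i \<in> Xt t" "j \<in> Xt t" "i \<noteq> j" for i j t
    proof -
      have X: "i \<in> X" "j \<in> X" "cc i = cc j" "W i < e' i \<longleftrightarrow> W j < e' j" using ij by (auto simp: Xt_def \<tau>_def)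
      then have k: "i < k" "j < k" by (auto simp: X_def)
      have ne: "(f ^^ i) ` H \<noteq> (f ^^ j) ` H" using distinct_gaps[of i j] distinct_gaps[of j i] k ij(3) by (metis linorder_neqE_nat)
      obtain p q where pq: "gap p q" "(f ^^ i) ` H = {p..q}" using gapj[of i] k by (auto simp: isgap_def)
      obtain p' q' where pq': "gap p' q'" "(f ^^ j) ` H = {p'..q'}" using gapj[of j] k by (auto simp: isgap_def)
      have o: "p < q" "p' < q'" using pq pq' by (auto simp: gap_def)
      have "\<not> max p p' < min q q'" using gap_unique[OF pq(1) pq'(1)] ne pq pq' by auto
      then have dj: "q \<le> p' \<or> q' \<le> p" using o by (auto simp: max_def min_def split: if_splits)
      have e1: "{p..q} = closed_segment (W i) (e' i)" "{p'..q'} = closed_segment (W j) (e' j)"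
        using seg[of i] seg[of j] k pq pq' by auto
      have gg: "g i = \<bar>e' i - W i\<bar>" "g j = \<bar>e' j - W j\<bar>" using gj k by auto
      show ?thesis
      proof (cases "W i < e' i")
        case True
        then have "p = W i" "q = e' i" "p' = W j" "q' = e' j" using e1 X(4) o by (auto simp: closed_segment_eq_real_ivl Icc_eq_Icc)
        moreover have "cc i \<le> W i" "cc i \<le> W j" using cc(2)[OF X(1)] cc(2)[OF X(2)] True X(3,4) by (auto simp: mult_le_0_iff)
        ultimately show ?thesis using dj X(3,4) True gg unfolding d_def by auto
      next
        case False
        then have F: "e' i < W i" "e' j < W j" using X(4) gg gpos(1)[of i] gpos(1)[of j] by auto
        then have "q = W i" "p = e' i" "q' = W j" "p' = e' j" using e1 o by (auto simp: closed_segment_eq_real_ivl Icc_eq_Icc)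
        moreover have "W i \<le> cc i" "W j \<le> cc i" using cc(2)[OF X(1)] cc(2)[OF X(2)] F X(3) by (auto simp: mult_le_0_iff)
        ultimately show ?thesis using dj X(3) F gg unfolding d_def by auto
      qed
    qed
    define star where "star j \<longleftrightarrow> j \<in> X \<and> j = js (\<tau> j)" for j
    \<comment> \<open>The other gaps of the type lie beyond the nearest one, hence at least its
      length away from \<open>c\<close>.\<close>
    have dlow: "g (js t) \<le> d j" "d j > 0" if "j \<in> Xt t" "\<not> star j" for j t
    proof -
      have ne: "Xt t \<noteq> {}" using that by blast
      have "j \<noteq> js t" using that by (auto simp: star_def Xt_def)
      then have "d j + g j \<le> d (js t) \<or> d (js t) + g (js t) \<le> d j" using disj[OF that(1) js(1)[OF ne]] by blast
      moreover have "d (js t) \<le> d j" using js(2)[OF ne that(1)] .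
      moreover have "0 \<le> d (js t)" by (simp add: d_def)
      ultimately show "g (js t) \<le> d j" "d j > 0" using gpos(1)[of j] gpos(1)[of "js t"] by linarith+
    qed
    define B where "B j = b0 + (if j \<in> X \<and> \<not> star j then real P * ln (g j / d j) else 0)" for j
    have Bge: "B j \<ge> 0" for j
    proof (cases "j \<in> X \<and> \<not> star j")
      case True
      then have "j \<in> Xt (\<tau> j)" by (simp add: Xt_def)
      then have "d j > 0" using dlow True by blast
      moreover have "d j < g j" using cc(3) True by (simp add: d_def)
      ultimately have "ln (g j / d j) \<ge> 0" by simp
      then show ?thesis using b0 by (simp add: B_def)
    qed (use b0 in \<open>auto simp: B_def\<close>)
    have lnc2: "ln (c2 * x) = ln x - b0" if "x > 0" for x using that \<rho> by (simp add: ln_mult b0_def)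
    have ustep: "U (Suc j) \<le> U j + B j" if "j < k" "\<not> star j" for j
    proof (cases "j \<in> X")
      case False
      then have "c2 * \<sigma> j \<le> \<sigma> (Suc j)" using that by (simp add: X_def)
      then have "ln (c2 * \<sigma> j) \<le> ln (\<sigma> (Suc j))" using \<sigma> \<rho> by (intro ln_mono) auto
      then show ?thesis using lnc2[OF \<sigma>(1)] False by (simp add: U_def B_def)
    next
      case True
      then have "j \<in> Xt (\<tau> j)" by (simp add: Xt_def)
      then have d: "d j > 0" using dlow that by blast
      have q: "(d j / g j) ^ P > 0" using d gpos by simp
      have "c2 * (\<sigma> j * (d j / g j) ^ P) \<le> \<sigma> (Suc j)" using cc(4)[OF True] by (simp add: d_def mult.assoc)
      then have "ln (c2 * (\<sigma> j * (d j / g j) ^ P)) \<le> ln (\<sigma> (Suc j))" using \<sigma> \<rho> q by (intro ln_mono) auto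
      moreover have "ln (c2 * (\<sigma> j * (d j / g j) ^ P)) = ln (\<sigma> j) + real P * ln (d j / g j) - b0"
        using lnc2[of "\<sigma> j * (d j / g j) ^ P"] \<sigma>[of j] q d gpos(1)[of j] by (simp add: ln_mult ln_realpow)
      moreover have "ln (d j / g j) = - ln (g j / d j)" using d gpos(1)[of j] by (simp add: ln_div)
      ultimately show ?thesis using True that by (simp add: U_def B_def)
    qed
    have ustar: "U (Suc j) \<le> (real P + 1) * U j + B j" if "star j" for j
    proof -
      have jX: "j \<in> X" using that by (simp add: star_def)
      have "ln (c2 * \<sigma> j ^ Suc P) \<le> ln (\<sigma> (Suc j))" using cc(5)[OF jX] \<sigma>[of j] \<rho> by (intro ln_mono) auto
      moreover have "ln (c2 * \<sigma> j ^ Suc P) = real (Suc P) * ln (\<sigma> j) - b0"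
        using lnc2[of "\<sigma> j ^ Suc P"] \<sigma>[of j] by (simp only: ln_realpow zero_less_power)
      ultimately show ?thesis using that by (simp add: U_def B_def algebra_simps)
    qed
    have tot: "U n \<le> (real P + 1) ^ card {j. j < n \<and> star j} * (U 0 + (\<Sum>j<n. B j))" if "n \<le> k" for n
      using that
    proof (induction n)
      case (Suc n)
      define m where "m = card {j. j < n \<and> star j}"
      define Z where "Z = U 0 + (\<Sum>j<n. B j)"
      have IH: "U n \<le> (real P + 1) ^ m * Z" using Suc by (simp add: m_def Z_def)
      have Z1: "U 0 + (\<Sum>j<Suc n. B j) = Z + B n" by (simp add: Z_def)
      show ?case
      proof (cases "star n")
        case True
        have "{j. j < Suc n \<and> star j} = insert n {j. j < n \<and> star j}" using True by (auto simp: less_Suc_eq)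
        then have c: "card {j. j < Suc n \<and> star j} = Suc m" by (simp add: m_def)
        have "U (Suc n) \<le> (real P + 1) * U n + B n" by (rule ustar[OF True])
        also have "\<dots> \<le> (real P + 1) * ((real P + 1) ^ m * Z) + (real P + 1) ^ Suc m * B n"
        proof (intro add_mono mult_left_mono IH)
          have "1 * B n \<le> (real P + 1) ^ Suc m * B n" by (intro mult_right_mono one_le_power Bge) auto
          then show "B n \<le> (real P + 1) ^ Suc m * B n" by simp
        qed simp
        also have "\<dots> = (real P + 1) ^ Suc m * (Z + B n)" by (simp add: algebra_simps)
        finally show ?thesis unfolding c Z1 .
      next
        case False
        have "{j. j < Suc n \<and> star j} = {j. j < n \<and> star j}" using False by (auto simp: less_Suc_eq)
        then have c: "card {j. j < Suc n \<and> star j} = m" by (simp add: m_def)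
        have "U (Suc n) \<le> U n + B n" using ustep Suc.prems False by simp
        also have "\<dots> \<le> (real P + 1) ^ m * Z + (real P + 1) ^ m * B n"
        proof (intro add_mono IH)
          have "1 * B n \<le> (real P + 1) ^ m * B n" by (intro mult_right_mono one_le_power Bge) auto
          then show "B n \<le> (real P + 1) ^ m * B n" by simp
        qed
        also have "\<dots> = (real P + 1) ^ m * (Z + B n)" by (simp add: algebra_simps)
        finally show ?thesis unfolding c Z1 .
      qed
    qed simp
    have "card {j. j < k \<and> star j} \<le> card Ty"
    proof (rule card_inj_on_le)
      show "inj_on \<tau> {j. j < k \<and> star j}" by (intro inj_onI) (auto simp: star_def)
      show "\<tau> ` {j. j < k \<and> star j} \<subseteq> Ty" using cc(1) by (auto simp: star_def \<tau>_def Ty_def)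
    qed (rule Ty(1))
    then have cT: "(real P + 1) ^ card {j. j < k \<and> star j} \<le> L"
      unfolding L_def Ty(2) by (intro power_increasing) auto
    \<comment> \<open>A gap that reaches length \<open>r / 2\<close> at time \<open>k\<close> cannot
      be shorter than \<open>r / (2 * M ^ k)\<close> before.\<close>
    have glow: "ln r - ln (g j) \<le> ln 2 + real k * ln M" if "j < k" for j
    proof -
      have "r / 2 \<le> g k" using lg by (simp add: g_def)
      also have "g k \<le> M ^ (k - j) * g j"
        using diameter_iter_le[OF Hj[of j], of "k - j"] that by (simp add: g_def iter_add_image[symmetric])
      also have "\<dots> \<le> M ^ k * g j" using M_ge_1 gpos(1)[of j] by (intro mult_right_mono power_increasing) auto
      finally have "ln (r / 2) \<le> ln (M ^ k * g j)" using r by (intro ln_mono) auto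
      also have "\<dots> = real k * ln M + ln (g j)" using M_ge_1 gpos(1)[of j] by (simp add: ln_mult ln_realpow)
      finally show ?thesis using r by (simp add: ln_div)
    qed
    \<comment> \<open>\<open>g / d\<close> is at most \<open>(d + g) / d\<close>, and the intervals
      from \<open>d\<close> to \<open>d + g\<close> lie between \<open>g (js t)\<close> and
      \<open>r\<close>, since \<open>d < g < r / 2\<close>.\<close>
    have tsum: "(\<Sum>j\<in>{j \<in> Xt t. \<not> star j}. ln (g j / d j)) \<le> ln 2 + real k * ln M" for t
    proof (cases "Xt t = {}")
      case True
      then show ?thesis using lnM by simp
    next
      case False
      define S where "S = {j \<in> Xt t. \<not> star j}"
      have jt: "js t \<in> Xt t" "js t < k" "js t \<in> X" using js(1)[OF False] by (auto simp: Xt_def X_def)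
      have SX: "j \<in> Xt t" "j < k" "j \<in> X" "\<not> star j" if "j \<in> S" for j using that by (auto simp: S_def Xt_def X_def)
      have "(\<Sum>j\<in>S. ln (g j / d j)) \<le> (\<Sum>j\<in>S. ln (d j + g j) - ln (d j))"
      proof (rule sum_mono)
        fix j assume j: "j \<in> S"
        have "d j > 0" using dlow SX[OF j] by blast
        then have "ln (g j / d j) = ln (g j) - ln (d j)" using gpos(1)[of j] by (simp add: ln_div)
        also have "\<dots> \<le> ln (d j + g j) - ln (d j)" using \<open>d j > 0\<close> gpos(1)[of j] by simp
        finally show "ln (g j / d j) \<le> ln (d j + g j) - ln (d j)" .
      qed
      also have "\<dots> \<le> ln r - ln (g (js t))"
      proof (rule sum_ln_disjoint_le)
        show "finite S" using finX by (simp add: S_def Xt_def)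
        show "0 < g (js t)" by (rule gpos)
        show "g (js t) \<le> r" using sm[OF jt(2)] r by (simp add: g_def)
        show "g (js t) \<le> d j \<and> d j < d j + g j \<and> d j + g j \<le> r" if "j \<in> S" for j
        proof -
          have "d j < g j" using cc(3)[OF SX(3)[OF that]] by (simp add: d_def)
          then show ?thesis using dlow(1)[OF SX(1,4)[OF that]] gpos(1)[of j] sm[OF SX(2)[OF that]] by (simp add: g_def)
        qed
        show "d i + g i \<le> d j \<or> d j + g j \<le> d i" if "i \<in> S" "j \<in> S" "i \<noteq> j" for i j
          using disj[OF SX(1)[OF that(1)] SX(1)[OF that(2)] that(3)] .
      qed
      also have "\<dots> \<le> ln 2 + real k * ln M" by (rule glow[OF jt(2)])
      finally show ?thesis by (simp add: S_def)
    qed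
    have "(\<Sum>j<k. B j) = real k * b0 + (\<Sum>j<k. if j \<in> X \<and> \<not> star j then real P * ln (g j / d j) else 0)"
      by (simp add: B_def sum.distrib)
    also have "(\<Sum>j<k. if j \<in> X \<and> \<not> star j then real P * ln (g j / d j) else 0) = (\<Sum>j\<in>{j \<in> X. \<not> star j}. real P * ln (g j / d j))"
      by (intro sum.mono_neutral_cong_right) (auto simp: X_def)
    also have "\<dots> = (\<Sum>t\<in>Ty. \<Sum>j\<in>{j \<in> {j \<in> X. \<not> star j}. \<tau> j = t}. real P * ln (g j / d j))"
      by (rule sum.group[symmetric]) (use finX Ty(1) cc(1) in \<open>auto simp: \<tau>_def Ty_def\<close>)
    also have "\<dots> = (\<Sum>t\<in>Ty. real P * (\<Sum>j\<in>{j \<in> Xt t. \<not> star j}. ln (g j / d j)))"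
      by (intro sum.cong refl) (auto simp: Xt_def sum_distrib_left intro!: sum.cong)
    also have "\<dots> \<le> (\<Sum>t\<in>Ty. real P * (ln 2 + real k * ln M))"
      by (intro sum_mono mult_left_mono tsum) auto
    also have "\<dots> = real nT * (real P * (ln 2 + real k * ln M))" by (simp add: Ty)
    finally have "(\<Sum>j<k. B j) \<le> real k * b0 + real nT * (real P * (ln 2 + real k * ln M))" by simp
    also have "\<dots> \<le> Q * (real k + 1)"
    proof -
      have "Q * (real k + 1) = real k * b0 + b0 + real nT * (real P * ((ln 2 + ln M) * (real k + 1)))"
        by (simp add: Q_def algebra_simps)
      moreover have "ln 2 + real k * ln M \<le> (ln 2 + ln M) * (real k + 1)" using lnM by (simp add: algebra_simps)
      then have "real nT * (real P * (ln 2 + real k * ln M)) \<le> real nT * (real P * ((ln 2 + ln M) * (real k + 1)))"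
        by (intro mult_left_mono) auto
      ultimately show ?thesis using b0 by linarith
    qed
    finally have sumB: "(\<Sum>j<k. B j) \<le> Q * (real k + 1)" .
    have "U k \<le> (real P + 1) ^ card {j. j < k \<and> star j} * (U 0 + (\<Sum>j<k. B j))" using tot by simp
    also have "\<dots> \<le> L * (U 0 + Q * (real k + 1))"
      using cT sumB U0[of 0] Bge by (intro mult_mono add_left_mono add_nonneg_nonneg sum_nonneg) (auto simp: L_def)
    finally have "U k \<le> L * (U 0 + Q * (real k + 1))" .
    moreover have "U j = ln (g j / h j)" for j using gpos[of j] by (simp add: U_def \<sigma>_def ln_div)
    ultimately show ?thesis by (simp add: g_def h_def)
  qed
  moreover have "L \<ge> 1" "Q \<ge> 0" using b0 lnM by (auto simp: L_def Q_def)
  ultimately show ?thesis using \<rho>(1) by (intro exI[of _ \<rho>] conjI exI[of _ L] exI[of _ Q]) blast+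
qed

end

section \<open>Decay of arcs and of pull-backs\<close>

context expanding_julia begin

text \<open>Along the cycle the derivative grows at the rate \<open>\<nu>\<close>, and distortion
  takes half of it. \<open>diameter_iter_power\<close> carries the bound back over the
  \<open>i\<close> steps before the cycle, which divides the rate; the constants depend on
  \<open>q\<close>.\<close>

lemma preper_decay:
  "\<exists>r1>0. \<forall>q. q \<in> J \<and> preper q \<longrightarrow> (\<exists>\<beta>>0. \<exists>K\<ge>1. \<forall>V m. arc V \<and> q \<in> V \<and> (\<forall>j<m. width j V < r1) \<longrightarrow>
     diameter V \<le> K * exp (- \<beta> * real m))"
proof -
  obtain r1 K where r1: "r1 > 0" "K \<ge> 1" and tp: "\<forall>A N p. arc A \<and> p \<in> A \<and> A \<inter> J \<noteq> {} \<and> (\<forall>j<N. width j A < r1) \<longrightarrow>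
     diameter A * Df N p \<le> K * exp (\<nu> / 2 * real N) * width N A"
    using telescope_point[OF half_gt_zero[OF \<nu>_pos]] by (elim exE conjE) (rule that)
  have "\<exists>\<beta>>0. \<exists>K\<ge>1. \<forall>V m. arc V \<and> q \<in> V \<and> (\<forall>j<m. width j V < r1) \<longrightarrow>
     diameter V \<le> K * exp (- \<beta> * real m)" if q: "q \<in> J" "preper q" for q
  proof -
    obtain i P where iP: "P \<ge> 1" "(f ^^ P) ((f ^^ i) q) = (f ^^ i) q" using preper_cycle[OF q(2)] by blast
    define p where "p = (f ^^ i) q"
    have p: "p \<in> J" "(f ^^ P) p = p" using q J_iter iP by (auto simp: p_def)
    obtain k s where k: "k > 0" and pw: "\<forall>A. arc A \<longrightarrow> k * diameter A ^ s \<le> width i A"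
      using diameter_iter_power[of i] by (elim exE conjE) (rule that)
    define D where "D = b - a"
    have D: "D > 0" using ab by (simp add: D_def)
    define \<beta> where "\<beta> = \<nu> / 2 / real (Suc s)"
    define K' where "K' = max 1 (K * D * D / k * exp (\<nu> / 2 * (real i + real P)))"
    have "diameter V \<le> K' * exp (- \<beta> * real m)" if V: "arc V" "q \<in> V" and sm: "\<And>j. j < m \<Longrightarrow> width j V < r1" for V m
    proof -
      define A where "A = (f ^^ i) ` V"
      \<comment> \<open>Complete periods left after \<open>i\<close> steps; truncated subtraction
        makes this 0 if \<open>m < i\<close>.\<close>
      define n where "n = (m - i) div P"
      have A: "arc A" "p \<in> A" using iter_arc[OF V(1)] V(2) by (auto simp: A_def p_def)
      have nP: "n * P \<le> m - i" by (simp add: n_def)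
      have "width j A < r1" if "j < n * P" for j
      proof -
        have "j + i < m" using that nP by linarith
        then show ?thesis using sm[of "j + i"] by (simp add: A_def iter_add_image)
      qed
      then have "diameter A * Df (n * P) p \<le> K * exp (\<nu> / 2 * real (n * P)) * width (n * P) A"
        using tp A p by blast
      also have "\<dots> \<le> K * exp (\<nu> / 2 * real (n * P)) * D"
        using r1 by (intro mult_left_mono arc_diameter_le[OF iter_arc[OF A(1)], folded D_def]) auto
      finally have "diameter A * Df (n * P) p \<le> K * exp (\<nu> / 2 * real (n * P)) * D" .
      moreover have "diameter A * exp (\<nu> * real (n * P)) \<le> diameter A * Df (n * P) p"
        using arc_diameter_pos[OF A(1)] by (intro mult_left_mono cycle_growth[OF p(1) iP(1) p(2)]) auto
      moreover have "exp (\<nu> * real (n * P)) = exp (\<nu> / 2 * real (n * P)) * exp (\<nu> / 2 * real (n * P))"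
        by (simp add: exp_add[symmetric])
      moreover define y where "y = exp (\<nu> / 2 * real (n * P))"
      ultimately have "(diameter A * y) * y \<le> (K * D) * y" by (simp only: mult_ac)
      moreover have "y > 0" by (simp add: y_def)
      ultimately have dA: "diameter A * exp (\<nu> / 2 * real (n * P)) \<le> K * D" by (simp only: y_def mult_le_cancel_right_pos)
      have "m < n * P + P + i"
      proof -
        have "m - i < n * P + P" unfolding n_def using iP(1) by (metis add.commute div_mult_mod_eq mod_less_divisor nat_add_left_cancel_less less_le_trans zero_less_one)
        then show ?thesis by linarith
      qed
      then have "real m \<le> real (n * P) + real P + real i" by linarith
      then have "\<nu> / 2 * real m \<le> \<nu> / 2 * (real (n * P) + real P + real i)" using \<nu>_pos by (intro mult_left_mono) auto
      then have "exp (\<nu> / 2 * real m) \<le> exp (\<nu> / 2 * real (n * P)) * exp (\<nu> / 2 * (real i + real P))"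
        unfolding exp_add[symmetric] exp_le_cancel_iff by (simp only: distrib_left add_ac)
      then have "diameter A * exp (\<nu> / 2 * real m) \<le> diameter A * (exp (\<nu> / 2 * real (n * P)) * exp (\<nu> / 2 * (real i + real P)))"
        using arc_diameter_pos[OF A(1)] by (intro mult_left_mono) auto
      also have "\<dots> \<le> (K * D) * exp (\<nu> / 2 * (real i + real P))"
        using mult_right_mono[OF dA, of "exp (\<nu> / 2 * (real i + real P))"] by (simp add: mult_ac)
      finally have dA': "diameter A * exp (\<nu> / 2 * real m) \<le> (K * D) * exp (\<nu> / 2 * (real i + real P))" .
      have dV: "0 < diameter V" "diameter V \<le> D" using arc_diameter_pos[OF V(1)] arc_diameter_le[OF V(1)] by (auto simp: D_def)
      \<comment> \<open>One more factor than the power bound has, so that a root can be taken even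
        if \<open>s = 0\<close>.\<close>
      have "k * diameter V ^ Suc s = (k * diameter V ^ s) * diameter V" by simp
      also have "\<dots> \<le> diameter A * D" using pw V(1) dV arc_diameter_pos[OF A(1)] by (intro mult_mono) (auto simp: A_def)
      finally have "k * diameter V ^ Suc s \<le> diameter A * D" .
      then have "k * diameter V ^ Suc s * exp (\<nu> / 2 * real m) \<le> diameter A * D * exp (\<nu> / 2 * real m)" by (intro mult_right_mono) auto
      also have "\<dots> \<le> K * D * exp (\<nu> / 2 * (real i + real P)) * D" using mult_right_mono[OF dA', of D] D by (simp add: mult_ac)
      finally have "diameter V ^ Suc s * exp (\<nu> / 2 * real m) \<le> K * D * D / k * exp (\<nu> / 2 * (real i + real P))"
        using k by (simp add: field_simps)
      also have "\<dots> \<le> K'" by (simp add: K'_def)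
      also have "K' \<le> K' ^ Suc s" by (rule self_le_power) (auto simp: K'_def)
      finally have "diameter V ^ Suc s \<le> K' ^ Suc s * exp (- (\<nu> / 2 * real m))" by (simp add: exp_minus field_simps)
      also have "exp (- (\<nu> / 2 * real m)) = exp (- \<beta> * real m) ^ Suc s"
        unfolding exp_of_nat_mult[symmetric] by (simp add: \<beta>_def field_simps)
      finally have "diameter V ^ Suc s \<le> (K' * exp (- \<beta> * real m)) ^ Suc s" by (simp only: power_mult_distrib)
      then show ?thesis by (rule power_le_imp_le_base) (simp add: K'_def)
    qed
    moreover have "\<beta> > 0" "K' \<ge> 1" using \<nu>_pos by (auto simp: \<beta>_def K'_def)
    ultimately show ?thesis by blast
  qed
  then show ?thesis using r1(1) by blast
qed

text \<open>Long gaps have finitely many edges, all of them in \<open>J\<close> being preperiodic.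
  With \<open>\<beta>\<close> both as rate and as inverse constant the bound weakens as
  \<open>\<beta>\<close> decreases, so a common value exists.\<close>

lemma edge_decay:
  "\<exists>r1>0. \<forall>\<rho>>0. \<exists>\<beta>>0. \<forall>q G V m. isgap G \<and> \<rho> \<le> diameter G \<and> q \<in> G \<and> q \<in> J \<and> arc V \<and> q \<in> V \<and>
     (\<forall>j<m. width j V < r1) \<longrightarrow> diameter V \<le> exp (- \<beta> * real m) / \<beta>"
proof -
  obtain r1 where r1: "r1 > 0" and pd: "\<forall>q. q \<in> J \<and> preper q \<longrightarrow> (\<exists>\<beta>>0. \<exists>K\<ge>1. \<forall>V m. arc V \<and> q \<in> V \<and> (\<forall>j<m. width j V < r1) \<longrightarrow>
     diameter V \<le> K * exp (- \<beta> * real m))"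
    using preper_decay by (elim exE conjE) (rule that)
  have "\<exists>\<beta>>0. \<forall>q G V m. isgap G \<and> \<rho> \<le> diameter G \<and> q \<in> G \<and> q \<in> J \<and> arc V \<and> q \<in> V \<and>
     (\<forall>j<m. width j V < r1) \<longrightarrow> diameter V \<le> exp (- \<beta> * real m) / \<beta>" if \<rho>: "\<rho> > 0" for \<rho>
  proof -
    define S where "S = {q \<in> J. \<exists>G. isgap G \<and> \<rho> \<le> diameter G \<and> q \<in> G}"
    have "S \<subseteq> fst ` {(u, v). gap u v \<and> \<rho> \<le> v - u} \<union> snd ` {(u, v). gap u v \<and> \<rho> \<le> v - u}"
    proof
      fix q assume "q \<in> S"
      then obtain u v where uv: "q \<in> J" "gap u v" "\<rho> \<le> diameter {u..v}" "q \<in> {u..v}" by (auto simp: S_def isgap_def)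
      then have "u < v" by (simp add: gap_def)
      moreover have "q = u \<or> q = v" using free_J_endpoint[OF gap_free[OF uv(2)] uv(1)] uv(4) by blast
      ultimately show "q \<in> fst ` {(u, v). gap u v \<and> \<rho> \<le> v - u} \<union> snd ` {(u, v). gap u v \<and> \<rho> \<le> v - u}"
        using uv by force
    qed
    then have fin: "finite S" using finite_gaps[OF \<rho>] by (meson finite_Un finite_imageI finite_subset)
    define Pr where "Pr q \<beta> \<longleftrightarrow> (\<forall>V m. arc V \<and> q \<in> V \<and> (\<forall>j<m. width j V < r1) \<longrightarrow>
       diameter V \<le> exp (- \<beta> * real m) / \<beta>)" for q \<beta>
    have "\<exists>\<beta>0>0. \<forall>\<beta>. 0 < \<beta> \<and> \<beta> \<le> \<beta>0 \<longrightarrow> Pr q \<beta>" if "q \<in> S" for q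
    proof -
      have "q \<in> J" using that by (simp add: S_def)
      moreover have "preper q" using that preper_edge isgap_free by (auto simp: S_def)
      ultimately obtain \<beta>1 K where b1: "\<beta>1 > 0" "K \<ge> 1" and d: "\<forall>V m. arc V \<and> q \<in> V \<and> (\<forall>j<m. width j V < r1) \<longrightarrow>
         diameter V \<le> K * exp (- \<beta>1 * real m)" using pd by blast
      have "Pr q \<beta>" if \<beta>: "0 < \<beta>" "\<beta> \<le> min \<beta>1 (1 / K)" for \<beta>
        unfolding Pr_def
      proof (intro allI impI)
        fix V m assume "arc V \<and> q \<in> V \<and> (\<forall>j<m. width j V < r1)"
        then have "diameter V \<le> K * exp (- \<beta>1 * real m)" using d by blast
        also have "\<dots> \<le> (1 / \<beta>) * exp (- \<beta> * real m)"
        proof (rule mult_mono)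
          show "K \<le> 1 / \<beta>" using \<beta> b1 by (simp add: field_simps)
          show "exp (- \<beta>1 * real m) \<le> exp (- \<beta> * real m)" using \<beta> by (simp add: mult_right_mono)
        qed (use \<beta> in auto)
        finally show "diameter V \<le> exp (- \<beta> * real m) / \<beta>" by simp
      qed
      then show ?thesis using b1 by (intro exI[of _ "min \<beta>1 (1 / K)"]) auto
    qed
    then obtain \<beta>0 where "\<beta>0 > 0" "\<forall>q\<in>S. \<forall>\<beta>. 0 < \<beta> \<and> \<beta> \<le> \<beta>0 \<longrightarrow> Pr q \<beta>"
      using finite_uniform_small[OF fin, of Pr] by blast
    then have b0: "\<beta>0 > 0" "\<And>q. q \<in> S \<Longrightarrow> Pr q \<beta>0" by auto
    show ?thesis
    proof (intro exI[of _ \<beta>0] conjI b0(1) allI impI)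
      fix q G V m assume h: "isgap G \<and> \<rho> \<le> diameter G \<and> q \<in> G \<and> q \<in> J \<and> arc V \<and> q \<in> V \<and>
        (\<forall>j<m. width j V < r1)"
      then have "q \<in> S" by (auto simp: S_def)
      then show "diameter V \<le> exp (- \<beta>0 * real m) / \<beta>0" using b0(2) h unfolding Pr_def by blast
    qed
  qed
  then show ?thesis using r1 by blast
qed

text \<open>Let the gap around \<open>V\<close> first reach length \<open>r / 2\<close> at time
  \<open>k\<close>. If \<open>k\<close> is a definite fraction of \<open>N\<close>, the gap itself
  is exponentially small. Otherwise the image of \<open>V\<close> sits at an edge of a long gap and
  stays short for at least \<open>N / 2\<close> more steps. It is then a tiny fraction of that gap,
  and \<open>relative_gap\<close> carries this back to time 0.\<close>

lemma gap_decay: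
  "\<exists>r1>0. \<forall>r. scale r \<and> r \<le> r1 \<longrightarrow> (\<exists>\<alpha>>0. \<exists>K\<ge>1. \<forall>V w N. free V \<and> w \<in> V \<and> w \<in> J \<and> (\<forall>j<N. width j V < r) \<longrightarrow>
     diameter V \<le> K * exp (- \<alpha> * real N))"
proof -
  obtain ra where ra: "ra > 0" and gd: "\<forall>r. scale r \<and> r \<le> ra \<longrightarrow> (\<exists>K. \<forall>H k. isgap H \<and> (\<forall>j<k. width j H < r / 2) \<and>
     r / 2 \<le> width k H \<longrightarrow> diameter H \<le> K * exp (- (\<nu> / 2) * real k))"
    using gap_decay_until_large by (elim exE conjE) (rule that)
  obtain rb where rb: "rb > 0" and ed: "\<forall>\<rho>>0. \<exists>\<beta>>0. \<forall>q G V m. isgap G \<and> \<rho> \<le> diameter G \<and> q \<in> G \<and> q \<in> J \<and> arc V \<and> q \<in> V \<and>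
     (\<forall>j<m. width j V < rb) \<longrightarrow> diameter V \<le> exp (- \<beta> * real m) / \<beta>"
    using edge_decay by (elim exE conjE) (rule that)
  obtain rc L Q where rc: "rc > 0" "L \<ge> 1" "Q \<ge> 0" and rg: "\<forall>r H V w k. scale r \<and> r \<le> rc \<and> isgap H \<and> (\<forall>j<k. width j H < r / 2) \<and>
     r / 2 \<le> width k H \<and> arc V \<and> V \<subseteq> H \<and> w \<in> V \<and> w \<in> J \<longrightarrow>
     ln (width k H / width k V) \<le> L * (ln (diameter H / diameter V) + Q * (real k + 1))"
    using relative_gap by (elim exE conjE) (rule that)
  have "\<exists>\<alpha>>0. \<exists>K\<ge>1. \<forall>V w N. free V \<and> w \<in> V \<and> w \<in> J \<and> (\<forall>j<N. width j V < r) \<longrightarrow>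
     diameter V \<le> K * exp (- \<alpha> * real N)" if s: "scale r" and rr: "r \<le> ra" "r \<le> rb" "r \<le> rc" for r
  proof -
    have r: "r > 0" using scale_facts(1)[OF s] .
    obtain K1 where K1: "\<forall>H k. isgap H \<and> (\<forall>j<k. width j H < r / 2) \<and>
     r / 2 \<le> width k H \<longrightarrow> diameter H \<le> K1 * exp (- (\<nu> / 2) * real k)" using gd s rr by blast
    obtain \<beta> where \<beta>: "\<beta> > 0" and be: "\<forall>q G V m. isgap G \<and> r / 2 \<le> diameter G \<and> q \<in> G \<and> q \<in> J \<and> arc V \<and> q \<in> V \<and>
     (\<forall>j<m. width j V < rb) \<longrightarrow> diameter V \<le> exp (- \<beta> * real m) / \<beta>" using ed half_gt_zero[OF r] by blast
    \<comment> \<open>The bound \<open>1 / 2\<close> leaves at least \<open>N / 2\<close> steps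
      after time \<open>k\<close>. The other one lets the term with \<open>Q\<close> consume at most
      half of the gain \<open>\<beta> / (2 * L)\<close> per step.\<close>
    define \<kappa> where "\<kappa> = min (1 / 2) (\<beta> / (4 * L * (Q + 1)))"
    have \<kappa>: "\<kappa> > 0" "\<kappa> \<le> 1 / 2" using \<beta> rc by (auto simp: \<kappa>_def)
    have Q\<kappa>: "Q * \<kappa> \<le> \<beta> / (4 * L)"
    proof -
      have "Q * \<kappa> \<le> (Q + 1) * (\<beta> / (4 * L * (Q + 1)))" using rc \<beta> \<kappa> by (intro mult_mono) (auto simp: \<kappa>_def)
      also have "\<dots> = \<beta> / (4 * L)" using rc by simp
      finally show ?thesis .
    qed
    define \<alpha> where "\<alpha> = min (\<nu> / 2 * \<kappa>) (\<beta> / (4 * L))"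
    have \<alpha>: "\<alpha> > 0" using \<kappa> \<beta> rc \<nu>_pos by (auto simp: \<alpha>_def)
    define c where "c = Q - (ln (r / 2) + ln \<beta>) / L"
    define K where "K = max 1 (max K1 ((b - a) * exp c))"
    have "diameter V \<le> K * exp (- \<alpha> * real N)" if V: "free V" "w \<in> V" "w \<in> J" and sm: "\<And>j. j < N \<Longrightarrow> width j V < r" for V w N
    proof -
      have aV: "arc V" using V(1) by (rule free_arc)
      obtain u v where uv: "gap u v" "V \<subseteq> {u..v}" using free_in_gap[OF V(1)] by blast
      define H where "H = {u..v}"
      have H: "isgap H" "V \<subseteq> H" using uv by (auto simp: H_def isgap_def)
      note aH = free_arc[OF isgap_free[OF H(1)]]
      obtain i where "r \<le> width i H" using scale_facts(3)[OF s V(3) aH] V(2) H isgap_free by blast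
      then have ex: "r / 2 \<le> width i H" using r by simp
      define k where "k = (LEAST k. r / 2 \<le> width k H)"
      have k: "r / 2 \<le> width k H" unfolding k_def by (rule LeastI[of "\<lambda>k. r / 2 \<le> width k H", OF ex])
      have kl: "width j H < r / 2" if "j < k" for j using not_less_Least[OF that[unfolded k_def]] by simp
      have dV: "diameter V > 0" "diameter V \<le> diameter H" "diameter H \<le> b - a" "diameter H > 0"
        using arc_diameter_pos[OF aV] arc_diameter_mono[OF aH H(2)] arc_diameter_le[OF aH] by auto
      show ?thesis
      proof (cases "\<kappa> * real N \<le> real k")
        case True
        have "diameter H \<le> K1 * exp (- (\<nu> / 2) * real k)" using K1 H(1) k kl by blast
        also have "\<dots> \<le> K * exp (- (\<nu> / 2) * real k)" by (intro mult_right_mono) (auto simp: K_def)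
        also have "\<dots> \<le> K * exp (- \<alpha> * real N)"
        proof -
          have "\<alpha> * real N \<le> (\<nu> / 2 * \<kappa>) * real N" by (intro mult_right_mono) (auto simp: \<alpha>_def)
          also have "\<dots> = \<nu> / 2 * (\<kappa> * real N)" by simp
          also have "\<dots> \<le> \<nu> / 2 * real k" using True \<nu>_pos by (intro mult_left_mono) auto
          finally show ?thesis by (intro mult_left_mono) (auto simp: K_def)
        qed
        finally show ?thesis using dV by linarith
      next
        case False
        have kN: "real k \<le> real N / 2" using False \<kappa> mult_right_mono[OF \<kappa>(2), of "real N"] by simp
        have small: "diameter ((f ^^ j) ` (f ^^ k) ` V) < rb" if "j < N - k" for j
          using sm[of "j + k"] that rr by (force simp: iter_add_image)
        have Gk: "isgap ((f ^^ k) ` H)" 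
        proof (rule small_gap_iter[OF s H(1)])
          show "width j H < r" if "j < k" for j using kl[OF that] r by linarith
        qed
        define h where "h = width k V"
        define g where "g = width k H"
        have hp: "h > 0" using arc_diameter_pos[OF iter_arc[OF aV]] by (simp add: h_def)
        have g: "r / 2 \<le> g" using k by (simp add: g_def)
        have "(f ^^ k) w \<in> (f ^^ k) ` H" "(f ^^ k) w \<in> J" "(f ^^ k) w \<in> (f ^^ k) ` V" using V H J_iter by auto
        then have "h \<le> exp (- \<beta> * real (N - k)) / \<beta>"
          using be Gk k iter_arc[OF aV] small unfolding h_def by blast
        also have "\<dots> \<le> exp (- (\<beta> / 2) * real N) / \<beta>"
        proof -
          have "real N / 2 \<le> real (N - k)" using kN by linarith
          then have "\<beta> * (real N / 2) \<le> \<beta> * real (N - k)" using \<beta> by (intro mult_left_mono) auto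
          then show ?thesis using \<beta> by (intro divide_right_mono) auto
        qed
        finally have "ln h \<le> ln (exp (- (\<beta> / 2) * real N) / \<beta>)" using hp by (intro ln_mono) auto
        also have "\<dots> = - (\<beta> / 2) * real N - ln \<beta>" using \<beta> by (simp add: ln_div)
        finally have lh: "ln h \<le> - (\<beta> / 2) * real N - ln \<beta>" .
        have "ln (r / 2) \<le> ln g" using r g by (intro ln_mono) auto
        then have "ln (r / 2) + ln \<beta> + (\<beta> / 2) * real N \<le> ln g - ln h" using lh by linarith
        also have "\<dots> = ln (g / h)" using hp g r by (simp add: ln_div)
        also have "\<dots> \<le> L * (ln (diameter H / diameter V) + Q * (real k + 1))"
          unfolding g_def h_def using rg s rr(3) H(1) kl k aV H(2) V(2,3) by blast
        finally have 1: "(ln (r / 2) + ln \<beta> + (\<beta> / 2) * real N) / L \<le> ln (diameter H / diameter V) + Q * (real k + 1)"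
          using rc by (simp add: field_simps)
        have 2: "Q * (real k + 1) \<le> Q + \<beta> / (4 * L) * real N"
        proof -
          have "Q * real k \<le> Q * (\<kappa> * real N)" using False rc by (intro mult_left_mono) auto
          also have "\<dots> \<le> \<beta> / (4 * L) * real N" using mult_right_mono[OF Q\<kappa>, of "real N"] by (simp add: mult.assoc)
          finally show ?thesis by (simp add: algebra_simps)
        qed
        have 3: "(ln (r / 2) + ln \<beta> + (\<beta> / 2) * real N) / L = Q - c + 2 * (\<beta> / (4 * L) * real N)"
          using rc by (simp add: c_def field_simps)
        have "\<beta> / (4 * L) * real N - c \<le> ln (diameter H / diameter V)" using 1 2 3 by linarith
        also have "\<dots> = ln (diameter H) - ln (diameter V)" using dV by (simp add: ln_div)
        finally have "ln (diameter V) \<le> ln (diameter H) + c - \<beta> / (4 * L) * real N" by linarith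
        also have "ln (diameter H) \<le> ln (b - a)" using dV by (intro ln_mono) auto
        finally have "exp (ln (diameter V)) \<le> exp (ln (b - a) + c - \<beta> / (4 * L) * real N)" by simp
        also have "\<dots> = (b - a) * exp c * exp (- (\<beta> / (4 * L)) * real N)" using ab by (simp add: exp_add exp_diff exp_minus field_simps)
        also have "\<dots> \<le> K * exp (- \<alpha> * real N)"
        proof (rule mult_mono)
          have "\<alpha> * real N \<le> \<beta> / (4 * L) * real N" by (intro mult_right_mono) (auto simp: \<alpha>_def)
          then show "exp (- (\<beta> / (4 * L)) * real N) \<le> exp (- \<alpha> * real N)" by simp
        qed (auto simp: K_def)
        finally show ?thesis using dV by simp
      qed
    qed
    moreover have "K \<ge> 1" by (simp add: K_def)
    ultimately show ?thesis using \<alpha> by blast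
  qed
  then show ?thesis using ra rb rc(1) by (intro exI[of _ "min ra (min rb rc)"]) auto
qed

end

context interval_map begin

lemma diameter_image_mvt:
  assumes "arc B" shows "\<exists>y\<in>B. diameter (f ` B) \<le> diameter B * \<bar>df y\<bar>"
proof -
  obtain p q where pq: "p < q" "f ` B = {p..q}" using image_arc[OF assms] by (rule arcE)
  obtain u v where uv: "a \<le> u" "v \<le> b" "B = {u..v}" using assms by (rule arcE)
  have *: "\<exists>y\<in>B. diameter (f ` B) \<le> diameter B * \<bar>df y\<bar>"
    if st: "s \<in> B" "t \<in> B" "s < t" "\<bar>f t - f s\<bar> = q - p" for s t
  proof -
    obtain z where z: "z \<in> {s<..<t}" "f t - f s = (t - s) * df z" using mvt_ex[of s t] st uv by auto
    have "t - s \<le> diameter B" using arc_dist_le[OF assms st(2,1)] st(3) by simp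
    then have "(t - s) * \<bar>df z\<bar> \<le> diameter B * \<bar>df z\<bar>" by (intro mult_right_mono) auto
    moreover have "diameter (f ` B) = (t - s) * \<bar>df z\<bar>" using pq st(3,4) z(2) by (simp add: abs_mult)
    moreover have "z \<in> B" using z(1) st uv by auto
    ultimately show ?thesis by auto
  qed
  have "p \<in> f ` B" "q \<in> f ` B" using pq by auto
  then obtain s t where st: "s \<in> B" "t \<in> B" "f s = p" "f t = q" by blast
  then have "s \<noteq> t" using pq(1) by auto
  then show ?thesis using *[of s t] *[of t s] st pq(1) by fastforce
qed

text \<open>Take preimages \<open>s\<close> of \<open>x\<close> and \<open>t\<close> of
  \<open>y\<close> at the least possible distance: a value outside \<open>{x..y}\<close> between
  them would produce a closer pair by the intermediate value theorem.\<close>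

lemma subarc_onto:
  assumes A: "arc A" and xy: "x < y" "{x..y} \<subseteq> (f ^^ n) ` A"
  shows "\<exists>B. arc B \<and> B \<subseteq> A \<and> (f ^^ n) ` B = {x..y}"
proof -
  define g where "g = f ^^ n"
  obtain u v where uv: "a \<le> u" "u < v" "v \<le> b" "A = {u..v}" using A by (rule arcE)
  have cg: "continuous_on A g" using cont_iter arc_subset[OF A] continuous_on_subset unfolding g_def by blast
  define S where "S z = {s \<in> A. g s = z}" for z
  have cS: "compact (S z)" for z
  proof -
    have "closed (A \<inter> g -` {z})" using cg uv by (intro continuous_closed_preimage) auto
    then have "compact (A \<inter> (A \<inter> g -` {z}))" using arc_compact[OF A] by (rule compact_Int_closed[rotated])
    moreover have "A \<inter> (A \<inter> g -` {z}) = S z" by (auto simp: S_def)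
    ultimately show ?thesis by simp
  qed
  have "x \<in> g ` A" "y \<in> g ` A" using xy by (auto simp: g_def)
  then have ne: "S x \<noteq> {}" "S y \<noteq> {}" by (auto simp: S_def)
  obtain s t where st: "s \<in> S x" "t \<in> S y" "dist s t = setdist (S x) (S y)"
    using setdist_compact_closed[OF cS compact_imp_closed[OF cS] ne] by blast
  have min: "\<bar>s - t\<bar> \<le> \<bar>s' - t'\<bar>" if "s' \<in> S x" "t' \<in> S y" for s' t'
    using setdist_le_dist[OF that] st(3) by (simp add: dist_real_def)
  have gst: "g s = x" "g t = y" "s \<in> A" "t \<in> A" using st by (auto simp: S_def)
  then have "s \<noteq> t" using xy by auto
  define B where "B = closed_segment s t"
  have BA: "B \<subseteq> A" using gst uv by (auto simp: B_def closed_segment_eq_real_ivl)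
  have aB: "arc B" using BA \<open>s \<noteq> t\<close> gst uv arcI[of "min s t" "max s t"] by (auto simp: B_def closed_segment_eq_real_ivl min_def max_def)
  have conn: "is_interval (g ` closed_segment p q)" if "closed_segment p q \<subseteq> A" for p q
    using connected_continuous_image[OF continuous_on_subset[OF cg that] connected_segment(1)] is_interval_connected_1 by blast
  have "g z \<in> {x..y}" if z: "z \<in> B" for z
  proof (rule ccontr)
    assume n: "g z \<notin> {x..y}"
    have zz: "z \<noteq> s" "z \<noteq> t" using n gst xy by auto
    have sz: "closed_segment s z \<subseteq> B" "closed_segment z t \<subseteq> B" using z by (auto simp: B_def closed_segment_eq_real_ivl split: if_splits)
    consider "g z > y" | "g z < x" using n by fastforce
    then show False
    proof cases
      case 1
      have "is_interval (g ` closed_segment s z)" using conn sz BA by blast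
      moreover have "x \<in> g ` closed_segment s z" "g z \<in> g ` closed_segment s z" using gst by auto
      ultimately have "y \<in> g ` closed_segment s z" using 1 xy unfolding is_interval_1 by (meson less_imp_le)
      then obtain t' where t': "t' \<in> closed_segment s z" "g t' = y" by auto
      then have "\<bar>s - t\<bar> \<le> \<bar>s - t'\<bar>" using min[of s t'] st(1) sz(1) BA by (auto simp: S_def)
      then show False using t' z zz by (auto simp: B_def closed_segment_eq_real_ivl split: if_splits)
    next
      case 2
      have "is_interval (g ` closed_segment z t)" using conn sz BA by blast
      moreover have "y \<in> g ` closed_segment z t" "g z \<in> g ` closed_segment z t" using gst by auto
      ultimately have "x \<in> g ` closed_segment z t" using 2 xy unfolding is_interval_1 by (meson less_imp_le)
      then obtain s' where s': "s' \<in> closed_segment z t" "g s' = x" by auto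
      then have "\<bar>s - t\<bar> \<le> \<bar>s' - t\<bar>" using min[of s' t] st(2) sz(2) BA by (auto simp: S_def)
      then show False using s' z zz by (auto simp: B_def closed_segment_eq_real_ivl split: if_splits)
    qed
  qed
  moreover have "{x..y} \<subseteq> g ` B"
  proof
    have "is_interval (g ` B)" using conn BA by (simp add: B_def)
    moreover have "x \<in> g ` B" "y \<in> g ` B" using gst by (auto simp: B_def)
    moreover fix z assume "z \<in> {x..y}"
    ultimately show "z \<in> g ` B" unfolding is_interval_1 by (meson atLeastAtMost_iff)
  qed
  ultimately have "g ` B = {x..y}" by blast
  then show ?thesis using aB BA unfolding g_def by blast
qed

end

context expanding_julia begin

text \<open>At the first time \<open>N\<close> of large size the image either covers
  \<open>J\<close> after a bounded time, where \<open>closing_bound\<close> applies, or contains a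
  long piece at an edge inside a gap. In the latter case the part of \<open>A\<close> mapped onto
  that piece is bounded by \<open>gap_decay\<close>, and distortion compares \<open>A\<close> with
  it.\<close>

lemma arc_decay:
  "\<exists>r1>0. \<forall>r. scale r \<and> r \<le> r1 \<longrightarrow> (\<exists>\<theta>>0. \<exists>K\<ge>1. \<forall>A n. arc A \<and> \<not> free A \<and> (\<forall>j<n. width j A < r) \<longrightarrow>
     diameter A \<le> K * exp (- \<theta> * real n))"
proof -
  obtain rg where rg: "rg > 0" and gd: "\<forall>r. scale r \<and> r \<le> rg \<longrightarrow> (\<exists>\<alpha>>0. \<exists>K\<ge>1. \<forall>V w N. free V \<and> w \<in> V \<and> w \<in> J \<and> (\<forall>j<N. width j V < r) \<longrightarrow>
     diameter V \<le> K * exp (- \<alpha> * real N))"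
    using gap_decay by (elim exE conjE) (rule that)
  obtain rs where rs: "rs > 0" "\<forall>r. 0 < r \<and> r \<le> rs \<longrightarrow> scale r" using scale_ex by blast
  \<comment> \<open>The rate \<open>\<alpha>\<close> must be known before distortion is made as
    small as \<open>\<alpha> / 2\<close>, so \<open>gap_decay\<close> is applied at an auxiliary
    scale.\<close>
  define r' where "r' = min rg rs"
  have "scale r'" "r' \<le> rg" "r' > 0" using rg rs by (auto simp: r'_def)
  then obtain \<alpha> Kg where \<alpha>: "\<alpha> > 0" "Kg \<ge> 1" and gd': "\<forall>V w N. free V \<and> w \<in> V \<and> w \<in> J \<and> (\<forall>j<N. width j V < r') \<longrightarrow>
     diameter V \<le> Kg * exp (- \<alpha> * real N)" using gd by blast
  obtain rt Kt where rt: "rt > 0" "Kt \<ge> 1" and ts: "\<forall>A N w. arc A \<and> A \<inter> J \<noteq> {} \<and> w 0 \<ge> 0 \<and>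
     (\<forall>j<N. width j A < rt \<and> (\<exists>y\<in>(f ^^ j) ` A. w (Suc j) \<le> w j * \<bar>df y\<bar>)) \<longrightarrow>
     diameter A * w N \<le> Kt * exp (\<alpha> / 2 * real N) * width N A * w 0"
    using telescope_small[OF half_gt_zero[OF \<alpha>(1)]] by (elim exE conjE) (rule that)
  obtain rc Kc where rc: "rc > 0" "Kc \<ge> 1" and cb: "\<forall>A k m. arc A \<and> m \<ge> 1 \<and> (\<forall>j<k. width j A < rc) \<and> J \<subseteq> (f ^^ (k + m)) ` A \<longrightarrow>
     diameter A \<le> Kc * M ^ m * exp ((\<nu> / 2 - \<nu>) * real k)"
    using closing_bound[OF half_gt_zero[OF \<nu>_pos]] by (elim exE conjE) (rule that)
  define D where "D = b - a"
  have D: "D > 0" using ab by (simp add: D_def)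
  have "\<exists>\<theta>>0. \<exists>K\<ge>1. \<forall>A n. arc A \<and> \<not> free A \<and> (\<forall>j<n. width j A < r) \<longrightarrow>
     diameter A \<le> K * exp (- \<theta> * real n)" if s: "scale r" and rr: "r \<le> r'" "r \<le> rt" "r \<le> rc" for r
  proof -
    have r: "r > 0" using scale_facts(1)[OF s] .
    have \<eta>: "0 < r / 8" "r / 8 \<le> r / 8" using r by auto
    obtain m0 where m0: "\<forall>A. \<forall>z\<in>A \<inter> J. arc A \<and> r \<le> diameter A \<longrightarrow> (\<forall>n\<ge>m0. J \<subseteq> (f ^^ n) ` A) \<or>
      (\<exists>x y. gap x y \<and> A \<subseteq> {x - r / 8..y + r / 8} \<and>
        ((x \<in> J \<and> x \<in> A \<and> z \<le> x \<and> x - z \<le> r / 8 \<and> {x..x + r / 2} \<subseteq> A \<inter> {x..y}) \<or>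
         (y \<in> J \<and> y \<in> A \<and> y \<le> z \<and> z - y \<le> r / 8 \<and> {y - r / 2..y} \<subseteq> A \<inter> {x..y})))"
      using covers_or_near_gap[OF \<eta>] by (elim exE) (rule that)
    define \<theta> where "\<theta> = min (\<nu> / 2) (\<alpha> / 2)"
    define K where "K = max 1 (max (Kc * M ^ (m0 + 1)) (2 / r * (Kt * D * Kg)))"
    have \<theta>: "\<theta> > 0" using \<alpha> \<nu>_pos by (simp add: \<theta>_def)
    have "diameter A \<le> K * exp (- \<theta> * real n)" if A: "arc A" "\<not> free A" and sm: "\<And>j. j < n \<Longrightarrow> width j A < r" for A n
    proof -
      obtain n0 where "J \<subseteq> (f ^^ n0) ` A" using nonfree_covers[OF A] by blast
      then have ex: "r \<le> width n0 A" using diameter_J(2)[OF iter_arc[OF A(1)], of n0] scale_facts(2)[OF s] by linarith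
      define N where "N = (LEAST N. r \<le> width N A)"
      have N: "r \<le> width N A" unfolding N_def by (rule LeastI[of "\<lambda>N. r \<le> width N A", OF ex])
      have Nl: "width j A < r" if "j < N" for j using not_less_Least[OF that[unfolded N_def]] by simp
      have nN: "n \<le> N" using sm[of N] N by (meson not_less)
      define B where "B = (f ^^ N) ` A"
      have B: "arc B" "\<not> free B" using iter_arc[OF A(1)] nonfree_iter[OF A] by (auto simp: B_def)
      then obtain z where "z \<in> B \<inter> J" unfolding free_def using interior_subset by blast
      then consider "\<forall>n\<ge>m0. J \<subseteq> (f ^^ n) ` B" |
        x y where "gap x y" "(x \<in> J \<and> {x..x + r / 2} \<subseteq> B \<inter> {x..y}) \<or> (y \<in> J \<and> {y - r / 2..y} \<subseteq> B \<inter> {x..y})"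
        using m0 B(1) N unfolding B_def[symmetric] by meson
      then have "diameter A \<le> K * exp (- \<theta> * real N)"
      proof cases
        case 1
        then have "J \<subseteq> (f ^^ (m0 + 1)) ` (f ^^ N) ` A" unfolding B_def by (meson le_add1)
        then have "J \<subseteq> (f ^^ (N + (m0 + 1))) ` A" unfolding iter_add_image[symmetric] by (simp only: add_ac)
        moreover have "\<forall>j<N. width j A < rc" using Nl rr by force
        ultimately have "diameter A \<le> Kc * M ^ (m0 + 1) * exp ((\<nu> / 2 - \<nu>) * real N)" using cb A(1) by (meson le_add2)
        also have "\<dots> \<le> K * exp (- \<theta> * real N)"
        proof (rule mult_mono)
          have "(\<nu> / 2 - \<nu>) * real N \<le> - \<theta> * real N" by (intro mult_right_mono) (auto simp: \<theta>_def)
          then show "exp ((\<nu> / 2 - \<nu>) * real N) \<le> exp (- \<theta> * real N)" by simp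
        qed (auto simp: K_def)
        finally show ?thesis .
      next
        case 2
        then obtain p q e where pq: "q - p = r / 2" "{p..q} \<subseteq> B" "{p..q} \<subseteq> {x..y}" "e \<in> {p..q}" "e \<in> J"
        proof (elim disjE conjE)
          assume "x \<in> J" "{x..x + r / 2} \<subseteq> B \<inter> {x..y}"
          then show ?thesis using r by (intro that[of "x + r / 2" x x]) auto
        next
          assume "y \<in> J" "{y - r / 2..y} \<subseteq> B \<inter> {x..y}"
          then show ?thesis using r by (intro that[of y "y - r / 2" y]) auto
        qed
        have pq0: "p < q" using pq(1) r by simp
        \<comment> \<open>This arc is free and, by backward invariance, contains a point of
          \<open>J\<close> over the edge \<open>e\<close>.\<close>
        obtain H where H: "arc H" "H \<subseteq> A" "(f ^^ N) ` H = {p..q}" using subarc_onto[OF A(1) pq0 pq(2)[unfolded B_def]] by (elim exE conjE) (rule that)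
        have "arc {p..q}" using iter_arc[OF H(1), of N] H(3) by simp
        then have "free {p..q}" using free_subset[OF gap_free[OF 2(1)]] pq(3) by blast
        then have fH: "free H" using nonfree_iter[OF H(1)] H(3) by metis
        obtain w where w: "w \<in> H" "(f ^^ N) w = e" using pq(4) H(3) by (metis imageE)
        have "w \<in> J" using J_iter_backward[of w N] w pq(5) arc_subset[OF H(1)] by blast
        have Hsm: "width j H < r'" if "j < N" for j
          using arc_diameter_mono[OF iter_arc[OF A(1)] image_mono[OF H(2)], of j] Nl[OF that] rr by (simp add: iter_arc H(1))
        have dH: "diameter H \<le> Kg * exp (- \<alpha> * real N)" using gd' fH w(1) \<open>w \<in> J\<close> Hsm by blast
        \<comment> \<open>This length is at most \<open>Kg * exp (- \<alpha> * N)\<close> at time 0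
          and equals \<open>r / 2\<close> at time \<open>N\<close>, so the telescoped estimate
          forces \<open>A\<close> to be short.\<close>
        define W where "W j = width j H" for j
        have W: "W 0 \<ge> 0" "W 0 = diameter H" "W N = r / 2" using arc_diameter_pos[OF H(1)] H(3) pq(1) r by (auto simp: W_def)
        have step: "\<forall>j<N. width j A < rt \<and> (\<exists>y\<in>(f ^^ j) ` A. W (Suc j) \<le> W j * \<bar>df y\<bar>)"
        proof (intro allI impI conjI)
          fix j assume "j < N"
          then show "width j A < rt" using Nl rr by force
          obtain y where "y \<in> (f ^^ j) ` H" "diameter (f ` (f ^^ j) ` H) \<le> width j H * \<bar>df y\<bar>"
            using diameter_image_mvt[OF iter_arc[OF H(1)]] by blast
          then show "\<exists>y\<in>(f ^^ j) ` A. W (Suc j) \<le> W j * \<bar>df y\<bar>"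
            using H(2) by (intro bexI[of _ y]) (auto simp: W_def image_comp)
        qed
        have "A \<inter> J \<noteq> {}" using w H \<open>w \<in> J\<close> by blast
        then have "diameter A * W N \<le> Kt * exp (\<alpha> / 2 * real N) * width N A * W 0"
          using ts A(1) W(1) step by blast
        also have "\<dots> \<le> Kt * exp (\<alpha> / 2 * real N) * D * (Kg * exp (- \<alpha> * real N))"
          using rt D \<alpha> W dH arc_diameter_le[OF iter_arc[OF A(1)], folded D_def]
          by (intro mult_mono mult_nonneg_nonneg diameter_ge_0 arc_bounded iter_arc A(1)) auto
        also have "\<dots> = Kt * D * Kg * exp (- (\<alpha> / 2) * real N)"
        proof -
          have "exp (- \<alpha> * real N) = exp (- (\<alpha> / 2) * real N) * exp (- (\<alpha> / 2) * real N)" by (simp add: exp_add[symmetric])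
          moreover have "exp (\<alpha> / 2 * real N) * exp (- (\<alpha> / 2) * real N) = 1" by (simp add: exp_add[symmetric])
          ultimately show ?thesis by (simp add: mult_ac)
        qed
        finally have "diameter A \<le> 2 / r * (Kt * D * Kg) * exp (- (\<alpha> / 2) * real N)" using W(3) r by (simp add: field_simps)
        also have "\<dots> \<le> K * exp (- \<theta> * real N)"
        proof (rule mult_mono)
          have "- (\<alpha> / 2) * real N \<le> - \<theta> * real N" by (intro mult_right_mono) (auto simp: \<theta>_def)
          then show "exp (- (\<alpha> / 2) * real N) \<le> exp (- \<theta> * real N)" by simp
        qed (auto simp: K_def)
        finally show ?thesis .
      qed
      also have "\<dots> \<le> K * exp (- \<theta> * real n)"
      proof (intro mult_left_mono)
        show "exp (- \<theta> * real N) \<le> exp (- \<theta> * real n)" using nN \<theta> by (simp add: mult_left_mono)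
      qed (simp add: K_def)
      finally show ?thesis .
    qed
    moreover have "K \<ge> 1" by (simp add: K_def)
    ultimately show ?thesis using \<theta> by blast
  qed
  then show ?thesis using \<open>r' > 0\<close> rt(1) rc(1) by (intro exI[of _ "min r' (min rt rc)"]) auto
qed

end

section \<open>Topology of pull-backs\<close>

context interval_map begin

lemma open_interval_shape:
  assumes W: "openin (top_of_set {a..b}) W" "connected W" "W \<noteq> {}"
  obtains u v where "a \<le> u" "u < v" "v \<le> b" "{u<..<v} \<subseteq> W" "W \<subseteq> {u..v}" "u \<in> W \<longrightarrow> u = a" "v \<in> W \<longrightarrow> v = b"
proof -
  have sub: "W \<subseteq> {a..b}" using W(1) openin_imp_subset by blast
  have bd: "bdd_below W" "bdd_above W" by (rule bdd_below_mono[OF bdd_below_Icc sub], rule bdd_above_mono[OF bdd_above_Icc sub])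
  have near: "\<exists>e>0. \<forall>y\<in>{a..b}. \<bar>y - z\<bar> < e \<longrightarrow> y \<in> W" if "z \<in> W" for z
    using W(1) that unfolding openin_euclidean_subtopology_iff by (auto simp: dist_real_def)
  have iv: "is_interval W" using W(2) is_interval_connected_1 by blast
  define u where "u = Inf W"
  define v where "v = Sup W"
  have uW: "u \<le> z" "z \<le> v" if "z \<in> W" for z using that bd by (auto simp: u_def v_def cInf_lower cSup_upper)
  obtain z0 where z0: "z0 \<in> W" using W(3) by blast
  have au: "a \<le> u" "v \<le> b" using sub W(3) by (auto simp: u_def v_def intro!: cInf_greatest cSup_least)
  have lowW: "\<exists>y\<in>W. y < z" if z: "z \<in> W" "z > a" for z
  proof -
    obtain e where e: "e > 0" "\<forall>y\<in>{a..b}. \<bar>y - z\<bar> < e \<longrightarrow> y \<in> W" using near z by blast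
    have "max a (z - e / 2) \<in> W" using e z sub by (auto simp: max_def)
    then show ?thesis using z e by (intro bexI[of _ "max a (z - e / 2)"]) auto
  qed
  have highW: "\<exists>y\<in>W. z < y" if z: "z \<in> W" "z < b" for z
  proof -
    obtain e where e: "e > 0" "\<forall>y\<in>{a..b}. \<bar>y - z\<bar> < e \<longrightarrow> y \<in> W" using near z by blast
    have "min b (z + e / 2) \<in> W" using e z sub by (auto simp: min_def)
    then show ?thesis using z e by (intro bexI[of _ "min b (z + e / 2)"]) auto
  qed
  have "u < v"
  proof (cases "z0 = a")
    case True
    then obtain y where "y \<in> W" "z0 < y" using highW[OF z0] ab by auto
    then show ?thesis using uW[OF z0] uW[of y] by linarith
  next
    case False
    then obtain y where "y \<in> W" "y < z0" using lowW[OF z0] sub z0 by fastforce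
    then show ?thesis using uW[OF z0] uW[of y] by linarith
  qed
  moreover have "{u<..<v} \<subseteq> W"
  proof
    fix z assume z: "z \<in> {u<..<v}"
    obtain p where p: "p \<in> W" "p < z" using z cInf_lessD[OF W(3), of z] by (auto simp: u_def)
    obtain q where q: "q \<in> W" "z < q" using z less_cSupD[OF W(3), of z] by (auto simp: v_def)
    show "z \<in> W" using iv p q unfolding is_interval_1 by (meson less_imp_le)
  qed
  moreover have "u \<in> W \<longrightarrow> u = a" using lowW[of u] uW au by fastforce
  moreover have "v \<in> W \<longrightarrow> v = b" using highW[of v] uW au by fastforce
  ultimately show ?thesis using au uW by (intro that[of u v]) auto
qed

text \<open>Components of a relatively open subset are open, because an interval is locally
  connected.\<close>

lemma pullback_open:
  assumes "open S" "W \<in> pullbacks {a..b} f n (S \<inter> {a..b})"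
  shows "openin (top_of_set {a..b}) W" "connected W" "W \<noteq> {}"
proof -
  have eq: "{y \<in> {a..b}. (f ^^ n) y \<in> S \<inter> {a..b}} = {a..b} \<inter> (f ^^ n) -` S" using iter_in by auto
  have o: "openin (top_of_set {a..b}) {y \<in> {a..b}. (f ^^ n) y \<in> S \<inter> {a..b}}"
    unfolding eq by (rule continuous_openin_preimage_gen[OF cont_iter assms(1)])
  moreover have "locally connected {a..b}" by (intro convex_imp_locally_connected) auto
  ultimately have "locally connected {y \<in> {a..b}. (f ^^ n) y \<in> S \<inter> {a..b}}" using locally_open_subset by blast
  then have "openin (top_of_set {y \<in> {a..b}. (f ^^ n) y \<in> S \<inter> {a..b}}) W"
    using assms(2) openin_components_locally_connected unfolding pullbacks_def by blast
  then show "openin (top_of_set {a..b}) W" using o openin_trans by blast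
  show "connected W" "W \<noteq> {}" using assms(2) in_components_connected in_components_nonempty unfolding pullbacks_def by blast+
qed

lemma image_closed_interval:
  assumes "a \<le> u" "u < v" "v \<le> b" "{u<..<v} \<subseteq> W" "closed T" "(f ^^ n) ` W \<subseteq> T"
  shows "(f ^^ n) ` {u..v} \<subseteq> T"
proof -
  have cl: "closure {u<..<v} = {u..v}" using assms(2) by simp
  have "continuous_on {u..v} (f ^^ n)" using cont_iter continuous_on_subset assms(1,3) by (metis atLeastatMost_subset_iff)
  then have "(f ^^ n) ` closure {u<..<v} \<subseteq> T"
    using assms(4-6) by (intro image_closure_subset) (auto simp: cl)
  then show ?thesis by (simp add: cl)
qed

end

context expanding_julia begin

text \<open>Otherwise \<open>W\<close> contains no critical point and no endpoint of \<open>{a..b}\<close>, as \<open>W'\<close> is small; hence \<open>f\<close> maps it onto \<open>W'\<close>.\<close>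

lemma pullback_meets_J:
  assumes s: "scale r" and W': "W' \<inter> J \<noteq> {}" "\<And>x y. x \<in> W' \<Longrightarrow> y \<in> W' \<Longrightarrow> \<bar>x - y\<bar> < r"
    and iv: "is_interval W'" and uv: "a \<le> u" "u < v" "v \<le> b" "{u<..<v} \<subseteq> W" "W \<subseteq> {u..v}"
    and ends: "u \<in> W \<longrightarrow> u = a" "v \<in> W \<longrightarrow> v = b" and fW: "f ` W \<subseteq> W'"
    and max: "\<And>S. W \<subseteq> S \<Longrightarrow> connected S \<Longrightarrow> S \<subseteq> {a..b} \<Longrightarrow> f ` S \<subseteq> W' \<Longrightarrow> S \<subseteq> W"
  shows "W \<inter> J \<noteq> {}"
proof
  assume WJ: "W \<inter> J = {}"
  have WI: "W \<subseteq> {a..b}" using uv by auto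
  have none: "e \<notin> Crit \<union> {a, b}" if e: "e \<in> W" for e
  proof
    assume c: "e \<in> Crit \<union> {a, b}"
    obtain y where y: "y \<in> W'" "y \<in> J" using W'(1) by blast
    have "f e \<in> W'" using e fW by blast
    then have "\<bar>y - f e\<bar> < r" using W'(2) y by blast
    moreover have "r \<le> \<bar>y - f e\<bar>" using scale_facts(5)[OF s c] WJ e y by blast
    ultimately show False by simp
  qed
  have uW: "u \<notin> W" "v \<notin> W" using none ends by auto
  have "x \<in> {u<..<v}" if "x \<in> W" for x
    using subsetD[OF uv(5) that] uW that by (metis atLeastAtMost_iff greaterThanLessThan_iff order_le_less)
  then have W: "W = {u<..<v}" using uv(4) by blast
  have conS: "connected (insert e W)" if "e \<in> {u, v}" for e
  proof -
    have "insert e W = {u..<v} \<or> insert e W = {u<..v}" using that uv(2) unfolding W by auto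
    then show ?thesis by auto
  qed
  \<comment> \<open>An end of \<open>W\<close> mapped into \<open>W'\<close> could be added to
    \<open>W\<close>, against maximality.\<close>
  have nu: "f e \<notin> W'" if e: "e \<in> {u, v}" for e
  proof
    assume "f e \<in> W'"
    then have "insert e W \<subseteq> W" using e uv fW WI by (intro max conS) auto
    then show False using e uW by blast
  qed
  have os: "closed_segment u v = {u..v}" "open_segment u v = W"
    using uv(2) by (simp_all add: closed_segment_eq_real_ivl open_segment_eq_real_ivl W)
  have im: "f ` {u..v} = closed_segment (f u) (f v)"
    using image_segment[of u v] none uv unfolding os by auto
  have mid: "(u + v) / 2 \<in> W" using uv(2) by (simp add: W)
  then have m1: "f ((u + v) / 2) \<in> W'" using fW by blast
  have "f ((u + v) / 2) \<in> f ` {u..v}" using mid W by auto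
  then have m2: "f ((u + v) / 2) \<in> closed_segment (f u) (f v)" using im by simp
  obtain y where y: "y \<in> W'" "y \<in> J" using W'(1) by blast
  have cv: "q \<in> W'" if "p \<in> W'" "p' \<in> W'" "p \<le> q" "q \<le> p'" for p p' q
    using iv that unfolding is_interval_1 by blast
  \<comment> \<open>The interval \<open>W'\<close> contains a point of the segment but neither of
    its ends, so it lies in the segment.\<close>
  have "y \<in> closed_segment (f u) (f v)"
    using cv[OF m1 y(1)] cv[OF y(1) m1] nu[of u] nu[of v] m2
    by (auto simp: closed_segment_eq_real_ivl split: if_splits) (meson linear order_trans)+
  then obtain z where z: "z \<in> {u..v}" "y = f z" using im by blast
  then have "z \<noteq> u" "z \<noteq> v" using nu y(1) by auto
  then have "z \<in> W" using z(1) by (simp add: W)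
  then show False using J_backward[of z] z y(2) WI WJ by blast
qed

text \<open>Induction on \<open>n\<close>: the image of \<open>W\<close> lies in a pull-back of one
  order less, which bounds all images at positive times. Time 0 is left to
  \<open>backward_stable\<close>, for which \<open>W\<close> has to meet \<open>J\<close>. The
  bounds are for the closed interval, as arcs are closed.\<close>

lemma pullback_small:
  assumes s: "scale r" and \<delta>: "0 < \<delta>" "2 * \<delta> < r"
    and bs: "\<forall>A n. arc A \<and> A \<inter> J \<noteq> {} \<and> (\<forall>i. 1 \<le> i \<and> i < n \<longrightarrow> width i A < r) \<and>
      width n A \<le> 2 * \<delta> \<longrightarrow> diameter A < r"
    and x: "x \<in> J"
  shows "W \<in> pullbacks {a..b} f n (ball x \<delta> \<inter> {a..b}) \<Longrightarrow> a \<le> u \<Longrightarrow> u < v \<Longrightarrow> v \<le> b \<Longrightarrow>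
    {u<..<v} \<subseteq> W \<Longrightarrow> W \<subseteq> {u..v} \<Longrightarrow>
    W \<inter> J \<noteq> {} \<and> (\<forall>i\<le>n. width i {u..v} < r) \<and> width n {u..v} \<le> 2 * \<delta>"
proof (induction n arbitrary: W u v)
  case 0
  have "connected (ball x \<delta> \<inter> {a..b})" by (intro convex_connected convex_Int) auto
  moreover have "x \<in> ball x \<delta> \<inter> {a..b}" using J_in[OF x] \<delta> by simp
  moreover have eq: "{y \<in> {a..b}. (f ^^ 0) y \<in> ball x \<delta> \<inter> {a..b}} = ball x \<delta> \<inter> {a..b}" by auto
  ultimately have W: "W = ball x \<delta> \<inter> {a..b}" using 0(1) unfolding pullbacks_def eq
    by (metis components_eq_sing_iff empty_iff singletonD)
  then have "W \<inter> J \<noteq> {}" using x J_in[OF x] \<delta> by auto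
  have "(f ^^ 0) ` {u..v} \<subseteq> cball x \<delta>"
    by (rule image_closed_interval[OF 0(2,3,4,5)]) (auto simp: W)
  then have "{u..v} \<subseteq> cball x \<delta>" by simp
  then have "diameter {u..v} \<le> diameter (cball x \<delta>)" by (intro diameter_subset) auto
  then have "diameter {u..v} \<le> 2 * \<delta>" using \<delta> by simp
  then show ?case using \<open>W \<inter> J \<noteq> {}\<close> \<delta>(2) by simp
next
  case (Suc n)
  define B where "B = ball x \<delta> \<inter> {a..b}"
  have Wp: "W \<in> components {y \<in> {a..b}. (f ^^ Suc n) y \<in> B}" using Suc.prems(1) by (simp add: pullbacks_def B_def)
  note Wc = in_components_connected[OF Wp] in_components_nonempty[OF Wp] in_components_subset[OF Wp]
  have WI: "W \<subseteq> {a..b}" using Wc(3) by blast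
  have cfW: "connected (f ` W)" by (rule connected_continuous_image[OF continuous_on_subset[OF cont_f WI] Wc(1)])
  have fWs: "f ` W \<subseteq> {y \<in> {a..b}. (f ^^ n) y \<in> B}" using Wc(3) maps by (auto simp: funpow_swap1)
  then have "\<exists>W'. W' \<in> components {y \<in> {a..b}. (f ^^ n) y \<in> B} \<and> f ` W \<subseteq> W'"
    using exists_component_superset[OF fWs _ cfW] Wc(2) by blast
  then obtain W' where W': "W' \<in> components {y \<in> {a..b}. (f ^^ n) y \<in> B}" "f ` W \<subseteq> W'" by blast
  have Wp': "W' \<in> pullbacks {a..b} f n (ball x \<delta> \<inter> {a..b})" using W'(1) by (simp add: pullbacks_def B_def)
  obtain u' v' where uv': "a \<le> u'" "u' < v'" "v' \<le> b" "{u'<..<v'} \<subseteq> W'" "W' \<subseteq> {u'..v'}"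
    by (rule open_interval_shape[OF pullback_open[OF open_ball Wp']])
  note IH = Suc.IH[OF Wp' uv']
  have iv': "is_interval W'" using in_components_connected[OF W'(1)] is_interval_connected_1 by blast
  have dist': "\<bar>p - q\<bar> < r" if "p \<in> W'" "q \<in> W'" for p q
  proof -
    have "diameter {u'..v'} < r" using IH by (metis funpow_0 image_ident le0 id_apply image_cong)
    then have "v' - u' < r" using uv'(2) by simp
    moreover have "p \<in> {u'..v'}" "q \<in> {u'..v'}" using that uv'(5) by auto
    ultimately show ?thesis by (simp add: abs_less_iff)
  qed
  obtain u0 v0 where uv0: "a \<le> u0" "u0 < v0" "v0 \<le> b" "{u0<..<v0} \<subseteq> W" "W \<subseteq> {u0..v0}" "u0 \<in> W \<longrightarrow> u0 = a" "v0 \<in> W \<longrightarrow> v0 = b"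
    by (rule open_interval_shape[OF pullback_open[OF open_ball Suc.prems(1)]])
  have WJ: "W \<inter> J \<noteq> {}"
  proof (rule pullback_meets_J[OF s _ dist' iv' uv0 W'(2)])
    show "W' \<inter> J \<noteq> {}" using IH by blast
    fix S assume S: "W \<subseteq> S" "connected S" "S \<subseteq> {a..b}" "f ` S \<subseteq> W'"
    have "S \<subseteq> {y \<in> {a..b}. (f ^^ Suc n) y \<in> B}"
      using S(3,4) in_components_subset[OF W'(1)] by (auto simp: funpow_swap1)
    then show "S \<subseteq> W" using in_components_maximal[THEN iffD1, OF Wp] S(1,2) Wc(2) by blast
  qed
  define A where "A = {u..v}"
  have A: "arc A" using arcI Suc.prems by (simp add: A_def)
  have AJ: "A \<inter> J \<noteq> {}" using WJ Suc.prems by (auto simp: A_def)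
  have A': "arc {u'..v'}" using uv' by (intro arcI) auto
  have "(f ^^ 1) ` {u..v} \<subseteq> {u'..v'}"
    by (rule image_closed_interval[OF Suc.prems(2-5)]) (use W'(2) uv'(5) in auto)
  then have fA: "f ` A \<subseteq> {u'..v'}" by (simp add: A_def)
  have sm: "diameter ((f ^^ Suc i) ` A) \<le> width i {u'..v'}" for i
  proof -
    have "(f ^^ Suc i) ` A = (f ^^ i) ` f ` A" by (simp add: image_comp funpow_swap1 comp_def)
    then show ?thesis using arc_diameter_mono[OF iter_arc[OF A'] image_mono[OF fA]] iter_arc[OF A, of "Suc i"] by metis
  qed
  have last: "diameter ((f ^^ Suc n) ` A) \<le> 2 * \<delta>" using sm[of n] IH by linarith
  have mid: "width i A < r" if "1 \<le> i" "i \<le> Suc n" for i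
    using that sm[of "i - 1"] IH by (cases i) (auto intro: le_less_trans)
  then have "diameter A < r" using bs A AJ last by (meson less_imp_le)
  then have "width i A < r" if "i \<le> Suc n" for i
    using mid[of i] that by (cases "i = 0") auto
  then show ?case using WJ last by (simp add: A_def)
qed

text \<open>Points of \<open>W\<close> mapped into \<open>J\<close> are in \<open>J\<close> by
  backward invariance, so if \<open>W\<close> met \<open>J\<close> in a finite set, exactness would
  make \<open>J\<close> finite.\<close>

lemma pullback_arc_nonfree:
  assumes W: "openin (top_of_set {a..b}) W" "W \<inter> J \<noteq> {}" and A: "arc A" "W \<subseteq> A"
  shows "\<not> free A"
proof
  assume "free A"
  then have fin: "finite (W \<inter> J)" using free_iff_finite[OF A(1)] A(2) by (meson Int_mono finite_subset order_refl)
  obtain n where n: "J \<subseteq> (f ^^ n) ` W" using exact[OF W] by blast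
  have "J \<subseteq> (f ^^ n) ` (W \<inter> J)"
  proof
    fix y assume y: "y \<in> J"
    then obtain z where z: "z \<in> W" "y = (f ^^ n) z" using n by blast
    then have "z \<in> J" using J_iter_backward[of z n] y openin_imp_subset[OF W(1)] by blast
    then show "y \<in> (f ^^ n) ` (W \<inter> J)" using z by blast
  qed
  then show False using fin infinite_J finite_subset by blast
qed

text \<open>The constant \<open>K\<close> is absorbed: for \<open>n > n1\<close> by giving up half
  of the rate, for \<open>n \<le> n1\<close> by the choice of \<open>\<delta>\<close>.\<close>

theorem pullbacks_shrink:
  "\<exists>\<delta>>0. \<exists>c>1. \<forall>x\<in>J. \<forall>n\<ge>1. \<forall>W \<in> pullbacks {a..b} f n (ball x \<delta> \<inter> {a..b}). measure lborel W \<le> c powi (- int n)"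
proof -
  obtain r1 where r1: "r1 > 0" and ad: "\<forall>r. scale r \<and> r \<le> r1 \<longrightarrow> (\<exists>\<theta>>0. \<exists>K\<ge>1. \<forall>A n. arc A \<and> \<not> free A \<and> (\<forall>j<n. width j A < r) \<longrightarrow>
     diameter A \<le> K * exp (- \<theta> * real n))"
    using arc_decay by (elim exE conjE) (rule that)
  obtain rs where rs: "rs > 0" "\<forall>r. 0 < r \<and> r \<le> rs \<longrightarrow> scale r" using scale_ex by blast
  define r where "r = min r1 rs"
  have s: "scale r" "r \<le> r1" "r > 0" using r1 rs by (auto simp: r_def)
  then obtain \<theta> K where \<theta>: "\<theta> > 0" "K \<ge> 1" and dec: "\<forall>A n. arc A \<and> \<not> free A \<and> (\<forall>j<n. width j A < r) \<longrightarrow>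
     diameter A \<le> K * exp (- \<theta> * real n)" using ad by blast
  obtain \<delta>1 where \<delta>1: "\<delta>1 > 0" and bs: "\<forall>A n. arc A \<and> A \<inter> J \<noteq> {} \<and> (\<forall>i. 1 \<le> i \<and> i < n \<longrightarrow> width i A < r) \<and>
    width n A < \<delta>1 \<longrightarrow> diameter A < r" using backward_stable[OF s(1)] by (elim exE conjE) (rule that)
  obtain n1 :: nat where n1: "2 * ln K / \<theta> \<le> real n1" using real_arch_simple by blast
  \<comment> \<open>The smallest of the bounds wanted for \<open>n \<le> n1\<close>. An arc of at
    least this length would have an image at time \<open>n\<close> longer than
    \<open>2 * \<delta>\<close>.\<close>
  define \<kappa> where "\<kappa> = exp (- (\<theta> / 2) * real n1)"
  have "\<kappa> > 0" by (simp add: \<kappa>_def)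
  then obtain \<kappa>' where \<kappa>': "\<kappa>' > 0" "\<forall>n\<le>n1. \<forall>A. arc A \<and> \<kappa> \<le> diameter A \<longrightarrow> \<kappa>' \<le> width n A"
    using diameter_image_lower_upto by blast
  define \<delta> where "\<delta> = min r (min \<delta>1 \<kappa>') / 4"
  have \<delta>: "0 < \<delta>" "2 * \<delta> < r" "2 * \<delta> < \<delta>1" "2 * \<delta> < \<kappa>'" using s \<delta>1 \<kappa>'(1) by (auto simp: \<delta>_def min_def)
  have bs': "\<forall>A n. arc A \<and> A \<inter> J \<noteq> {} \<and> (\<forall>i. 1 \<le> i \<and> i < n \<longrightarrow> width i A < r) \<and>
      width n A \<le> 2 * \<delta> \<longrightarrow> diameter A < r" using bs \<delta>(3) by (meson le_less_trans)
  have "measure lborel W \<le> exp (\<theta> / 2) powi (- int n)"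
    if x: "x \<in> J" and W: "W \<in> pullbacks {a..b} f n (ball x \<delta> \<inter> {a..b})" for x n W
  proof -
    note Wo = pullback_open[OF open_ball W]
    obtain u v where uv: "a \<le> u" "u < v" "v \<le> b" "{u<..<v} \<subseteq> W" "W \<subseteq> {u..v}"
      by (rule open_interval_shape[OF Wo])
    define A where "A = {u..v}"
    have A: "arc A" "W \<subseteq> A" using uv by (simp_all add: A_def arcI)
    have sm: "W \<inter> J \<noteq> {}" "\<forall>i\<le>n. width i A < r" "width n A \<le> 2 * \<delta>"
      using pullback_small[OF s(1) \<delta>(1,2) bs' x W uv] unfolding A_def by blast+
    have nf: "\<not> free A" by (rule pullback_arc_nonfree[OF Wo(1) sm(1) A])
    have d1: "diameter A \<le> K * exp (- \<theta> * real n)" using dec A(1) nf sm(2) by (meson less_imp_le)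
    have "diameter A \<le> exp (- (\<theta> / 2) * real n)"
    proof (cases "n \<le> n1")
      case True
      have "diameter A < \<kappa>" using \<kappa>'(2) True A(1) sm(3) \<delta>(4) by (meson le_less_trans not_le)
      also have "\<kappa> \<le> exp (- (\<theta> / 2) * real n)" using True \<theta>(1) by (simp add: \<kappa>_def mult_left_mono)
      finally show ?thesis by simp
    next
      case False
      have "K = exp (ln K)" using \<theta>(2) by simp
      also have "\<dots> \<le> exp (\<theta> / 2 * real n)"
      proof -
        have "2 * ln K / \<theta> \<le> real n" using n1 False by linarith
        then show ?thesis using \<theta>(1) by (simp add: field_simps)
      qed
      finally have "K * exp (- \<theta> * real n) \<le> exp (\<theta> / 2 * real n) * exp (- \<theta> * real n)" by (intro mult_right_mono) auto
      also have "\<dots> = exp (- (\<theta> / 2) * real n)" by (simp add: exp_add[symmetric])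
      finally show ?thesis using d1 by linarith
    qed
    moreover have "measure lborel W \<le> diameter A"
    proof -
      have "openin (top_of_set {a..b}) W" by (rule Wo(1))
      then have "W \<in> sets borel" by (auto simp: openin_open)
      then have "measure lborel W \<le> measure lborel {u..v}" using uv by (intro measure_mono_fmeasurable) (auto simp: fmeasurable_def)
      then show ?thesis using uv(2) by (simp add: A_def)
    qed
    moreover have "exp (\<theta> / 2) powi (- int n) = exp (- (\<theta> / 2) * real n)"
      by (simp add: power_int_minus exp_minus exp_of_nat2_mult[symmetric] mult.commute)
    ultimately show ?thesis by simp
  qed
  then show ?thesis using \<delta>(1) \<theta>(1) by (intro exI[of _ \<delta>] conjI exI[of _ "exp (\<theta> / 2)"]) auto
qed

end

section \<open>Smooth maps, Fatou sets and orbit measures\<close>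

text \<open>Peano's form of Taylor's formula: the estimate for \<open>g (Suc m)\<close> is
  integrated from \<open>c\<close> by the mean value bound.\<close>

lemma taylor_leading_term:
  fixes g :: "nat \<Rightarrow> real \<Rightarrow> real"
  assumes deriv: "\<And>k x. x \<in> I \<Longrightarrow> (g k has_real_derivative g (Suc k) x) (at x within I)"
    and I: "convex I" "c \<in> I" and "\<epsilon> > 0" and zero: "\<And>i. m \<le> i \<Longrightarrow> i < m + j \<Longrightarrow> g i c = 0"
  shows "\<exists>\<rho>>0. \<forall>x\<in>I. \<bar>x - c\<bar> < \<rho> \<longrightarrow> \<bar>g m x - g (m + j) c * (x - c) ^ j / fact j\<bar> \<le> \<epsilon> * \<bar>x - c\<bar> ^ j"
  using zero
proof (induction j arbitrary: m)
  case 0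
  have "continuous (at c within I) (g m)" using deriv[OF I(2)] by (rule DERIV_continuous)
  then obtain d where "d > 0" "\<forall>x\<in>I. dist x c < d \<longrightarrow> dist (g m x) (g m c) < \<epsilon>"
    using \<open>\<epsilon> > 0\<close> unfolding continuous_within_eps_delta by blast
  then show ?case by (intro exI[of _ d]) (auto simp: dist_real_def less_imp_le)
next
  case (Suc j)
  have "g i c = 0" if "Suc m \<le> i" "i < Suc m + j" for i using that by (intro Suc.prems) auto
  then obtain \<rho> where \<rho>: "\<rho> > 0" "\<And>x. x \<in> I \<Longrightarrow> \<bar>x - c\<bar> < \<rho> \<Longrightarrow>
      \<bar>g (Suc m) x - g (Suc m + j) c * (x - c) ^ j / fact j\<bar> \<le> \<epsilon> * \<bar>x - c\<bar> ^ j"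
    using Suc.IH[of "Suc m"] by blast
  define L where "L = g (Suc m + j) c"
  define \<phi> where "\<phi> x = g m x - L * (x - c) ^ Suc j / fact (Suc j)" for x
  have gm: "g m c = 0" using Suc.prems by simp
  have "\<bar>\<phi> x\<bar> \<le> \<epsilon> * \<bar>x - c\<bar> ^ Suc j" if x: "x \<in> I" "\<bar>x - c\<bar> < \<rho>" for x
  proof -
    define S where "S = closed_segment c x"
    have S: "S \<subseteq> I" using I x by (simp add: S_def closed_segment_subset)
    have "norm (\<phi> x - \<phi> c) \<le> (\<epsilon> * \<bar>x - c\<bar> ^ j) * norm (x - c)"
    proof (rule field_differentiable_bound[where S = S and f' = "\<lambda>z. g (Suc m) z - L * (z - c) ^ j / fact j"])
      show "convex S" "x \<in> S" "c \<in> S" by (auto simp: S_def)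
      fix z assume z: "z \<in> S"
      have "(g m has_real_derivative g (Suc m) z) (at z within S)" using deriv S z by (meson DERIV_subset subsetD)
      moreover have "((\<lambda>x. L * (x - c) ^ Suc j / fact (Suc j)) has_real_derivative L * (z - c) ^ j / fact j) (at z within S)"
        by (rule derivative_eq_intros refl | simp)+
      ultimately show "(\<phi> has_real_derivative g (Suc m) z - L * (z - c) ^ j / fact j) (at z within S)"
        unfolding \<phi>_def by (rule DERIV_diff)
      have zc: "\<bar>z - c\<bar> \<le> \<bar>x - c\<bar>" using z by (auto simp: S_def closed_segment_eq_real_ivl split: if_splits)
      then have "\<bar>g (Suc m) z - L * (z - c) ^ j / fact j\<bar> \<le> \<epsilon> * \<bar>z - c\<bar> ^ j"
        unfolding L_def using \<rho>(2)[of z] S z x by auto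
      also have "\<dots> \<le> \<epsilon> * \<bar>x - c\<bar> ^ j" using zc \<open>\<epsilon> > 0\<close> by (intro mult_left_mono power_mono) auto
      finally show "norm (g (Suc m) z - L * (z - c) ^ j / fact j) \<le> \<epsilon> * \<bar>x - c\<bar> ^ j" by simp
    qed
    then show ?thesis using gm by (simp add: \<phi>_def mult_ac)
  qed
  then show ?case using \<rho>(1) by (intro exI[of _ \<rho>]) (simp add: \<phi>_def L_def)
qed

lemma smooth_on_nderiv:
  assumes "smooth_on I f" "x \<in> I"
  shows "(nderiv_on I k f has_real_derivative nderiv_on I (Suc k) f x) (at x within I)"
  using assms unfolding smooth_on_def has_real_derivative_iff_has_vector_derivative
  by (simp add: vector_derivative_works[symmetric])

text \<open>At a critical point let \<open>k\<close> be the least order at least 2 of a nonzero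
  derivative. Then the first derivative has a leading term of degree \<open>k - 1\<close>, and an
  error of half its size yields the two constants in \<open>order\<close>.\<close>

lemma nondegenerate_interval_map:
  assumes nd: "nondegenerate_smooth_map {a..b} f" and "a \<le> b"
  shows "interval_map a b f (nderiv_on {a..b} 1 f)"
proof
  define g where "g k = nderiv_on {a..b} k f" for k
  have sm: "smooth_on {a..b} f" using nd by (simp add: nondegenerate_smooth_map_def)
  have g: "(g k has_real_derivative g (Suc k) x) (at x within {a..b})" if "x \<in> {a..b}" for k x
    unfolding g_def by (rule smooth_on_nderiv[OF sm that])
  have "a \<noteq> b" using nd by (auto simp: nondegenerate_smooth_map_def)
  then show "a < b" using \<open>a \<le> b\<close> by simp
  have "f ` {a..b} \<subseteq> {a..b}" using nd by (simp add: nondegenerate_smooth_map_def)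
  then show "f x \<in> {a..b}" if "x \<in> {a..b}" for x using that by blast
  show "(f has_real_derivative nderiv_on {a..b} 1 f x) (at x within {a..b})" if "x \<in> {a..b}" for x
    using g[OF that, of 0] by (simp add: g_def)
  show "continuous_on {a..b} (nderiv_on {a..b} 1 f)"
    using g[of _ 1] DERIV_continuous unfolding continuous_on_eq_continuous_within g_def by blast
  show "finite {x \<in> {a..b}. nderiv_on {a..b} 1 f x = 0}" using nd by (simp add: nondegenerate_smooth_map_def)
  fix c assume c: "c \<in> {a..b}" "nderiv_on {a..b} 1 f c = 0"
  then have ex: "\<exists>k. k \<ge> 2 \<and> g k c \<noteq> 0" using nd by (auto simp: nondegenerate_smooth_map_def g_def)
  define k where "k = (LEAST k. k \<ge> 2 \<and> g k c \<noteq> 0)"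
  have k: "k \<ge> 2" "g k c \<noteq> 0" using LeastI_ex[OF ex] by (auto simp: k_def)
  have z: "g i c = 0" if "1 \<le> i" "i < k" for i
  proof (cases "i = 1")
    case False
    then show ?thesis using not_less_Least[OF that(2)[unfolded k_def]] that(1) by simp
  qed (use c in \<open>simp add: g_def\<close>)
  define p where "p = k - 1"
  define L where "L = \<bar>g k c\<bar> / fact p"
  have L: "L > 0" using k by (simp add: L_def)
  have "g i c = 0" if "1 \<le> i" "i < 1 + p" for i using z that by (simp add: p_def)
  then obtain \<rho> where \<rho>: "\<rho> > 0" "\<And>x. x \<in> {a..b} \<Longrightarrow> \<bar>x - c\<bar> < \<rho> \<Longrightarrow>
      \<bar>g 1 x - g (1 + p) c * (x - c) ^ p / fact p\<bar> \<le> L / 2 * \<bar>x - c\<bar> ^ p"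
    using taylor_leading_term[of "{a..b}" g c "L / 2" 1 p] g c L by auto
  have "L / 2 * \<bar>x - c\<bar> ^ p \<le> \<bar>g 1 x\<bar> \<and> \<bar>g 1 x\<bar> \<le> (3 * L / 2) * \<bar>x - c\<bar> ^ p"
    if "x \<in> {a..b}" "\<bar>x - c\<bar> < \<rho>" for x
  proof -
    have "1 + p = k" using k by (simp add: p_def)
    then have "\<bar>g (1 + p) c * (x - c) ^ p / fact p\<bar> = L * \<bar>x - c\<bar> ^ p" by (simp add: L_def abs_mult power_abs)
    then show ?thesis using \<rho>(2)[OF that] by linarith
  qed
  then show "\<exists>p k1 k2 \<rho>. 0 < k1 \<and> 0 < k2 \<and> 0 < \<rho> \<and> (\<forall>x\<in>{a..b}. \<bar>x - c\<bar> < \<rho> \<longrightarrow>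
        k1 * \<bar>x - c\<bar> ^ p \<le> \<bar>nderiv_on {a..b} 1 f x\<bar> \<and> \<bar>nderiv_on {a..b} 1 f x\<bar> \<le> k2 * \<bar>x - c\<bar> ^ p)"
    using L \<rho>(1) unfolding g_def by (intro exI[of _ p] exI[of _ "L / 2"] exI[of _ "3 * L / 2"] exI[of _ \<rho>]) auto
qed

section \<open>Invariance of the Fatou and Julia sets\<close>

lemma equicontinuous_iterates_on_subset:
  "equicontinuous_iterates_on f S \<Longrightarrow> T \<subseteq> S \<Longrightarrow> equicontinuous_iterates_on f T"
  unfolding equicontinuous_iterates_on_def by (meson subsetD)

text \<open>Equicontinuity passes to subsets, so on one equicontinuous neighbourhood the iterates
  are also locally equicontinuous.\<close>

lemma in_fatou_set_iff:
  "x \<in> fatou_set I f \<longleftrightarrow> (\<exists>U. openin (top_of_set I) U \<and> x \<in> U \<and> equicontinuous_iterates_on f U)"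
proof
  assume "x \<in> fatou_set I f"
  then obtain U where U: "openin (top_of_set I) U" "locally (equicontinuous_iterates_on f) U" "x \<in> U"
    unfolding fatou_set_def normal_iterates_on_def by blast
  obtain u v where uv: "openin (top_of_set U) u" "equicontinuous_iterates_on f v" "x \<in> u" "u \<subseteq> v" "v \<subseteq> U"
    by (rule locallyE[OF U(2) openin_subtopology_self U(3)])
  then show "\<exists>U. openin (top_of_set I) U \<and> x \<in> U \<and> equicontinuous_iterates_on f U"
    using openin_trans[OF uv(1) U(1)] equicontinuous_iterates_on_subset by blast
next
  assume "\<exists>U. openin (top_of_set I) U \<and> x \<in> U \<and> equicontinuous_iterates_on f U"
  then obtain U where U: "openin (top_of_set I) U" "x \<in> U" "equicontinuous_iterates_on f U" by blast
  have "locally (equicontinuous_iterates_on f) U"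
  proof (rule locallyI)
    fix w y assume w: "openin (top_of_set U) w" "y \<in> w"
    then have "equicontinuous_iterates_on f w"
      using equicontinuous_iterates_on_subset[OF U(3) openin_imp_subset] by blast
    then show "\<exists>u v. openin (top_of_set U) u \<and> equicontinuous_iterates_on f v \<and> y \<in> u \<and> u \<subseteq> v \<and> v \<subseteq> w"
      using w by (intro exI[of _ w]) auto
  qed
  then show "x \<in> fatou_set I f" using U unfolding fatou_set_def normal_iterates_on_def by blast
qed

context interval_map begin

lemma closed_julia_set: "closed (julia_set {a..b} f)"
proof -
  have "openin (top_of_set {a..b}) (fatou_set {a..b} f)" using fatou_set_greatest by blast
  then have "closedin (top_of_set {a..b}) (julia_set {a..b} f)" unfolding julia_set_def by auto
  then show ?thesis by (rule closedin_closed_trans) auto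
qed

lemma fatou_set_equicontinuous:
  assumes "e \<in> fatou_set {a..b} f" "\<epsilon> > 0"
  shows "\<exists>\<eta>>0. \<forall>n. \<forall>x\<in>{a..b}. \<bar>x - e\<bar> < \<eta> \<longrightarrow> \<bar>(f ^^ n) x - (f ^^ n) e\<bar> < \<epsilon>"
proof -
  obtain U where U: "openin (top_of_set {a..b}) U" "e \<in> U" "equicontinuous_iterates_on f U"
    using assms(1) in_fatou_set_iff by blast
  obtain d where d: "d > 0" "\<And>x. x \<in> {a..b} \<Longrightarrow> \<bar>x - e\<bar> < d \<Longrightarrow> x \<in> U"
    using U(1,2) unfolding openin_euclidean_subtopology_iff by (auto simp: dist_real_def)
  obtain \<eta> where \<eta>: "\<eta> > 0" "\<And>n y. n \<ge> 1 \<Longrightarrow> y \<in> U \<Longrightarrow> \<bar>y - e\<bar> < \<eta> \<Longrightarrow> \<bar>(f ^^ n) y - (f ^^ n) e\<bar> < \<epsilon>"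
    using U(2,3) assms(2) unfolding equicontinuous_iterates_on_def dist_real_def by meson
  \<comment> \<open>Equicontinuity is about \<open>n \<ge> 1\<close>; the \<open>\<epsilon>\<close>
    in the radius takes care of \<open>n = 0\<close>.\<close>
  have "\<bar>(f ^^ n) x - (f ^^ n) e\<bar> < \<epsilon>" if "x \<in> {a..b}" "\<bar>x - e\<bar> < min \<epsilon> (min d \<eta>)" for n x
    using d(2)[of x] \<eta>(2)[of n x] that by (cases "n = 0") auto
  then show ?thesis using d(1) \<eta>(1) assms(2) by (intro exI[of _ "min \<epsilon> (min d \<eta>)"]) auto
qed

lemma fatou_set_backward:
  assumes x: "x \<in> {a..b}" "f x \<in> fatou_set {a..b} f"
  shows "x \<in> fatou_set {a..b} f"
proof -
  obtain U where U: "openin (top_of_set {a..b}) U" "f x \<in> U" "equicontinuous_iterates_on f U"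
    using x in_fatou_set_iff by blast
  define V where "V = {a..b} \<inter> f -` U"
  have "openin (top_of_set {a..b}) V" unfolding V_def using U(1) cont_f maps
    by (intro continuous_openin_preimage[where T = "{a..b}"]) auto
  moreover have "x \<in> V" using x U by (simp add: V_def)
  moreover have "equicontinuous_iterates_on f V"
    unfolding equicontinuous_iterates_on_def dist_real_def
  proof (intro ballI allI impI)
    fix y \<epsilon> assume y: "y \<in> V" and \<epsilon>: "\<epsilon> > (0::real)"
    then have yU: "f y \<in> U" "y \<in> {a..b}" by (auto simp: V_def)
    then obtain \<eta> where \<eta>: "\<eta> > 0" "\<And>n z. n \<ge> 1 \<Longrightarrow> z \<in> U \<Longrightarrow> \<bar>z - f y\<bar> < \<eta> \<Longrightarrow> \<bar>(f ^^ n) z - (f ^^ n) (f y)\<bar> < \<epsilon>"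
      using U(3) \<epsilon> unfolding equicontinuous_iterates_on_def dist_real_def by meson
    \<comment> \<open>The bound by \<open>\<epsilon>\<close> settles the first iterate, the bound by
      \<open>\<eta>\<close> the later ones.\<close>
    obtain d where d: "d > 0" "\<And>z. z \<in> {a..b} \<Longrightarrow> \<bar>z - y\<bar> < d \<Longrightarrow> \<bar>f z - f y\<bar> < min \<epsilon> \<eta>"
      using cont_f yU(2) \<eta>(1) \<epsilon> unfolding continuous_on_iff dist_real_def by (metis min_less_iff_conj)
    have "\<bar>(f ^^ n) z - (f ^^ n) y\<bar> < \<epsilon>" if n: "n \<ge> 1" and z: "z \<in> V" "\<bar>z - y\<bar> < d" for n z
    proof -
      obtain m where m: "n = Suc m" using n by (cases n) auto
      have fz: "f z \<in> U" "\<bar>f z - f y\<bar> < min \<epsilon> \<eta>" using z d(2) by (auto simp: V_def)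
      then show ?thesis using \<eta>(2)[of m "f z"] unfolding m by (cases "m = 0") (auto simp: funpow_swap1)
    qed
    then show "\<exists>\<eta>>0. \<forall>n\<ge>1. \<forall>z\<in>V. \<bar>z - y\<bar> < \<eta> \<longrightarrow> \<bar>(f ^^ n) z - (f ^^ n) y\<bar> < \<epsilon>" using d(1) by blast
  qed
  ultimately show ?thesis using in_fatou_set_iff by blast
qed

text \<open>Off \<open>Crit\<close> and the ends of the interval \<open>f\<close> is open, so points
  near \<open>f e\<close> have preimages near \<open>e\<close>, whose orbits run through them one
  step later.\<close>

lemma fatou_set_forward:
  assumes e: "e \<in> fatou_set {a..b} f" "df e \<noteq> 0" "a < e" "e < b"
  shows "f e \<in> fatou_set {a..b} f"
proof -
  obtain U where U: "openin (top_of_set {a..b}) U" "e \<in> U" "equicontinuous_iterates_on f U"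
    using e in_fatou_set_iff by blast
  obtain T where T: "open T" "U = {a..b} \<inter> T" using U(1) by (auto simp: openin_open)
  define S where "S = T \<inter> ({a<..<b} - Crit)"
  have oS: "open S" unfolding S_def using T(1) finite_Crit by (intro open_Int open_Diff finite_imp_closed) auto
  have eS: "e \<in> S" using e U T by (auto simp: S_def Crit_def)
  have SU: "S \<subseteq> U" "S \<subseteq> {a..b}" using T by (auto simp: S_def)
  have om: "f x \<in> interior (f ` R)" if x: "x \<in> R" and R: "open R" "R \<subseteq> S" for x R
  proof (rule sussmann_open_mapping[where S = S and f' = "times (df x)" and g' = "times (inverse (df x))"])
    have xS: "x \<in> S" using x R by blast
    have "at x within {a..b} = at x" using xS by (intro at_within_interior) (auto simp: S_def)
    then show "(f has_derivative times (df x)) (at x)" using deriv[of x] xS SU by (auto simp: has_field_derivative_def)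
    have "df x \<noteq> 0" using xS by (auto simp: S_def Crit_def)
    then show "times (df x) \<circ> times (inverse (df x)) = id" by (auto simp: fun_eq_iff)
    show "continuous_on S f" using cont_f continuous_on_subset SU by blast
    show "x \<in> interior R" using x R by (simp add: interior_open)
  qed (use oS x R in \<open>auto intro: bounded_linear_mult_right\<close>)
  define V where "V = f ` S"
  have "V \<subseteq> interior V" unfolding V_def using om[OF _ oS order_refl] by blast
  then have "open V" using interior_subset by (metis open_interior subset_antisym)
  moreover have "V \<subseteq> {a..b}" using SU(2) maps by (auto simp: V_def)
  ultimately have oV: "openin (top_of_set {a..b}) V" by (simp add: open_subset)
  moreover have "equicontinuous_iterates_on f V"
    unfolding equicontinuous_iterates_on_def
  proof (intro ballI allI impI)
    fix y \<epsilon> assume y: "y \<in> V" and \<epsilon>: "\<epsilon> > (0::real)"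
    then obtain x where x: "x \<in> S" "y = f x" by (auto simp: V_def)
    then obtain \<eta> where \<eta>: "\<eta> > 0" "\<And>n z. n \<ge> 1 \<Longrightarrow> z \<in> U \<Longrightarrow> dist z x < \<eta> \<Longrightarrow> dist ((f ^^ n) z) ((f ^^ n) x) < \<epsilon>"
      using U(3) \<epsilon> SU unfolding equicontinuous_iterates_on_def by (meson subsetD)
    define R where "R = S \<inter> ball x \<eta>"
    have "y \<in> interior (f ` R)" unfolding x(2) using x \<eta>(1) oS by (intro om) (auto simp: R_def)
    then obtain d where d: "d > 0" "ball y d \<subseteq> f ` R" by (auto simp: mem_interior)
    have "dist ((f ^^ n) z) ((f ^^ n) y) < \<epsilon>" if z: "dist z y < d" for n z
    proof -
      have "z \<in> f ` R" using z d(2) by (auto simp: dist_commute)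
      then obtain t where t: "t \<in> R" "z = f t" by blast
      then have "dist ((f ^^ Suc n) t) ((f ^^ Suc n) x) < \<epsilon>" using SU by (intro \<eta>(2)) (auto simp: R_def dist_commute)
      then show ?thesis using x(2) t(2) by (simp add: funpow_swap1)
    qed
    then show "\<exists>\<eta>>0. \<forall>n\<ge>1. \<forall>z\<in>V. dist z y < \<eta> \<longrightarrow> dist ((f ^^ n) z) ((f ^^ n) y) < \<epsilon>" using d(1) by blast
  qed
  moreover have "f e \<in> V" using eS by (simp add: V_def)
  ultimately show ?thesis using in_fatou_set_iff by blast
qed

end

text \<open>For a point with \<open>(f ^^ n) p = p\<close>, the uniform measure on its cycle, as the
  image of the uniform measure on times below \<open>n\<close>; \<open>n\<close> need not be the
  least period.\<close>

definition orbit_measure :: "real set \<Rightarrow> (real \<Rightarrow> real) \<Rightarrow> real \<Rightarrow> nat \<Rightarrow> real measure" where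
  "orbit_measure J f p n = distr (measure_pmf (pmf_of_set {..<n})) (restrict_space borel J) (\<lambda>j. (f ^^ j) p)"

text \<open>On the orbit \<open>f\<close> corresponds to the cyclic shift of times, which preserves
  the uniform measure.\<close>

lemma orbit_measure_invariant:
  assumes J: "\<And>x. x \<in> J \<Longrightarrow> f x \<in> J" "p \<in> J" and f: "continuous_on J f" and n: "n \<ge> 1" "(f ^^ n) p = p"
  shows "orbit_measure J f p n \<in> invariant_prob_measures J f"
proof -
  define R where "R = restrict_space borel J"
  define P where "P = pmf_of_set {..<n}"
  define h where "h j = (f ^^ j) p" for j
  have hJ: "h j \<in> J" for j using J by (induction j) (auto simp: h_def)
  have sp: "space R = J" by (simp add: R_def space_restrict_space)
  have hm: "h \<in> measurable (measure_pmf P) R" using hJ by (auto simp: sp)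
  have "f \<in> measurable R borel" unfolding R_def using f by (rule borel_measurable_continuous_on_restrict)
  then have fm: "f \<in> measurable R R" unfolding R_def using J(1) by (intro measurable_restrict_space2) (auto simp: space_restrict_space)
  have om: "orbit_measure J f p n = distr P R h" by (simp add: orbit_measure_def R_def P_def h_def[abs_def])
  define s where "s j = Suc j mod n" for j
  have per: "h (j mod n) = h j" for j unfolding h_def by (rule funpow_mod_eq[OF n(2)])
  have hs: "f \<circ> h = h \<circ> s" using per by (auto simp: fun_eq_iff s_def) (simp add: h_def)
  have "bij_betw s {..<n} {..<n}"
  proof (rule bij_betw_imageI)
    show inj: "inj_on s {..<n}"
    proof (rule inj_onI)
      fix i j assume ij: "i \<in> {..<n}" "j \<in> {..<n}" "s i = s j"
      show "i = j" using ij unfolding s_def by (cases "Suc i = n"; cases "Suc j = n") (auto simp: mod_less)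
    qed
    have "s ` {..<n} \<subseteq> {..<n}" using n(1) by (auto simp: s_def)
    then show "s ` {..<n} = {..<n}" using inj by (intro endo_inj_surj) auto
  qed
  then have "map_pmf s P = P" unfolding P_def using n(1) by (intro map_pmf_of_set_bij_betw) (auto simp: lessThan_empty_iff)
  then have Ps: "distr P (count_space UNIV) s = P" by (metis map_pmf_rep_eq)
  have "distr (distr P R h) R f = distr P R (h \<circ> s)" unfolding hs[symmetric] by (rule distr_distr[OF fm hm])
  also have "\<dots> = distr (distr P (count_space UNIV) s) R h" using hJ by (intro distr_distr[symmetric]) (auto simp: sp)
  also have "\<dots> = distr P R h" by (simp add: Ps)
  finally have "distr (distr P R h) R f = distr P R h" .
  moreover have "prob_space (distr P R h)" by (rule prob_space.prob_space_distr[OF prob_space_measure_pmf hm])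
  ultimately show ?thesis unfolding invariant_prob_measures_def om using fm by (auto simp: R_def cong: distr_cong)
qed

text \<open>The integral is the average of the logarithms along the orbit. Both parts are computed
  separately; a zero of \<open>g\<close> on the orbit makes the negative part infinite and
  contributes 0 to the positive one.\<close>

lemma integral_ext_orbit_measure:
  assumes J: "\<And>x. x \<in> J \<Longrightarrow> f x \<in> J" "p \<in> J" and n: "n \<ge> 1" and g: "continuous_on J g"
  shows "integral_ext (orbit_measure J f p n) (\<lambda>x. ln_ext \<bar>g x\<bar>) =
    (if \<exists>j<n. g ((f ^^ j) p) = 0 then - \<infinity> else ereal (ln (\<Prod>j<n. \<bar>g ((f ^^ j) p)\<bar>) / real n))"
proof -
  define R where "R = restrict_space borel J"
  define h where "h j = (f ^^ j) p" for j
  have hJ: "h j \<in> J" for j using J by (induction j) (auto simp: h_def)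
  have hm: "h \<in> measurable (measure_pmf (pmf_of_set {..<n})) R" using hJ by (auto simp: R_def space_restrict_space)
  have gm: "g \<in> measurable R borel" unfolding R_def using g by (rule borel_measurable_continuous_on_restrict)
  have lm: "ln_ext \<in> borel_measurable borel" unfolding ln_ext_def[abs_def] by measurable
  have m: "(\<lambda>x. ln_ext \<bar>g x\<bar>) \<in> borel_measurable R" using gm lm by measurable
  have om: "orbit_measure J f p n = distr (pmf_of_set {..<n}) R h" by (simp add: orbit_measure_def R_def h_def[abs_def])
  have ne: "{..<n} \<noteq> {}" using n by (auto simp: lessThan_empty_iff)
  have int: "(\<integral>\<^sup>+ x. e2ennreal (F x) \<partial>orbit_measure J f p n) = (\<Sum>j<n. e2ennreal (F (h j))) / ennreal (real n)"
    if "F \<in> borel_measurable R" for F :: "real \<Rightarrow> ereal"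
  proof -
    have "(\<integral>\<^sup>+ x. e2ennreal (F x) \<partial>orbit_measure J f p n) = (\<integral>\<^sup>+ j. e2ennreal (F (h j)) \<partial>measure_pmf (pmf_of_set {..<n}))"
      unfolding om using that by (intro nn_integral_distr[OF hm]) measurable
    also have "\<dots> = (\<Sum>j<n. e2ennreal (F (h j))) / ennreal (real n)"
      using nn_integral_pmf_of_set[OF ne, of "\<lambda>j. e2ennreal (F (h j))"]
      by (simp add: ennreal_of_nat_eq_real_of_nat)
    finally show ?thesis .
  qed
  have m': "(\<lambda>x. - ln_ext \<bar>g x\<bar>) \<in> borel_measurable R" using m by measurable
  define l where "l j = ln \<bar>g (h j)\<bar>" for j
  have pos: "e2ennreal (ln_ext \<bar>g (h j)\<bar>) = ennreal (if g (h j) = 0 then 0 else max 0 (l j))" for j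
    by (auto simp: ln_ext_def l_def e2ennreal_neg max_def ennreal_neg)
  have P: "enn2ereal (\<integral>\<^sup>+ x. e2ennreal (ln_ext \<bar>g x\<bar>) \<partial>orbit_measure J f p n) = ereal ((\<Sum>j<n. if g (h j) = 0 then 0 else max 0 (l j)) / real n)"
    unfolding int[OF m] pos using n by (subst sum_ennreal) (auto simp: divide_ennreal sum_nonneg)
  show ?thesis
  proof (cases "\<exists>j<n. g (h j) = 0")
    case True
    then obtain j where j: "j < n" "g (h j) = 0" by blast
    have "e2ennreal (- ln_ext \<bar>g (h j)\<bar>) = top" using j by (simp add: ln_ext_def)
    then have t: "(\<Sum>j<n. e2ennreal (- ln_ext \<bar>g (h j)\<bar>)) = top" using j(1) by auto
    have "enn2ereal (\<integral>\<^sup>+ x. e2ennreal (- ln_ext \<bar>g x\<bar>) \<partial>orbit_measure J f p n) = \<infinity>"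
      unfolding int[OF m'] t by (simp add: ennreal_top_divide)
    then show ?thesis using True P unfolding integral_ext_def h_def by auto
  next
    case False
    then have nz: "g (h j) \<noteq> 0" if "j < n" for j using that by blast
    have "e2ennreal (- ln_ext \<bar>g (h j)\<bar>) = ennreal (max 0 (- l j))" if "j < n" for j
      using nz[OF that] by (auto simp: ln_ext_def l_def max_def ennreal_neg)
    then have "(\<Sum>j<n. e2ennreal (- ln_ext \<bar>g (h j)\<bar>)) = (\<Sum>j<n. ennreal (max 0 (- l j)))" by (intro sum.cong) auto
    also have "\<dots> = ennreal (\<Sum>j<n. max 0 (- l j))" by (rule sum_ennreal) simp
    finally have t: "(\<Sum>j<n. e2ennreal (- ln_ext \<bar>g (h j)\<bar>)) = ennreal (\<Sum>j<n. max 0 (- l j))" .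
    then have N: "enn2ereal (\<integral>\<^sup>+ x. e2ennreal (- ln_ext \<bar>g x\<bar>) \<partial>orbit_measure J f p n) = ereal ((\<Sum>j<n. max 0 (- l j)) / real n)"
      unfolding int[OF m'] t using n by (simp add: divide_ennreal sum_nonneg)
    have "(\<Sum>j<n. if g (h j) = 0 then 0 else max 0 (l j)) - (\<Sum>j<n. max 0 (- l j)) = (\<Sum>j<n. l j)"
      unfolding sum_subtractf[symmetric] using nz by (intro sum.cong) auto
    also have "\<dots> = ln (\<Prod>j<n. \<bar>g (h j)\<bar>)" unfolding l_def using nz by (subst ln_prod) auto
    finally have "integral_ext (orbit_measure J f p n) (\<lambda>x. ln_ext \<bar>g x\<bar>) = ereal (ln (\<Prod>j<n. \<bar>g (h j)\<bar>) / real n)"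
      unfolding integral_ext_def P N by (simp add: diff_divide_distrib[symmetric])
    then show ?thesis using False unfolding h_def by auto
  qed
qed

lemma chi_inf_le_cycle:
  assumes "\<And>x. x \<in> julia_set I f \<Longrightarrow> f x \<in> julia_set I f" "p \<in> julia_set I f"
    and "continuous_on (julia_set I f) f" "continuous_on (julia_set I f) (nderiv_on I 1 f)"
    and n: "n \<ge> 1" "(f ^^ n) p = p" and \<nu>: "ereal \<nu> \<le> chi_inf I f"
  shows "exp (\<nu> * real n) \<le> (\<Prod>j<n. \<bar>nderiv_on I 1 f ((f ^^ j) p)\<bar>)"
proof -
  have "orbit_measure (julia_set I f) f p n \<in> invariant_prob_measures (julia_set I f) f"
    using assms by (intro orbit_measure_invariant) auto
  then have "ereal \<nu> \<le> integral_ext (orbit_measure (julia_set I f) f p n) (\<lambda>x. ln_ext \<bar>nderiv_on I 1 f x\<bar>)"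
    using \<nu> unfolding chi_inf_def by (meson INF_lower order_trans)
  then have le: "ereal \<nu> \<le> (if \<exists>j<n. nderiv_on I 1 f ((f ^^ j) p) = 0 then - \<infinity> else
      ereal (ln (\<Prod>j<n. \<bar>nderiv_on I 1 f ((f ^^ j) p)\<bar>) / real n))"
    using integral_ext_orbit_measure[OF assms(1,2) n(1) assms(4)] by simp
  \<comment> \<open>At a zero of the derivative the right-hand side would be
    \<open>- \<infinity>\<close>, which is below \<open>ereal \<nu>\<close>.\<close>
  then have nz: "\<not> (\<exists>j<n. nderiv_on I 1 f ((f ^^ j) p) = 0)" by (auto split: if_splits)
  then have "\<nu> \<le> ln (\<Prod>j<n. \<bar>nderiv_on I 1 f ((f ^^ j) p)\<bar>) / real n"
    using le by (simp only: if_False ereal_less_eq)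
  then have "\<nu> * real n \<le> ln (\<Prod>j<n. \<bar>nderiv_on I 1 f ((f ^^ j) p)\<bar>)" using n(1) by (simp add: field_simps)
  then have "exp (\<nu> * real n) \<le> exp (ln (\<Prod>j<n. \<bar>nderiv_on I 1 f ((f ^^ j) p)\<bar>))" by simp
  also have "\<dots> = (\<Prod>j<n. \<bar>nderiv_on I 1 f ((f ^^ j) p)\<bar>)" using nz by (intro exp_ln prod_pos) auto
  finally show ?thesis .
qed

theorem theoremB:
  fixes a b :: real and f :: "real \<Rightarrow> real"
  assumes "a \<le> b"
    and "nondegenerate_smooth_map {a..b} f"
    and "topologically_exact_on_julia {a..b} f"
    and "chi_inf {a..b} f > 0"
  shows "\<exists>\<delta>>0. \<exists>c>1. \<forall>x \<in> julia_set {a..b} f. \<forall>n\<ge>1.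
           \<forall>W \<in> pullbacks {a..b} f n (ball x \<delta> \<inter> {a..b}).
             measure lborel W \<le> c powi (- int n)"
proof (cases "julia_set {a..b} f = {}")
  case True
  \<comment> \<open>An empty Julia set has no points \<open>x\<close>, so any two constants
    do.\<close>
  then show ?thesis by (intro exI[of _ 1] exI[of _ 2] conjI) auto
next
  case False
  define J where "J = julia_set {a..b} f"
  define df where "df = nderiv_on {a..b} 1 f"
  interpret interval_map a b f df unfolding df_def by (rule nondegenerate_interval_map[OF assms(2,1)])
  \<comment> \<open>A positive real below the extended real \<open>chi_inf\<close>; it becomes the
    expansion rate of all cycles in \<open>J\<close>.\<close>
  obtain \<nu> where "0 < ereal \<nu>" "ereal \<nu> < chi_inf {a..b} f" using ereal_dense2[OF assms(4)] by blast
  then have \<nu>: "0 < \<nu>" "ereal \<nu> \<le> chi_inf {a..b} f" by auto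
  have JI: "J \<subseteq> {a..b}" by (auto simp: J_def julia_set_def)
  have Fn: "x \<in> fatou_set {a..b} f" if "x \<in> {a..b}" "x \<notin> J" for x using that by (simp add: J_def julia_set_def)
  have fwd: "f x \<in> J" if "x \<in> J" for x
    using that fatou_set_backward[of x] maps[of x] by (auto simp: J_def julia_set_def)
  interpret expanding_julia a b f df J \<nu>
  proof
    show "0 < \<nu>" "J \<subseteq> {a..b}" "J \<noteq> {}" by (fact \<nu>(1), fact JI, use False J_def in simp)
    show "closed J" unfolding J_def by (rule closed_julia_set)
    show "f x \<in> J" if "x \<in> J" for x using fwd[OF that] .
    show "\<not> is_singleton J" using assms(3) by (simp add: topologically_exact_on_julia_def J_def)
    show "\<exists>n\<ge>1. J \<subseteq> (f ^^ n) ` U" if "openin (top_of_set {a..b}) U" "U \<inter> J \<noteq> {}" for U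
      using assms(3) that unfolding topologically_exact_on_julia_def J_def by blast
    show "df e = 0 \<or> e = a \<or> e = b" if e: "e \<in> {a..b}" "e \<notin> J" "f e \<in> J" for e
      using fatou_set_forward[OF Fn[OF e(1,2)]] e by (fastforce simp: J_def julia_set_def)
    show "\<exists>\<eta>>0. \<forall>n. \<forall>x\<in>{a..b}. \<bar>x - e\<bar> < \<eta> \<longrightarrow> \<bar>(f ^^ n) x - (f ^^ n) e\<bar> < \<epsilon>"
      if "e \<in> {a..b}" "e \<notin> J" "\<epsilon> > 0" for e \<epsilon>
      using fatou_set_equicontinuous[OF Fn[OF that(1,2)] that(3)] .
    show "exp (\<nu> * real n) \<le> (\<Prod>j<n. \<bar>df ((f ^^ j) p)\<bar>)" if "p \<in> J" "n \<ge> 1" "(f ^^ n) p = p" for p n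
      unfolding df_def
    proof (rule chi_inf_le_cycle[OF _ _ _ _ that(2,3) \<nu>(2)])
      show "continuous_on (julia_set {a..b} f) f" "continuous_on (julia_set {a..b} f) (nderiv_on {a..b} 1 f)"
        using continuous_on_subset[OF cont_f] continuous_on_subset[OF cont_df] JI by (auto simp: J_def df_def)
    qed (use fwd that in \<open>auto simp: J_def\<close>)
  qed
  show ?thesis using pullbacks_shrink unfolding J_def .
qed

end
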